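(* Consider the hidden Markov model $(X_n,Y_n)_{n\in\mathbb{Z}}$ with signal state space $E$, observation state space $F$, reference measure $\varphi$, matrix function $M$, signal transition matrix $P$ and filter transition kernel $\mathsf{\Pi}$ on $\mathcal{P}(E)$, as described in the context. Say that Condition (C) holds if for every $\varepsilon>0$ there exist an integer $N\in\mathbb{N}$ and Borel subsets $\mathcal{S}\subset\mathcal{P}(E)$ and $\mathcal{O}\subset F^N$ such that: (1) $\mathbf{P}(\pi^{\min}_0\in\mathcal{S}\text{ and }\pi^{\max}_0\in\mathcal{S})>0$ and $\varphi^{\otimes N}(\mathcal{O})>0$; (2) $\mu M(y_1)\cdots M(y_N)1>0$ for all $\mu\in\mathcal{S}$ and $(y_1,\ldots,y_N)\in\mathcal{O}$; (3) for all $\mu,\nu\in\mathcal{S}$ and $(y_1,\ldots,y_N)\in\mathcal{O}$, $$\left\|\frac{\mu M(y_1)\cdots M(y_N)}{\mu M(y_1)\cdots M(y_N)1}-\frac{\nu M(y_1)\cdots M(y_N)}{\nu M(y_1)\cdots M(y_N)1}\right\|<\varepsilon .$$ Then the following hold. (a) Suppose that Condition (C) holds. Then the filter admits a unique invariant measure, i.e. there is exactly one $\mathsf{M}\in\mathcal{P}(\mathcal{P}(E))$ with $\mathsf{M}\mathsf{\Pi}=\mathsf{M}$, and $n^{-1}\sum_{k=1}^n\mathsf{M}_0\mathsf{\Pi}^k\Rightarrow\mathsf{M}$ as $n\to\infty$ for any $\mathsf{M}_0\in\mathcal{P}(\mathcal{P}(E))$. If, in addition, $P$ is aperiodic, then $\mathsf{M}_0\mathsf{\Pi}^n\Rightarrow\mathsf{M}$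 as $n\to\infty$ for any $\mathsf{M}_0\in\mathcal{P}(\mathcal{P}(E))$. (b) Conversely, suppose that $F$ is a finite or countable set, and that the filter is uniquely ergodic (there is exactly one $\mathsf{M}\in\mathcal{P}(\mathcal{P}(E))$ with $\mathsf{M}\mathsf{\Pi}=\mathsf{M}$). Then Condition (C) holds.
   Context: Conventions. For a Polish space $S$, $\mathcal{P}(S)$ is the space of Borel probability measures on $S$ with the topology of weak convergence (itself Polish), $\mathcal{C}_b(S)$ the bounded continuous functions, $\Rightarrow$ denotes weak convergence, and $\|\mu-\nu\|=\sup_{\|f\|_\infty\le 1}|\int f\,d\mu-\int f\,d\nu|$. Measures on $E$ are identified with row vectors, functions on $E$ with column vectors; $1$ is the constant function. Model. $E$ is finite ($E=\{1,\ldots,p\}$) or countable ($E=\mathbb{N}$); $F$ is a Polish space; $\varphi$ is a $\sigma$-finite measure on $F$; $M:F\to\mathbb{R}_+^{E\times E}$ is a (Borel measurable) nonnegative matrix function with $\sup_{i\in E}\sum_{j\in E}M_{ij}(y)<\infty$ for $\varphi$-a.e. $y$, such that $P_{ij}=\int M_{ij}(y)\,\varphi(dy)$ is the transition matrix of an irreducible, positive recurrent (not necessarily aperiodic) Markov chain on $E$. Its unique invariant probability measure is $\lambda$. On $\Omega=E^{\mathbb{Z}}\times F^{\mathbb{Z}}$ with Borel $\sigma$-field and coordinate process $(X_n,Y_n)_{n\in\mathbb{Z}}$, $\mathbf{P}$ is the probability measure under which $(X_n,Y_n)_{n\in\mathbb{Z}}$ is a stationary Markov chain with $$\mathbf{P}(X_k=j,\,Y_k\in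 A\mid X_{k-1}=i,\,Y_{k-1}=y)=\int_A M_{ij}(y')\,\varphi(dy').$$ $\sigma$-fields and filters. $\mathcal{F}^X_{-\infty,m}=\sigma\{X_k:k\le m\}$, $\mathcal{F}^Y_{-\infty,n}=\sigma\{Y_k:k\le n\}$, $\mathcal{G}_{m,n}=\mathcal{F}^X_{-\infty,m}\vee\mathcal{F}^Y_{-\infty,n}$, $\mathcal{G}_{-\infty,n}=\bigcap_{m\le n}\mathcal{G}_{m,n}$. Define the (regular) conditional distributions $\pi^{\min}_n=\mathbf{P}(X_n\in\cdot\mid\mathcal{F}^Y_{-\infty,n})$ and $\pi^{\max}_n=\mathbf{P}(X_n\in\cdot\mid\mathcal{G}_{-\infty,n})$. Filter kernel. $\mathsf{\Pi}$ is the Markov transition kernel on $\mathcal{P}(E)$ given by $$\int f(\nu)\,\mathsf{\Pi}(\mu,d\nu)=\int f\left(\frac{\mu M(y)}{\mu M(y)1}\right)\mu M(y)1\,\varphi(dy),\qquad f\in\mathcal{C}_b(\mathcal{P}(E)),$$ the integrand being read as $0$ where $\mu M(y)1=0$. For $\mathsf{M}\in\mathcal{P}(\mathcal{P}(E))$, $\mathsf{M}\mathsf{\Pi}=\int\mathsf{\Pi}(\mu,\cdot)\,\mathsf{M}(d\mu)$. *)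

theory Defs
  imports "HOL-Probability.Probability"
begin

section \<open>Spaces of probability measures with the topology of weak convergence\<close>

definition borel_of :: "'a topology \<Rightarrow> 'a measure" where
  "borel_of S = sigma (topspace S) {U. openin S U}"

definition prob_measures :: "'a topology \<Rightarrow> 'a measure set" where
  "prob_measures S = {\<mu>. prob_space \<mu> \<and> sets \<mu> = sets (borel_of S)}"

definition bdd_continuous :: "'a topology \<Rightarrow> ('a \<Rightarrow> real) set" where
  "bdd_continuous S = {f. continuous_map S euclideanreal f \<and> bounded (f ` topspace S)}"

text \<open>
  The coarsest topology on the Borel probability measures of \<open>S\<close> for which every
  \<open>\<mu> \<mapsto> \<integral>f d\<mu>\<close> with \<open>f\<close> bounded and continuous is continuous.  The construction can
  be iterated, and weak convergence is \<^const>\<open>limitin\<close> with respect to it.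
\<close>
definition weak_topology :: "'a topology \<Rightarrow> 'a measure topology" where
  "weak_topology S = topology_generated_by
     {{\<mu> \<in> prob_measures S. (\<integral>x. f x \<partial>\<mu>) \<in> U} | f U. f \<in> bdd_continuous S \<and> open U}"

definition tv_norm :: "'a measure \<Rightarrow> 'a measure \<Rightarrow> real" where
  "tv_norm \<mu> \<nu> = (SUP f \<in> {f \<in> borel_measurable \<mu>. \<forall>x \<in> space \<mu>. \<bar>f x\<bar> \<le> 1}.
     \<bar>(\<integral>x. f x \<partial>\<mu>) - (\<integral>x. f x \<partial>\<nu>)\<bar>)"

text \<open>
  The signal state space \<open>E\<close> is a countable (possibly finite) type with the discrete topology;
  \<open>PE\<close> is the space of probability measures on \<open>E\<close>, and \<open>PPE\<close> that of probability
  measures on \<open>PE\<close>.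
\<close>
abbreviation PE :: "'e::countable measure topology" where
  "PE \<equiv> weak_topology (discrete_topology UNIV)"

abbreviation PPE :: "'e::countable measure measure topology" where
  "PPE \<equiv> weak_topology PE"


section \<open>Transition matrices\<close>

definition stochastic_matrix :: "('e::countable \<Rightarrow> 'e \<Rightarrow> ennreal) \<Rightarrow> bool" where
  "stochastic_matrix P \<longleftrightarrow> (\<forall>i. (\<integral>\<^sup>+j. P i j \<partial>count_space UNIV) = 1)"

primrec mat_pow :: "('e::countable \<Rightarrow> 'e \<Rightarrow> ennreal) \<Rightarrow> nat \<Rightarrow> 'e \<Rightarrow> 'e \<Rightarrow> ennreal" where
  "mat_pow P 0 i j = (if i = j then 1 else 0)"
| "mat_pow P (Suc n) i j = (\<integral>\<^sup>+k. P i k * mat_pow P n k j \<partial>count_space UNIV)"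

definition irreducible_matrix :: "('e::countable \<Rightarrow> 'e \<Rightarrow> ennreal) \<Rightarrow> bool" where
  "irreducible_matrix P \<longleftrightarrow> (\<forall>i j. \<exists>n. mat_pow P n i j > 0)"

text \<open>
  \<open>first_passage P n i j\<close> is the probability that the chain started in \<open>i\<close> visits \<open>j\<close> at
  time \<open>n\<close> for the first time after time \<open>0\<close>.
\<close>
primrec first_passage :: "('e::countable \<Rightarrow> 'e \<Rightarrow> ennreal) \<Rightarrow> nat \<Rightarrow> 'e \<Rightarrow> 'e \<Rightarrow> ennreal" where
  "first_passage P 0 i j = 0"
| "first_passage P (Suc n) i j =
     (if n = 0 then P i j else \<integral>\<^sup>+k. P i k * first_passage P n k j \<partial>count_space (- {j}))"

definition positive_recurrent :: "('e::countable \<Rightarrow> 'e \<Rightarrow> ennreal) \<Rightarrow> bool" where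
  "positive_recurrent P \<longleftrightarrow>
     (\<forall>i. (\<Sum>n. first_passage P n i i) = 1 \<and> (\<Sum>n. of_nat n * first_passage P n i i) < \<infinity>)"

definition aperiodic_matrix :: "('e::countable \<Rightarrow> 'e \<Rightarrow> ennreal) \<Rightarrow> bool" where
  "aperiodic_matrix P \<longleftrightarrow> (\<forall>i. Gcd {n. n \<ge> 1 \<and> mat_pow P n i i > 0} = 1)"


section \<open>Hidden Markov models\<close>

type_synonym ('e, 'f) path = "(int \<Rightarrow> 'e) \<times> (int \<Rightarrow> 'f)"

definition path_space :: "('e::countable, 'f::polish_space) path measure" where
  "path_space = (PiM UNIV (\<lambda>_. count_space UNIV)) \<Otimes>\<^sub>M (PiM UNIV (\<lambda>_. borel))"

definition coord_X :: "int \<Rightarrow> ('e, 'f) path \<Rightarrow> 'e" where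
  "coord_X n \<omega> = fst \<omega> n"

definition coord_Y :: "int \<Rightarrow> ('e, 'f) path \<Rightarrow> 'f" where
  "coord_Y n \<omega> = snd \<omega> n"

definition path_shift :: "('e, 'f) path \<Rightarrow> ('e, 'f) path" where
  "path_shift \<omega> = (\<lambda>n. fst \<omega> (n + 1), \<lambda>n. snd \<omega> (n + 1))"

text \<open>Sub-\<open>\<sigma>\<close>-fields are represented by measures, of which only the \<open>\<sigma>\<close>-algebra matters.\<close>

definition sigma_X :: "int \<Rightarrow> ('e::countable, 'f::polish_space) path measure" where
  "sigma_X m = sigma (space path_space)
     {coord_X k -` A \<inter> space path_space | k A. k \<le> m}"

definition sigma_Y :: "int \<Rightarrow> ('e::countable, 'f::polish_space) path measure" where
  "sigma_Y n = sigma (space path_space)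
     {coord_Y k -` A \<inter> space path_space | k A. k \<le> n \<and> A \<in> sets borel}"

definition sigma_XY :: "int \<Rightarrow> int \<Rightarrow> ('e::countable, 'f::polish_space) path measure" where
  "sigma_XY m n = sigma (space path_space) (sets (sigma_X m) \<union> sets (sigma_Y n))"

definition sigma_tail_XY :: "int \<Rightarrow> ('e::countable, 'f::polish_space) path measure" where
  "sigma_tail_XY n = sigma (space path_space) (\<Inter>m\<in>{..n}. sets (sigma_XY m n))"

definition trans_mat ::
  "'f::polish_space measure \<Rightarrow> ('f \<Rightarrow> 'e::countable \<Rightarrow> 'e \<Rightarrow> real) \<Rightarrow> 'e \<Rightarrow> 'e \<Rightarrow> ennreal" where
  "trans_mat \<phi> M i j = (\<integral>\<^sup>+y. ennreal (M y i j) \<partial>\<phi>)"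

text \<open>
  The last two assumptions say that under \<open>Pr\<close> the coordinate process is a stationary Markov
  chain with the prescribed transition kernel; \<open>sigma_XY (k - 1) (k - 1)\<close> is its past up to
  time \<open>k - 1\<close>.
\<close>
locale hidden_markov_model =
  fixes \<phi> :: "'f::polish_space measure"
    and M :: "'f \<Rightarrow> 'e::countable \<Rightarrow> 'e \<Rightarrow> real"
    and Pr :: "('e, 'f) path measure"
  assumes sets_phi: "sets \<phi> = sets borel"
    and sigma_finite_phi: "sigma_finite_measure \<phi>"
    and M_nonneg: "\<And>y i j. 0 \<le> M y i j"
    and M_measurable: "\<And>i j. (\<lambda>y. M y i j) \<in> borel_measurable borel"
    and M_row_bound: "AE y in \<phi>. (SUP i. \<integral>\<^sup>+j. ennreal (M y i j) \<partial>count_space UNIV) < \<infinity>"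
    and stochastic_P: "stochastic_matrix (trans_mat \<phi> M)"
    and irreducible_P: "irreducible_matrix (trans_mat \<phi> M)"
    and positive_recurrent_P: "positive_recurrent (trans_mat \<phi> M)"
    and prob_space_Pr: "prob_space Pr"
    and sets_Pr: "sets Pr = sets path_space"
    and stationary_Pr: "distr Pr path_space path_shift = Pr"
    and markov_Pr: "\<And>k j A. A \<in> sets borel \<Longrightarrow>
      AE \<omega> in Pr.
        nn_cond_exp Pr (sigma_XY (k - 1) (k - 1))
          (indicator {\<omega> \<in> space path_space. coord_X k \<omega> = j \<and> coord_Y k \<omega> \<in> A}) \<omega>
        = (\<integral>\<^sup>+y\<in>A. ennreal (M y (coord_X (k - 1) \<omega>) j) \<partial>\<phi>)"

definition regular_cond_distr ::
  "'a measure \<Rightarrow> 'a measure \<Rightarrow> ('a \<Rightarrow> 'b) \<Rightarrow> 'b measure \<Rightarrow> ('a \<Rightarrow> 'b measure) \<Rightarrow> bool" where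
  "regular_cond_distr Pr F X N \<kappa> \<longleftrightarrow>
     \<kappa> \<in> F \<rightarrow>\<^sub>M prob_algebra N \<and>
     (\<forall>A \<in> sets N. AE \<omega> in Pr.
        emeasure (\<kappa> \<omega>) A = nn_cond_exp Pr F (indicator (X -` A \<inter> space Pr)) \<omega>)"

definition is_pi_min ::
  "('e::countable, 'f::polish_space) path measure \<Rightarrow> int \<Rightarrow> (('e, 'f) path \<Rightarrow> 'e measure) \<Rightarrow> bool" where
  "is_pi_min Pr n \<pi> \<longleftrightarrow> regular_cond_distr Pr (sigma_Y n) (coord_X n) (count_space UNIV) \<pi>"

definition is_pi_max ::
  "('e::countable, 'f::polish_space) path measure \<Rightarrow> int \<Rightarrow> (('e, 'f) path \<Rightarrow> 'e measure) \<Rightarrow> bool" where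
  "is_pi_max Pr n \<pi> \<longleftrightarrow> regular_cond_distr Pr (sigma_tail_XY n) (coord_X n) (count_space UNIV) \<pi>"


section \<open>The filter kernel\<close>

text \<open>
  Row vectors are \<^typ>\<open>ennreal\<close>-valued, so that the products are defined for all observations,
  including those in the null set where the row sums of \<open>M y\<close> are unbounded.
\<close>

definition row_of :: "'e::countable measure \<Rightarrow> 'e \<Rightarrow> ennreal" where
  "row_of \<mu> i = emeasure \<mu> {i}"

definition row_mult :: "('e::countable \<Rightarrow> ennreal) \<Rightarrow> ('e \<Rightarrow> 'e \<Rightarrow> real) \<Rightarrow> 'e \<Rightarrow> ennreal" where
  "row_mult v A j = (\<integral>\<^sup>+i. v i * ennreal (A i j) \<partial>count_space UNIV)"

definition row_mass :: "('e::countable \<Rightarrow> ennreal) \<Rightarrow> ennreal" where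
  "row_mass v = (\<integral>\<^sup>+j. v j \<partial>count_space UNIV)"

definition normalized :: "('e::countable \<Rightarrow> ennreal) \<Rightarrow> 'e measure" where
  "normalized v = density (count_space UNIV) (\<lambda>j. v j / row_mass v)"

text \<open>\<open>row_prod M y n v\<close> is \<open>v M(y\<^sub>1) \<dots> M(y\<^sub>n)\<close>.\<close>
primrec row_prod ::
  "('f \<Rightarrow> 'e::countable \<Rightarrow> 'e \<Rightarrow> real) \<Rightarrow> (nat \<Rightarrow> 'f) \<Rightarrow> nat \<Rightarrow> ('e \<Rightarrow> ennreal) \<Rightarrow> 'e \<Rightarrow> ennreal" where
  "row_prod M y 0 v = v"
| "row_prod M y (Suc n) v = row_mult (row_prod M y n v) (M (y (Suc n)))"

text \<open>
  The kernel is the image of the measure \<open>\<mu>M(y)1 \<phi>(dy)\<close> under \<open>y \<mapsto> \<mu>M(y) / \<mu>M(y)1\<close>.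
  The value \<open>\<mu>\<close> in the degenerate cases is irrelevant: they form a null set of the former
  measure.  Lemma \<open>integral_filter_kernel\<close> at the end is the usual description by integrals of
  bounded continuous functions.
\<close>
definition filter_step :: "('f \<Rightarrow> 'e::countable \<Rightarrow> 'e \<Rightarrow> real) \<Rightarrow> 'e measure \<Rightarrow> 'f \<Rightarrow> 'e measure" where
  "filter_step M \<mu> y =
     (let v = row_mult (row_of \<mu>) (M y)
      in if row_mass v = 0 \<or> row_mass v = \<infinity> then \<mu> else normalized v)"

definition filter_kernel ::
  "'f::polish_space measure \<Rightarrow> ('f \<Rightarrow> 'e::countable \<Rightarrow> 'e \<Rightarrow> real) \<Rightarrow> 'e measure \<Rightarrow> 'e measure measure" where
  "filter_kernel \<phi> M \<mu> =
     distr (density \<phi> (\<lambda>y. row_mass (row_mult (row_of \<mu>) (M y)))) (borel_of PE) (filter_step M \<mu>)"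

definition apply_kernel :: "('a \<Rightarrow> 'a measure) \<Rightarrow> nat \<Rightarrow> 'a measure \<Rightarrow> 'a measure" where
  "apply_kernel K n m = ((\<lambda>m'. m' \<bind> K) ^^ n) m"

definition cesaro_mean :: "(nat \<Rightarrow> 'a measure) \<Rightarrow> nat \<Rightarrow> 'a measure" where
  "cesaro_mean m n = measure_of (space (m 0)) (sets (m 0))
     (\<lambda>A. (\<Sum>k=1..n. emeasure (m k) A) / of_nat n)"

definition invariant_measure ::
  "('e::countable measure \<Rightarrow> 'e measure measure) \<Rightarrow> 'e measure measure \<Rightarrow> bool" where
  "invariant_measure K m \<longleftrightarrow> m \<in> prob_measures PE \<and> m \<bind> K = m"


section \<open>Condition (C)\<close>

text \<open>
  Points of \<open>F\<^sup>N\<close> are functions on \<open>{1..N}\<close>.  Observations for which a product \<open>\<mu>M(y\<^sub>1)\<dots>M(y\<^sub>N)\<close> has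
  infinite mass form a null set and can always be removed from \<open>Ob\<close>, so the meaning of the
  quotients there is irrelevant.
\<close>
definition condition_C ::
  "'f::polish_space measure \<Rightarrow> ('f \<Rightarrow> 'e::countable \<Rightarrow> 'e \<Rightarrow> real) \<Rightarrow> ('e, 'f) path measure \<Rightarrow>
   (('e, 'f) path \<Rightarrow> 'e measure) \<Rightarrow> (('e, 'f) path \<Rightarrow> 'e measure) \<Rightarrow> bool" where
  "condition_C \<phi> M Pr \<pi>min \<pi>max \<longleftrightarrow>
     (\<forall>\<epsilon>>0. \<exists>N\<ge>1. \<exists>S \<in> sets (borel_of PE). \<exists>Ob \<in> sets (PiM {1..N} (\<lambda>_. borel)).
        measure Pr {\<omega> \<in> space Pr. \<pi>min \<omega> \<in> S \<and> \<pi>max \<omega> \<in> S} > 0 \<and>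
        emeasure (PiM {1..N} (\<lambda>_. \<phi>)) Ob > 0 \<and>
        (\<forall>\<mu>\<in>S. \<forall>y\<in>Ob. row_mass (row_prod M y N (row_of \<mu>)) > 0) \<and>
        (\<forall>\<mu>\<in>S. \<forall>\<nu>\<in>S. \<forall>y\<in>Ob.
           tv_norm (normalized (row_prod M y N (row_of \<mu>)))
                   (normalized (row_prod M y N (row_of \<nu>))) < \<epsilon>))"


section \<open>The filter kernel is a Markov kernel with the expected integrals\<close>

lemma prob_measures_discrete:
  "prob_measures (discrete_topology (UNIV::'e::countable set)) = {\<mu>. prob_space \<mu> \<and> sets \<mu> = UNIV}"
proof -
  have "sigma_sets UNIV (Pow UNIV) = (UNIV :: 'e set set)" by (auto intro: sigma_sets.Basic)
  then show ?thesis by (simp add: prob_measures_def borel_of_def)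
qed

lemma space_prob_algebra_count_space:
  "space (prob_algebra (count_space (UNIV::'e::countable set))) = prob_measures (discrete_topology UNIV)"
  by (auto simp: space_prob_algebra prob_measures_discrete)

lemma topspace_weak_topology [simp]: "topspace (weak_topology S) = prob_measures S"
proof -
  have "(\<lambda>_. 0) \<in> bdd_continuous S" by (auto simp: bdd_continuous_def bounded_iff)
  then have "prob_measures S \<in> {{\<mu> \<in> prob_measures S. (\<integral>x. f x \<partial>\<mu>) \<in> U} | f U. f \<in> bdd_continuous S \<and> open U}"
    by (intro CollectI exI[of _ "\<lambda>_. 0"] exI[of _ UNIV]) auto
  then show ?thesis unfolding weak_topology_def topology_generated_by_topspace by blast
qed

lemma prob_density_eq:
  fixes \<mu> :: "'e::countable measure"
  assumes "\<mu> \<in> prob_measures (discrete_topology UNIV)"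
  shows "\<mu> = density (count_space UNIV) (\<lambda>i. ennreal (measure \<mu> {i}))"
proof -
  from assms interpret prob_space \<mu> by (simp add: prob_measures_discrete)
  have s: "sets \<mu> = UNIV" using assms by (simp add: prob_measures_discrete)
  show ?thesis
    by (rule measure_eqI_countable[of _ UNIV]) (auto simp: s emeasure_density emeasure_eq_measure)
qed

lemma weak_conv_PE:
  fixes u :: "nat \<Rightarrow> 'e::countable measure"
  assumes u: "\<And>n. u n \<in> prob_measures (discrete_topology UNIV)"
    and a: "a \<in> prob_measures (discrete_topology UNIV)"
    and lim: "\<And>i. (\<lambda>n. measure (u n) {i}) \<longlonglongrightarrow> measure a {i}"
    and f: "bounded (range f)"
  shows "(\<lambda>n. \<integral>x. f x \<partial>u n) \<longlonglongrightarrow> (\<integral>x. (f x :: real) \<partial>a)"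
proof -
  let ?C = "count_space (UNIV :: 'e set)"
  obtain B where B: "\<And>x. \<bar>f x\<bar> \<le> B" using f by (auto simp: bounded_iff)
  have nn: "(\<integral>\<^sup>+i. norm (measure \<mu> {i}) \<partial>?C) = 1" if "\<mu> \<in> prob_measures (discrete_topology UNIV)" for \<mu> :: "'e measure"
  proof -
    from that interpret prob_space \<mu> by (simp add: prob_measures_discrete)
    have sp: "space \<mu> = UNIV" using that by (auto simp: prob_measures_discrete dest: sets_eq_imp_space_eq[of _ "count_space UNIV", simplified])
    have "1 = emeasure (density ?C (\<lambda>i. ennreal (measure \<mu> {i}))) UNIV"
      using prob_density_eq[OF that] emeasure_space_1 sp by simp
    then show ?thesis by (simp add: emeasure_density)
  qed
  have int: "integrable ?C (\<lambda>i. measure \<mu> {i})" if "\<mu> \<in> prob_measures (discrete_topology UNIV)" for \<mu> :: "'e measure"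
    using nn[OF that] by (intro integrableI_bounded) auto
  have intf: "integrable ?C (\<lambda>i. measure \<mu> {i} * f i)" if "\<mu> \<in> prob_measures (discrete_topology UNIV)" for \<mu> :: "'e measure"
  proof (rule Bochner_Integration.integrable_bound[OF integrable_mult_right[OF int[OF that], of B]])
    show "AE i in ?C. norm (measure \<mu> {i} * f i) \<le> norm (B * measure \<mu> {i})"
    proof (rule AE_I2)
      fix i
      have "measure \<mu> {i} * \<bar>f i\<bar> \<le> measure \<mu> {i} * \<bar>B\<bar>"
        using B[of i] by (intro mult_left_mono) auto
      then show "norm (measure \<mu> {i} * f i) \<le> norm (B * measure \<mu> {i})"
        by (simp add: abs_mult mult.commute)
    qed
  qed simp
  have eq: "(\<integral>x. f x \<partial>\<mu>) = (\<integral>i. measure \<mu> {i} * f i \<partial>?C)" if "\<mu> \<in> prob_measures (discrete_topology UNIV)" for \<mu> :: "'e measure"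
    by (subst prob_density_eq[OF that], subst integral_density) auto
  have sch: "(\<lambda>n. \<integral>\<^sup>+ i. norm (measure (u n) {i} - measure a {i}) \<partial>?C) \<longlonglongrightarrow> 0"
    by (rule Scheffe_lemma2) (use int[OF a] nn[OF u] nn[OF a] lim in \<open>auto\<close>)
  have sch': "(\<lambda>n. B * (\<integral> i. norm (measure (u n) {i} - measure a {i}) \<partial>?C)) \<longlonglongrightarrow> B * 0"
  proof (rule tendsto_mult_left)
    have "(\<integral>\<^sup>+ i. norm (measure (u n) {i} - measure a {i}) \<partial>?C) = ennreal (\<integral> i. norm (measure (u n) {i} - measure a {i}) \<partial>?C)" for n
      by (rule nn_integral_eq_integral) (use int[OF u] int[OF a] in auto)
    then show "(\<lambda>n. (\<integral> i. norm (measure (u n) {i} - measure a {i}) \<partial>?C)) \<longlonglongrightarrow> 0"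
      using sch by (subst tendsto_ennreal_iff[symmetric]) auto
  qed
  have bd: "norm ((\<integral>x. f x \<partial>u n) - (\<integral>x. f x \<partial>a)) \<le> B * (\<integral> i. norm (measure (u n) {i} - measure a {i}) \<partial>?C)" for n
  proof -
    have "(\<integral>x. f x \<partial>u n) - (\<integral>x. f x \<partial>a) = (\<integral>i. (measure (u n) {i} - measure a {i}) * f i \<partial>?C)"
      unfolding eq[OF u] eq[OF a]
      by (subst Bochner_Integration.integral_diff[symmetric]) (use intf[OF u] intf[OF a] in \<open>auto simp: left_diff_distrib\<close>)
    also have "norm \<dots> \<le> (\<integral>i. norm ((measure (u n) {i} - measure a {i}) * f i) \<partial>?C)"
      by (rule integral_norm_bound)
    also have "\<dots> \<le> (\<integral>i. B * norm (measure (u n) {i} - measure a {i}) \<partial>?C)"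
    proof (rule integral_mono)
      show "integrable ?C (\<lambda>i. norm ((measure (u n) {i} - measure a {i}) * f i))"
        using intf[OF u] intf[OF a] by (auto simp: left_diff_distrib)
      show "integrable ?C (\<lambda>i. B * norm (measure (u n) {i} - measure a {i}))"
        using int[OF u] int[OF a] by auto
      show "norm ((measure (u n) {i} - measure a {i}) * f i) \<le> B * norm (measure (u n) {i} - measure a {i})" for i
        using mult_right_mono[OF B[of i], of "\<bar>measure (u n) {i} - measure a {i}\<bar>"]
        by (simp add: abs_mult mult.commute)
    qed
    finally show ?thesis by simp
  qed
  show ?thesis
  proof (rule LIM_zero_cancel, rule Lim_null_comparison)
    show "eventually (\<lambda>n. norm ((\<integral>x. f x \<partial>u n) - (\<integral>x. f x \<partial>a)) \<le> B * (\<integral> i. norm (measure (u n) {i} - measure a {i}) \<partial>?C)) sequentially"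
      using bd by auto
    show "(\<lambda>n. B * (\<integral> i. norm (measure (u n) {i} - measure a {i}) \<partial>?C)) \<longlonglongrightarrow> 0"
      using sch' by simp
  qed
qed

lemma openin_PE:
  fixes U :: "'e::countable measure set"
  assumes "openin PE U"
  shows "\<exists>V. open V \<and> U = {\<mu> \<in> prob_measures (discrete_topology UNIV). (\<lambda>i. measure \<mu> {i}) \<in> V}"
proof -
  let ?P = "prob_measures (discrete_topology (UNIV :: 'e set))"
  let ?e = "\<lambda>\<mu> (i::'e). measure \<mu> {i}"
  from assms have "generate_topology_on {{\<mu> \<in> ?P. (\<integral>x. f x \<partial>\<mu>) \<in> U} | f U. f \<in> bdd_continuous (discrete_topology UNIV) \<and> open U} U"
    unfolding weak_topology_def openin_topology_generated_by_iff .
  then show ?thesis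
  proof induction
    case Empty then show ?case by (intro exI[of _ "{}"]) auto
  next
    case (Int a b)
    then obtain V W where "open V" "open W" "a = {\<mu>\<in>?P. ?e \<mu> \<in> V}" "b = {\<mu>\<in>?P. ?e \<mu> \<in> W}" by blast
    then show ?case by (intro exI[of _ "V \<inter> W"]) auto
  next
    case (UN K)
    then have "\<forall>k\<in>K. \<exists>V. open V \<and> k = {\<mu>\<in>?P. ?e \<mu> \<in> V}" by blast
    then obtain V where "\<forall>k\<in>K. open (V k) \<and> k = {\<mu>\<in>?P. ?e \<mu> \<in> V k}"
      unfolding bchoice_iff by (elim exE)
    then have V: "\<And>k. k \<in> K \<Longrightarrow> open (V k)" "\<And>k. k \<in> K \<Longrightarrow> k = {\<mu>\<in>?P. ?e \<mu> \<in> V k}"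
      by blast+
    have "\<Union>K = {\<mu>\<in>?P. ?e \<mu> \<in> (\<Union>k\<in>K. V k)}" using V(2) by blast
    moreover have "open (\<Union>k\<in>K. V k)" using V(1) by auto
    ultimately show ?case by blast
  next
    case (Basis s)
    then obtain f W where s: "s = {\<mu> \<in> ?P. (\<integral>x. f x \<partial>\<mu>) \<in> W}" and W: "open W"
      and "f \<in> bdd_continuous (discrete_topology (UNIV::'e set))" by blast
    then have f: "bounded (range f)" by (simp add: bdd_continuous_def)
    define g where "g = inv_into ?P ?e"
    have inj: "inj_on ?e ?P"
    proof (rule inj_onI)
      fix \<mu> \<nu> assume P: "\<mu> \<in> ?P" "\<nu> \<in> ?P" and e: "?e \<mu> = ?e \<nu>"
      have "\<mu> = density (count_space UNIV) (\<lambda>i. ennreal (?e \<mu> i))" using prob_density_eq[OF P(1)] .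
      also have "\<dots> = density (count_space UNIV) (\<lambda>i. ennreal (?e \<nu> i))" unfolding fun_cong[OF e] ..
      also have "\<dots> = \<nu>" using prob_density_eq[OF P(2)] by (rule sym)
      finally show "\<mu> = \<nu>" .
    qed
    have ge: "g (?e \<mu>) = \<mu>" if "\<mu> \<in> ?P" for \<mu> unfolding g_def by (rule inv_into_f_f[OF inj that])
    have "continuous_on (?e ` ?P) (\<lambda>p. \<integral>x. f x \<partial>g p)"
    proof (rule continuous_on_sequentiallyI)
      fix p q assume p: "\<forall>n. p n \<in> ?e ` ?P" and q: "q \<in> ?e ` ?P" and l: "p \<longlonglongrightarrow> q"
      have "\<forall>n. \<exists>\<mu>. \<mu> \<in> ?P \<and> p n = ?e \<mu>" using p by blast
      then obtain u where "\<forall>n. u n \<in> ?P \<and> p n = ?e (u n)" unfolding choice_iff by (elim exE)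
      then have u: "\<And>n. u n \<in> ?P" "\<And>n. p n = ?e (u n)" by blast+
      from q obtain a where a: "a \<in> ?P" "q = ?e a" by auto
      have "(\<lambda>n. p n i) \<longlonglongrightarrow> q i" for i
        by (rule continuous_on_tendsto_compose[OF continuous_on_product_coordinates l]) auto
      then have "(\<lambda>n. \<integral>x. f x \<partial>u n) \<longlonglongrightarrow> (\<integral>x. f x \<partial>a)"
        using weak_conv_PE[OF u(1) a(1) _ f] by (simp add: u a)
      then show "(\<lambda>n. \<integral>x. f x \<partial>g (p n)) \<longlonglongrightarrow> (\<integral>x. f x \<partial>g q)"
        by (simp add: u a ge)
    qed
    then obtain V where V: "open V" "V \<inter> ?e ` ?P = (\<lambda>p. \<integral>x. f x \<partial>g p) -` W \<inter> ?e ` ?P"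
      using W unfolding continuous_on_open_invariant by blast
    have "s = {\<mu>\<in>?P. ?e \<mu> \<in> V}"
    proof (rule set_eqI)
      fix \<mu> show "\<mu> \<in> s \<longleftrightarrow> \<mu> \<in> {\<mu>\<in>?P. ?e \<mu> \<in> V}"
      proof (cases "\<mu> \<in> ?P")
        case True
        then have "?e \<mu> \<in> V \<longleftrightarrow> (\<integral>x. f x \<partial>g (?e \<mu>)) \<in> W" using V(2) by blast
        then show ?thesis using True by (simp add: ge s)
      qed (simp add: s)
    qed
    then show ?case using V(1) by blast
  qed
qed

lemma sets_borel_of_PE:
  "sets (borel_of (PE :: 'e::countable measure topology)) = sets (prob_algebra (count_space UNIV))"
proof
  let ?P = "prob_measures (discrete_topology (UNIV :: 'e set))"
  let ?A = "prob_algebra (count_space (UNIV :: 'e set))"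
  have "{U. openin (PE :: 'e measure topology) U} \<subseteq> sets ?A"
  proof safe
    fix U :: "'e measure set" assume "openin PE U"
    then obtain V where V: "open V" "U = {\<mu> \<in> ?P. (\<lambda>i. measure \<mu> {i}) \<in> V}" using openin_PE by blast
    have [measurable]: "(\<lambda>\<mu>. measure \<mu> {i}) \<in> borel_measurable ?A" for i :: 'e
      unfolding prob_algebra_def by (intro measurable_restrict_space1) simp
    have "(\<lambda>\<mu> i. measure \<mu> {i}) \<in> ?A \<rightarrow>\<^sub>M borel"
      by (rule measurable_coordinatewise_then_product) simp
    from measurable_sets[OF this, of V] V show "U \<in> sets ?A"
      by (simp add: space_prob_algebra_count_space vimage_def Int_def conj_commute)
  qed
  then have "sigma_sets (space ?A) {U. openin (PE :: 'e measure topology) U} \<subseteq> sets ?A"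
    by (rule sets.sigma_sets_subset)
  moreover have op: "{U. openin (PE :: 'e measure topology) U} \<subseteq> Pow ?P" 
    using openin_subset[of "PE :: 'e measure topology"] by auto
  ultimately show "sets (borel_of PE) \<subseteq> sets ?A"
    by (simp add: borel_of_def space_prob_algebra_count_space)
  have sp: "space (borel_of (PE :: 'e measure topology)) = ?P"
    using op by (simp add: borel_of_def space_measure_of)
  have "(\<lambda>\<mu>. \<mu>) \<in> borel_of (PE :: 'e measure topology) \<rightarrow>\<^sub>M ?A"
  proof (rule measurable_prob_algebraI)
    show "prob_space \<mu>" if "\<mu> \<in> space (borel_of PE)" for \<mu> :: "'e measure"
      using that by (simp add: sp prob_measures_discrete)
    show "(\<lambda>\<mu>. \<mu>) \<in> borel_of (PE :: 'e measure topology) \<rightarrow>\<^sub>M subprob_algebra (count_space UNIV)"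
    proof (rule measurable_subprob_algebra)
      fix \<mu> :: "'e measure" assume "\<mu> \<in> space (borel_of PE)"
      then have \<mu>: "prob_space \<mu>" "sets \<mu> = UNIV" by (auto simp: sp prob_measures_discrete)
      then show "subprob_space \<mu>" "sets \<mu> = sets (count_space UNIV)"
        by (auto intro: prob_space_imp_subprob_space)
    next
      fix A :: "'e set"
      have "(\<lambda>\<mu>. measure \<mu> A) \<in> borel_measurable (borel_of (PE :: 'e measure topology))"
      proof (rule borel_measurableI)
        fix W :: "real set" assume W: "open W"
        have "indicat_real A \<in> bdd_continuous (discrete_topology UNIV)"
          by (auto simp: bdd_continuous_def bounded_iff intro!: exI[of _ 1])
        then have "openin PE {\<mu> \<in> ?P. (\<integral>x. indicat_real A x \<partial>\<mu>) \<in> W}"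
          using W unfolding weak_topology_def by (intro topology_generated_by_Basis) blast
        moreover have "(\<integral>x. indicat_real A x \<partial>\<mu>) = measure \<mu> A" if "\<mu> \<in> ?P" for \<mu>
          using that sets_eq_imp_space_eq[of \<mu> "count_space UNIV"] by (simp add: prob_measures_discrete)
        ultimately have "openin PE {\<mu> \<in> ?P. measure \<mu> A \<in> W}" by (simp cong: conj_cong)
        then have "{\<mu> \<in> ?P. measure \<mu> A \<in> W} \<in> sets (borel_of PE)"
          using op by (simp add: borel_of_def sigma_sets.Basic)
        then show "(\<lambda>\<mu>. measure \<mu> A) -` W \<inter> space (borel_of (PE :: 'e measure topology)) \<in> sets (borel_of PE)"
          by (simp add: sp vimage_def Int_def conj_commute)
      qed
      then have "(\<lambda>\<mu>. ennreal (measure \<mu> A)) \<in> borel_measurable (borel_of (PE :: 'e measure topology))" by simp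
      moreover have "emeasure \<mu> A = ennreal (measure \<mu> A)" if "\<mu> \<in> space (borel_of PE)" for \<mu> :: "'e measure"
        using that by (auto simp: sp prob_measures_discrete prob_space_def finite_measure.emeasure_eq_measure)
      ultimately show "(\<lambda>\<mu>. emeasure \<mu> A) \<in> borel_measurable (borel_of (PE :: 'e measure topology))"
        by (simp cong: measurable_cong)
    qed
  qed
  from measurable_sets[OF this] show "sets ?A \<subseteq> sets (borel_of PE)"
    using sets.sets_into_space[of _ ?A] by (auto simp: sp space_prob_algebra_count_space Int_absorb2 )
qed


lemma borel_measurable_nn_integral_count_space:
  fixes f :: "'a \<Rightarrow> 'e::countable \<Rightarrow> ennreal"
  assumes "\<And>i. (\<lambda>y. f y i) \<in> borel_measurable N"
  shows "(\<lambda>y. \<integral>\<^sup>+i. f y i \<partial>count_space UNIV) \<in> borel_measurable N"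
proof -
  have "case_prod f \<in> borel_measurable (N \<Otimes>\<^sub>M count_space UNIV)"
    unfolding case_prod_beta
    by (rule measurable_compose_countable'[where f = "\<lambda>i x. f (fst x) i" and g = snd and I = UNIV])
       (use assms in auto)
  then show ?thesis
    by (rule sigma_finite_measure.borel_measurable_nn_integral[OF sigma_finite_measure_count_space])
qed

lemma row_mass_row_mult:
  fixes A :: "'e::countable \<Rightarrow> 'e \<Rightarrow> real"
  shows "row_mass (row_mult v A) = (\<integral>\<^sup>+i. v i * (\<integral>\<^sup>+j. ennreal (A i j) \<partial>count_space UNIV) \<partial>count_space UNIV)"
proof -
  have "row_mass (row_mult v A) =
      (\<integral>\<^sup>+i. (\<integral>\<^sup>+j. v i * ennreal (A i j) \<partial>count_space UNIV) \<partial>count_space (UNIV :: 'e set))"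
    unfolding row_mass_def row_mult_def by (rule nn_integral_count_space_nn_integral) auto
  then show ?thesis by (simp add: nn_integral_cmult)
qed

context hidden_markov_model
begin

lemma row_mult_measurable [measurable]:
  "(\<lambda>y. row_mult (row_of \<mu>) (M y) j) \<in> borel_measurable borel"
  unfolding row_mult_def
  by (rule borel_measurable_nn_integral_count_space) (use M_measurable in simp)

lemma row_mass_measurable [measurable]:
  "(\<lambda>y. row_mass (row_mult (row_of \<mu>) (M y))) \<in> borel_measurable borel"
  unfolding row_mass_def
  by (rule borel_measurable_nn_integral_count_space) simp

lemma nn_integral_row_of:
  fixes \<mu> :: "'e measure"
  assumes "\<mu> \<in> prob_measures (discrete_topology UNIV)"
  shows "(\<integral>\<^sup>+i. row_of \<mu> i \<partial>count_space UNIV) = 1"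
proof -
  from assms interpret prob_space \<mu> by (simp add: prob_measures_discrete)
  have sp: "space \<mu> = UNIV"
    using assms sets_eq_imp_space_eq[of \<mu> "count_space UNIV"] by (simp add: prob_measures_discrete)
  have "1 = emeasure (density (count_space UNIV) (\<lambda>i. ennreal (measure \<mu> {i}))) UNIV"
    using prob_density_eq[OF assms] emeasure_space_1 sp by simp
  then show ?thesis by (simp add: emeasure_density row_of_def emeasure_eq_measure)
qed

lemma AE_row_mass_finite:
  assumes "\<mu> \<in> prob_measures (discrete_topology UNIV)"
  shows "AE y in \<phi>. row_mass (row_mult (row_of \<mu>) (M y)) < \<infinity>"
  using M_row_bound
proof eventually_elim
  case (elim y)
  let ?s = "SUP i. \<integral>\<^sup>+j. ennreal (M y i j) \<partial>count_space UNIV"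
  have "row_mass (row_mult (row_of \<mu>) (M y)) \<le> (\<integral>\<^sup>+i. row_of \<mu> i * ?s \<partial>count_space UNIV)"
    unfolding row_mass_row_mult by (intro nn_integral_mono mult_left_mono SUP_upper) auto
  also have "\<dots> = ?s"
    by (simp add: nn_integral_multc nn_integral_row_of[OF assms])
  finally show ?case using elim by simp
qed

lemma nn_integral_row_mass:
  assumes "\<mu> \<in> prob_measures (discrete_topology UNIV)"
  shows "(\<integral>\<^sup>+y. row_mass (row_mult (row_of \<mu>) (M y)) \<partial>\<phi>) = 1"
proof -
  note [measurable_cong] = sets_phi
  note [measurable] = M_measurable
  have [measurable]: "(\<lambda>y. \<integral>\<^sup>+j. ennreal (M y i j) \<partial>count_space UNIV) \<in> borel_measurable borel" for i
    by (rule borel_measurable_nn_integral_count_space) simp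
  have "(\<integral>\<^sup>+y. row_mass (row_mult (row_of \<mu>) (M y)) \<partial>\<phi>) =
     (\<integral>\<^sup>+i. \<integral>\<^sup>+y. row_of \<mu> i * (\<integral>\<^sup>+j. ennreal (M y i j) \<partial>count_space UNIV) \<partial>\<phi> \<partial>count_space UNIV)"
    unfolding row_mass_row_mult
    by (rule nn_integral_count_space_nn_integral) auto
  also have "\<dots> = (\<integral>\<^sup>+i. row_of \<mu> i * (\<integral>\<^sup>+j. trans_mat \<phi> M i j \<partial>count_space UNIV) \<partial>count_space UNIV)"
    unfolding trans_mat_def
    by (subst nn_integral_cmult, simp, subst nn_integral_count_space_nn_integral) auto
  also have "\<dots> = 1"
    using stochastic_P by (simp add: stochastic_matrix_def nn_integral_row_of[OF assms])
  finally show ?thesis .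
qed

lemma joint_measurable:
  shows "(\<lambda>x. row_mult (row_of (fst x)) (M (snd x)) j) \<in> borel_measurable (borel_of PE \<Otimes>\<^sub>M borel)"
    and "(\<lambda>x. row_mass (row_mult (row_of (fst x)) (M (snd x)))) \<in> borel_measurable (borel_of PE \<Otimes>\<^sub>M borel)"
proof -
  have r: "(\<lambda>\<mu>. row_of \<mu> i) \<in> borel_measurable (borel_of PE)" for i :: 'e
  proof -
    have "(\<lambda>\<mu>. row_of \<mu> i) \<in> borel_measurable (prob_algebra (count_space (UNIV :: 'e set)))"
      unfolding row_of_def prob_algebra_def by (intro measurable_restrict_space1) simp
    then show ?thesis using measurable_cong_sets[OF sets_borel_of_PE refl] by blast
  qed
  show *: "(\<lambda>x. row_mult (row_of (fst x)) (M (snd x)) j) \<in> borel_measurable (borel_of PE \<Otimes>\<^sub>M borel)" for j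
    unfolding row_mult_def
    by (intro borel_measurable_nn_integral_count_space borel_measurable_times_ennreal
        measurable_compose[OF measurable_fst r]
        measurable_compose[OF measurable_snd measurable_compose[OF M_measurable measurable_ennreal]])
  show "(\<lambda>x. row_mass (row_mult (row_of (fst x)) (M (snd x)))) \<in> borel_measurable (borel_of PE \<Otimes>\<^sub>M borel)"
    unfolding row_mass_def by (rule borel_measurable_nn_integral_count_space) (rule *)
qed

lemma space_borel_of_PE: "space (borel_of PE) = prob_measures (discrete_topology UNIV)"
  using sets_eq_imp_space_eq[OF sets_borel_of_PE] by (simp add: space_prob_algebra_count_space)

lemma filter_step_measurable_joint:
  "(\<lambda>x. filter_step M (fst x) (snd x)) \<in> borel_of PE \<Otimes>\<^sub>M borel \<rightarrow>\<^sub>M borel_of PE"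
proof -
  let ?v = "\<lambda>x. row_mult (row_of (fst x)) (M (snd x))"
  let ?B = "borel_of PE \<Otimes>\<^sub>M borel :: ('e measure \<times> 'f) measure"
  note joint_measurable[measurable]
  have em: "emeasure (normalized (?v x)) A = (\<integral>\<^sup>+j. ?v x j / row_mass (?v x) * indicator A j \<partial>count_space UNIV)" for x A
    by (simp add: normalized_def emeasure_density)
  have pr: "prob_space (normalized (?v x))" if "row_mass (?v x) \<noteq> 0" "row_mass (?v x) \<noteq> \<infinity>" for x
  proof
    have "emeasure (normalized (?v x)) UNIV = row_mass (?v x) / row_mass (?v x)"
      unfolding em by (simp add: nn_integral_divide row_mass_def)
    then show "emeasure (normalized (?v x)) (space (normalized (?v x))) = 1"
      using that by (simp add: normalized_def ennreal_divide_self less_top)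
  qed
  have fst: "prob_space (fst x) \<and> sets (fst x) = UNIV" if "x \<in> space ?B" for x
    using that by (auto simp: space_pair_measure space_borel_of_PE prob_measures_discrete)
  have "(\<lambda>x. filter_step M (fst x) (snd x)) \<in> ?B \<rightarrow>\<^sub>M prob_algebra (count_space UNIV)"
  proof (rule measurable_prob_algebraI)
    show p: "prob_space (filter_step M (fst x) (snd x))" if "x \<in> space ?B" for x
      using fst[OF that] pr[of x] by (auto simp: filter_step_def Let_def)
    show "(\<lambda>x. filter_step M (fst x) (snd x)) \<in> ?B \<rightarrow>\<^sub>M subprob_algebra (count_space UNIV)"
    proof (rule measurable_subprob_algebra)
      show "subprob_space (filter_step M (fst x) (snd x))" if "x \<in> space ?B" for x
        using p[OF that] by (rule prob_space_imp_subprob_space)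
      show "sets (filter_step M (fst x) (snd x)) = sets (count_space UNIV)" if "x \<in> space ?B" for x
        using fst[OF that] by (simp add: filter_step_def Let_def normalized_def)
      fix A :: "'e set"
      have [measurable]: "(\<lambda>x. \<integral>\<^sup>+j. ?v x j / row_mass (?v x) * indicator A j \<partial>count_space UNIV) \<in> borel_measurable ?B"
        by (rule borel_measurable_nn_integral_count_space) simp
      have "(\<lambda>\<mu>. emeasure \<mu> A) \<in> borel_measurable (prob_algebra (count_space (UNIV :: 'e set)))"
        unfolding prob_algebra_def by (intro measurable_restrict_space1) simp
      then have [measurable]: "(\<lambda>\<mu>. emeasure \<mu> A) \<in> borel_measurable (borel_of PE)"
        using measurable_cong_sets[OF sets_borel_of_PE refl] by blast
      have "(\<lambda>x. if row_mass (?v x) = 0 \<or> row_mass (?v x) = \<infinity> then emeasure (fst x) A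
             else \<integral>\<^sup>+j. ?v x j / row_mass (?v x) * indicator A j \<partial>count_space UNIV) \<in> borel_measurable ?B"
        by measurable
      moreover have "emeasure (filter_step M (fst x) (snd x)) A =
        (if row_mass (?v x) = 0 \<or> row_mass (?v x) = \<infinity> then emeasure (fst x) A
             else \<integral>\<^sup>+j. ?v x j / row_mass (?v x) * indicator A j \<partial>count_space UNIV)" for x
        unfolding filter_step_def Let_def em[symmetric] by (rule if_distrib)
      ultimately show "(\<lambda>x. emeasure (filter_step M (fst x) (snd x)) A) \<in> borel_measurable ?B"
        by (simp only:)
    qed
  qed
  then show ?thesis
    using measurable_cong_sets[OF refl sets_borel_of_PE] by blast
qed

lemma filter_step_measurable:
  assumes "\<mu> \<in> prob_measures (discrete_topology UNIV)"
  shows "filter_step M \<mu> \<in> borel \<rightarrow>\<^sub>M borel_of PE"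
  using measurable_Pair2[OF filter_step_measurable_joint, of \<mu>] assms
  by (simp add: space_borel_of_PE)

lemma filter_kernel_in_prob_measures:
  assumes \<mu>: "\<mu> \<in> prob_measures (discrete_topology UNIV)"
  shows "filter_kernel \<phi> M \<mu> \<in> prob_measures PE"
proof -
  note [measurable_cong] = sets_phi
  let ?d = "density \<phi> (\<lambda>y. row_mass (row_mult (row_of \<mu>) (M y)))"
  have "prob_space ?d"
    by (rule prob_spaceI) (simp add: emeasure_density nn_integral_row_mass[OF \<mu>] cong: nn_integral_cong_simp)
  moreover have "filter_step M \<mu> \<in> ?d \<rightarrow>\<^sub>M borel_of PE"
    using filter_step_measurable[OF \<mu>] by simp
  ultimately show ?thesis
    by (simp add: filter_kernel_def prob_measures_def prob_space.prob_space_distr)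
qed

text \<open>\<^const>\<open>filter_kernel\<close> is a Markov kernel in the sense of the Giry monad.\<close>
lemma filter_kernel_measurable:
  "filter_kernel \<phi> M \<in> borel_of PE \<rightarrow>\<^sub>M prob_algebra (borel_of PE)"
proof (rule measurable_prob_algebraI)
  note [measurable_cong] = sets_phi
  note joint_measurable[measurable] filter_step_measurable_joint[measurable]
  show p: "prob_space (filter_kernel \<phi> M \<mu>)" if "\<mu> \<in> space (borel_of PE)" for \<mu>
    using filter_kernel_in_prob_measures[of \<mu>] that by (simp add: space_borel_of_PE prob_measures_def)
  show "filter_kernel \<phi> M \<in> borel_of PE \<rightarrow>\<^sub>M subprob_algebra (borel_of PE)"
  proof (rule measurable_subprob_algebra)
    show "subprob_space (filter_kernel \<phi> M \<mu>)" if "\<mu> \<in> space (borel_of PE)" for \<mu>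
      using p[OF that] by (rule prob_space_imp_subprob_space)
    show "sets (filter_kernel \<phi> M \<mu>) = sets (borel_of PE)" for \<mu>
      by (simp add: filter_kernel_def)
    fix A :: "'e measure set" assume A[measurable]: "A \<in> sets (borel_of PE)"
    have "(\<lambda>x. row_mass (row_mult (row_of (fst x)) (M (snd x))) * indicator A (filter_step M (fst x) (snd x)))
        \<in> borel_measurable (borel_of PE \<Otimes>\<^sub>M borel)"
      by measurable
    then have "(\<lambda>x. row_mass (row_mult (row_of (fst x)) (M (snd x))) * indicator A (filter_step M (fst x) (snd x)))
        \<in> borel_measurable (borel_of PE \<Otimes>\<^sub>M \<phi>)"
      by simp
    from sigma_finite_measure.borel_measurable_nn_integral[OF sigma_finite_phi, of "\<lambda>\<mu> y. row_mass (row_mult (row_of \<mu>) (M y)) * indicator A (filter_step M \<mu> y)"] this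
    have "(\<lambda>\<mu>. \<integral>\<^sup>+y. row_mass (row_mult (row_of \<mu>) (M y)) * indicator A (filter_step M \<mu> y) \<partial>\<phi>)
        \<in> borel_measurable (borel_of PE)"
      by (simp add: case_prod_beta)
    moreover have "emeasure (filter_kernel \<phi> M \<mu>) A =
        (\<integral>\<^sup>+y. row_mass (row_mult (row_of \<mu>) (M y)) * indicator A (filter_step M \<mu> y) \<partial>\<phi>)"
      if "\<mu> \<in> space (borel_of PE)" for \<mu>
    proof -
      have [measurable]: "filter_step M \<mu> \<in> borel \<rightarrow>\<^sub>M borel_of PE"
        using filter_step_measurable that by (simp add: space_borel_of_PE)
      have sp: "space \<phi> = UNIV" using sets_eq_imp_space_eq[OF sets_phi] by simp
      have B: "filter_step M \<mu> -` A \<in> sets borel"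
        using measurable_sets[of "filter_step M \<mu>" borel "borel_of PE" A] by simp
      have "emeasure (filter_kernel \<phi> M \<mu>) A =
         (\<integral>\<^sup>+y. row_mass (row_mult (row_of \<mu>) (M y)) * indicator (filter_step M \<mu> -` A) y \<partial>\<phi>)"
        unfolding filter_kernel_def
        by (subst emeasure_distr) (use B in \<open>auto simp: sp emeasure_density sets_phi\<close>)
      then show ?thesis by (simp add: indicator_def)
    qed
    ultimately show "(\<lambda>\<mu>. emeasure (filter_kernel \<phi> M \<mu>) A) \<in> borel_measurable (borel_of PE)"
      by (simp cong: measurable_cong)
  qed
qed

lemma integral_filter_kernel:
  assumes \<mu>: "\<mu> \<in> prob_measures (discrete_topology UNIV)" and f: "f \<in> bdd_continuous PE"
  shows "(\<integral>\<nu>. f \<nu> \<partial>filter_kernel \<phi> M \<mu>) =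
    (\<integral>y. (let v = row_mult (row_of \<mu>) (M y)
          in if row_mass v = 0 then 0 else f (normalized v) * enn2real (row_mass v)) \<partial>\<phi>)"
proof -
  note [measurable_cong] = sets_phi
  let ?v = "\<lambda>y. row_mult (row_of \<mu>) (M y)"
  let ?m = "\<lambda>y. row_mass (?v y)"
  have [measurable]: "f \<in> borel_measurable (borel_of PE)"
  proof (rule borel_measurableI)
    fix W :: "real set" assume "open W"
    then have "openin PE {x \<in> topspace PE. f x \<in> W}"
      using f by (auto simp: bdd_continuous_def continuous_map_def)
    then show "f -` W \<inter> space (borel_of PE) \<in> sets (borel_of PE)"
      using openin_subset[of PE] unfolding borel_of_def
      by (subst space_measure_of, blast) (auto simp: sets_measure_of vimage_def Int_def conj_commute intro!: sigma_sets.Basic)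
  qed
  note filter_step_measurable[OF \<mu>, measurable]
  have d: "density \<phi> ?m = density \<phi> (\<lambda>y. ennreal (enn2real (?m y)))"
    using AE_row_mass_finite[OF \<mu>] by (intro density_cong) (auto elim!: eventually_mono simp: less_top)
  have "(\<integral>\<nu>. f \<nu> \<partial>filter_kernel \<phi> M \<mu>) = (\<integral>y. enn2real (?m y) * f (filter_step M \<mu> y) \<partial>\<phi>)"
    unfolding filter_kernel_def d by (subst integral_distr, simp, simp, subst integral_density) auto
  also have "\<dots> = (\<integral>y. (let v = ?v y in if row_mass v = 0 then 0 else f (normalized v) * enn2real (row_mass v)) \<partial>\<phi>)"
    by (rule Bochner_Integration.integral_cong) (auto simp: filter_step_def Let_def)
  finally show ?thesis .
qed

end

end

theory Submission
  imports Defs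
begin

text \<open>
  Condition (C) forces \<open>\<pi>min = \<pi>max\<close> almost surely: the \<open>l\<^sup>1\<close>-distance of the two filters grows on
  average by at most a factor 2 over any number of steps, by ergodicity of the signal it becomes
  smaller than every \<open>\<epsilon>\<close> at some random time, and therefore it vanishes.

  If the two filters agree, the filter forgets its initial law. Expanding \<open>\<rho> M(y\<^sub>1) \<cdots> M(y\<^sub>n)\<close> along the
  starting state \<open>k\<close>, the \<open>n\<close>-step filter kernel becomes a mixture over \<open>\<rho>\<close> of expectations given
  \<open>X\<^bsub>-n\<^esub> = k\<close>. Given \<open>X\<^bsub>-n\<^esub> = k\<close>, the filter started in \<open>\<rho>\<close> is close to the filter started in the
  invariant law, since the filters started in single states converge to \<open>\<pi>max\<close> and the one started
  in the invariant law converges to \<open>\<pi>min\<close>; and the ergodic theorem for the signal chain removes the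
  conditioning, in Cesaro mean or, for an aperiodic chain, directly. Hence all laws converge to the
  law of \<open>\<pi>min\<close>.

  Conversely, the laws of \<open>\<pi>min\<close> and \<open>\<pi>max\<close> are both invariant, so unique ergodicity makes them
  equal. Since \<open>\<pi>min\<close> is the conditional expectation of \<open>\<pi>max\<close>, this gives \<open>\<pi>min = \<pi>max\<close>, and
  for countable \<open>F\<close> a single observation of positive probability yields Condition (C).
\<close>

section \<open>Versions of conditional probabilities and martingale convergence\<close>

text \<open>The obstacle is that intersecting over the remote past of the signal and joining with
  the observations do not commute: \<open>sigma_tail_XY 0\<close> can be essentially larger than
  \<open>sigma_Y 0\<close>, even for an ergodic signal. Condition (C) enters at one place only, to
  show that the gap between the two filters falls below every \<epsilon> with positive probability;
  from there on ergodicity takes over. The factor 2 is the price of normalization: unnormalized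
  differences keep their mass on average, and renormalizing costs the difference of the masses once
  more. Paid at every step it would be fatal, so the estimate is iterated in unnormalized form and
  normalized once. On a countable state space a probability measure is given by its point masses,
  and their pointwise convergence is already weak convergence, by Scheffe's lemma. Filters are
  therefore treated as countable families of scalar conditional probabilities that converge in mean.
  Almost sure convergence is used only along subsequences. The versions are bounded at every point,
  so that integrability and squares never involve null sets.\<close>

definition cond_prob_version :: "'a measure \<Rightarrow> 'a measure \<Rightarrow> 'a set \<Rightarrow> ('a \<Rightarrow> real) \<Rightarrow> bool" where
  "cond_prob_version N K T g \<longleftrightarrow> g \<in> borel_measurable K \<and> (\<forall>x. 0 \<le> g x \<and> g x \<le> 1) \<and>
     (\<forall>Z\<in>sets K. measure N (T \<inter> Z) = (\<integral>x. g x * indicator Z x \<partial>N))"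

context prob_space
begin

lemma integrable_unit_interval:
  fixes g :: "'a \<Rightarrow> real"
  assumes "g \<in> borel_measurable M" "\<And>x. 0 \<le> g x \<and> g x \<le> 1"
  shows "integrable M g"
  using assms by (intro integrable_const_bound[of _ 1]) auto

text \<open>Cauchy-Schwarz against the constant 1, read off from the variance of
  \<open>\<bar>h\<bar>\<close> being nonnegative.\<close>

lemma abs_expectation_le_sqrt:
  fixes h :: "'a \<Rightarrow> real"
  assumes [measurable]: "h \<in> borel_measurable M" and b: "\<And>x. \<bar>h x\<bar> \<le> B"
  shows "expectation (\<lambda>x. \<bar>h x\<bar>) \<le> sqrt (expectation (\<lambda>x. (h x)\<^sup>2))"
proof -
  have i: "integrable M (\<lambda>x. \<bar>h x\<bar>)" using b by (intro integrable_const_bound[of _ B]) auto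
  have i2: "integrable M (\<lambda>x. \<bar>h x\<bar>\<^sup>2)"
    using b abs_ge_zero power_mono[OF b, of _ 2] by (intro integrable_const_bound[of _ "B\<^sup>2"]) auto
  have "0 \<le> variance (\<lambda>x. \<bar>h x\<bar>)" by (rule variance_positive)
  also have "\<dots> = expectation (\<lambda>x. \<bar>h x\<bar>\<^sup>2) - (expectation (\<lambda>x. \<bar>h x\<bar>))\<^sup>2"
    by (rule variance_eq[OF i i2])
  finally show ?thesis by (intro real_le_rsqrt) simp
qed

lemma cond_prob_version_real_cond_exp:
  assumes K: "subalgebra M K" and T: "T \<in> events" and g: "cond_prob_version M K T g"
  shows "AE x in M. real_cond_exp M K (indicator T) x = g x"
proof -
  interpret finite_measure_subalgebra M K by standard (rule K)
  have gm: "g \<in> borel_measurable K" and b: "\<And>x. 0 \<le> g x \<and> g x \<le> 1"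
    and e: "\<And>Z. Z \<in> sets K \<Longrightarrow> measure M (T \<inter> Z) = (\<integral>x. g x * indicator Z x \<partial>M)"
    using g by (auto simp: cond_prob_version_def)
  have [measurable]: "g \<in> borel_measurable M" using measurable_from_subalg[OF K gm] .
  show ?thesis
  proof (rule real_cond_exp_charact[OF _ _ _ gm])
    fix A assume A: "A \<in> sets K"
    then have "A \<in> events" using K by (auto simp: subalgebra_def)
    then show "(\<integral>x\<in>A. indicator T x \<partial>M) = (\<integral>x\<in>A. g x \<partial>M)"
      using e[OF A] T unfolding set_lebesgue_integral_def
      by (simp add: indicator_inter_arith[symmetric] Int_commute mult.commute)
  qed (use T b in \<open>auto intro!: integrable_unit_interval\<close>)
qed

lemma cond_prob_version_AE_unique:
  assumes "subalgebra M K" "T \<in> events" "cond_prob_version M K T f" "cond_prob_version M K T g"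
  shows "AE x in M. f x = g x"
  using cond_prob_version_real_cond_exp[OF assms(1,2,3)] cond_prob_version_real_cond_exp[OF assms(1,2,4)]
  by eventually_elim simp

text \<open>Passes from the indicators in the definition of a version to bounded
  \<open>K\<close>-measurable factors, because a version is almost surely the conditional
  expectation.\<close>

lemma cond_prob_version_expectation:
  fixes h :: "'a \<Rightarrow> real"
  assumes K: "subalgebra M K" and T[measurable]: "T \<in> events" and g: "cond_prob_version M K T g"
    and h: "h \<in> borel_measurable K" "\<And>x. \<bar>h x\<bar> \<le> B"
  shows "(\<integral>x. h x * g x \<partial>M) = (\<integral>x. h x * indicator T x \<partial>M)"
proof -
  interpret finite_measure_subalgebra M K by standard (rule K)
  have [measurable]: "g \<in> borel_measurable M" "h \<in> borel_measurable M"
    using g h measurable_from_subalg[OF K] by (auto simp: cond_prob_version_def)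
  have "(\<integral>x. h x * g x \<partial>M) = (\<integral>x. h x * real_cond_exp M K (indicator T) x \<partial>M)"
    using cond_prob_version_real_cond_exp[OF K T g] by (intro integral_cong_AE) auto
  also have "\<dots> = (\<integral>x. h x * indicator T x \<partial>M)"
  proof (rule real_cond_exp_intg(2)[OF _ h(1)])
    show "integrable M (\<lambda>x. h x * indicator T x)"
      using h(2) by (intro integrable_const_bound[of _ "\<bar>B\<bar>"]) (auto simp: indicator_def intro: order_trans[OF _ abs_ge_self])
  qed simp
  finally show ?thesis .
qed

text \<open>Pythagoras: \<open>f\<close> is the orthogonal projection of \<open>g\<close> onto the
  smaller sigma-field, since integrating either version against the \<open>H\<close>-measurable
  \<open>f\<close> gives the integral of \<open>f\<close> over \<open>T\<close>. The identity turns
  monotone second moments into Cauchy sequences, and equal second moments into equal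
  versions.\<close>

lemma cond_prob_version_sq_dist:
  assumes H: "subalgebra M H" and K: "subalgebra M K" "sets H \<subseteq> sets K" and T: "T \<in> events"
    and f: "cond_prob_version M H T f" and g: "cond_prob_version M K T g"
  shows "expectation (\<lambda>x. (f x - g x)\<^sup>2) = expectation (\<lambda>x. (g x)\<^sup>2) - expectation (\<lambda>x. (f x)\<^sup>2)"
proof -
  have fH: "f \<in> borel_measurable H" and gK: "g \<in> borel_measurable K" using f g by (auto simp: cond_prob_version_def)
  have fK: "f \<in> borel_measurable K"
    using measurable_from_subalg[OF _ fH, of K] K H by (auto simp: subalgebra_def)
  have [measurable]: "f \<in> borel_measurable M" "g \<in> borel_measurable M"
    using measurable_from_subalg[OF H fH] measurable_from_subalg[OF K(1) gK] by auto
  have b: "\<bar>f x\<bar> \<le> 1" "\<bar>g x\<bar> \<le> 1" "0 \<le> f x" "0 \<le> g x" for x using f g by (auto simp: cond_prob_version_def)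
  have i: "integrable M (\<lambda>x. (f x)\<^sup>2)" "integrable M (\<lambda>x. (g x)\<^sup>2)" "integrable M (\<lambda>x. f x * g x)"
    using b by (auto intro!: integrable_unit_interval simp: power_le_one mult_le_one)
  have "(\<integral>x. f x * g x \<partial>M) = (\<integral>x. f x * f x \<partial>M)"
    using cond_prob_version_expectation[OF H T f fH b(1)] cond_prob_version_expectation[OF K(1) T g fK b(1)] by simp
  moreover have "expectation (\<lambda>x. (f x - g x)\<^sup>2) = expectation (\<lambda>x. (f x)\<^sup>2 + (g x)\<^sup>2 - 2 * (f x * g x))"
    by (simp add: power2_diff mult.assoc)
  moreover have "\<dots> = expectation (\<lambda>x. (f x)\<^sup>2) + expectation (\<lambda>x. (g x)\<^sup>2) - 2 * expectation (\<lambda>x. f x * g x)"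
    using i by simp
  ultimately show ?thesis by (simp add: power2_eq_square)
qed

text \<open>Both sides are finite measures in \<open>Z\<close>, the restriction of \<open>M\<close>
  to \<open>T\<close> and the measure with density \<open>F\<close>; agreement on an
  intersection-stable generator extends to \<open>K\<close>.\<close>

lemma cond_prob_versionI_generator:
  assumes K: "subalgebra M K" and T: "T \<in> events" and FK: "F \<in> borel_measurable K" and Fb: "\<And>x. 0 \<le> F x \<and> F x \<le> 1"
    and stable: "Int_stable E" and top: "space M \<in> E" and gen: "sets K = sigma_sets (space M) E"
    and E: "\<And>Z. Z \<in> E \<Longrightarrow> measure M (T \<inter> Z) = (\<integral>x. F x * indicator Z x \<partial>M)"
  shows "cond_prob_version M K T F"
  unfolding cond_prob_version_def
proof (intro conjI FK allI ballI)
  fix Z assume Z: "Z \<in> sets K"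
  have [measurable]: "F \<in> borel_measurable M" using measurable_from_subalg[OF K FK] .
  have EM: "E \<subseteq> events" using K gen by (auto simp: subalgebra_def intro: sigma_sets.Basic)
      have idK: "(\<lambda>x. x) \<in> M \<rightarrow>\<^sub>M K" using K by (auto simp: measurable_def subalgebra_def Int_absorb2 dest: sets.sets_into_space)
      have em1: "emeasure (distr (density M (indicator T)) K (\<lambda>x. x)) A = measure M (T \<inter> A)" if "A \<in> sets K" for A
      proof -
        have A: "A \<in> events" using that K by (auto simp: subalgebra_def)
        then have "A \<subseteq> space M" by (rule sets.sets_into_space)
        then have "emeasure (distr (density M (indicator T)) K (\<lambda>x. x)) A = emeasure (density M (indicator T)) A"
          using that idK by (subst emeasure_distr) (auto simp: vimage_def Int_absorb2)
        also have "\<dots> = (\<integral>\<^sup>+x. indicator (T \<inter> A) x \<partial>M)"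
          using A T by (subst emeasure_density) (auto intro!: nn_integral_cong simp: indicator_def simp del: nn_integral_indicator)
        also have "\<dots> = measure M (T \<inter> A)"
          using A T by (subst nn_integral_indicator) (auto simp: emeasure_eq_measure)
        finally show ?thesis .
      qed
      have em2: "emeasure (distr (density M F) K (\<lambda>x. x)) A = (\<integral>x. F x * indicator A x \<partial>M)" if "A \<in> sets K" for A
      proof -
        have A[measurable]: "A \<in> events" using that K by (auto simp: subalgebra_def)
        then have "A \<subseteq> space M" by (rule sets.sets_into_space)
        then have "emeasure (distr (density M F) K (\<lambda>x. x)) A = emeasure (density M F) A"
          using that idK by (subst emeasure_distr) (auto simp: vimage_def Int_absorb2)
        also have "\<dots> = (\<integral>\<^sup>+x. ennreal (F x) * indicator A x \<partial>M)"
          by (subst emeasure_density) auto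
        also have "\<dots> = (\<integral>\<^sup>+x. ennreal (F x * indicator A x) \<partial>M)"
          by (intro nn_integral_cong) (auto simp: indicator_def)
        also have "\<dots> = ennreal (\<integral>x. F x * indicator A x \<partial>M)"
          using Fb by (intro nn_integral_eq_integral integrable_unit_interval) (auto simp: indicator_def)
        finally show ?thesis .
      qed
      have "distr (density M (indicator T)) K (\<lambda>x. x) = distr (density M F) K (\<lambda>x. x)"
      proof (rule measure_eqI_generator_eq[where E="E" and \<Omega>="space M" and A="\<lambda>_. space M"])
        show "Int_stable E" by (rule stable)
        show "E \<subseteq> Pow (space M)" using EM sets.sets_into_space by blast
        show "emeasure (distr (density M (indicator T)) K (\<lambda>x. x)) X = emeasure (distr (density M F) K (\<lambda>x. x)) X"
          if "X \<in> E" for X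
          using E[OF that] that gen by (subst em1, blast intro: sigma_sets.Basic, subst em2) (auto intro: sigma_sets.Basic)
        show "range (\<lambda>_. space M) \<subseteq> E" using top by auto
        have s: "space M \<in> sets K" using top gen by (auto intro: sigma_sets.Basic)
        show "emeasure (distr (density M (indicator T)) K (\<lambda>x. x)) (space M) \<noteq> \<infinity>" by (simp add: em1[OF s])
      qed (use gen in auto)
      then have "ennreal (measure M (T \<inter> Z)) = ennreal (\<integral>x. F x * indicator Z x \<partial>M)"
        using em1[OF Z] em2[OF Z] by simp
      moreover have "0 \<le> (\<integral>x. F x * indicator Z x \<partial>M)" using Fb by (intro Bochner_Integration.integral_nonneg) auto
      ultimately show "measure M (T \<inter> Z) = (\<integral>x. F x * indicator Z x \<partial>M)" by simp
qed (use Fb in auto)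

text \<open>Levy's upward and downward theorems in mean, by one argument. By Pythagoras the squared
  distance of two members is the difference of their second moments, and these are monotone and
  bounded, so the sequence is Cauchy in mean. It has an almost surely convergent subsequence, whose
  limit is again a version for \<open>K\<close> and thus equals \<open>g\<close> almost
  surely.\<close>

lemma cond_prob_L1_convergence:
  assumes H: "\<And>n. subalgebra M (H n)" and K: "subalgebra M K" and T: "T \<in> events"
    and f: "\<And>n. cond_prob_version M (H n) T (f n)" and g: "cond_prob_version M K T g"
    and lim: "(\<forall>n. sets (H n) \<subseteq> sets (H (Suc n))) \<and> sets K = sigma_sets (space M) (\<Union>n. sets (H n)) \<or>
              (\<forall>n. sets (H (Suc n)) \<subseteq> sets (H n)) \<and> sets K = (\<Inter>n. sets (H n))"
  shows "(\<lambda>n. expectation (\<lambda>x. \<bar>f n x - g x\<bar>)) \<longlonglongrightarrow> 0"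
proof -
  have fH: "f n \<in> borel_measurable (H n)" for n using f by (auto simp: cond_prob_version_def)
  have fb: "0 \<le> f n x" "f n x \<le> 1" "0 \<le> g x" "g x \<le> 1" for n x using f g by (auto simp: cond_prob_version_def)
  have gK: "g \<in> borel_measurable K" using g by (auto simp: cond_prob_version_def)
  have [measurable]: "f n \<in> borel_measurable M" "g \<in> borel_measurable M" for n
    using measurable_from_subalg[OF H fH] measurable_from_subalg[OF K gK] by auto
  have spH: "space (H n) = space M" "space K = space M" for n using H K by (auto simp: subalgebra_def)
  define e where "e n = expectation (\<lambda>x. (f n x)\<^sup>2)" for n
  have e01: "0 \<le> e n" "e n \<le> 1" for n
  proof -
    show "0 \<le> e n" unfolding e_def by simp
    have "e n \<le> expectation (\<lambda>x. 1)" unfolding e_def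
      using fb by (intro integral_mono integrable_unit_interval) (auto simp: power_le_one)
    then show "e n \<le> 1" by (simp add: prob_space)
  qed
  have mono: "(\<forall>m n. m \<le> n \<longrightarrow> sets (H m) \<subseteq> sets (H n)) \<or> (\<forall>m n. m \<le> n \<longrightarrow> sets (H n) \<subseteq> sets (H m))"
    using lim lift_Suc_mono_le[of "\<lambda>n. sets (H n)"] lift_Suc_antimono_le[of "\<lambda>n. sets (H n)"] by blast
  have sq: "expectation (\<lambda>x. (f m x - f n x)\<^sup>2) = \<bar>e m - e n\<bar>" for m n
  proof -
    have *: "expectation (\<lambda>x. (f m x - f n x)\<^sup>2) = e n - e m" if "sets (H m) \<subseteq> sets (H n)" for m n
      unfolding e_def by (rule cond_prob_version_sq_dist[OF H H that T f f])
    have **: "expectation (\<lambda>x. (f m x - f n x)\<^sup>2) = e m - e n" if "sets (H n) \<subseteq> sets (H m)" for m n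
      using *[OF that] by (simp add: power2_commute)
    have "0 \<le> expectation (\<lambda>x. (f m x - f n x)\<^sup>2)" by simp
    then show ?thesis using * ** mono by (metis abs_of_nonneg abs_minus_commute nle_le)
  qed
  have "Cauchy e"
  proof -
    have "mono e \<or> antimono e"
    proof -
      have "e m \<le> e n" if "sets (H m) \<subseteq> sets (H n)" for m n
      proof -
        have "expectation (\<lambda>x. (f m x - f n x)\<^sup>2) = e n - e m"
          unfolding e_def by (rule cond_prob_version_sq_dist[OF H H that T f f])
        moreover have "0 \<le> expectation (\<lambda>x. (f m x - f n x)\<^sup>2)" by simp
        ultimately show ?thesis by simp
      qed
      then show ?thesis using mono unfolding mono_def antimono_def by blast
    qed
    moreover have "Bseq e" using e01 by (intro BseqI'[of _ 1]) auto
    ultimately have "convergent e" by (intro Bseq_monoseq_convergent) (auto simp: monoseq_iff)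
    then show ?thesis by (rule convergent_Cauchy)
  qed
  have L1: "expectation (\<lambda>x. \<bar>f m x - f n x\<bar>) \<le> sqrt \<bar>e m - e n\<bar>" for m n
    unfolding sq[symmetric] using fb by (intro abs_expectation_le_sqrt[where B=1]) (auto simp: abs_le_iff diff_le_eq intro: add_increasing2 order_trans)
  have C: "\<exists>N. \<forall>i\<ge>N. \<forall>j\<ge>N. expectation (\<lambda>x. \<bar>f i x - f j x\<bar>) < d" if d: "d > 0" for d
  proof -
    obtain N where "\<forall>i\<ge>N. \<forall>j\<ge>N. norm (e i - e j) < d\<^sup>2"
      using \<open>Cauchy e\<close> d unfolding Cauchy_iff by (meson zero_less_power)
    then have "sqrt \<bar>e i - e j\<bar> < d" if "i \<ge> N" "j \<ge> N" for i j
      using that d by (intro real_sqrt_less_mono[THEN order_less_le_trans, of _ "d\<^sup>2"]) auto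
    then show ?thesis using L1 by (meson le_less_trans)
  qed
  obtain r where r: "strict_mono r" and rC: "AE x in M. Cauchy (\<lambda>i. f (r i) x)"
  proof (rule cauchy_L1_AE_cauchy_subseq[of M f])
    show "integrable M (f n)" for n using fb by (intro integrable_unit_interval) auto
  qed (use C in auto)
  \<comment> \<open>\<open>limsup\<close> exists at every point, stays in [0, 1], and does not
    change when finitely many terms are dropped; the last property makes it measurable for the
    intersection of a decreasing family.\<close>
  define F where "F x = enn2real (limsup (\<lambda>i. ennreal (f (r i) x)))" for x
  have Flim: "(\<lambda>i. f (r i) x) \<longlonglongrightarrow> F x" if Cx: "Cauchy (\<lambda>i. f (r i) x)" for x
  proof -
    obtain l where l: "(\<lambda>i. f (r i) x) \<longlonglongrightarrow> l" using Cx by (auto simp: Cauchy_convergent_iff convergent_def)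
    then have l0: "l \<ge> 0" by (rule LIMSEQ_le_const) (use fb in auto)
    have "(\<lambda>i. ennreal (f (r i) x)) \<longlonglongrightarrow> ennreal l" using l by (simp add: tendsto_ennrealI)
    then have "limsup (\<lambda>i. ennreal (f (r i) x)) = ennreal l" by (intro lim_imp_Limsup) auto
    then show ?thesis using l l0 by (simp add: F_def)
  qed
  have Fb: "0 \<le> F x \<and> F x \<le> 1" for x
  proof -
    have "limsup (\<lambda>i. ennreal (f (r i) x)) \<le> 1" by (rule Limsup_bounded) (use fb in auto)
    then have "F x \<le> enn2real 1" unfolding F_def by (intro enn2real_mono) auto
    then show ?thesis unfolding F_def by simp
  qed
  have FK: "F \<in> borel_measurable K"
  proof -
    have fr: "f (r i) \<in> borel_measurable N" if "sets (H (r i)) \<subseteq> sets N" "space N = space M" for i N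
      using fH[of "r i"] that spH by (auto simp: measurable_def)
    from lim show ?thesis
    proof
      assume *: "(\<forall>n. sets (H n) \<subseteq> sets (H (Suc n))) \<and> sets K = sigma_sets (space M) (\<Union>n. sets (H n))"
      then have "f (r i) \<in> borel_measurable K" for i by (intro fr) (auto simp: spH intro: sigma_sets.Basic)
      then show ?thesis unfolding F_def by measurable
    next
      assume *: "(\<forall>n. sets (H (Suc n)) \<subseteq> sets (H n)) \<and> sets K = (\<Inter>n. sets (H n))"
      have "F \<in> borel_measurable (H n)" for n
      proof -
        have "sets (H (r (i + n))) \<subseteq> sets (H n)" for i
          using lift_Suc_antimono_le[of "\<lambda>n. sets (H n)" n "r (i+n)"] * seq_suble[OF r, of "i+n"] by auto
        then have [measurable]: "f (r (i + n)) \<in> borel_measurable (H n)" for i by (intro fr) (auto simp: spH)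
        have "F = (\<lambda>x. enn2real (limsup (\<lambda>i. ennreal (f (r (i + n)) x))))"
          unfolding F_def by (subst limsup_shift_k) simp
        then show ?thesis by simp
      qed
      then show ?thesis using * by (auto simp: measurable_def spH)
    qed
  qed
  have [measurable]: "F \<in> borel_measurable M" using measurable_from_subalg[OF K FK] .
  have FL1: "(\<lambda>i. expectation (\<lambda>x. \<bar>f (r i) x - F x\<bar>)) \<longlonglongrightarrow> expectation (\<lambda>x. 0)"
  proof (rule integral_dominated_convergence[where w="\<lambda>_. 1"])
    show "AE x in M. (\<lambda>i. \<bar>f (r i) x - F x\<bar>) \<longlonglongrightarrow> 0"
      using rC
    proof eventually_elim
      case (elim x)
      show ?case using tendsto_rabs[OF tendsto_diff[OF Flim[OF elim] tendsto_const[of "F x"]]] by simp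
    qed
    show "AE x in M. norm \<bar>f (r i) x - F x\<bar> \<le> 1" for i
      using fb Fb by (intro AE_I2) (auto simp: abs_le_iff diff_le_eq intro: add_increasing2 order_trans)
  qed auto
  \<comment> \<open>The hypothesis covers both directions: a \<open>Z\<close> from one member of an
    increasing family lies in all later members, and a \<open>Z\<close> in the intersection of a
    decreasing family lies in every member.\<close>
  have FZ: "measure M (T \<inter> Z) = (\<integral>x. F x * indicator Z x \<partial>M)"
    if Z: "\<forall>\<^sub>F i in sequentially. Z \<in> sets (H (r i))" for Z
  proof -
    from Z obtain i0 where "Z \<in> sets (H (r i0))" by (auto simp: eventually_sequentially)
    then have [measurable]: "Z \<in> events" using H by (auto simp: subalgebra_def)
    have "(\<lambda>i. (\<integral>x. f (r i) x * indicator Z x \<partial>M)) \<longlonglongrightarrow> (\<integral>x. F x * indicator Z x \<partial>M)"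
    proof (rule integral_dominated_convergence[where w="\<lambda>_. 1"])
      show "AE x in M. (\<lambda>i. f (r i) x * indicator Z x) \<longlonglongrightarrow> F x * indicator Z x"
        using rC by eventually_elim (intro tendsto_mult Flim tendsto_const)
      show "AE x in M. norm (f (r i) x * indicator Z x) \<le> 1" for i
        using fb by (auto simp: indicator_def)
    qed auto
    moreover have "\<forall>\<^sub>F i in sequentially. (\<integral>x. f (r i) x * indicator Z x \<partial>M) = measure M (T \<inter> Z)"
      using Z by eventually_elim (use f in \<open>auto simp: cond_prob_version_def\<close>)
    ultimately have "(\<lambda>i. measure M (T \<inter> Z)) \<longlonglongrightarrow> (\<integral>x. F x * indicator Z x \<partial>M)"
      by (rule Lim_transform_eventually)
    then show ?thesis by (simp add: LIMSEQ_const_iff)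
  qed
  have FV: "cond_prob_version M K T F"
    using lim
  proof
    assume *: "(\<forall>n. sets (H (Suc n)) \<subseteq> sets (H n)) \<and> sets K = (\<Inter>n. sets (H n))"
    then show ?thesis using FK Fb FZ by (auto simp: cond_prob_version_def)
  next
    assume *: "(\<forall>n. sets (H n) \<subseteq> sets (H (Suc n))) \<and> sets K = sigma_sets (space M) (\<Union>n. sets (H n))"
    let ?E = "\<Union>n. sets (H n)"
    have up: "sets (H m) \<subseteq> sets (H n)" if "m \<le> n" for m n
      using lift_Suc_mono_le[of "\<lambda>n. sets (H n)"] * that by blast
    show ?thesis
    proof (rule cond_prob_versionI_generator[OF K T FK Fb, where E="?E"])
      show "Int_stable ?E"
      proof (rule Int_stableI)
        fix a b assume "a \<in> ?E" "b \<in> ?E"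
        then obtain m n where "a \<in> sets (H m)" "b \<in> sets (H n)" by auto
        then have "a \<in> sets (H (max m n))" "b \<in> sets (H (max m n))"
          using up[of m "max m n"] up[of n "max m n"] by auto
        then show "a \<inter> b \<in> ?E" by blast
      qed
      show "space M \<in> ?E" using spH by (metis (no_types, lifting) UN_I sets.top UNIV_I)
      show "sets K = sigma_sets (space M) ?E" using * by blast
      show "measure M (T \<inter> Z) = (\<integral>x. F x * indicator Z x \<partial>M)" if ZE: "Z \<in> ?E" for Z
      proof (rule FZ)
        obtain n where n: "Z \<in> sets (H n)" using ZE by auto
        show "\<forall>\<^sub>F i in sequentially. Z \<in> sets (H (r i))"
          using eventually_ge_at_top[of n]
        proof eventually_elim
          case (elim i)
          then have "n \<le> r i" using seq_suble[OF r, of i] by simp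
          then show ?case using up n by blast
        qed
      qed
    qed
  qed
  have Fg: "AE x in M. F x = g x" by (rule cond_prob_version_AE_unique[OF K T FV g])
  have rg: "(\<lambda>i. expectation (\<lambda>x. \<bar>f (r i) x - g x\<bar>)) \<longlonglongrightarrow> 0"
  proof -
    have "expectation (\<lambda>x. \<bar>f (r i) x - F x\<bar>) = expectation (\<lambda>x. \<bar>f (r i) x - g x\<bar>)" for i
      using Fg by (intro integral_cong_AE) auto
    then show ?thesis using FL1 by simp
  qed
  have int: "integrable M (\<lambda>x. \<bar>f m x - f n x\<bar>)" "integrable M (\<lambda>x. \<bar>f m x - g x\<bar>)" for m n
  proof -
    have "integrable M (f n)" "integrable M g" for n
      using fb by (auto intro!: integrable_unit_interval)
    then show "integrable M (\<lambda>x. \<bar>f m x - f n x\<bar>)" "integrable M (\<lambda>x. \<bar>f m x - g x\<bar>)"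
      by simp_all
  qed
  show ?thesis
  proof (rule LIMSEQ_I)
    fix d :: real assume d: "d > 0"
    obtain N where N: "\<forall>i\<ge>N. \<forall>j\<ge>N. expectation (\<lambda>x. \<bar>f i x - f j x\<bar>) < d/2" using C[of "d/2"] d by auto
    obtain N' where N': "\<forall>i\<ge>N'. expectation (\<lambda>x. \<bar>f (r i) x - g x\<bar>) < d/2"
      using LIMSEQ_D[OF rg, of "d/2"] d by auto
    show "\<exists>no. \<forall>n\<ge>no. norm (expectation (\<lambda>x. \<bar>f n x - g x\<bar>) - 0) < d"
    proof (intro exI allI impI)
      fix n assume n: "max N N' \<le> n"
      have "expectation (\<lambda>x. \<bar>f n x - g x\<bar>) \<le> expectation (\<lambda>x. \<bar>f n x - f (r n) x\<bar> + \<bar>f (r n) x - g x\<bar>)"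
        using int by (intro integral_mono) auto
      also have "\<dots> = expectation (\<lambda>x. \<bar>f n x - f (r n) x\<bar>) + expectation (\<lambda>x. \<bar>f (r n) x - g x\<bar>)"
        using int by simp
      also have "\<dots> < d/2 + d/2"
      proof (rule add_strict_mono)
        show "expectation (\<lambda>x. \<bar>f n x - f (r n) x\<bar>) < d/2" using N n seq_suble[OF r, of n] by simp
        show "expectation (\<lambda>x. \<bar>f (r n) x - g x\<bar>) < d/2" using N' n by simp
      qed
      also have "d/2 + d/2 = d" by simp
      finally show "norm (expectation (\<lambda>x. \<bar>f n x - g x\<bar>) - 0) < d" by simp
    qed
  qed
qed

end

section \<open>Path space and the law of observation windows\<close>

declare One_nat_def [simp del]

section \<open>Path space, its sigma-fields and its shifts\<close>

lemma space_path_space [simp]: "space path_space = UNIV"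
  by (simp add: path_space_def space_pair_measure space_PiM)

lemma coord_X_measurable [measurable]: "coord_X k \<in> path_space \<rightarrow>\<^sub>M count_space UNIV"
  unfolding coord_X_def path_space_def by measurable

lemma coord_Y_measurable [measurable]: "coord_Y k \<in> path_space \<rightarrow>\<^sub>M borel"
  unfolding coord_Y_def path_space_def by measurable

lemma measurable_path_spaceI:
  assumes "\<And>k. (\<lambda>x. coord_X k (f x)) \<in> N \<rightarrow>\<^sub>M count_space UNIV" "\<And>k. (\<lambda>x. coord_Y k (f x)) \<in> N \<rightarrow>\<^sub>M borel"
  shows "f \<in> N \<rightarrow>\<^sub>M path_space"
proof -
  have "(\<lambda>x. (\<lambda>k. coord_X k (f x), \<lambda>k. coord_Y k (f x))) \<in> N \<rightarrow>\<^sub>M path_space"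
    unfolding path_space_def
    by (intro measurable_Pair measurable_PiM_single') (use assms in auto)
  then show ?thesis by (simp add: coord_X_def coord_Y_def)
qed

lemma sets_sigma_Y:
  "sets (sigma_Y n) = sigma_sets UNIV {coord_Y k -` A | k A. k \<le> n \<and> A \<in> sets borel}"
  unfolding sigma_Y_def by (subst sets_measure_of) auto

lemma sets_sigma_X: "sets (sigma_X m) = sigma_sets UNIV {coord_X k -` A | k A. k \<le> m}"
  unfolding sigma_X_def by (subst sets_measure_of) auto

lemma space_sigma_Y [simp]: "space (sigma_Y n) = UNIV"
  unfolding sigma_Y_def by (subst space_measure_of) auto

lemma space_sigma_XY [simp]: "space (sigma_XY m n) = UNIV"
  unfolding sigma_XY_def by (subst space_measure_of) auto

lemma space_sigma_tail_XY [simp]: "space (sigma_tail_XY n) = UNIV"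
  unfolding sigma_tail_XY_def by (subst space_measure_of) auto

lemma sets_sigma_XY:
  "sets (sigma_XY m n) = sigma_sets UNIV ({coord_X k -` A | k A. k \<le> m} \<union> {coord_Y k -` A | k A. k \<le> n \<and> A \<in> sets borel})"
proof -
  let ?X = "{coord_X k -` A | k A. k \<le> m}"
  let ?Y = "{coord_Y k -` A | k A. k \<le> n \<and> A \<in> sets borel}"
  have "sets (sigma_XY m n) = sigma_sets UNIV (sigma_sets UNIV ?X \<union> sigma_sets UNIV ?Y)"
    unfolding sigma_XY_def by (subst sets_measure_of) (auto simp: sets_sigma_X sets_sigma_Y)
  also have "\<dots> = sigma_sets UNIV (?X \<union> ?Y)"
  proof
    have "sigma_sets UNIV ?X \<subseteq> sigma_sets UNIV (?X \<union> ?Y)" "sigma_sets UNIV ?Y \<subseteq> sigma_sets UNIV (?X \<union> ?Y)"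
      by (rule sigma_sets_mono', blast)+
    then show "sigma_sets UNIV (sigma_sets UNIV ?X \<union> sigma_sets UNIV ?Y) \<subseteq> sigma_sets UNIV (?X \<union> ?Y)"
      by (intro sigma_sets_mono) simp
    show "sigma_sets UNIV (?X \<union> ?Y) \<subseteq> sigma_sets UNIV (sigma_sets UNIV ?X \<union> sigma_sets UNIV ?Y)"
      by (rule sigma_sets_mono') (auto intro: sigma_sets.Basic)
  qed
  finally show ?thesis .
qed

text \<open>An intersection of sigma-fields is itself a sigma-field.\<close>

lemma sets_sigma_tail_XY: "sets (sigma_tail_XY n) = (\<Inter>m\<in>{..n}. sets (sigma_XY m n))"
proof -
  let ?S = "(\<Inter>m\<in>{..n}. sets (sigma_XY m n))"
  have "sigma_sets UNIV ?S \<subseteq> sets (sigma_XY m n)" if "m \<le> n" for m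
    using sets.sigma_sets_subset[of ?S "sigma_XY m n"] that by auto
  moreover have "?S \<subseteq> sigma_sets UNIV ?S" by (auto intro: sigma_sets.Basic)
  ultimately have "sigma_sets UNIV ?S = ?S" by blast
  then show ?thesis unfolding sigma_tail_XY_def by (subst sets_measure_of) auto
qed

lemma measurable_sigma_YI:
  assumes "\<And>k. k \<le> n \<Longrightarrow> (\<lambda>x. coord_Y k (f x)) \<in> N \<rightarrow>\<^sub>M borel"
  shows "f \<in> N \<rightarrow>\<^sub>M sigma_Y n"
  unfolding sigma_Y_def
proof (rule measurable_measure_of, goal_cases)
  case (3 y)
  then obtain k A where k: "y = coord_Y k -` A \<inter> space path_space" "k \<le> n" "A \<in> sets borel" by blast
  have "f -` y \<inter> space N = (\<lambda>x. coord_Y k (f x)) -` A \<inter> space N" using k by auto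
  then show ?case using measurable_sets[OF assms[OF k(2)] k(3)] by simp
qed auto

lemma measurable_sigma_XYI:
  assumes "\<And>k. k \<le> m \<Longrightarrow> (\<lambda>x. coord_X k (f x)) \<in> N \<rightarrow>\<^sub>M count_space UNIV"
    and "\<And>k. k \<le> n \<Longrightarrow> (\<lambda>x. coord_Y k (f x)) \<in> N \<rightarrow>\<^sub>M borel"
  shows "f \<in> N \<rightarrow>\<^sub>M sigma_XY m n"
proof (rule measurable_sigma_sets[OF sets_sigma_XY], goal_cases)
  case (3 y)
  then consider k A where "y = coord_X k -` A" "k \<le> m" | k A where "y = coord_Y k -` A" "k \<le> n" "A \<in> sets borel" by blast
  then show ?case
  proof cases
    case 1
    have "f -` y \<inter> space N = (\<lambda>x. coord_X k (f x)) -` A \<inter> space N" using 1 by auto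
    then show ?thesis using measurable_sets[OF assms(1)[OF 1(2)], of A] by simp
  next
    case 2
    have "f -` y \<inter> space N = (\<lambda>x. coord_Y k (f x)) -` A \<inter> space N" using 2 by auto
    then show ?thesis using measurable_sets[OF assms(2)[OF 2(2)] 2(3)] by simp
  qed
qed auto

lemma coord_X_sigma_XY: "k \<le> m \<Longrightarrow> coord_X k \<in> sigma_XY m n \<rightarrow>\<^sub>M count_space UNIV"
  by (rule measurableI) (auto simp: sets_sigma_XY intro!: sigma_sets.Basic)

lemma coord_Y_sigma_XY: "k \<le> n \<Longrightarrow> coord_Y k \<in> sigma_XY m n \<rightarrow>\<^sub>M borel"
  by (rule measurableI) (auto simp: sets_sigma_XY intro!: sigma_sets.Basic)

lemma coord_Y_sigma_Y: "k \<le> n \<Longrightarrow> coord_Y k \<in> sigma_Y n \<rightarrow>\<^sub>M borel"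
  by (rule measurableI) (auto simp: sets_sigma_Y intro!: sigma_sets.Basic)

lemma sets_subset_of_measurable_id:
  assumes "(\<lambda>x. x) \<in> N \<rightarrow>\<^sub>M K" "space N = UNIV"
  shows "sets K \<subseteq> sets N"
  using measurable_sets[OF assms(1)] assms(2) by auto

lemma sigma_XY_mono: "m \<le> m' \<Longrightarrow> n \<le> n' \<Longrightarrow> sets (sigma_XY m n) \<subseteq> sets (sigma_XY m' n')"
  by (rule sets_subset_of_measurable_id)
     (auto intro!: measurable_sigma_XYI coord_X_sigma_XY coord_Y_sigma_XY)

lemma sigma_Y_subset_XY: "n \<le> n' \<Longrightarrow> sets (sigma_Y n) \<subseteq> sets (sigma_XY m n')"
  by (rule sets_subset_of_measurable_id) (auto intro!: measurable_sigma_YI coord_Y_sigma_XY)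

lemma sigma_XY_subset_path: "sets (sigma_XY m n) \<subseteq> sets path_space"
  by (rule sets_subset_of_measurable_id) (auto intro!: measurable_sigma_XYI)

lemma sigma_Y_subset_path: "sets (sigma_Y n) \<subseteq> sets path_space"
  by (rule sets_subset_of_measurable_id) (auto intro!: measurable_sigma_YI)

lemma sigma_tail_subset: "sets (sigma_tail_XY n) \<subseteq> sets (sigma_XY n n)"
  unfolding sets_sigma_tail_XY by auto

lemma sigma_tail_mono:
  assumes "n \<le> n'" shows "sets (sigma_tail_XY n) \<subseteq> sets (sigma_tail_XY n')"
proof
  fix A assume A: "A \<in> sets (sigma_tail_XY n)"
  have "A \<in> sets (sigma_XY m n')" for m
  proof -
    have "A \<in> sets (sigma_XY (min m n) n)" using A unfolding sets_sigma_tail_XY by auto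
    then show ?thesis using sigma_XY_mono[of "min m n" m n n'] assms by auto
  qed
  then show "A \<in> sets (sigma_tail_XY n')" unfolding sets_sigma_tail_XY by auto
qed

lemma sigma_Y_subset_tail: "sets (sigma_Y n) \<subseteq> sets (sigma_tail_XY n)"
  unfolding sets_sigma_tail_XY using sigma_Y_subset_XY by blast

text \<open>\<open>path_shift\<close> is \<open>sh 1\<close>; negative shifts look back in
  time.\<close>

definition sh :: "int \<Rightarrow> ('e, 'f) path \<Rightarrow> ('e, 'f) path" where
  "sh c \<omega> = (\<lambda>n. fst \<omega> (n + c), \<lambda>n. snd \<omega> (n + c))"

lemma coord_sh [simp]: "coord_X k (sh c \<omega>) = coord_X (k + c) \<omega>" "coord_Y k (sh c \<omega>) = coord_Y (k + c) \<omega>"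
  by (simp_all add: coord_X_def coord_Y_def sh_def)

lemma sh_sh [simp]: "sh a (sh b \<omega>) = sh (a + b) \<omega>" and sh_0 [simp]: "sh 0 \<omega> = \<omega>"
  by (simp_all add: sh_def add.assoc)

lemma sh_measurable [measurable]: "sh c \<in> path_space \<rightarrow>\<^sub>M path_space"
  by (rule measurable_path_spaceI) auto

lemma sh_measurable_sigma_XY: "sh c \<in> sigma_XY (m + c) (n + c) \<rightarrow>\<^sub>M sigma_XY m n"
  by (rule measurable_sigma_XYI) (auto intro: coord_X_sigma_XY coord_Y_sigma_XY)

lemma sh_measurable_sigma_tail: "sh c \<in> sigma_tail_XY (n + c) \<rightarrow>\<^sub>M sigma_tail_XY n"
proof (rule measurableI)
  fix A assume A: "A \<in> sets (sigma_tail_XY n)"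
  have "sh c -` A \<in> sets (sigma_XY m (n + c))" if "m \<le> n + c" for m
  proof -
    have "A \<in> sets (sigma_XY (m - c) n)" using A that unfolding sets_sigma_tail_XY by auto
    moreover have "sh c \<in> sigma_XY m (n + c) \<rightarrow>\<^sub>M sigma_XY (m - c) n"
      using sh_measurable_sigma_XY[of c "m-c" n] by simp
    ultimately show ?thesis by (auto dest: measurable_sets)
  qed
  then show "sh c -` A \<inter> space (sigma_tail_XY (n + c)) \<in> sets (sigma_tail_XY (n + c))"
    unfolding sets_sigma_tail_XY by auto
qed simp

lemma row_prod_cong:
  "(\<And>k. 1 \<le> k \<Longrightarrow> k \<le> n \<Longrightarrow> y k = y' k) \<Longrightarrow> row_prod M y n v = row_prod M y' n v"
  by (induction n) auto

text \<open>The observations at times m+1, ..., m+n, renumbered from 1 as \<open>row_prod\<close>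
  expects, and restricted to \<open>{1..n}\<close> so that the window is a point of the product
  space.\<close>

definition yw :: "int \<Rightarrow> nat \<Rightarrow> ('e, 'f) path \<Rightarrow> nat \<Rightarrow> 'f" where
  "yw m n \<omega> = (\<lambda>k\<in>{1..n}. coord_Y (m + int k) \<omega>)"

lemma yw_measurable':
  assumes "\<And>k. 1 \<le> k \<Longrightarrow> k \<le> n \<Longrightarrow> coord_Y (m + int k) \<in> N \<rightarrow>\<^sub>M borel"
  shows "yw m n \<in> N \<rightarrow>\<^sub>M PiM {1..n} (\<lambda>_. borel)"
  unfolding yw_def by (rule measurable_restrict) (use assms in auto)

lemma yw_measurable [measurable]: "yw m n \<in> path_space \<rightarrow>\<^sub>M PiM {1..n} (\<lambda>_. borel)"
  by (rule yw_measurable') simp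

lemma yw_sh [simp]: "yw m n (sh c \<omega>) = yw (m + c) n \<omega>"
  by (auto simp: yw_def fun_eq_iff add.commute add.left_commute)

section \<open>Stationarity, the Markov property and the density of an observation window\<close>

sublocale hidden_markov_model \<subseteq> prob_space Pr
  by (rule prob_space_Pr)

context hidden_markov_model begin

declare sets_Pr [measurable_cong]

lemma space_Pr [simp]: "space Pr = UNIV"
  using sets_eq_imp_space_eq[OF sets_Pr] by simp

lemma subalgebra_XY: "subalgebra Pr (sigma_XY m n)"
  using sigma_XY_subset_path by (auto simp: subalgebra_def sets_Pr)

lemma subalgebra_Y: "subalgebra Pr (sigma_Y n)"
  using sigma_Y_subset_path by (auto simp: subalgebra_def sets_Pr)

lemma subalgebra_tail: "subalgebra Pr (sigma_tail_XY n)"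
  using sigma_XY_subset_path sigma_tail_subset by (fastforce simp: subalgebra_def sets_Pr)

lemma coord_X_Pr [measurable]: "coord_X k \<in> Pr \<rightarrow>\<^sub>M count_space UNIV"
  and coord_Y_Pr [measurable]: "coord_Y k \<in> Pr \<rightarrow>\<^sub>M borel"
  by measurable

lemma coord_X_events [measurable]: "{\<omega>. coord_X k \<omega> \<in> A} \<in> sets Pr"
  using measurable_sets[OF coord_X_Pr, of A k] by (simp add: vimage_def)

lemma coord_X_eq_events [measurable]: "{\<omega>. coord_X k \<omega> = i} \<in> sets Pr"
  using coord_X_events[of k "{i}"] by simp

lemma coord_X_eq_sigma_XY: "k \<le> m \<Longrightarrow> {\<omega>. coord_X k \<omega> = i} \<in> sets (sigma_XY m n)"
  using measurable_sets[OF coord_X_sigma_XY, of k m "{i}" n] by (simp add: vimage_def)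

text \<open>Iterating stationarity gives the forward shifts; a backward shift undoes a forward one
  under which the law is already invariant.\<close>

lemma distr_sh: "distr Pr path_space (sh c) = Pr"
proof -
  have sh1: "path_shift = sh 1" by (auto simp: path_shift_def sh_def fun_eq_iff)
  have 1: "distr Pr path_space (sh (int n)) = Pr" for n
  proof (induction n)
    case 0
    have "distr Pr path_space (\<lambda>\<omega>. \<omega>) = Pr" by (intro distr_id2) (simp add: sets_Pr)
    then show ?case by (simp add: sh_def)
  next
    case (Suc n)
    have "distr Pr path_space (sh (int (Suc n))) = distr (distr Pr path_space (sh (int n))) path_space (sh 1)"
      by (subst distr_distr) (auto simp: comp_def)
    then show ?case using Suc stationary_Pr by (simp add: sh1)
  qed
  show ?thesis
  proof (cases "c \<ge> 0")
    case True then show ?thesis using 1[of "nat c"] by simp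
  next
    case False
    then have c: "c = - int (nat (-c))" by simp
    have "distr Pr path_space (sh c) = distr (distr Pr path_space (sh (int (nat (-c))))) path_space (sh c)"
      by (simp only: 1)
    also have "\<dots> = distr Pr path_space (\<lambda>\<omega>. \<omega>)"
      by (subst distr_distr) (auto simp: comp_def, use c in simp)
    also have "\<dots> = Pr" by (intro distr_id2) (simp add: sets_Pr)
    finally show ?thesis .
  qed
qed

lemma emeasure_sh: "E \<in> sets path_space \<Longrightarrow> emeasure Pr (sh c -` E) = emeasure Pr E"
  using emeasure_distr[of "sh c" Pr path_space E] by (simp add: distr_sh)

lemma measure_sh: "E \<in> sets path_space \<Longrightarrow> measure Pr (sh c -` E) = measure Pr E"
  using emeasure_sh by (simp add: measure_def)

lemma nn_integral_sh: "f \<in> borel_measurable path_space \<Longrightarrow> (\<integral>\<^sup>+\<omega>. f (sh c \<omega>) \<partial>Pr) = (\<integral>\<^sup>+\<omega>. f \<omega> \<partial>Pr)"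
  using nn_integral_distr[of "sh c" Pr path_space f] by (simp add: distr_sh)

lemma integral_sh:
  fixes f :: "_ \<Rightarrow> real"
  shows "f \<in> borel_measurable path_space \<Longrightarrow> (\<integral>\<omega>. f (sh c \<omega>) \<partial>Pr) = (\<integral>\<omega>. f \<omega> \<partial>Pr)"
  using integral_distr[of "sh c" Pr path_space f] by (simp add: distr_sh)

lemma AE_sh:
  assumes "AE \<omega> in Pr. P \<omega>"
  shows "AE \<omega> in Pr. P (sh c \<omega>)"
proof -
  obtain N where N: "N \<in> null_sets Pr" "{\<omega>. \<not> P \<omega>} \<subseteq> N"
    using assms by (auto simp: eventually_ae_filter)
  have "sh c -` N \<in> null_sets Pr"
  proof (rule null_setsI)
    have "N \<in> sets path_space" using N(1) by (auto simp: sets_Pr)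
    then show "emeasure Pr (sh c -` N) = 0" "sh c -` N \<in> sets Pr"
      using N(1) measurable_sets[OF sh_measurable, of N c] by (auto simp: emeasure_sh sets_Pr)
  qed
  then show ?thesis by (rule AE_I') (use N in auto)
qed

lemma emeasure_split_X:
  assumes "E \<in> sets Pr"
  shows "emeasure Pr E = (\<integral>\<^sup>+l. emeasure Pr (E \<inter> {\<omega>. coord_X k \<omega> = l}) \<partial>count_space UNIV)"
proof -
  have "emeasure Pr (\<Union>l. E \<inter> {\<omega>. coord_X k \<omega> = l}) = (\<integral>\<^sup>+l. emeasure Pr (E \<inter> {\<omega>. coord_X k \<omega> = l}) \<partial>count_space UNIV)"
    using assms by (intro emeasure_UN_countable) (auto simp: disjoint_family_on_def)
  moreover have "(\<Union>l. E \<inter> {\<omega>. coord_X k \<omega> = l}) = E" by auto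
  ultimately show ?thesis by simp
qed

text \<open>On the event X_m = l the transition probability in \<open>markov_Pr\<close> is a
  constant and leaves the integral.\<close>

lemma markov_step_pure:
  assumes B: "B \<in> sets (sigma_XY m m)" and A: "A \<in> sets borel"
  shows "emeasure Pr (B \<inter> {\<omega>. coord_X m \<omega> = l} \<inter> {\<omega>. coord_X (m+1) \<omega> = j \<and> coord_Y (m+1) \<omega> \<in> A}) =
    emeasure Pr (B \<inter> {\<omega>. coord_X m \<omega> = l}) * (\<integral>\<^sup>+y. indicator A y * ennreal (M y l j) \<partial>\<phi>)"
proof -
  interpret S: finite_measure_subalgebra Pr "sigma_XY m m" by standard (rule subalgebra_XY)
  let ?B = "B \<inter> {\<omega>. coord_X m \<omega> = l}"
  let ?E = "{\<omega>. coord_X (m+1) \<omega> = j \<and> coord_Y (m+1) \<omega> \<in> A}"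
  have B': "?B \<in> sets (sigma_XY m m)" using B coord_X_eq_sigma_XY[of m m l m] by auto
  then have [measurable]: "?B \<in> sets Pr" using subalgebra_XY[of m m] by (auto simp: subalgebra_def)
  have "{\<omega>\<in>space path_space. coord_X (m+1) \<omega> = j \<and> coord_Y (m+1) \<omega> \<in> A} \<in> sets path_space"
    using A by measurable
  then have E[measurable]: "?E \<in> sets Pr" by (simp add: sets_Pr)
  have "emeasure Pr (?B \<inter> ?E) = (\<integral>\<^sup>+\<omega>. indicator ?B \<omega> * indicator ?E \<omega> \<partial>Pr)"
    by (subst nn_integral_indicator[symmetric]) (auto intro!: nn_integral_cong simp: indicator_def simp del: nn_integral_indicator)
  also have "\<dots> = (\<integral>\<^sup>+\<omega>. indicator ?B \<omega> * nn_cond_exp Pr (sigma_XY m m) (indicator ?E) \<omega> \<partial>Pr)"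
    using B' by (intro S.nn_cond_exp_intg[symmetric]) auto
  also have "\<dots> = (\<integral>\<^sup>+\<omega>. indicator ?B \<omega> * (\<integral>\<^sup>+y. indicator A y * ennreal (M y l j) \<partial>\<phi>) \<partial>Pr)"
  proof (rule nn_integral_cong_AE)
    show "AE \<omega> in Pr. indicator ?B \<omega> * nn_cond_exp Pr (sigma_XY m m) (indicator ?E) \<omega> =
       indicator ?B \<omega> * (\<integral>\<^sup>+y. indicator A y * ennreal (M y l j) \<partial>\<phi>)"
      using markov_Pr[OF A, of "m+1" j]
      by eventually_elim (auto simp: indicator_def mult.commute split: if_splits)
  qed
  also have "\<dots> = emeasure Pr ?B * (\<integral>\<^sup>+y. indicator A y * ennreal (M y l j) \<partial>\<phi>)"
    by (subst nn_integral_multc) auto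
  finally show ?thesis .
qed

lemma markov_step:
  assumes B: "B \<in> sets (sigma_XY m m)" and A: "A \<in> sets borel"
  shows "emeasure Pr (B \<inter> {\<omega>. coord_X (m+1) \<omega> = j \<and> coord_Y (m+1) \<omega> \<in> A}) =
    (\<integral>\<^sup>+l. emeasure Pr (B \<inter> {\<omega>. coord_X m \<omega> = l}) * (\<integral>\<^sup>+y. indicator A y * ennreal (M y l j) \<partial>\<phi>) \<partial>count_space UNIV)"
proof -
  have "{\<omega>\<in>space path_space. coord_X (m+1) \<omega> = j \<and> coord_Y (m+1) \<omega> \<in> A} \<in> sets path_space"
    using A by measurable
  moreover have "B \<in> sets Pr" using B subalgebra_XY[of m m] by (auto simp: subalgebra_def)
  ultimately have "B \<inter> {\<omega>. coord_X (m+1) \<omega> = j \<and> coord_Y (m+1) \<omega> \<in> A} \<in> sets Pr" by (auto simp: sets_Pr)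
  note split = emeasure_split_X[OF this, of m]
  have "B \<inter> {\<omega>. coord_X (m+1) \<omega> = j \<and> coord_Y (m+1) \<omega> \<in> A} \<inter> {\<omega>. coord_X m \<omega> = l} =
     B \<inter> {\<omega>. coord_X m \<omega> = l} \<inter> {\<omega>. coord_X (m+1) \<omega> = j \<and> coord_Y (m+1) \<omega> \<in> A}" for l by blast
  then show ?thesis unfolding split by (simp only: markov_step_pure[OF B A])
qed

lemma row_prod_measurable:
  assumes "\<And>i. (\<lambda>x. v x i) \<in> borel_measurable N"
    and "\<And>k. 1 \<le> k \<Longrightarrow> k \<le> n \<Longrightarrow> (\<lambda>x. y x k) \<in> N \<rightarrow>\<^sub>M borel"
  shows "(\<lambda>x. row_prod M (y x) n (v x) j) \<in> borel_measurable N"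
  using assms
proof (induction n arbitrary: j)
  case (Suc n)
  have "(\<lambda>x. M (y x (Suc n)) i j) \<in> borel_measurable N" for i
    by (rule measurable_compose[OF _ M_measurable]) (use Suc.prems in auto)
  then have 1: "(\<lambda>x. ennreal (M (y x (Suc n)) i j)) \<in> borel_measurable N" for i
    by (rule measurable_compose[OF _ measurable_ennreal])
  have 2: "(\<lambda>x. row_prod M (y x) n (v x) i) \<in> borel_measurable N" for i
    using Suc by auto
  show ?case
    unfolding row_prod.simps row_mult_def
    by (rule borel_measurable_nn_integral_count_space, rule borel_measurable_times_ennreal, rule 2, rule 1)
qed simp

lemma row_mass_row_prod_measurable:
  assumes "\<And>i. (\<lambda>x. v x i) \<in> borel_measurable N"
    and "\<And>k. 1 \<le> k \<Longrightarrow> k \<le> n \<Longrightarrow> (\<lambda>x. y x k) \<in> N \<rightarrow>\<^sub>M borel"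
  shows "(\<lambda>x. row_mass (row_prod M (y x) n (v x))) \<in> borel_measurable N"
  unfolding row_mass_def by (intro borel_measurable_nn_integral_count_space row_prod_measurable assms)

lemma product_sigma_finite_phi: "product_sigma_finite (\<lambda>_::nat. \<phi>)"
  using sigma_finite_phi by (simp add: product_sigma_finite_def)

abbreviation "phiN n \<equiv> PiM {1..n::nat} (\<lambda>_. \<phi>)"

lemma sets_phiN [measurable_cong]: "sets (phiN n) = sets (PiM {1..n} (\<lambda>_. borel))"
  by (rule sets_PiM_cong) (auto simp: sets_phi)

lemma space_phi [simp]: "space \<phi> = UNIV"
  using sets_eq_imp_space_eq[OF sets_phi] by simp

lemma row_prod_phiN [measurable]: "(\<lambda>y. row_prod M y n v j) \<in> borel_measurable (PiM {1..n} (\<lambda>_. borel))"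
  by (rule row_prod_measurable) auto

lemma row_mass_row_prod_phiN [measurable]: "(\<lambda>y. row_mass (row_prod M y n v)) \<in> borel_measurable (PiM {1..n} (\<lambda>_. borel))"
  by (rule row_mass_row_prod_measurable) auto

lemma nn_integral_phiN_Suc:
  assumes "f \<in> borel_measurable (PiM {1..Suc n} (\<lambda>_. borel))"
  shows "(\<integral>\<^sup>+y. f y \<partial>phiN (Suc n)) = (\<integral>\<^sup>+y. (\<integral>\<^sup>+z. f (y(Suc n := z)) \<partial>\<phi>) \<partial>phiN n)"
proof -
  interpret product_sigma_finite "\<lambda>_::nat. \<phi>" by (rule product_sigma_finite_phi)
  have eq: "{1..Suc n} = insert (Suc n) {1..n}" by auto
  have "f \<in> borel_measurable (PiM (insert (Suc n) {1..n}) (\<lambda>_. \<phi>))"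
    using assms unfolding eq[symmetric] by (subst measurable_cong_sets[OF sets_phiN refl])
  then show ?thesis unfolding eq by (intro product_nn_integral_insert) auto
qed

text \<open>Induction on the length of the window: one Markov step appends one observation, and
  Tonelli moves the sum over the intermediate state under the integral, where it becomes a
  row-matrix product. The past event \<open>B\<close> enters only through its row vector P(B, X_m =
  i).\<close>

lemma box_formula:
  assumes B: "B \<in> sets (sigma_XY m m)" and A: "\<And>k. A k \<in> sets borel"
  shows "emeasure Pr (B \<inter> {\<omega>. \<forall>k\<in>{1..n}. coord_Y (m + int k) \<omega> \<in> A k} \<inter> {\<omega>. coord_X (m + int n) \<omega> = j}) =
    (\<integral>\<^sup>+y. (\<Prod>k\<in>{1..n}. indicator (A k) (y k)) * row_prod M y n (\<lambda>i. emeasure Pr (B \<inter> {\<omega>. coord_X m \<omega> = i})) j \<partial>phiN n)"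
proof (induction n arbitrary: j)
  case 0
  interpret product_sigma_finite "\<lambda>_::nat. \<phi>" by (rule product_sigma_finite_phi)
  show ?case using emeasure_PiM_empty[of "\<lambda>_::nat. \<phi>"] by (simp add: space_PiM mult.commute)
next
  case (Suc n)
  let ?r = "\<lambda>i. emeasure Pr (B \<inter> {\<omega>. coord_X m \<omega> = i})"
  let ?C = "\<lambda>n. {\<omega> :: ('e, 'f) path. \<forall>k\<in>{1..n}. coord_Y (m + int k) \<omega> \<in> A k}"
  note [measurable] = A M_measurable
  have C: "?C n \<in> sets (sigma_XY (m + int n) (m + int n))"
  proof -
    let ?S = "sigma_XY (m + int n) (m + int n) :: ('e, 'f) path measure"
    have "{\<omega> \<in> space ?S. \<forall>k\<in>{1..n}. coord_Y (m + int k) \<omega> \<in> A k} \<in> sets ?S"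
    proof (rule sets.sets_Collect_finite_All)
      fix k assume "k \<in> {1..n}"
      then show "{\<omega> \<in> space ?S. coord_Y (m + int k) \<omega> \<in> A k} \<in> sets ?S"
        using measurable_sets[OF coord_Y_sigma_XY[of "m + int k" "m + int n" "m + int n"] A[of k]]
        by (simp add: vimage_def)
    qed simp
    then show ?thesis by simp
  qed
  have BC: "B \<inter> ?C n \<in> sets (sigma_XY (m + int n) (m + int n))"
    using B C sigma_XY_mono[of m "m + int n" m "m + int n"] by auto
  have CS: "B \<inter> ?C (Suc n) \<inter> {\<omega>. coord_X (m + int (Suc n)) \<omega> = j} =
    (B \<inter> ?C n) \<inter> {\<omega>. coord_X ((m + int n) + 1) \<omega> = j \<and> coord_Y ((m + int n) + 1) \<omega> \<in> A (Suc n)}"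
  proof -
    have I: "{1..Suc n} = insert (Suc n) {1..n}" and idx: "m + int (Suc n) = m + int n + 1" by auto
    have "(\<forall>k\<in>{1..Suc n}. coord_Y (m + int k) \<omega> \<in> A k) \<longleftrightarrow>
       (\<forall>k\<in>{1..n}. coord_Y (m + int k) \<omega> \<in> A k) \<and> coord_Y (m + int n + 1) \<omega> \<in> A (Suc n)" for \<omega> :: "('e, 'f) path"
      unfolding I idx[symmetric] by blast
    then show ?thesis unfolding idx by blast
  qed
  have "emeasure Pr (B \<inter> ?C (Suc n) \<inter> {\<omega>. coord_X (m + int (Suc n)) \<omega> = j}) =
     (\<integral>\<^sup>+l. (\<integral>\<^sup>+y. (\<Prod>k\<in>{1..n}. indicator (A k) (y k)) * row_prod M y n ?r l \<partial>phiN n) * (\<integral>\<^sup>+z. indicator (A (Suc n)) z * ennreal (M z l j) \<partial>\<phi>) \<partial>count_space UNIV)"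
    unfolding CS markov_step[OF BC A] Suc.IH[symmetric] by (simp add: Int_ac)
  also have "\<dots> = (\<integral>\<^sup>+l. (\<integral>\<^sup>+y. (\<Prod>k\<in>{1..n}. indicator (A k) (y k)) * row_prod M y n ?r l * (\<integral>\<^sup>+z. indicator (A (Suc n)) z * ennreal (M z l j) \<partial>\<phi>) \<partial>phiN n) \<partial>count_space UNIV)"
    by (subst nn_integral_multc) auto
  also have "\<dots> = (\<integral>\<^sup>+y. (\<integral>\<^sup>+l. (\<Prod>k\<in>{1..n}. indicator (A k) (y k)) * row_prod M y n ?r l * (\<integral>\<^sup>+z. indicator (A (Suc n)) z * ennreal (M z l j) \<partial>\<phi>) \<partial>count_space UNIV) \<partial>phiN n)"
    by (subst nn_integral_count_space_nn_integral) auto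
  also have "\<dots> = (\<integral>\<^sup>+y. (\<integral>\<^sup>+z. (\<Prod>k\<in>{1..Suc n}. indicator (A k) ((y(Suc n := z)) k)) * row_prod M (y(Suc n := z)) (Suc n) ?r j \<partial>\<phi>) \<partial>phiN n)"
  proof (rule nn_integral_cong)
    fix y
    have p: "(\<Prod>k\<in>{1..Suc n}. indicator (A k) ((y(Suc n := z)) k)) = ((\<Prod>k\<in>{1..n}. indicator (A k) (y k)) * indicator (A (Suc n)) z :: ennreal)" for z
    proof -
      have I: "{1..Suc n} = insert (Suc n) {1..n}" by auto
      have "(\<Prod>k\<in>{1..n}. indicator (A k) ((y(Suc n := z)) k)) = (\<Prod>k\<in>{1..n}. indicator (A k) (y k) :: ennreal)"
        by (intro prod.cong) auto
      then show ?thesis unfolding I by (simp add: mult.commute)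
    qed
    have r: "row_prod M (y(Suc n := z)) (Suc n) ?r j = (\<integral>\<^sup>+l. row_prod M y n ?r l * ennreal (M z l j) \<partial>count_space UNIV)" for z
      using row_prod_cong[of n "y(Suc n := z)" y M ?r] by (simp add: row_mult_def)
    have "(\<integral>\<^sup>+z. (\<Prod>k\<in>{1..Suc n}. indicator (A k) ((y(Suc n := z)) k)) * row_prod M (y(Suc n := z)) (Suc n) ?r j \<partial>\<phi>) =
      (\<integral>\<^sup>+z. (\<integral>\<^sup>+l. (\<Prod>k\<in>{1..n}. indicator (A k) (y k)) * row_prod M y n ?r l * (indicator (A (Suc n)) z * ennreal (M z l j)) \<partial>count_space UNIV) \<partial>\<phi>)"
      unfolding p r by (subst nn_integral_cmult[symmetric]) (auto intro!: nn_integral_cong simp: mult_ac)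
    also have "\<dots> = (\<integral>\<^sup>+l. (\<integral>\<^sup>+z. (\<Prod>k\<in>{1..n}. indicator (A k) (y k)) * row_prod M y n ?r l * (indicator (A (Suc n)) z * ennreal (M z l j)) \<partial>\<phi>) \<partial>count_space UNIV)"
      by (subst nn_integral_count_space_nn_integral) (auto simp: measurable_cong_sets[OF sets_phi refl])
    also have "\<dots> = (\<integral>\<^sup>+l. (\<Prod>k\<in>{1..n}. indicator (A k) (y k)) * row_prod M y n ?r l * (\<integral>\<^sup>+z. indicator (A (Suc n)) z * ennreal (M z l j) \<partial>\<phi>) \<partial>count_space UNIV)"
      by (subst nn_integral_cmult) (auto simp: measurable_cong_sets[OF sets_phi refl])
    finally show "(\<integral>\<^sup>+l. (\<Prod>k\<in>{1..n}. indicator (A k) (y k)) * row_prod M y n ?r l * (\<integral>\<^sup>+z. indicator (A (Suc n)) z * ennreal (M z l j) \<partial>\<phi>) \<partial>count_space UNIV) =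
      (\<integral>\<^sup>+z. (\<Prod>k\<in>{1..Suc n}. indicator (A k) ((y(Suc n := z)) k)) * row_prod M (y(Suc n := z)) (Suc n) ?r j \<partial>\<phi>)" ..
  qed
  also have "\<dots> = (\<integral>\<^sup>+y. (\<Prod>k\<in>{1..Suc n}. indicator (A k) (y k)) * row_prod M y (Suc n) ?r j \<partial>phiN (Suc n))"
    by (rule nn_integral_phiN_Suc[symmetric], intro borel_measurable_times_ennreal borel_measurable_prod_ennreal row_prod_phiN measurable_compose[OF measurable_component_singleton] borel_measurable_indicator) (use A in auto)
  finally show ?case .
qed

text \<open>Finite measures on the window space that agree on boxes are equal.\<close>

lemma path_distr:
  assumes B: "B \<in> sets (sigma_XY m m)"
  shows "distr (density Pr (indicator (B \<inter> {\<omega>. coord_X (m + int n) \<omega> = j}))) (PiM {1..n} (\<lambda>_. borel)) (yw m n) =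
    density (phiN n) (\<lambda>y. row_prod M y n (\<lambda>i. emeasure Pr (B \<inter> {\<omega>. coord_X m \<omega> = i})) j)"
proof -
  let ?r = "\<lambda>i. emeasure Pr (B \<inter> {\<omega>. coord_X m \<omega> = i})"
  let ?E = "B \<inter> {\<omega>. coord_X (m + int n) \<omega> = j}"
  let ?N = "PiM {1..n} (\<lambda>_. borel) :: (nat \<Rightarrow> 'f) measure"
  let ?P = "distr (density Pr (indicator ?E)) ?N (yw m n)"
  let ?Q = "density (phiN n) (\<lambda>y. row_prod M y n ?r j)"
  have BP: "B \<in> sets Pr" using B subalgebra_XY[of m m] by (auto simp: subalgebra_def)
  then have E[measurable]: "?E \<in> sets Pr" by auto
  have P: "emeasure ?P A = emeasure Pr (?E \<inter> yw m n -` A)" if "A \<in> sets ?N" for A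
  proof -
    have v: "yw m n -` A \<in> sets Pr" using measurable_sets[OF yw_measurable that] by (simp add: sets_Pr)
    have "emeasure ?P A = emeasure (density Pr (indicator ?E)) (yw m n -` A)"
      using that yw_measurable[of m n] by (subst emeasure_distr) (auto simp: measurable_cong_sets[OF sets_Pr refl])
    also have "\<dots> = (\<integral>\<^sup>+\<omega>. indicator (?E \<inter> yw m n -` A) \<omega> \<partial>Pr)"
      using v by (subst emeasure_density) (auto intro!: nn_integral_cong simp: indicator_def simp del: nn_integral_indicator)
    also have "\<dots> = emeasure Pr (?E \<inter> yw m n -` A)" using v by (intro nn_integral_indicator) auto
    finally show ?thesis .
  qed
  show "?P = ?Q"
  proof (rule measure_eqI_PiM_finite[where I="{1..n}" and M="\<lambda>_. borel" and A="\<lambda>_. space ?N"])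
    show "sets ?Q = sets ?N" by (simp only: sets_density sets_phiN)
    fix A :: "nat \<Rightarrow> 'f set" assume A: "\<And>i. i \<in> {1..n} \<Longrightarrow> A i \<in> sets borel"
    \<comment> \<open>\<open>box_formula\<close> asks for a measurable set at every index, so the
      box is filled up with \<open>UNIV\<close> outside \<open>{1..n}\<close>.\<close>
    define A' where "A' k = (if k \<in> {1..n} then A k else UNIV)" for k
    have A': "A' k \<in> sets borel" for k using A by (auto simp: A'_def)
    have AA: "Pi\<^sub>E {1..n} A \<in> sets ?N" using A by (intro sets_PiM_I_finite) auto
    have "?E \<inter> yw m n -` Pi\<^sub>E {1..n} A = B \<inter> {\<omega>. \<forall>k\<in>{1..n}. coord_Y (m + int k) \<omega> \<in> A' k} \<inter> {\<omega>. coord_X (m + int n) \<omega> = j}"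
      by (auto simp: yw_def PiE_iff A'_def)
    then have "emeasure ?P (Pi\<^sub>E {1..n} A) = (\<integral>\<^sup>+y. (\<Prod>k\<in>{1..n}. indicator (A' k) (y k)) * row_prod M y n ?r j \<partial>phiN n)"
      unfolding P[OF AA] by (simp add: box_formula[OF B A'])
    also have "\<dots> = (\<integral>\<^sup>+y. row_prod M y n ?r j * indicator (Pi\<^sub>E {1..n} A) y \<partial>phiN n)"
    proof (rule nn_integral_cong)
      fix y assume y: "y \<in> space (phiN n)"
      have "(\<Prod>k\<in>{1..n}. indicator (A' k) (y k)) = (indicator (Pi\<^sub>E {1..n} A) y :: ennreal)"
      proof (cases "\<forall>k\<in>{1..n}. y k \<in> A k")
        case True
        then show ?thesis using y by (auto simp: A'_def space_PiM PiE_iff indicator_def)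
      next
        case False
        then obtain k where k: "k \<in> {1..n}" "y k \<notin> A k" by blast
        then have "(\<Prod>k\<in>{1..n}. indicator (A' k) (y k)) = (0::ennreal)"
          by (intro prod_zero) (auto intro!: bexI[of _ k] simp: A'_def)
        then show ?thesis using k by (auto simp: PiE_iff indicator_def)
      qed
      then show "(\<Prod>k\<in>{1..n}. indicator (A' k) (y k)) * row_prod M y n ?r j = row_prod M y n ?r j * indicator (Pi\<^sub>E {1..n} A) y"
        by (simp add: mult.commute)
    qed
    also have "\<dots> = emeasure ?Q (Pi\<^sub>E {1..n} A)"
      using AA by (subst emeasure_density) (auto simp: sets_phiN)
    finally show "emeasure ?P (Pi\<^sub>E {1..n} A) = emeasure ?Q (Pi\<^sub>E {1..n} A)" .
  next
    show "range (\<lambda>_. space ?N) \<subseteq> prod_algebra {1..n} (\<lambda>_. borel)"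
      by (auto simp: space_PiM prod_algebra_eq_finite)
    show "emeasure ?P (space ?N) \<noteq> \<infinity>" using P[of "space ?N"] by simp
  qed auto
qed

text \<open>The source of all later computations: jointly with a past event, the window and the end
  state have the unnormalized filter as density with respect to the product of
  \<open>\<phi>\<close>.\<close>

lemma path_formula:
  assumes B: "B \<in> sets (sigma_XY m m)" and h: "h \<in> borel_measurable (PiM {1..n} (\<lambda>_. borel))"
  shows "(\<integral>\<^sup>+\<omega>. indicator B \<omega> * indicator {\<omega>. coord_X (m + int n) \<omega> = j} \<omega> * h (yw m n \<omega>) \<partial>Pr) =
    (\<integral>\<^sup>+y. h y * row_prod M y n (\<lambda>i. emeasure Pr (B \<inter> {\<omega>. coord_X m \<omega> = i})) j \<partial>phiN n)"
proof -
  have BP: "B \<in> sets Pr" using B subalgebra_XY[of m m] by (auto simp: subalgebra_def)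
  let ?E = "B \<inter> {\<omega>. coord_X (m + int n) \<omega> = j}"
  have [measurable]: "?E \<in> sets Pr" using BP by auto
  note h [measurable]
  have "(\<integral>\<^sup>+\<omega>. indicator B \<omega> * indicator {\<omega>. coord_X (m + int n) \<omega> = j} \<omega> * h (yw m n \<omega>) \<partial>Pr) =
     (\<integral>\<^sup>+\<omega>. indicator ?E \<omega> * h (yw m n \<omega>) \<partial>Pr)"
    by (intro nn_integral_cong) (auto simp: indicator_def)
  also have "\<dots> = (\<integral>\<^sup>+\<omega>. h (yw m n \<omega>) \<partial>density Pr (indicator ?E))"
    by (subst nn_integral_density) auto
  also have "\<dots> = (\<integral>\<^sup>+y. h y \<partial>distr (density Pr (indicator ?E)) (PiM {1..n} (\<lambda>_. borel)) (yw m n))"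
    by (subst nn_integral_distr) auto
  also have "\<dots> = (\<integral>\<^sup>+y. row_prod M y n (\<lambda>i. emeasure Pr (B \<inter> {\<omega>. coord_X m \<omega> = i})) j * h y \<partial>phiN n)"
    unfolding path_distr[OF B] by (subst nn_integral_density) auto
  finally show ?thesis by (simp add: mult.commute)
qed

lemma path_formula_mass:
  assumes B: "B \<in> sets (sigma_XY m m)" and h[measurable]: "h \<in> borel_measurable (PiM {1..n} (\<lambda>_. borel))"
  shows "(\<integral>\<^sup>+\<omega>. indicator B \<omega> * h (yw m n \<omega>) \<partial>Pr) =
    (\<integral>\<^sup>+y. h y * row_mass (row_prod M y n (\<lambda>i. emeasure Pr (B \<inter> {\<omega>. coord_X m \<omega> = i}))) \<partial>phiN n)"
proof -
  have [measurable]: "B \<in> sets Pr" using B subalgebra_XY[of m m] by (auto simp: subalgebra_def)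
  let ?r = "\<lambda>i. emeasure Pr (B \<inter> {\<omega>. coord_X m \<omega> = i})"
  have *: "indicator B \<omega> * h (yw m n \<omega>) = (\<integral>\<^sup>+j. indicator B \<omega> * indicator {\<omega>. coord_X (m + int n) \<omega> = j} \<omega> * h (yw m n \<omega>) \<partial>count_space UNIV)" for \<omega>
  proof -
    have "(\<integral>\<^sup>+j. indicator B \<omega> * indicator {\<omega>. coord_X (m + int n) \<omega> = j} \<omega> * h (yw m n \<omega>) \<partial>count_space UNIV)
      = (\<integral>\<^sup>+j. (indicator B \<omega> * h (yw m n \<omega>)) * indicator {coord_X (m + int n) \<omega>} j \<partial>count_space UNIV)"
      by (intro nn_integral_cong) (auto simp: indicator_def)
    also have "\<dots> = indicator B \<omega> * h (yw m n \<omega>)" by (subst nn_integral_cmult_indicator) auto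
    finally show ?thesis ..
  qed
  have "(\<integral>\<^sup>+\<omega>. indicator B \<omega> * h (yw m n \<omega>) \<partial>Pr) = (\<integral>\<^sup>+j. (\<integral>\<^sup>+\<omega>. indicator B \<omega> * indicator {\<omega>. coord_X (m + int n) \<omega> = j} \<omega> * h (yw m n \<omega>) \<partial>Pr) \<partial>count_space UNIV)"
    by (subst *, rule nn_integral_count_space_nn_integral) auto
  also have "\<dots> = (\<integral>\<^sup>+j. (\<integral>\<^sup>+y. h y * row_prod M y n ?r j \<partial>phiN n) \<partial>count_space UNIV)"
    by (simp only: path_formula[OF B h])
  also have "\<dots> = (\<integral>\<^sup>+y. (\<integral>\<^sup>+j. h y * row_prod M y n ?r j \<partial>count_space UNIV) \<partial>phiN n)"
    by (rule nn_integral_count_space_nn_integral[symmetric]) auto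
  also have "\<dots> = (\<integral>\<^sup>+y. h y * row_mass (row_prod M y n ?r) \<partial>phiN n)"
    unfolding row_mass_def by (intro nn_integral_cong nn_integral_cmult) auto
  finally show ?thesis .
qed

end

section \<open>Filters on finite observation windows\<close>

definition unit_row :: "'e \<Rightarrow> 'e \<Rightarrow> ennreal" where
  "unit_row k i = (if i = k then 1 else 0)"

lemma row_mult_sum:
  fixes v :: "'e::countable \<Rightarrow> ennreal"
  assumes "\<And>i. w i = (\<integral>\<^sup>+k. v k * u k i \<partial>count_space UNIV)"
  shows "row_mult w A j = (\<integral>\<^sup>+k. v k * row_mult (u k) A j \<partial>count_space (UNIV :: 'e set))"
proof -
  have "row_mult w A j = (\<integral>\<^sup>+i. (\<integral>\<^sup>+k. v k * u k i * ennreal (A i j) \<partial>count_space UNIV) \<partial>count_space UNIV)"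
    unfolding row_mult_def assms by (intro nn_integral_cong) (simp add: nn_integral_multc)
  also have "\<dots> = (\<integral>\<^sup>+k. (\<integral>\<^sup>+i. v k * u k i * ennreal (A i j) \<partial>count_space UNIV) \<partial>count_space UNIV)"
    by (rule nn_integral_count_space_nn_integral) auto
  also have "\<dots> = (\<integral>\<^sup>+k. v k * row_mult (u k) A j \<partial>count_space UNIV)"
    unfolding row_mult_def by (intro nn_integral_cong) (simp add: nn_integral_cmult mult.assoc)
  finally show ?thesis .
qed

text \<open>Linearity in the starting row. The expansion along the starting state reduces statements
  about a general initial law to statements about single states.\<close>

lemma row_prod_sum:
  fixes v :: "'e::countable \<Rightarrow> ennreal"
  shows "row_prod M y n v j = (\<integral>\<^sup>+k. v k * row_prod M y n (unit_row k) j \<partial>count_space UNIV)"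
proof (induction n arbitrary: j)
  case 0
  have "(\<integral>\<^sup>+k. v k * unit_row k j \<partial>count_space UNIV) = (\<integral>\<^sup>+k. v j * indicator {j} k \<partial>count_space UNIV)"
    by (intro nn_integral_cong) (auto simp: unit_row_def indicator_def)
  then show ?case by (simp add: nn_integral_cmult_indicator)
next
  case (Suc n)
  show ?case unfolding row_prod.simps by (rule row_mult_sum) (rule Suc.IH)
qed

lemma row_prod_cmult: "row_prod M y n (\<lambda>i. c * v i) j = c * row_prod M y n v j"
proof (induction n arbitrary: j)
  case (Suc n)
  then have "row_prod M y n (\<lambda>i. c * v i) = (\<lambda>j. c * row_prod M y n v j)" by auto
  then show ?case by (simp add: row_mult_def nn_integral_cmult mult.assoc)
qed simp

lemma row_prod_add: "row_prod M y n (\<lambda>i. v i + w i) j = row_prod M y n v j + row_prod M y n w j"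
proof (induction n arbitrary: j)
  case (Suc n)
  then have "row_prod M y n (\<lambda>i. v i + w i) = (\<lambda>j. row_prod M y n v j + row_prod M y n w j)" by auto
  then show ?case by (simp add: row_mult_def nn_integral_add distrib_right)
qed simp

lemma row_prod_mono: "(\<And>i. v i \<le> w i) \<Longrightarrow> row_prod M y n v j \<le> row_prod M y n w j"
proof (induction n arbitrary: j)
  case (Suc n)
  then show ?case by (auto simp: row_mult_def intro!: nn_integral_mono mult_right_mono)
qed simp

lemma row_mass_cmult: "row_mass (\<lambda>i. c * v i) = c * row_mass v"
  by (simp add: row_mass_def nn_integral_cmult)

lemma row_mass_mono: "(\<And>i. v i \<le> w i) \<Longrightarrow> row_mass v \<le> row_mass w"
  by (auto simp: row_mass_def intro: nn_integral_mono)

lemma row_mass_add: "row_mass (\<lambda>i. v i + w i) = row_mass v + row_mass w"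
  by (simp add: row_mass_def nn_integral_add)

lemma row_mass_unit_row [simp]: "row_mass (unit_row (k::'e::countable)) = 1"
proof -
  have "row_mass (unit_row k) = (\<integral>\<^sup>+i. indicator {k} i \<partial>count_space UNIV)"
    unfolding row_mass_def by (intro nn_integral_cong) (auto simp: unit_row_def indicator_def)
  then show ?thesis by simp
qed

lemma row_mass_ge: "v i \<le> row_mass v"
  using nn_integral_ge_point[of i UNIV v] by (simp add: row_mass_def)

lemma row_mass_eq_0_iff: "row_mass v = 0 \<longleftrightarrow> (\<forall>i. v i = 0)" for v :: "'e::countable \<Rightarrow> ennreal"
  by (simp add: row_mass_def nn_integral_0_iff_AE AE_count_space)

lemma row_mass_sum:
  fixes v :: "'e::countable \<Rightarrow> ennreal" and u :: "'e \<Rightarrow> 'e \<Rightarrow> ennreal"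
  assumes "\<And>i. w i = (\<integral>\<^sup>+k. v k * u k i \<partial>count_space UNIV)"
  shows "row_mass w = (\<integral>\<^sup>+k. v k * row_mass (u k) \<partial>count_space UNIV)"
proof -
  have "row_mass w = (\<integral>\<^sup>+k. (\<integral>\<^sup>+i. v k * u k i \<partial>count_space UNIV) \<partial>count_space UNIV)"
    unfolding row_mass_def assms by (rule nn_integral_count_space_nn_integral) auto
  then show ?thesis by (simp add: row_mass_def nn_integral_cmult)
qed

lemma row_mass_row_of:
  "\<mu> \<in> prob_measures (discrete_topology UNIV) \<Longrightarrow> row_mass (row_of (\<mu> :: 'e::countable measure)) = 1"
proof -
  assume \<mu>: "\<mu> \<in> prob_measures (discrete_topology UNIV)"
  then interpret prob_space \<mu> by (simp add: prob_measures_discrete)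
  have s: "sets \<mu> = sets (count_space UNIV)" using \<mu> by (simp add: prob_measures_discrete)
  have "emeasure \<mu> UNIV = (\<integral>\<^sup>+i. emeasure \<mu> {i} \<partial>count_space UNIV)"
    using emeasure_countable_singleton[of UNIV \<mu>] s by auto
  then show ?thesis using emeasure_space_1 sets_eq_imp_space_eq[OF s] by (simp add: row_mass_def row_of_def)
qed

text \<open>A total version of \<open>normalized\<close>: with a Dirac measure in the degenerate
  cases it is a probability measure for every \<open>v\<close>, so bounds by 1 and measurability
  hold at every point.\<close>

definition nrm :: "('e::countable \<Rightarrow> ennreal) \<Rightarrow> 'e measure" where
  "nrm v = (if row_mass v = 0 \<or> row_mass v = \<infinity> then return (count_space UNIV) undefined else normalized v)"

lemma emeasure_normalized: "emeasure (normalized v) A = (\<integral>\<^sup>+j. v j / row_mass v * indicator A j \<partial>count_space UNIV)"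
  by (simp add: normalized_def emeasure_density)

lemma normalized_singleton: "emeasure (normalized v) {i} = v i / row_mass v"
proof -
  have "emeasure (normalized v) {i} = (\<integral>\<^sup>+j. v i / row_mass v * indicator {i} j \<partial>count_space UNIV)"
    unfolding emeasure_normalized by (intro nn_integral_cong) (auto simp: indicator_def)
  then show ?thesis by (simp add: nn_integral_cmult_indicator)
qed

lemma nrm_prob: "nrm v \<in> prob_measures (discrete_topology UNIV)"
proof (cases "row_mass v = 0 \<or> row_mass v = \<infinity>")
  case True
  then show ?thesis by (simp add: nrm_def prob_measures_discrete prob_space_return)
next
  case False
  have "emeasure (normalized v) UNIV = row_mass v / row_mass v"
    unfolding emeasure_normalized by (simp add: nn_integral_divide row_mass_def)
  also have "\<dots> = 1" using False by (simp add: ennreal_divide_self less_top)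
  finally have "prob_space (normalized v)" by (intro prob_spaceI) (simp add: normalized_def)
  then show ?thesis using False by (simp add: nrm_def prob_measures_discrete normalized_def)
qed

text \<open>Bayes' formula without a division; it includes mass 0, where \<open>v\<close>
  vanishes.\<close>

lemma nrm_coord:
  assumes "row_mass v < \<infinity>"
  shows "ennreal (measure (nrm v) {i}) * row_mass v = v i"
proof (cases "row_mass v = 0")
  case True
  then show ?thesis by (simp add: row_mass_eq_0_iff)
next
  case False
  from nrm_prob[of v] interpret prob_space "nrm v" by (simp add: prob_measures_discrete)
  have "ennreal (measure (nrm v) {i}) = v i / row_mass v"
  proof -
    have "nrm v = normalized v" using False assms by (auto simp: nrm_def)
    then show ?thesis using normalized_singleton[of v i] emeasure_eq_measure[of "{i}"] by simp
  qed
  moreover have "v i / row_mass v * row_mass v = v i"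
  proof -
    have "v i / row_mass v * row_mass v = (v i * row_mass v) / row_mass v"
      by (simp add: ennreal_times_divide mult.commute)
    then show ?thesis using False assms by (simp add: ennreal_mult_divide_eq less_top)
  qed
  ultimately show ?thesis by simp
qed

lemma nrm_measurable:
  fixes v :: "'x \<Rightarrow> 'e::countable \<Rightarrow> ennreal"
  assumes [measurable]: "\<And>i. (\<lambda>x. v x i) \<in> borel_measurable N"
  shows "(\<lambda>x. nrm (v x)) \<in> N \<rightarrow>\<^sub>M borel_of PE"
proof -
  have [measurable]: "(\<lambda>x. row_mass (v x)) \<in> borel_measurable N"
    unfolding row_mass_def by (rule borel_measurable_nn_integral_count_space) simp
  have "(\<lambda>x. nrm (v x)) \<in> N \<rightarrow>\<^sub>M prob_algebra (count_space UNIV)"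
  proof (rule measurable_prob_algebraI)
    show p: "prob_space (nrm (v x))" for x using nrm_prob[of "v x"] by (simp add: prob_measures_discrete)
    show "(\<lambda>x. nrm (v x)) \<in> N \<rightarrow>\<^sub>M subprob_algebra (count_space UNIV)"
    proof (rule measurable_subprob_algebra)
      show "subprob_space (nrm (v x))" for x using p by (rule prob_space_imp_subprob_space)
      show "sets (nrm (v x)) = sets (count_space UNIV)" for x
        using nrm_prob[of "v x"] by (simp add: prob_measures_discrete)
      fix A :: "'e set"
      have [measurable]: "(\<lambda>x. \<integral>\<^sup>+j. v x j / row_mass (v x) * indicator A j \<partial>count_space UNIV) \<in> borel_measurable N"
        by (rule borel_measurable_nn_integral_count_space) simp
      have "(\<lambda>x. if row_mass (v x) = 0 \<or> row_mass (v x) = \<infinity> then indicator A undefined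
           else \<integral>\<^sup>+j. v x j / row_mass (v x) * indicator A j \<partial>count_space UNIV) \<in> borel_measurable N"
        by measurable
      moreover have "emeasure (nrm (v x)) A = (if row_mass (v x) = 0 \<or> row_mass (v x) = \<infinity> then indicator A undefined
           else \<integral>\<^sup>+j. v x j / row_mass (v x) * indicator A j \<partial>count_space UNIV)" for x
        by (simp add: nrm_def emeasure_normalized)
      ultimately show "(\<lambda>x. emeasure (nrm (v x)) A) \<in> borel_measurable N" by (simp only:)
    qed
  qed
  then show ?thesis using measurable_cong_sets[OF refl sets_borel_of_PE] by blast
qed

lemma measure_coord_measurable [measurable]:
  "(\<lambda>\<mu>. measure \<mu> {i}) \<in> borel_measurable (borel_of (PE :: 'e::countable measure topology))"
proof -
  have "(\<lambda>\<mu>. measure \<mu> {i}) \<in> borel_measurable (prob_algebra (count_space (UNIV :: 'e set)))"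
    unfolding prob_algebra_def by (intro measurable_restrict_space1) simp
  then show ?thesis using measurable_cong_sets[OF sets_borel_of_PE refl] by blast
qed

lemma row_of_measurable [measurable]:
  "(\<lambda>\<mu>. row_of \<mu> i) \<in> borel_measurable (borel_of (PE :: 'e::countable measure topology))"
proof -
  have "(\<lambda>\<mu>. row_of \<mu> i) \<in> borel_measurable (prob_algebra (count_space (UNIV :: 'e set)))"
    unfolding row_of_def prob_algebra_def by (intro measurable_restrict_space1) simp
  then show ?thesis using measurable_cong_sets[OF sets_borel_of_PE refl] by blast
qed

lemma row_of_eq_measure:
  "\<mu> \<in> prob_measures (discrete_topology UNIV) \<Longrightarrow> row_of (\<mu> :: 'e::countable measure) i = ennreal (measure \<mu> {i})"
  by (auto simp: prob_measures_discrete row_of_def prob_space_def finite_measure.emeasure_eq_measure)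

lemma (in prob_space) measure_eq_of_nn_integral:
  assumes [measurable]: "F \<in> borel_measurable M" "Z \<in> events" "T \<inter> Z \<in> events" and F: "\<And>x. 0 \<le> F x \<and> F x \<le> 1"
    and eq: "emeasure M (T \<inter> Z) = (\<integral>\<^sup>+x. indicator Z x * ennreal (F x) \<partial>M)"
  shows "measure M (T \<inter> Z) = (\<integral>x. F x * indicator Z x \<partial>M)"
proof -
  have "(\<integral>\<^sup>+x. indicator Z x * ennreal (F x) \<partial>M) = (\<integral>\<^sup>+x. ennreal (F x * indicator Z x) \<partial>M)"
    by (intro nn_integral_cong) (auto simp: indicator_def)
  also have "\<dots> = ennreal (\<integral>x. F x * indicator Z x \<partial>M)"
    using F by (intro nn_integral_eq_integral integrable_unit_interval) (auto simp: indicator_def)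
  finally have "ennreal (measure M (T \<inter> Z)) = ennreal (\<integral>x. F x * indicator Z x \<partial>M)"
    using eq by (simp add: emeasure_eq_measure)
  moreover have "0 \<le> (\<integral>x. F x * indicator Z x \<partial>M)" using F by (intro Bochner_Integration.integral_nonneg) auto
  ultimately show ?thesis by simp
qed

section \<open>The sigma-fields of finitely many past observations\<close>

definition past_window :: "nat \<Rightarrow> ('e::countable, 'f::polish_space) path measure" where
  "past_window n = vimage_algebra UNIV (yw (- int n) n) (PiM {1..n} (\<lambda>_. borel))"

lemma space_past_window [simp]: "space (past_window n) = UNIV"
  by (simp add: past_window_def)

lemma sets_past_window: "sets (past_window n) = {yw (- int n) n -` A | A. A \<in> sets (PiM {1..n} (\<lambda>_. borel))}"
proof -
  have "yw m n \<omega> \<in> space (PiM {1..n} (\<lambda>_. borel))" for m :: int and \<omega> :: "('a,'b) path"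
    using measurable_space[OF yw_measurable[of m n], of \<omega>] by simp
  then show ?thesis unfolding past_window_def by (subst sets_vimage_algebra2) auto
qed

lemma coord_Y_past_window:
  assumes "- int n < k" "k \<le> 0"
  shows "coord_Y k \<in> (past_window n :: ('e::countable, 'f::polish_space) path measure) \<rightarrow>\<^sub>M borel"
proof -
  let ?W = "past_window n :: ('e, 'f) path measure"
  have "yw (- int n) n \<in> ?W \<rightarrow>\<^sub>M PiM {1..n} (\<lambda>_. borel)"
    unfolding past_window_def
    by (rule measurable_vimage_algebra1) (use measurable_space[OF yw_measurable] in auto)
  moreover have k: "nat (k + int n) \<in> {1..n}" using assms by auto
  ultimately have "(\<lambda>\<omega>. yw (- int n) n \<omega> (nat (k + int n))) \<in> ?W \<rightarrow>\<^sub>M borel"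
    by (rule measurable_compose[OF _ measurable_component_singleton])
  moreover have "(\<lambda>\<omega> :: ('e, 'f) path. yw (- int n) n \<omega> (nat (k + int n))) = coord_Y k"
    using assms k by (auto simp: yw_def fun_eq_iff)
  ultimately show ?thesis by simp
qed

lemma past_window_subsetI:
  fixes N :: "('e::countable, 'f::polish_space) path measure"
  assumes "\<And>k. - int n < k \<Longrightarrow> k \<le> 0 \<Longrightarrow> coord_Y k \<in> N \<rightarrow>\<^sub>M borel" "space N = UNIV"
  shows "sets (past_window n) \<subseteq> sets N"
proof -
  have "yw (- int n) n \<in> N \<rightarrow>\<^sub>M PiM {1..n} (\<lambda>_. borel)"
    by (rule yw_measurable') (use assms in auto)
  from measurable_sets[OF this] show ?thesis using assms(2) by (auto simp: sets_past_window)
qed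

lemma past_window_mono: "sets (past_window n) \<subseteq> sets (past_window (Suc n))"
  by (rule past_window_subsetI) (auto intro!: coord_Y_past_window)

lemma past_window_subset_sigma_Y: "sets (past_window n) \<subseteq> sets (sigma_Y 0)"
  by (rule past_window_subsetI) (auto intro!: coord_Y_sigma_Y)

lemma sigma_Y_past_windows:
  "sets (sigma_Y 0 :: ('e::countable, 'f::polish_space) path measure) = sigma_sets UNIV (\<Union>n. sets (past_window n))"
proof
  let ?Y = "sigma_Y 0 :: ('e, 'f) path measure"
  show "sigma_sets UNIV (\<Union>n. sets (past_window n)) \<subseteq> sets ?Y"
    using sets.sigma_sets_subset[of "\<Union>n. sets (past_window n)" ?Y] past_window_subset_sigma_Y by auto
  show "sets ?Y \<subseteq> sigma_sets UNIV (\<Union>n. sets (past_window n))"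
    unfolding sets_sigma_Y
  proof (rule sigma_sets_mono', clarify)
    fix k :: int and A :: "'f set" assume k: "k \<le> 0" and A: "A \<in> sets borel"
    have "coord_Y k -` A \<inter> space (past_window (nat (1 - k)) :: ('e, 'f) path measure) \<in> sets (past_window (nat (1 - k)))"
      by (rule measurable_sets[OF coord_Y_past_window A]) (use k in auto)
    then show "coord_Y k -` A \<in> (\<Union>n. sets (past_window n :: ('e, 'f) path measure))" by auto
  qed
qed

text \<open>An intersection-stable generator that separates the events up to time
  \<open>- int n\<close> from those of the window, which is the form that
  \<open>path_formula\<close> can evaluate. An observation at time k is sorted into one of the two
  groups according to \<open>k \<le> - int n\<close>.\<close>

lemma sigma_XY_generator:
  "sets (sigma_XY (- int n) 0 :: ('e::countable, 'f::polish_space) path measure) = sigma_sets UNIV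
     {B \<inter> yw (- int n) n -` A | B A. B \<in> sets (sigma_XY (- int n) (- int n)) \<and> A \<in> sets (PiM {1..n} (\<lambda>_. borel))}"
  (is "_ = sigma_sets UNIV ?E")
proof
  have "yw (- int n) n \<in> (sigma_XY (- int n) 0 :: ('e, 'f) path measure) \<rightarrow>\<^sub>M PiM {1..n} (\<lambda>_. borel)"
    by (rule yw_measurable') (auto intro: coord_Y_sigma_XY)
  from measurable_sets[OF this]
  have "yw (- int n) n -` A \<in> sets (sigma_XY (- int n) 0 :: ('e, 'f) path measure)" if "A \<in> sets (PiM {1..n} (\<lambda>_. borel))" for A :: "(nat \<Rightarrow> 'f) set"
    using that by simp
  moreover have "B \<in> sets (sigma_XY (- int n) 0)" if "B \<in> sets (sigma_XY (- int n) (- int n))" for B :: "('e, 'f) path set"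
    using that sigma_XY_mono[of "- int n" "- int n" "- int n" 0] by auto
  ultimately have "?E \<subseteq> sets (sigma_XY (- int n) 0)" by blast
  then show "sigma_sets UNIV ?E \<subseteq> sets (sigma_XY (- int n) 0)"
    using sets.sigma_sets_subset[of ?E "sigma_XY (- int n) 0"] by simp
  have sp: "yw m n -` space (PiM {1..n} (\<lambda>_. borel :: 'f measure)) = (UNIV :: ('e, 'f) path set)" for m :: int
    using measurable_space[OF yw_measurable[of m n]] by auto
  have B: "B \<in> ?E" if "B \<in> sets (sigma_XY (- int n) (- int n))" for B :: "('e, 'f) path set"
    using that sp by (intro CollectI exI[of _ B] exI[of _ "space (PiM {1..n} (\<lambda>_. borel))"]) auto
  have *: "Z \<in> ?E" if "Z \<in> {coord_X k -` A | k A. k \<le> - int n} \<union> {coord_Y k -` A | k A. k \<le> 0 \<and> A \<in> sets borel}"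
    for Z :: "('e, 'f) path set"
  proof -
    from that show ?thesis
    proof (elim UnE)
      assume "Z \<in> {coord_X k -` A | k A. k \<le> - int n}"
      then obtain k A where k: "k \<le> - int n" and Z: "Z = coord_X k -` A" by blast
      have "coord_X k -` A \<inter> space (sigma_XY (- int n) (- int n) :: ('e, 'f) path measure) \<in> sets (sigma_XY (- int n) (- int n))"
        by (rule measurable_sets[OF coord_X_sigma_XY[OF k]]) simp
      then show ?thesis unfolding Z by (intro B) simp
    next
      assume "Z \<in> {coord_Y k -` A | k A. k \<le> 0 \<and> A \<in> sets borel}"
      then obtain k A where k: "k \<le> 0" and A: "A \<in> sets borel" and Z: "Z = coord_Y k -` A" by blast
      show ?thesis
      proof (cases "k \<le> - int n")
        case True
        have "coord_Y k -` A \<inter> space (sigma_XY (- int n) (- int n) :: ('e, 'f) path measure) \<in> sets (sigma_XY (- int n) (- int n))"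
          by (rule measurable_sets[OF coord_Y_sigma_XY[OF True] A])
        then show ?thesis unfolding Z by (intro B) simp
      next
        case False
        have "coord_Y k -` A \<inter> space (past_window n :: ('e, 'f) path measure) \<in> sets (past_window n)"
          by (rule measurable_sets[OF coord_Y_past_window A]) (use False k in auto)
        then have "Z \<in> sets (past_window n)" using Z by simp
        then obtain A' where A': "A' \<in> sets (PiM {1..n} (\<lambda>_. borel))" and ZA: "Z = yw (- int n) n -` A'"
          unfolding sets_past_window by blast
        have "UNIV \<in> sets (sigma_XY (- int n) (- int n) :: ('e, 'f) path measure)"
          using sets.top[of "sigma_XY (- int n) (- int n) :: ('e, 'f) path measure"] by simp
        then show ?thesis using A' unfolding ZA by (intro CollectI exI[of _ UNIV] exI[of _ A']) simp
      qed
    qed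
  qed
  show "sets (sigma_XY (- int n) 0) \<subseteq> sigma_sets UNIV ?E"
    unfolding sets_sigma_XY[of "- int n" 0] by (rule sigma_sets_mono', rule subsetI, rule *)
qed

section \<open>Window filters as conditional probabilities, and their limits\<close>

context hidden_markov_model begin

text \<open>Integrating out the observation replaces \<open>M z\<close> by the stochastic matrix
  \<open>trans_mat \<phi> M\<close>, which preserves mass.\<close>

lemma nn_integral_row_mass_mult: "(\<integral>\<^sup>+z. row_mass (row_mult v (M z)) \<partial>\<phi>) = row_mass v"
proof -
  note [measurable_cong] = sets_phi
  note [measurable] = M_measurable
  have [measurable]: "(\<lambda>y. \<integral>\<^sup>+j. ennreal (M y i j) \<partial>count_space UNIV) \<in> borel_measurable borel" for i
    by (rule borel_measurable_nn_integral_count_space) simp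
  have "(\<integral>\<^sup>+y. row_mass (row_mult v (M y)) \<partial>\<phi>) =
     (\<integral>\<^sup>+i. \<integral>\<^sup>+y. v i * (\<integral>\<^sup>+j. ennreal (M y i j) \<partial>count_space UNIV) \<partial>\<phi> \<partial>count_space UNIV)"
    unfolding row_mass_row_mult
    by (rule nn_integral_count_space_nn_integral) auto
  also have "\<dots> = (\<integral>\<^sup>+i. v i * (\<integral>\<^sup>+j. trans_mat \<phi> M i j \<partial>count_space UNIV) \<partial>count_space UNIV)"
    unfolding trans_mat_def
    by (subst nn_integral_cmult, simp, subst nn_integral_count_space_nn_integral) auto
  also have "\<dots> = row_mass v"
    using stochastic_P by (simp add: stochastic_matrix_def row_mass_def)
  finally show ?thesis .
qed

lemma nn_integral_row_mass_row_prod: "(\<integral>\<^sup>+y. row_mass (row_prod M y n v) \<partial>phiN n) = row_mass v"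
proof (induction n)
  case 0
  interpret product_sigma_finite "\<lambda>_::nat. \<phi>" by (rule product_sigma_finite_phi)
  show ?case using emeasure_PiM_empty[of "\<lambda>_::nat. \<phi>"] by (simp add: space_PiM)
next
  case (Suc n)
  have eq: "row_prod M (y(Suc n := z)) (Suc n) v = row_mult (row_prod M y n v) (M z)" for y z
  proof -
    have "row_prod M (y(Suc n := z)) n v = row_prod M y n v" by (rule row_prod_cong) auto
    then show ?thesis by simp
  qed
  have "(\<integral>\<^sup>+y. row_mass (row_prod M y (Suc n) v) \<partial>phiN (Suc n)) =
      (\<integral>\<^sup>+y. (\<integral>\<^sup>+z. row_mass (row_prod M (y(Suc n := z)) (Suc n) v) \<partial>\<phi>) \<partial>phiN n)"
    by (rule nn_integral_phiN_Suc[OF row_mass_row_prod_phiN])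
  also have "\<dots> = row_mass v" unfolding eq nn_integral_row_mass_mult by (rule Suc.IH)
  finally show ?case .
qed

text \<open>The mass has a finite integral. The exceptional null set depends on \<open>v\<close>;
  for the unit rows a countable union is taken where it is used.\<close>

lemma AE_row_prod_finite:
  assumes "row_mass v < \<infinity>"
  shows "AE y in phiN n. row_mass (row_prod M y n v) < \<infinity>"
proof -
  have "(\<integral>\<^sup>+y. row_mass (row_prod M y n v) \<partial>phiN n) \<noteq> \<infinity>"
    using assms by (simp add: nn_integral_row_mass_row_prod)
  then have "AE y in phiN n. row_mass (row_prod M y n v) \<noteq> \<infinity>"
    by (intro nn_integral_PInf_AE) (simp_all add: measurable_cong_sets[OF sets_phiN refl])
  then show ?thesis by (simp add: less_top)
qed

text \<open>The invariant law of the signal: by stationarity it is the law at every time.\<close>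

definition lam :: "'e \<Rightarrow> ennreal" where "lam i = emeasure Pr {\<omega>. coord_X 0 \<omega> = i}"

lemma emeasure_coord_X: "emeasure Pr {\<omega>. coord_X m \<omega> = i} = lam i"
proof -
  have "{\<omega> :: ('e, 'f) path. coord_X m \<omega> = i} = sh m -` {\<omega>. coord_X 0 \<omega> = i}" by auto
  moreover have "{\<omega> :: ('e, 'f) path. coord_X 0 \<omega> = i} \<in> sets path_space" using coord_X_eq_events by (simp add: sets_Pr)
  ultimately show ?thesis using emeasure_sh[of "{\<omega>. coord_X 0 \<omega> = i}" m] by (simp only: lam_def)
qed

lemma row_mass_lam [simp]: "row_mass lam = 1"
  using emeasure_split_X[of UNIV 0] emeasure_space_1 by (simp add: row_mass_def lam_def sets.top[of Pr, simplified])

text \<open>The filter at time 0 that starts from the row \<open>v\<close> at time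
  \<open>- int n\<close> and sees only the observations after it.\<close>

definition wfilter :: "nat \<Rightarrow> ('e \<Rightarrow> ennreal) \<Rightarrow> ('e, 'f) path \<Rightarrow> 'e measure" where
  "wfilter n v \<omega> = nrm (row_prod M (yw (- int n) n \<omega>) n v)"

lemma wfilter_prob: "wfilter n v \<omega> \<in> prob_measures (discrete_topology UNIV)"
  by (simp add: wfilter_def nrm_prob)

lemma wfilter_measurable':
  assumes "\<And>k. - int n < k \<Longrightarrow> k \<le> 0 \<Longrightarrow> coord_Y k \<in> N \<rightarrow>\<^sub>M borel"
    and "\<And>i. (\<lambda>x. v x i) \<in> borel_measurable N"
  shows "(\<lambda>x. wfilter n (v x) x) \<in> N \<rightarrow>\<^sub>M borel_of PE"
  unfolding wfilter_def
proof (intro nrm_measurable row_prod_measurable assms(2))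
  fix k assume k: "1 \<le> k" "k \<le> n"
  then have "coord_Y (- int n + int k) \<in> N \<rightarrow>\<^sub>M borel" by (intro assms(1)) auto
  then show "(\<lambda>x. yw (- int n) n x k) \<in> N \<rightarrow>\<^sub>M borel" using k by (simp add: yw_def)
qed

lemma nrm_row_prod_coord_measurable [measurable]:
  "(\<lambda>y. measure (nrm (row_prod M y n v)) {i}) \<in> borel_measurable (PiM {1..n} (\<lambda>_. borel))"
  by (rule measurable_compose[OF nrm_measurable measure_coord_measurable]) simp

lemma measure_wfilter_01: "0 \<le> measure (wfilter n v \<omega>) A \<and> measure (wfilter n v \<omega>) A \<le> 1"
  using wfilter_prob[of n v \<omega>] by (auto simp: prob_measures_discrete prob_space.prob_le_1)

text \<open>As \<open>lam\<close> is the law of the signal at time \<open>- int n\<close>, this is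
  Bayes' formula: the density of window and end state divided by the density of the window
  alone.\<close>

lemma wfilter_lam_version:
  "cond_prob_version Pr (past_window n) {\<omega>. coord_X 0 \<omega> = i} (\<lambda>\<omega>. measure (wfilter n lam \<omega>) {i})"
  unfolding cond_prob_version_def
proof (intro conjI allI ballI)
  let ?F = "\<lambda>\<omega>. measure (wfilter n lam \<omega>) {i}" and ?T = "{\<omega>. coord_X 0 \<omega> = i}"
  show F: "?F \<in> borel_measurable (past_window n)"
    by (intro measurable_compose[OF _ measure_coord_measurable] wfilter_measurable' coord_Y_past_window) auto
  fix Z :: "('e, 'f) path set" assume Z: "Z \<in> sets (past_window n)"
  then obtain A where A[measurable]: "A \<in> sets (PiM {1..n} (\<lambda>_. borel))" and ZA: "Z = yw (- int n) n -` A"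
    by (auto simp: sets_past_window)
  have sub: "sets (past_window n) \<subseteq> sets Pr"
    using past_window_subset_sigma_Y sigma_Y_subset_path by (auto simp: sets_Pr)
  then have Zm[measurable]: "Z \<in> sets Pr" using Z by auto
  show "measure Pr (?T \<inter> Z) = (\<integral>\<omega>. ?F \<omega> * indicator Z \<omega> \<partial>Pr)"
  proof (rule measure_eq_of_nn_integral)
    show "?F \<in> borel_measurable Pr" using F sub by (auto simp: measurable_def)
    show "?T \<inter> Z \<in> sets Pr" by simp
    have "emeasure Pr (?T \<inter> Z) = (\<integral>\<^sup>+\<omega>. indicator UNIV \<omega> * indicator {\<omega>. coord_X (- int n + int n) \<omega> = i} \<omega> * indicator A (yw (- int n) n \<omega>) \<partial>Pr)"
      by (subst nn_integral_indicator[symmetric], simp) (auto intro!: nn_integral_cong simp: indicator_def ZA simp del: nn_integral_indicator)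
    also have "\<dots> = (\<integral>\<^sup>+y. indicator A y * row_prod M y n (\<lambda>i. emeasure Pr (UNIV \<inter> {\<omega>. coord_X (- int n) \<omega> = i})) i \<partial>phiN n)"
      using sets.top[of "sigma_XY (- int n) (- int n)"] by (intro path_formula) auto
    also have "\<dots> = (\<integral>\<^sup>+y. indicator A y * row_prod M y n lam i \<partial>phiN n)"
      by (simp add: emeasure_coord_X)
    also have "\<dots> = (\<integral>\<^sup>+y. (indicator A y * ennreal (measure (nrm (row_prod M y n lam)) {i})) * row_mass (row_prod M y n lam) \<partial>phiN n)"
    proof (rule nn_integral_cong_AE)
      show "AE y in phiN n. indicator A y * row_prod M y n lam i = (indicator A y * ennreal (measure (nrm (row_prod M y n lam)) {i})) * row_mass (row_prod M y n lam)"
        using AE_row_prod_finite[of lam n] by (auto elim!: eventually_mono simp: nrm_coord mult.assoc)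
    qed
    also have "\<dots> = (\<integral>\<^sup>+y. (indicator A y * ennreal (measure (nrm (row_prod M y n lam)) {i})) * row_mass (row_prod M y n (\<lambda>i. emeasure Pr (UNIV \<inter> {\<omega>. coord_X (- int n) \<omega> = i}))) \<partial>phiN n)"
      by (simp add: emeasure_coord_X)
    also have "\<dots> = (\<integral>\<^sup>+\<omega>. indicator UNIV \<omega> * (indicator A (yw (- int n) n \<omega>) * ennreal (measure (nrm (row_prod M (yw (- int n) n \<omega>) n lam)) {i})) \<partial>Pr)"
      using sets.top[of "sigma_XY (- int n) (- int n)"] by (intro path_formula_mass[symmetric]) auto
    also have "\<dots> = (\<integral>\<^sup>+\<omega>. indicator Z \<omega> * ennreal (?F \<omega>) \<partial>Pr)"
      by (intro nn_integral_cong) (auto simp: ZA wfilter_def indicator_def)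
    finally show "emeasure Pr (?T \<inter> Z) = (\<integral>\<^sup>+\<omega>. indicator Z \<omega> * ennreal (?F \<omega>) \<partial>Pr)" .
  qed (use measure_wfilter_01 in auto)
qed (use measure_wfilter_01 in auto)

lemma unit_row_measurable [measurable]: "(\<lambda>\<omega>. unit_row (coord_X k \<omega>) i) \<in> borel_measurable path_space"
proof -
  have "(\<lambda>j. unit_row j i) \<in> borel_measurable (count_space UNIV)" by simp
  then show ?thesis by (rule measurable_compose[OF coord_X_measurable])
qed

text \<open>By the Markov property, once the true state at time \<open>- int n\<close> is known, the
  earlier past adds no information about the window and the end state. The filter started in the
  true state therefore conditions on the whole past of the signal up to that time together with all
  observations.\<close>

lemma wfilter_unit_version:
  "cond_prob_version Pr (sigma_XY (- int n) 0) {\<omega>. coord_X 0 \<omega> = i}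
     (\<lambda>\<omega>. measure (wfilter n (unit_row (coord_X (- int n) \<omega>)) \<omega>) {i})"
proof -
  let ?F = "\<lambda>\<omega>. measure (wfilter n (unit_row (coord_X (- int n) \<omega>)) \<omega>) {i}" and ?T = "{\<omega>. coord_X 0 \<omega> = i}"
  let ?E = "{B \<inter> yw (- int n) n -` A | (B :: ('e, 'f) path set) A. B \<in> sets (sigma_XY (- int n) (- int n)) \<and> A \<in> sets (PiM {1..n} (\<lambda>_. borel))}"
  have F: "?F \<in> borel_measurable (sigma_XY (- int n) 0)"
  proof (intro measurable_compose[OF _ measure_coord_measurable] wfilter_measurable')
    show "(\<lambda>\<omega>. unit_row (coord_X (- int n) \<omega>) i) \<in> borel_measurable (sigma_XY (- int n) 0)" for i
      by (rule measurable_compose[OF coord_X_sigma_XY]) auto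
  qed (auto intro: coord_Y_sigma_XY)
  show ?thesis
  proof (rule cond_prob_versionI_generator[OF subalgebra_XY _ F, where E="?E"])
    show "?T \<in> sets Pr" by simp
    show "0 \<le> ?F x \<and> ?F x \<le> 1" for x by (rule measure_wfilter_01)
    show "Int_stable ?E"
    proof (rule Int_stableI)
      fix a b :: "('e, 'f) path set" assume "a \<in> ?E" "b \<in> ?E"
      then obtain B A B' A' where "B \<in> sets (sigma_XY (- int n) (- int n))" "A \<in> sets (PiM {1..n} (\<lambda>_. borel))"
        "B' \<in> sets (sigma_XY (- int n) (- int n))" "A' \<in> sets (PiM {1..n} (\<lambda>_. borel))"
        "a = B \<inter> yw (- int n) n -` A" "b = B' \<inter> yw (- int n) n -` A'" by blast
      then show "a \<inter> b \<in> ?E"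
        by (intro CollectI exI[of _ "B \<inter> B'"] exI[of _ "A \<inter> A'"]) auto
    qed
    have "yw (- int n) n -` space (PiM {1..n} (\<lambda>_. borel :: 'f measure)) = (UNIV :: ('e, 'f) path set)"
      using measurable_space[OF yw_measurable] by auto
    then show "space Pr \<in> ?E"
      using sets.top[of "sigma_XY (- int n) (- int n)"] sets.top[of "PiM {1..n} (\<lambda>_. borel)"] by auto
    show "sets (sigma_XY (- int n) 0) = sigma_sets (space Pr) ?E" by (simp add: sigma_XY_generator)
    fix Z assume "Z \<in> ?E"
    then obtain B A where B: "B \<in> sets (sigma_XY (- int n) (- int n))" and A[measurable]: "A \<in> sets (PiM {1..n} (\<lambda>_. borel))"
      and Z: "Z = B \<inter> yw (- int n) n -` A" by blast
    have BP[measurable]: "B \<in> sets Pr" using B subalgebra_XY by (auto simp: subalgebra_def)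
    have Am[measurable]: "yw (- int n) n -` A \<in> sets Pr" using measurable_sets[OF yw_measurable A] by (simp add: sets_Pr)
    let ?h = "\<lambda>k y. indicator A y * ennreal (measure (nrm (row_prod M y n (unit_row k))) {i})"
    let ?r = "\<lambda>i. emeasure Pr (B \<inter> {\<omega>. coord_X (- int n) \<omega> = i})"
    let ?Bk = "\<lambda>k. B \<inter> {\<omega>. coord_X (- int n) \<omega> = k}"
    show "measure Pr (?T \<inter> Z) = (\<integral>\<omega>. ?F \<omega> * indicator Z \<omega> \<partial>Pr)"
    proof (rule measure_eq_of_nn_integral)
      show "?F \<in> borel_measurable Pr" using F subalgebra_XY measurable_from_subalg by blast
      show "?T \<inter> Z \<in> sets Pr" "Z \<in> sets Pr" unfolding Z by auto
      have "emeasure Pr (?T \<inter> Z) = (\<integral>\<^sup>+\<omega>. indicator B \<omega> * indicator {\<omega>. coord_X (- int n + int n) \<omega> = i} \<omega> * indicator A (yw (- int n) n \<omega>) \<partial>Pr)"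
        unfolding Z by (subst nn_integral_indicator[symmetric], simp) (auto intro!: nn_integral_cong simp: indicator_def simp del: nn_integral_indicator)
      also have "\<dots> = (\<integral>\<^sup>+y. indicator A y * row_prod M y n ?r i \<partial>phiN n)"
        using B by (intro path_formula) auto
      \<comment> \<open>The row of \<open>B\<close> is expanded along the starting state
        \<open>k\<close>. The k-th term belongs to the event \<open>?Bk k\<close>, on which the
        filter starts in \<open>unit_row k\<close>, so it can be read back by
        \<open>path_formula_mass\<close>.\<close>
      also have "\<dots> = (\<integral>\<^sup>+y. (\<integral>\<^sup>+k. ?h k y * (?r k * row_mass (row_prod M y n (unit_row k))) \<partial>count_space UNIV) \<partial>phiN n)"
      proof (rule nn_integral_cong_AE)
        have "AE y in phiN n. \<forall>k. row_mass (row_prod M y n (unit_row k)) < \<infinity>"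
          unfolding AE_all_countable by (intro allI AE_row_prod_finite) simp
        then show "AE y in phiN n. indicator A y * row_prod M y n ?r i = (\<integral>\<^sup>+k. ?h k y * (?r k * row_mass (row_prod M y n (unit_row k))) \<partial>count_space UNIV)"
        proof eventually_elim
          case (elim y)
          have "indicator A y * row_prod M y n ?r i = (\<integral>\<^sup>+k. indicator A y * (?r k * row_prod M y n (unit_row k) i) \<partial>count_space UNIV)"
            by (subst row_prod_sum) (simp add: nn_integral_cmult)
          also have "\<dots> = (\<integral>\<^sup>+k. ?h k y * (?r k * row_mass (row_prod M y n (unit_row k))) \<partial>count_space UNIV)"
          proof (intro nn_integral_cong)
            fix k
            have "row_prod M y n (unit_row k) i = ennreal (measure (nrm (row_prod M y n (unit_row k))) {i}) * row_mass (row_prod M y n (unit_row k))"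
              using elim by (intro nrm_coord[symmetric]) auto
            then show "indicator A y * (?r k * row_prod M y n (unit_row k) i) = ?h k y * (?r k * row_mass (row_prod M y n (unit_row k)))"
              by (simp only: mult_ac)
          qed
          finally show ?case .
        qed
      qed
      also have "\<dots> = (\<integral>\<^sup>+k. (\<integral>\<^sup>+y. ?h k y * (?r k * row_mass (row_prod M y n (unit_row k))) \<partial>phiN n) \<partial>count_space UNIV)"
        by (rule nn_integral_count_space_nn_integral) auto
      also have "\<dots> = (\<integral>\<^sup>+k. (\<integral>\<^sup>+\<omega>. indicator (?Bk k) \<omega> * ?h k (yw (- int n) n \<omega>) \<partial>Pr) \<partial>count_space UNIV)"
      proof (intro nn_integral_cong)
        fix k
        have Bk: "?Bk k \<in> sets (sigma_XY (- int n) (- int n))" 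
          using B coord_X_eq_sigma_XY[of "- int n" "- int n" k "- int n"] by auto
        have "emeasure Pr (?Bk k \<inter> {\<omega>. coord_X (- int n) \<omega> = i}) = ?r k * unit_row k i" for i
        proof (cases "i = k")
          case True then show ?thesis by (simp add: unit_row_def Int_assoc)
        next
          case False
          then have "?Bk k \<inter> {\<omega>. coord_X (- int n) \<omega> = i} = {}" by auto
          then show ?thesis using False by (simp add: unit_row_def)
        qed
        then have "row_mass (row_prod M y n (\<lambda>i. emeasure Pr (?Bk k \<inter> {\<omega>. coord_X (- int n) \<omega> = i}))) = ?r k * row_mass (row_prod M y n (unit_row k))" for y
          using row_mass_cmult[of "?r k" "row_prod M y n (unit_row k)"] row_prod_cmult[of M y n "?r k" "unit_row k"]
          by presburger
        then show "(\<integral>\<^sup>+y. ?h k y * (?r k * row_mass (row_prod M y n (unit_row k))) \<partial>phiN n) = (\<integral>\<^sup>+\<omega>. indicator (?Bk k) \<omega> * ?h k (yw (- int n) n \<omega>) \<partial>Pr)"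
          using path_formula_mass[OF Bk, of "?h k" n] by simp
      qed
      also have "\<dots> = (\<integral>\<^sup>+\<omega>. (\<integral>\<^sup>+k. indicator (?Bk k) \<omega> * ?h k (yw (- int n) n \<omega>) \<partial>count_space UNIV) \<partial>Pr)"
        by (rule nn_integral_count_space_nn_integral[symmetric]) auto
      also have "\<dots> = (\<integral>\<^sup>+\<omega>. indicator Z \<omega> * ennreal (?F \<omega>) \<partial>Pr)"
      proof (intro nn_integral_cong)
        fix \<omega> :: "('e, 'f) path"
        have "(\<integral>\<^sup>+k. indicator (?Bk k) \<omega> * ?h k (yw (- int n) n \<omega>) \<partial>count_space UNIV) =
          (\<integral>\<^sup>+k. (indicator Z \<omega> * ennreal (?F \<omega>)) * indicator {coord_X (- int n) \<omega>} k \<partial>count_space UNIV)"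
          by (intro nn_integral_cong) (auto simp: indicator_def Z wfilter_def)
        then show "(\<integral>\<^sup>+k. indicator (?Bk k) \<omega> * ?h k (yw (- int n) n \<omega>) \<partial>count_space UNIV) = indicator Z \<omega> * ennreal (?F \<omega>)"
          by (simp add: nn_integral_cmult_indicator)
      qed
      finally show "emeasure Pr (?T \<inter> Z) = (\<integral>\<^sup>+\<omega>. indicator Z \<omega> * ennreal (?F \<omega>) \<partial>Pr)" .
    qed (rule measure_wfilter_01)
  qed
qed

lemma regular_cond_distr_version:
  assumes K: "subalgebra Pr K" and r: "regular_cond_distr Pr K (coord_X n) (count_space UNIV) \<kappa>"
  shows "cond_prob_version Pr K {\<omega>. coord_X n \<omega> = i} (\<lambda>\<omega>. measure (\<kappa> \<omega>) {i})"
  unfolding cond_prob_version_def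
proof (intro conjI allI ballI)
  interpret S: finite_measure_subalgebra Pr K by standard (rule K)
  let ?T = "{\<omega>. coord_X n \<omega> = i}"
  have sp: "space K = UNIV" using K by (simp add: subalgebra_def)
  have km: "\<kappa> \<in> K \<rightarrow>\<^sub>M prob_algebra (count_space UNIV)" using r by (simp add: regular_cond_distr_def)
  then have pr: "prob_space (\<kappa> \<omega>)" "sets (\<kappa> \<omega>) = UNIV" for \<omega>
    using measurable_space[OF km, of \<omega>] by (auto simp: sp space_prob_algebra)
  show F: "(\<lambda>\<omega>. measure (\<kappa> \<omega>) {i}) \<in> borel_measurable K"
    using measurable_compose[OF km] measurable_cong_sets[OF sets_borel_of_PE refl] measure_coord_measurable by blast
  show 0: "0 \<le> measure (\<kappa> \<omega>) {i}" "measure (\<kappa> \<omega>) {i} \<le> 1" for \<omega> using pr by (auto simp: prob_space.prob_le_1)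
  fix Z assume Z: "Z \<in> sets K"
  then have [measurable]: "Z \<in> sets Pr" using K by (auto simp: subalgebra_def)
  have eq: "AE \<omega> in Pr. ennreal (measure (\<kappa> \<omega>) {i}) = nn_cond_exp Pr K (indicator ?T) \<omega>"
  proof -
    have "AE \<omega> in Pr. emeasure (\<kappa> \<omega>) {i} = nn_cond_exp Pr K (indicator (coord_X n -` {i} \<inter> space Pr)) \<omega>"
      using r unfolding regular_cond_distr_def by simp
    moreover have "emeasure (\<kappa> \<omega>) {i} = ennreal (measure (\<kappa> \<omega>) {i})" for \<omega>
      using pr(1)[of \<omega>] by (simp add: finite_measure.emeasure_eq_measure prob_space_def)
    moreover have "coord_X n -` {i} \<inter> space Pr = ?T" by auto
    ultimately show ?thesis by simp
  qed
  show "measure Pr (?T \<inter> Z) = (\<integral>\<omega>. measure (\<kappa> \<omega>) {i} * indicator Z \<omega> \<partial>Pr)"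
  proof (rule measure_eq_of_nn_integral)
    show "(\<lambda>\<omega>. measure (\<kappa> \<omega>) {i}) \<in> borel_measurable Pr" by (rule measurable_from_subalg[OF K F])
    have "(\<integral>\<^sup>+\<omega>. indicator Z \<omega> * ennreal (measure (\<kappa> \<omega>) {i}) \<partial>Pr) = (\<integral>\<^sup>+\<omega>. indicator Z \<omega> * nn_cond_exp Pr K (indicator ?T) \<omega> \<partial>Pr)"
      using eq by (intro nn_integral_cong_AE) (auto elim!: eventually_mono)
    also have "\<dots> = (\<integral>\<^sup>+\<omega>. indicator Z \<omega> * indicator ?T \<omega> \<partial>Pr)"
      using Z by (intro S.nn_cond_exp_intg) auto
    also have "\<dots> = (\<integral>\<^sup>+\<omega>. indicator (?T \<inter> Z) \<omega> \<partial>Pr)"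
      by (auto intro!: nn_integral_cong simp: indicator_def simp del: nn_integral_indicator)
    finally show "emeasure Pr (?T \<inter> Z) = (\<integral>\<^sup>+\<omega>. indicator Z \<omega> * ennreal (measure (\<kappa> \<omega>) {i}) \<partial>Pr)" by simp
  qed (use 0 in auto)
qed

text \<open>Upward convergence: the windows increase to \<open>sigma_Y 0\<close>.\<close>

lemma wfilter_lam_L1:
  assumes "is_pi_min Pr 0 \<pi>"
  shows "(\<lambda>n. \<integral>\<omega>. \<bar>measure (wfilter n lam \<omega>) {i} - measure (\<pi> \<omega>) {i}\<bar> \<partial>Pr) \<longlonglongrightarrow> 0"
proof (rule cond_prob_L1_convergence[OF _ subalgebra_Y[of 0] coord_X_eq_events wfilter_lam_version])
  show "subalgebra Pr (past_window n)" for n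
    using past_window_subset_sigma_Y sigma_Y_subset_path by (auto simp: sets_Pr subalgebra_def)
  show "cond_prob_version Pr (sigma_Y 0) {\<omega>. coord_X 0 \<omega> = i} (\<lambda>\<omega>. measure (\<pi> \<omega>) {i})"
    using assms by (intro regular_cond_distr_version subalgebra_Y) (simp add: is_pi_min_def)
  show "(\<forall>n. sets (past_window n) \<subseteq> sets (past_window (Suc n))) \<and> sets (sigma_Y 0) = sigma_sets (space Pr) (\<Union>n. sets (past_window n)) \<or>
    (\<forall>n. sets (past_window (Suc n)) \<subseteq> sets (past_window n)) \<and> sets (sigma_Y 0) = (\<Inter>n. sets (past_window n))"
    using past_window_mono sigma_Y_past_windows by auto
qed

text \<open>Downward convergence: the sigma-fields decrease to \<open>sigma_tail_XY 0\<close>, so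
  \<open>\<pi>max\<close> is the limit of filters that start in the true state of the
  signal.\<close>

lemma wfilter_unit_L1:
  assumes "is_pi_max Pr 0 \<pi>"
  shows "(\<lambda>n. \<integral>\<omega>. \<bar>measure (wfilter n (unit_row (coord_X (- int n) \<omega>)) \<omega>) {i} - measure (\<pi> \<omega>) {i}\<bar> \<partial>Pr) \<longlonglongrightarrow> 0"
proof (rule cond_prob_L1_convergence[OF subalgebra_XY subalgebra_tail[of 0] coord_X_eq_events wfilter_unit_version])
  show "cond_prob_version Pr (sigma_tail_XY 0) {\<omega>. coord_X 0 \<omega> = i} (\<lambda>\<omega>. measure (\<pi> \<omega>) {i})"
    using assms by (intro regular_cond_distr_version subalgebra_tail) (simp add: is_pi_max_def)
  have "sets (sigma_tail_XY 0) = (\<Inter>n. sets (sigma_XY (- int n) 0))"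
  proof -
    have "{..0::int} = range (\<lambda>n. - int n)" by (auto simp: image_iff intro!: exI[of _ "nat (- _)"])
    then show ?thesis unfolding sets_sigma_tail_XY by auto
  qed
  then show "(\<forall>n. sets (sigma_XY (- int n) 0) \<subseteq> sets (sigma_XY (- int (Suc n)) 0)) \<and> sets (sigma_tail_XY 0) = sigma_sets (space Pr) (\<Union>n. sets (sigma_XY (- int n) 0)) \<or>
    (\<forall>n. sets (sigma_XY (- int (Suc n)) 0) \<subseteq> sets (sigma_XY (- int n) 0)) \<and> sets (sigma_tail_XY 0) = (\<Inter>n. sets (sigma_XY (- int n) 0))"
    using sigma_XY_mono[of "- int (Suc n)" "- int n" 0 0 for n] by (intro disjI2 conjI allI) auto
qed

end

section \<open>From convergence of point masses to bounded continuous functions\<close>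

lemma tendsto_fun_componentwise:
  fixes g :: "nat \<Rightarrow> 'e \<Rightarrow> real"
  assumes "\<And>i. (\<lambda>n. g n i) \<longlonglongrightarrow> a i"
  shows "g \<longlonglongrightarrow> a"
proof -
  have "limitin (product_topology (\<lambda>_. euclidean) UNIV) g a sequentially"
    unfolding limitin_componentwise using assms by simp
  then show ?thesis by (simp add: euclidean_product_topology)
qed

lemma PE_measure_eqI:
  fixes \<mu> \<nu> :: "'e::countable measure"
  assumes "\<mu> \<in> prob_measures (discrete_topology UNIV)" "\<nu> \<in> prob_measures (discrete_topology UNIV)"
    and "\<And>i. measure \<mu> {i} = measure \<nu> {i}"
  shows "\<mu> = \<nu>"
  using prob_density_eq[OF assms(1)] prob_density_eq[OF assms(2)] assms(3) by simp

text \<open>By \<open>openin_PE\<close> the open sets of \<open>PE\<close> are traces of open sets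
  in the product topology of the point masses, where convergence is coordinatewise.\<close>

lemma bdd_continuous_PE_sequentially:
  fixes u :: "nat \<Rightarrow> 'e::countable measure"
  assumes f: "f \<in> bdd_continuous PE"
    and u: "\<And>n. u n \<in> prob_measures (discrete_topology UNIV)" and a: "a \<in> prob_measures (discrete_topology UNIV)"
    and lim: "\<And>i. (\<lambda>n. measure (u n) {i}) \<longlonglongrightarrow> measure a {i}"
  shows "(\<lambda>n. f (u n)) \<longlonglongrightarrow> f a"
proof (rule topological_tendstoI)
  fix W :: "real set" assume W: "open W" "f a \<in> W"
  have "openin PE {x \<in> topspace PE. f x \<in> W}"
    using f W by (auto simp: bdd_continuous_def continuous_map_def)
  from openin_PE[OF this] obtain V where V: "open V"
    "{x \<in> topspace PE. f x \<in> W} = {\<mu> \<in> prob_measures (discrete_topology UNIV). (\<lambda>i. measure \<mu> {i}) \<in> V}"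
    by blast
  have "(\<lambda>i. measure a {i}) \<in> V" using V(2) W a by auto
  moreover have "(\<lambda>n i. measure (u n) {i}) \<longlonglongrightarrow> (\<lambda>i. measure a {i})"
    using lim by (rule tendsto_fun_componentwise)
  ultimately have "\<forall>\<^sub>F n in sequentially. (\<lambda>i. measure (u n) {i}) \<in> V"
    using V(1) by (auto dest: topological_tendstoD)
  then show "\<forall>\<^sub>F n in sequentially. f (u n) \<in> W"
    using V(2) u by (auto elim!: eventually_mono)
qed

lemma space_borel_of: "space (borel_of S) = topspace S"
  unfolding borel_of_def using openin_subset[of S] by (subst space_measure_of) auto

lemma sets_borel_of: "sets (borel_of S) = sigma_sets (topspace S) {U. openin S U}"
  unfolding borel_of_def using openin_subset[of S] by (subst sets_measure_of) auto

lemma bdd_continuous_measurable: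
  assumes f: "f \<in> bdd_continuous S"
  shows "f \<in> borel_measurable (borel_of S)"
proof (rule borel_measurableI)
  fix W :: "real set" assume "open W"
  then have "openin S {x \<in> topspace S. f x \<in> W}"
    using f by (auto simp: bdd_continuous_def continuous_map_def)
  moreover have "f -` W \<inter> space (borel_of S) = {x \<in> topspace S. f x \<in> W}"
    by (auto simp: space_borel_of)
  ultimately show "f -` W \<inter> space (borel_of S) \<in> sets (borel_of S)"
    by (auto simp: sets_borel_of intro: sigma_sets.Basic)
qed

lemma bdd_continuous_bound:
  assumes "f \<in> bdd_continuous S"
  obtains B where "B > 0" "\<And>x. x \<in> topspace S \<Longrightarrow> \<bar>f x\<bar> \<le> B"
proof -
  obtain B where "\<And>x. x \<in> topspace S \<Longrightarrow> \<bar>f x\<bar> \<le> B"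
    using assms by (auto simp: bdd_continuous_def bounded_iff)
  note B = this
  show ?thesis
  proof (rule that[of "\<bar>B\<bar> + 1"])
    show "\<bar>f x\<bar> \<le> \<bar>B\<bar> + 1" if "x \<in> topspace S" for x using B[OF that] by linarith
  qed linarith
qed

lemma tendsto_subseqI:
  fixes x :: "nat \<Rightarrow> real"
  assumes "\<And>r :: nat \<Rightarrow> nat. strict_mono r \<Longrightarrow> \<exists>s :: nat \<Rightarrow> nat. strict_mono s \<and> (\<lambda>n. x (r (s n))) \<longlonglongrightarrow> c"
  shows "x \<longlonglongrightarrow> c"
proof (rule ccontr)
  assume "\<not> x \<longlonglongrightarrow> c"
  then obtain e where e: "e > 0" and "\<not> (\<forall>\<^sub>F n in sequentially. dist (x n) c < e)"
    by (auto simp: tendsto_iff)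
  then have "\<forall>N. \<exists>n\<ge>N. \<not> dist (x n) c < e"
    by (simp only: not_eventually frequently_sequentially not_False_eq_True simp_thms)
  then have "infinite {n. \<not> dist (x n) c < e}"
    by (simp only: infinite_nat_iff_unbounded_le mem_Collect_eq simp_thms)
  then obtain r :: "nat \<Rightarrow> nat" where r: "strict_mono r" "\<And>n. r n \<in> {n. \<not> dist (x n) c < e}"
    using infinite_enumerate by blast
  from assms[OF r(1)] obtain s where "(\<lambda>n. x (r (s n))) \<longlonglongrightarrow> c" by auto
  then have "\<forall>\<^sub>F n in sequentially. dist (x (r (s n))) c < e" using e by (auto simp: tendsto_iff)
  then show False using r(2) by (auto simp: eventually_sequentially)
qed

context prob_space
begin

text \<open>The weights 2^-k collect countably many sequences into a single one, which is null in
  mean by Tannery's theorem. One almost surely convergent subsequence of it serves all indices at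
  once; this replaces a diagonal argument.\<close>

lemma AE_subseq_countable:
  fixes a :: "nat \<Rightarrow> 'i::countable \<Rightarrow> 'a \<Rightarrow> real"
  assumes [measurable]: "\<And>n i. a n i \<in> borel_measurable M" and b: "\<And>n i x. \<bar>a n i x\<bar> \<le> 1"
    and lim: "\<And>i. (\<lambda>n. expectation (\<lambda>x. \<bar>a n i x\<bar>)) \<longlonglongrightarrow> 0"
  shows "\<exists>r. strict_mono r \<and> (AE x in M. \<forall>i. (\<lambda>n. a (r n) i x) \<longlonglongrightarrow> 0)"
proof -
  define t where "t n k x = (1/2)^k * \<bar>a n (from_nat k) x\<bar>" for n k x
  have tb: "\<bar>t n k x\<bar> \<le> (1/2)^k" "0 \<le> t n k x" for n k x
    unfolding t_def using b[of n "from_nat k" x] by (auto simp: abs_mult intro!: mult_left_le)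
  have [measurable]: "t n k \<in> borel_measurable M" for n k unfolding t_def by measurable
  have geo: "summable (\<lambda>k. (1/2)^k :: real)" by (rule summable_geometric) simp
  have sm: "summable (\<lambda>k. t n k x)" for n x
    by (rule summable_comparison_test'[OF geo, of 0]) (use tb in auto)
  have it: "integrable M (t n k)" for n k
    using tb by (intro integrable_const_bound[of _ "(1/2)^k"]) auto
  have Et: "expectation (t n k) = (1/2)^k * expectation (\<lambda>x. \<bar>a n (from_nat k) x\<bar>)" for n k
    unfolding t_def by simp
  have Etb: "norm (expectation (t n k)) \<le> (1/2)^k" for n k
  proof -
    have "norm (expectation (t n k)) \<le> expectation (\<lambda>x. norm (t n k x))" by (rule integral_norm_bound)
    also have "\<dots> \<le> expectation (\<lambda>x. (1/2)^k)"
      using it tb by (intro integral_mono) auto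
    finally show ?thesis by (simp add: prob_space)
  qed
  have En: "expectation (\<lambda>x. norm (t n k x)) = expectation (t n k)" for n k using tb by simp
  have SE: "summable (\<lambda>k. expectation (t n k))" for n
    by (rule summable_comparison_test'[OF geo, of 0]) (use Etb in auto)
  have ES: "expectation (\<lambda>x. \<Sum>k. t n k x) = (\<Sum>k. expectation (t n k))" "integrable M (\<lambda>x. \<Sum>k. t n k x)" for n
    using integral_suminf[of M "t n"] integrable_suminf[of M "t n"] it sm tb SE by (auto simp: En)
  have lim_t: "(\<lambda>n. expectation (t n k)) \<longlonglongrightarrow> 0" for k
    unfolding Et using tendsto_mult_left[OF lim[of "from_nat k"], of "(1/2)^k"] by simp
  have "\<forall>\<^sub>F (k, n) in at_top \<times>\<^sub>F at_top. norm (expectation (t n k)) \<le> (1/2)^k"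
    using Etb by (auto intro: always_eventually)
  from tannerys_theorem[of "\<lambda>k n. expectation (t n k)" "\<lambda>k. 0" sequentially "\<lambda>k. (1/2)^k", OF lim_t this geo]
  have "(\<lambda>n. \<Sum>k. expectation (t n k)) \<longlonglongrightarrow> (\<Sum>k. 0)" by simp
  moreover have "expectation (\<lambda>x. norm (\<Sum>k. t n k x)) = expectation (\<lambda>x. \<Sum>k. t n k x)" for n
    using tb sm by (simp add: suminf_nonneg)
  ultimately have "(\<lambda>n. expectation (\<lambda>x. norm (\<Sum>k. t n k x))) \<longlonglongrightarrow> 0" by (simp add: ES)
  then obtain r where r: "strict_mono r" and AEr: "AE x in M. (\<lambda>n. \<Sum>k. t (r n) k x) \<longlonglongrightarrow> 0"
    using tendsto_L1_AE_subseq[of M "\<lambda>n x. \<Sum>k. t n k x"] ES(2) by auto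
  have "AE x in M. \<forall>i. (\<lambda>n. a (r n) i x) \<longlonglongrightarrow> 0"
    using AEr
  proof eventually_elim
    case (elim x)
    show ?case
    proof
      fix i :: 'i
      have le: "\<bar>a n i x\<bar> \<le> 2 ^ to_nat i * (\<Sum>k. t n k x)" for n
      proof -
        have "t n (to_nat i) x = sum (\<lambda>k. t n k x) {to_nat i}" by simp
        also have "\<dots> \<le> (\<Sum>k. t n k x)" using tb by (intro sum_le_suminf sm) auto
        finally have "(1/2)^(to_nat i) * \<bar>a n i x\<bar> \<le> (\<Sum>k. t n k x)" by (simp add: t_def)
        then show ?thesis by (simp add: field_simps power_one_over)
      qed
      have "(\<lambda>n. 2 ^ to_nat i * (\<Sum>k. t (r n) k x)) \<longlonglongrightarrow> 2 ^ to_nat i * 0"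
        by (intro tendsto_mult_left elim)
      then show "(\<lambda>n. a (r n) i x) \<longlonglongrightarrow> 0"
        using le by (intro Lim_null_comparison[of "\<lambda>n. a (r n) i x" "\<lambda>n. 2 ^ to_nat i * (\<Sum>k. t (r n) k x)"]) (auto intro: always_eventually)
    qed
  qed
  with r show ?thesis by blast
qed

text \<open>Along a subsequence all point masses converge almost surely, hence so does
  \<open>f (u n)\<close> by continuity, and in mean by boundedness. Since every subsequence has such
  a further subsequence with the same limit 0, the full sequence converges.\<close>

lemma L1_convergence_bdd_continuous:
  fixes u :: "nat \<Rightarrow> 'a \<Rightarrow> 'e::countable measure"
  assumes u[measurable]: "\<And>n. u n \<in> M \<rightarrow>\<^sub>M borel_of PE" and a[measurable]: "a \<in> M \<rightarrow>\<^sub>M borel_of PE"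
    and lim: "\<And>i. (\<lambda>n. expectation (\<lambda>x. \<bar>measure (u n x) {i} - measure (a x) {i}\<bar>)) \<longlonglongrightarrow> 0"
    and f: "f \<in> bdd_continuous PE"
  shows "(\<lambda>n. expectation (\<lambda>x. \<bar>f (u n x) - f (a x)\<bar>)) \<longlonglongrightarrow> 0"
proof (rule tendsto_subseqI)
  fix r :: "nat \<Rightarrow> nat" assume r: "strict_mono r"
  have P: "u n x \<in> prob_measures (discrete_topology UNIV)" "a x \<in> prob_measures (discrete_topology UNIV)" if "x \<in> space M" for n x
    using measurable_space[OF u that] measurable_space[OF a that] by (simp_all add: space_borel_of)
  \<comment> \<open>The value 0 off the space makes the bound by 1 hold at all points, as
    \<open>AE_subseq_countable\<close> demands.\<close>
  let ?a = "\<lambda>n i x. if x \<in> space M then measure (u (r n) x) {i} - measure (a x) {i} else 0"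
  have "\<exists>s. strict_mono s \<and> (AE x in M. \<forall>i. (\<lambda>n. ?a (s n) i x) \<longlonglongrightarrow> 0)"
  proof (rule AE_subseq_countable)
    show "?a n i \<in> borel_measurable M" for n i
      by (rule measurable_If_set) auto
    show "\<bar>?a n i x\<bar> \<le> 1" for n i x
    proof (cases "x \<in> space M")
      case True
      have "0 \<le> measure (u (r n) x) {i}" "measure (u (r n) x) {i} \<le> 1" "0 \<le> measure (a x) {i}" "measure (a x) {i} \<le> 1"
        using P(1)[OF True, of "r n"] P(2)[OF True] by (auto simp: prob_measures_discrete prob_space.prob_le_1)
      then have "\<bar>measure (u (r n) x) {i} - measure (a x) {i}\<bar> \<le> 1" by linarith
      then show ?thesis using True by simp
    qed simp
    have "expectation (\<lambda>x. \<bar>?a n i x\<bar>) = expectation (\<lambda>x. \<bar>measure (u (r n) x) {i} - measure (a x) {i}\<bar>)" for n i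
      by (intro Bochner_Integration.integral_cong) auto
    then show "(\<lambda>n. expectation (\<lambda>x. \<bar>?a n i x\<bar>)) \<longlonglongrightarrow> 0" for i
      using LIMSEQ_subseq_LIMSEQ[OF lim[of i] r] by (simp add: comp_def)
  qed
  then obtain s where s: "strict_mono s" and AEs: "AE x in M. \<forall>i. (\<lambda>n. ?a (s n) i x) \<longlonglongrightarrow> 0" by blast
  have fm[measurable]: "f \<in> borel_measurable (borel_of PE)" using f by (rule bdd_continuous_measurable)
  obtain B where B: "B > 0" "\<And>x. x \<in> topspace PE \<Longrightarrow> \<bar>f x\<bar> \<le> B" using bdd_continuous_bound[OF f] by blast
  have "(\<lambda>n. expectation (\<lambda>x. \<bar>f (u (r (s n)) x) - f (a x)\<bar>)) \<longlonglongrightarrow> expectation (\<lambda>x. 0)"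
  proof (rule integral_dominated_convergence[where w="\<lambda>_. 2 * B"])
    show "AE x in M. (\<lambda>n. \<bar>f (u (r (s n)) x) - f (a x)\<bar>) \<longlonglongrightarrow> 0"
      using AEs AE_space
    proof eventually_elim
      case (elim x)
      have "(\<lambda>n. f (u (r (s n)) x)) \<longlonglongrightarrow> f (a x)"
      proof (rule bdd_continuous_PE_sequentially[OF f])
        show "(\<lambda>n. measure (u (r (s n)) x) {i}) \<longlonglongrightarrow> measure (a x) {i}" for i
          using elim by (auto intro: LIM_zero_cancel)
      qed (use P elim in auto)
      then show ?case by (intro tendsto_rabs_zero LIM_zero)
    qed
    show "AE x in M. norm \<bar>f (u (r (s n)) x) - f (a x)\<bar> \<le> 2 * B" for n
    proof (rule AE_I2)
      fix x assume x: "x \<in> space M"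
      have "\<bar>f (u (r (s n)) x)\<bar> \<le> B" "\<bar>f (a x)\<bar> \<le> B" using P[OF x] B(2) by auto
      then show "norm \<bar>f (u (r (s n)) x) - f (a x)\<bar> \<le> 2 * B" by auto
    qed
  qed auto
  then show "\<exists>s. strict_mono s \<and> (\<lambda>n. expectation (\<lambda>x. \<bar>f (u (r (s n)) x) - f (a x)\<bar>)) \<longlonglongrightarrow> 0"
    using s by auto
qed

end

section \<open>Scaling, single filter steps and their continuity\<close>

lemma nrm_cmult:
  assumes "c \<noteq> 0" "c < \<infinity>"
  shows "nrm (\<lambda>i. c * v i) = nrm v"
proof -
  have "row_mass (\<lambda>i. c * v i) = c * row_mass v" by (rule row_mass_cmult)
  moreover have "c * row_mass v = 0 \<longleftrightarrow> row_mass v = 0" using assms by simp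
  moreover have "c * row_mass v = \<infinity> \<longleftrightarrow> row_mass v = \<infinity>"
    using assms by (auto simp: ennreal_mult_eq_top_iff)
  moreover have "normalized (\<lambda>i. c * v i) = normalized v" if "row_mass v \<noteq> 0" "row_mass v \<noteq> \<infinity>"
  proof -
    have "c * v i / (c * row_mass v) = v i / row_mass v" for i
      using that assms divide_mult_eq[of c "v i" "row_mass v"] by (simp add: less_top mult.commute)
    then show ?thesis unfolding normalized_def calculation(1) by simp
  qed
  ultimately show ?thesis by (simp add: nrm_def)
qed

text \<open>In the degenerate cases \<open>filter_step\<close> returns \<open>\<mu>\<close>, whereas
  this depends on the unnormalized row alone. The two agree as soon as the mass is neither 0 nor
  infinite.\<close>

definition fstep :: "('f \<Rightarrow> 'e::countable \<Rightarrow> 'e \<Rightarrow> real) \<Rightarrow> 'e measure \<Rightarrow> 'f \<Rightarrow> 'e measure" where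
  "fstep M \<mu> y = nrm (row_mult (row_of \<mu>) (M y))"

lemma filter_step_eq_fstep:
  "row_mass (row_mult (row_of \<mu>) (M y)) \<noteq> 0 \<Longrightarrow> row_mass (row_mult (row_of \<mu>) (M y)) \<noteq> \<infinity> \<Longrightarrow> filter_step M \<mu> y = fstep M \<mu> y"
  by (simp add: filter_step_def fstep_def nrm_def Let_def)

lemma row_of_nrm:
  assumes "row_mass v < \<infinity>"
  shows "v = (\<lambda>i. row_mass v * row_of (nrm v) i)"
  using nrm_coord[OF assms] row_of_eq_measure[OF nrm_prob[of v]] by (auto simp: fun_eq_iff mult.commute)

lemma row_mult_cmult: "row_mult (\<lambda>i. c * v i) A j = c * row_mult v A j"
  by (simp add: row_mult_def nn_integral_cmult mult.assoc)

lemma fstep_nrm: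
  assumes "row_mass v \<noteq> 0" "row_mass v < \<infinity>"
  shows "fstep M (nrm v) y = nrm (row_mult v (M y))"
proof -
  have "row_mult v (M y) = (\<lambda>j. row_mass v * row_mult (row_of (nrm v)) (M y) j)"
    by (subst row_of_nrm[OF assms(2)]) (auto simp: row_mult_cmult)
  then show ?thesis unfolding fstep_def by (simp only: nrm_cmult[OF assms])
qed

lemma nn_integral_PE:
  fixes \<mu> :: "'e::countable measure"
  assumes "\<mu> \<in> prob_measures (discrete_topology UNIV)"
  shows "(\<integral>\<^sup>+i. row_of \<mu> i * g i \<partial>count_space UNIV) = (\<integral>\<^sup>+i. g i \<partial>\<mu>)"
proof -
  have "(\<integral>\<^sup>+i. g i \<partial>\<mu>) = (\<integral>\<^sup>+i. g i \<partial>density (count_space UNIV) (\<lambda>i. ennreal (measure \<mu> {i})))"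
    using prob_density_eq[OF assms] by simp
  also have "\<dots> = (\<integral>\<^sup>+i. ennreal (measure \<mu> {i}) * g i \<partial>count_space UNIV)"
    by (subst nn_integral_density) auto
  finally show ?thesis by (simp add: row_of_eq_measure[OF assms])
qed

lemma integral_PE_bounded:
  fixes \<mu> :: "'e::countable measure"
  assumes \<mu>: "\<mu> \<in> prob_measures (discrete_topology UNIV)" and g: "\<And>i. 0 \<le> g i" "\<And>i. g i \<le> B"
  shows "(\<integral>\<^sup>+i. row_of \<mu> i * ennreal (g i) \<partial>count_space UNIV) = ennreal (\<integral>i. g i \<partial>\<mu>)"
proof -
  from \<mu> interpret prob_space \<mu> by (simp add: prob_measures_discrete)
  have "g \<in> borel_measurable \<mu>" using \<mu> by (simp add: prob_measures_discrete measurable_def)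
  then have "integrable \<mu> g" using g by (intro integrable_const_bound[of _ B]) auto
  then show ?thesis unfolding nn_integral_PE[OF \<mu>] using g by (intro nn_integral_eq_integral) auto
qed

text \<open>Numerator and mass are integrals with respect to the starting measure of the functions
  \<open>\<lambda>i. M y i j\<close> and of the row sums. Bounded row sums make both functions
  bounded, so both integrals are weakly continuous, and so is their ratio where the mass of the
  limit is positive.\<close>

lemma fstep_continuous:
  fixes u :: "nat \<Rightarrow> 'e::countable measure"
  assumes u: "\<And>n. u n \<in> prob_measures (discrete_topology UNIV)" and a: "a \<in> prob_measures (discrete_topology UNIV)"
    and lim: "\<And>i. (\<lambda>n. measure (u n) {i}) \<longlonglongrightarrow> measure a {i}"
    and nonneg: "\<And>i j. 0 \<le> M y i j"
    and bound: "(SUP i. \<integral>\<^sup>+j. ennreal (M y i j) \<partial>count_space UNIV) < \<infinity>"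
    and pos: "row_mass (row_mult (row_of a) (M y)) \<noteq> 0"
  shows "(\<lambda>n. measure (fstep M (u n) y) {j}) \<longlonglongrightarrow> measure (fstep M a y) {j}"
proof -
  let ?s = "\<lambda>i. \<integral>\<^sup>+j. ennreal (M y i j) \<partial>count_space UNIV"
  define B where "B = enn2real (SUP i. ?s i)"
  define s where "s i = enn2real (?s i)" for i
  have sB: "?s i \<le> ennreal B" for i
    unfolding B_def using bound by (subst ennreal_enn2real) (auto simp: less_top intro: SUP_upper)
  then have s_eq: "?s i = ennreal (s i)" for i
    unfolding s_def by (metis ennreal_enn2real ennreal_less_top order_le_less_trans)
  have B0: "0 \<le> B" by (simp add: B_def)
  have s0: "0 \<le> s i" "s i \<le> B" for i
    unfolding s_def using enn2real_mono[OF sB] B0 by auto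
  have Mle: "M y i j \<le> B" for i j
  proof -
    have "ennreal (M y i j) \<le> ?s i" by (rule nn_integral_ge_point) simp
    then have "ennreal (M y i j) \<le> ennreal B" using sB order_trans by blast
    then show ?thesis using B0 by simp
  qed
  have mult: "row_mult (row_of \<mu>) (M y) j = ennreal (\<integral>i. M y i j \<partial>\<mu>)"
    if "\<mu> \<in> prob_measures (discrete_topology UNIV)" for \<mu> j
    unfolding row_mult_def using nonneg Mle by (intro integral_PE_bounded[OF that]) auto
  have mass: "row_mass (row_mult (row_of \<mu>) (M y)) = ennreal (\<integral>i. s i \<partial>\<mu>)"
    if "\<mu> \<in> prob_measures (discrete_topology UNIV)" for \<mu>
    unfolding row_mass_row_mult s_eq using s0 by (intro integral_PE_bounded[OF that]) auto
  have coord: "measure (fstep M \<mu> y) {j} = (\<integral>i. M y i j \<partial>\<mu>) / (\<integral>i. s i \<partial>\<mu>)"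
    if \<mu>: "\<mu> \<in> prob_measures (discrete_topology UNIV)" and p: "(\<integral>i. s i \<partial>\<mu>) > 0" for \<mu>
  proof -
    let ?v = "row_mult (row_of \<mu>) (M y)"
    have "ennreal (measure (nrm ?v) {j}) * ennreal (\<integral>i. s i \<partial>\<mu>) = ennreal (\<integral>i. M y i j \<partial>\<mu>)"
      using nrm_coord[of ?v j] by (simp add: mass[OF \<mu>] mult[OF \<mu>])
    then have "ennreal (measure (nrm ?v) {j} * (\<integral>i. s i \<partial>\<mu>)) = ennreal (\<integral>i. M y i j \<partial>\<mu>)"
      using p by (simp add: ennreal_mult)
    moreover have "0 \<le> (\<integral>i. M y i j \<partial>\<mu>)" using nonneg by (intro Bochner_Integration.integral_nonneg) auto
    ultimately have "measure (nrm ?v) {j} * (\<integral>i. s i \<partial>\<mu>) = (\<integral>i. M y i j \<partial>\<mu>)"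
      using p by (subst (asm) ennreal_inj) auto
    then show ?thesis using p by (simp add: fstep_def field_simps)
  qed
  have sa: "(\<integral>i. s i \<partial>a) > 0" using pos by (simp add: mass[OF a] ennreal_eq_0_iff)
  have l1: "(\<lambda>n. \<integral>i. s i \<partial>u n) \<longlonglongrightarrow> (\<integral>i. s i \<partial>a)"
    by (rule weak_conv_PE[OF u a lim]) (use s0 in \<open>auto simp: bounded_iff intro!: exI[of _ B]\<close>)
  have l2: "(\<lambda>n. \<integral>i. M y i j \<partial>u n) \<longlonglongrightarrow> (\<integral>i. M y i j \<partial>a)"
    by (rule weak_conv_PE[OF u a lim]) (use nonneg Mle in \<open>auto simp: bounded_iff intro!: exI[of _ B]\<close>)
  have "(\<lambda>n. (\<integral>i. M y i j \<partial>u n) / (\<integral>i. s i \<partial>u n)) \<longlonglongrightarrow> (\<integral>i. M y i j \<partial>a) / (\<integral>i. s i \<partial>a)"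
    using l1 l2 sa by (intro tendsto_divide) auto
  moreover have "\<forall>\<^sub>F n in sequentially. (\<integral>i. M y i j \<partial>u n) / (\<integral>i. s i \<partial>u n) = measure (fstep M (u n) y) {j}"
    using order_tendstoD(1)[OF l1 sa] by eventually_elim (simp add: coord u)
  ultimately show ?thesis unfolding coord[OF a sa] by (rule Lim_transform_eventually)
qed

section \<open>The filter recursion and invariant laws\<close>

declare split_paired_All [simp del] split_paired_Ex [simp del]

context hidden_markov_model begin

text \<open>What \<open>\<pi>min\<close> and \<open>\<pi>max\<close> have in common. The inclusion
  in \<open>sigma_XY 0 0\<close> lets events of \<open>K\<close> serve as past events in
  \<open>path_formula\<close>.\<close>

definition filter_version :: "('e, 'f) path measure \<Rightarrow> (('e, 'f) path \<Rightarrow> 'e measure) \<Rightarrow> bool" where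
  "filter_version K \<pi> \<longleftrightarrow> subalgebra Pr K \<and> sets K \<subseteq> sets (sigma_XY 0 0) \<and> \<pi> \<in> K \<rightarrow>\<^sub>M borel_of PE \<and>
     (\<forall>i. cond_prob_version Pr K {\<omega>. coord_X 0 \<omega> = i} (\<lambda>\<omega>. measure (\<pi> \<omega>) {i}))"

lemma filter_version_min: "is_pi_min Pr 0 \<pi> \<Longrightarrow> filter_version (sigma_Y 0) \<pi>"
proof -
  assume p: "is_pi_min Pr 0 \<pi>"
  then have "\<pi> \<in> sigma_Y 0 \<rightarrow>\<^sub>M borel_of PE"
    using measurable_cong_sets[OF refl sets_borel_of_PE] by (auto simp: is_pi_min_def regular_cond_distr_def)
  then show ?thesis
    using p regular_cond_distr_version[OF subalgebra_Y] sigma_Y_subset_XY[of 0 0 0]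
    by (simp add: filter_version_def subalgebra_Y is_pi_min_def)
qed

lemma filter_version_max: "is_pi_max Pr 0 \<pi> \<Longrightarrow> filter_version (sigma_tail_XY 0) \<pi>"
proof -
  assume p: "is_pi_max Pr 0 \<pi>"
  then have "\<pi> \<in> sigma_tail_XY 0 \<rightarrow>\<^sub>M borel_of PE"
    using measurable_cong_sets[OF refl sets_borel_of_PE] by (auto simp: is_pi_max_def regular_cond_distr_def)
  then show ?thesis
    using p regular_cond_distr_version[OF subalgebra_tail] sigma_tail_subset[of 0]
    by (simp add: filter_version_def subalgebra_tail is_pi_max_def)
qed

lemma filter_version_prob:
  assumes "filter_version K \<pi>"
  shows "\<pi> \<omega> \<in> prob_measures (discrete_topology UNIV)"
proof -
  have "\<pi> \<in> K \<rightarrow>\<^sub>M borel_of PE" "space K = UNIV"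
    using assms by (auto simp: filter_version_def subalgebra_def)
  from measurable_space[OF this(1), of \<omega>] this(2) show ?thesis by (simp add: space_borel_of)
qed

lemma filter_version_measurable:
  assumes "filter_version K \<pi>"
  shows "\<pi> \<in> path_space \<rightarrow>\<^sub>M borel_of PE"
proof -
  have "\<pi> \<in> Pr \<rightarrow>\<^sub>M borel_of PE"
    using assms by (auto simp: filter_version_def intro: measurable_from_subalg)
  then show ?thesis using measurable_cong_sets[OF sets_Pr refl] by blast
qed

lemma sigma_finite_phiN: "sigma_finite_measure (phiN n)"
  using product_sigma_finite.sigma_finite[OF product_sigma_finite_phi] by simp

text \<open>The row vector of a past event is the mean of the filter over that event; through this
  the filter itself enters the density of future observations.\<close>

lemma filter_version_mass:
  assumes fv: "filter_version K \<pi>" and Z: "Z \<in> sets K"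
  shows "emeasure Pr (Z \<inter> {\<omega>. coord_X 0 \<omega> = i}) = (\<integral>\<^sup>+\<omega>. indicator Z \<omega> * row_of (\<pi> \<omega>) i \<partial>Pr)"
proof -
  let ?T = "{\<omega>. coord_X 0 \<omega> = i}"
  have K: "subalgebra Pr K" and v: "cond_prob_version Pr K ?T (\<lambda>\<omega>. measure (\<pi> \<omega>) {i})"
    using fv by (auto simp: filter_version_def)
  have Zm[measurable]: "Z \<in> sets Pr" using Z K by (auto simp: subalgebra_def)
  have [measurable]: "(\<lambda>\<omega>. measure (\<pi> \<omega>) {i}) \<in> borel_measurable Pr"
    using v measurable_from_subalg[OF K] by (auto simp: cond_prob_version_def)
  have b: "0 \<le> measure (\<pi> \<omega>) {i} \<and> measure (\<pi> \<omega>) {i} \<le> 1" for \<omega> using v by (auto simp: cond_prob_version_def)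
  have "(\<integral>\<^sup>+\<omega>. indicator Z \<omega> * row_of (\<pi> \<omega>) i \<partial>Pr) = (\<integral>\<^sup>+\<omega>. ennreal (measure (\<pi> \<omega>) {i} * indicator Z \<omega>) \<partial>Pr)"
    by (intro nn_integral_cong) (auto simp: row_of_eq_measure[OF filter_version_prob[OF fv]] indicator_def)
  also have "\<dots> = ennreal (\<integral>\<omega>. measure (\<pi> \<omega>) {i} * indicator Z \<omega> \<partial>Pr)"
    using b by (intro nn_integral_eq_integral integrable_unit_interval) (auto simp: indicator_def)
  also have "(\<integral>\<omega>. measure (\<pi> \<omega>) {i} * indicator Z \<omega> \<partial>Pr) = measure Pr (?T \<inter> Z)"
    using v Z by (auto simp: cond_prob_version_def)
  finally show ?thesis by (simp add: emeasure_eq_measure Int_commute)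
qed

text \<open>Given \<open>K\<close>, the next \<open>n\<close> observations have the mass of the
  filter times the matrices as density. On a rectangle \<open>Z \<times> A\<close> the row vector of
  \<open>Z\<close> is the mean of the filter over \<open>Z\<close>, and the mass is linear in the
  row; rectangles determine the joint law.\<close>

lemma filter_path_law:
  assumes fv: "filter_version K \<pi>" and k: "k \<in> borel_measurable (K \<Otimes>\<^sub>M PiM {1..n} (\<lambda>_. borel))"
  shows "(\<integral>\<^sup>+\<omega>. k (\<omega>, yw 0 n \<omega>) \<partial>Pr) =
    (\<integral>\<^sup>+\<omega>. (\<integral>\<^sup>+y. k (\<omega>, y) * row_mass (row_prod M y n (row_of (\<pi> \<omega>))) \<partial>phiN n) \<partial>Pr)"
proof -
  let ?N = "PiM {1..n} (\<lambda>_. borel) :: (nat \<Rightarrow> 'f) measure"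
  let ?KN = "K \<Otimes>\<^sub>M ?N"
  interpret S: sigma_finite_measure "phiN n" by (rule sigma_finite_phiN)
  have K: "subalgebra Pr K" and K0: "sets K \<subseteq> sets (sigma_XY 0 0)" and \<pi>K[measurable]: "\<pi> \<in> K \<rightarrow>\<^sub>M borel_of PE"
    using fv by (auto simp: filter_version_def)
  have spK: "space K = UNIV" using K by (simp add: subalgebra_def)
  have idK[measurable]: "(\<lambda>\<omega>. \<omega>) \<in> Pr \<rightarrow>\<^sub>M K" using K by (auto simp: measurable_def subalgebra_def)
  let ?m = "\<lambda>x. row_mass (row_prod M (snd x) n (row_of (\<pi> (fst x))))"
  have mm[measurable]: "?m \<in> borel_measurable ?KN"
  proof (rule row_mass_row_prod_measurable)
    show "(\<lambda>x. row_of (\<pi> (fst x)) i) \<in> borel_measurable ?KN" for i by measurable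
    show "(\<lambda>x. snd x k) \<in> ?KN \<rightarrow>\<^sub>M borel" if "1 \<le> k" "k \<le> n" for k
      by (rule measurable_compose[OF measurable_snd measurable_component_singleton]) (use that in auto)
  qed
  let ?D = "distr Pr K (\<lambda>\<omega>. \<omega>) \<Otimes>\<^sub>M phiN n"
  have sD[measurable_cong]: "sets ?D = sets ?KN"
    by (rule sets_pair_measure_cong) (simp_all only: sets_distr sets_phiN)
  let ?P = "distr Pr ?KN (\<lambda>\<omega>. (\<omega>, yw 0 n \<omega>))"
  let ?Q = "density ?D ?m"
  have P: "emeasure ?P (Z \<times> A) = (\<integral>\<^sup>+\<omega>. indicator Z \<omega> * (\<integral>\<^sup>+y. indicator A y * ?m (\<omega>, y) \<partial>phiN n) \<partial>Pr)"
    if Z: "Z \<in> sets K" and A[measurable]: "A \<in> sets ?N" for Z A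
  proof -
    have ZP[measurable]: "Z \<in> sets Pr" using Z K by (auto simp: subalgebra_def)
    let ?\<rho> = "\<lambda>i. emeasure Pr (Z \<inter> {\<omega>. coord_X 0 \<omega> = i})"
    let ?I = "\<lambda>k. \<integral>\<^sup>+y. indicator A y * row_mass (row_prod M y n (unit_row k)) \<partial>phiN n"
    have ms: "row_mass (row_prod M y n v) = (\<integral>\<^sup>+k. v k * row_mass (row_prod M y n (unit_row k)) \<partial>count_space UNIV)" for y v
      by (rule row_mass_sum) (rule row_prod_sum)
    have int_ms: "(\<integral>\<^sup>+y. indicator A y * row_mass (row_prod M y n v) \<partial>phiN n) = (\<integral>\<^sup>+k. v k * ?I k \<partial>count_space UNIV)" for v
    proof -
      have "(\<integral>\<^sup>+y. indicator A y * row_mass (row_prod M y n v) \<partial>phiN n)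
        = (\<integral>\<^sup>+y. (\<integral>\<^sup>+k. v k * (indicator A y * row_mass (row_prod M y n (unit_row k))) \<partial>count_space UNIV) \<partial>phiN n)"
        by (subst ms) (simp add: nn_integral_cmult[symmetric] mult_ac)
      also have "\<dots> = (\<integral>\<^sup>+k. (\<integral>\<^sup>+y. v k * (indicator A y * row_mass (row_prod M y n (unit_row k))) \<partial>phiN n) \<partial>count_space UNIV)"
        by (rule nn_integral_count_space_nn_integral) auto
      also have "\<dots> = (\<integral>\<^sup>+k. v k * ?I k \<partial>count_space UNIV)"
        by (intro nn_integral_cong nn_integral_cmult) measurable
      finally show ?thesis .
    qed
    have "emeasure ?P (Z \<times> A) = emeasure Pr ((\<lambda>\<omega>. (\<omega>, yw 0 n \<omega>)) -` (Z \<times> A))"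
      using Z A by (subst emeasure_distr) auto
    also have "\<dots> = (\<integral>\<^sup>+\<omega>. indicator ((\<lambda>\<omega>. (\<omega>, yw 0 n \<omega>)) -` (Z \<times> A)) \<omega> \<partial>Pr)"
    proof (rule nn_integral_indicator[symmetric])
      have "(\<lambda>\<omega>. (\<omega>, yw 0 n \<omega>)) \<in> Pr \<rightarrow>\<^sub>M ?KN" by measurable
      from measurable_sets[OF this, of "Z \<times> A"] Z A
      show "(\<lambda>\<omega>. (\<omega>, yw 0 n \<omega>)) -` (Z \<times> A) \<in> sets Pr" by simp
    qed
    also have "\<dots> = (\<integral>\<^sup>+\<omega>. indicator Z \<omega> * indicator A (yw 0 n \<omega>) \<partial>Pr)"
      by (intro nn_integral_cong) (auto simp: indicator_def)
    also have "\<dots> = (\<integral>\<^sup>+y. indicator A y * row_mass (row_prod M y n ?\<rho>) \<partial>phiN n)"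
      using Z K0 by (intro path_formula_mass) auto
    also have "\<dots> = (\<integral>\<^sup>+k. ?\<rho> k * ?I k \<partial>count_space UNIV)" by (rule int_ms)
    also have "\<dots> = (\<integral>\<^sup>+k. (\<integral>\<^sup>+\<omega>. indicator Z \<omega> * row_of (\<pi> \<omega>) k * ?I k \<partial>Pr) \<partial>count_space UNIV)"
    proof (intro nn_integral_cong)
      fix k
      have [measurable]: "(\<lambda>\<omega>. row_of (\<pi> \<omega>) k) \<in> borel_measurable Pr"
        using measurable_compose[OF measurable_from_subalg[OF K \<pi>K] row_of_measurable] .
      show "?\<rho> k * ?I k = (\<integral>\<^sup>+\<omega>. indicator Z \<omega> * row_of (\<pi> \<omega>) k * ?I k \<partial>Pr)"
        unfolding filter_version_mass[OF fv Z] by (subst nn_integral_multc) auto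
    qed
    also have "\<dots> = (\<integral>\<^sup>+\<omega>. (\<integral>\<^sup>+k. indicator Z \<omega> * row_of (\<pi> \<omega>) k * ?I k \<partial>count_space UNIV) \<partial>Pr)"
    proof (rule nn_integral_count_space_nn_integral[symmetric])
      fix k
      have [measurable]: "(\<lambda>\<omega>. row_of (\<pi> \<omega>) k) \<in> borel_measurable Pr"
        using measurable_compose[OF measurable_from_subalg[OF K \<pi>K] row_of_measurable] .
      show "(\<lambda>\<omega>. indicator Z \<omega> * row_of (\<pi> \<omega>) k * ?I k) \<in> borel_measurable Pr" by measurable
    qed auto
    also have "\<dots> = (\<integral>\<^sup>+\<omega>. indicator Z \<omega> * (\<integral>\<^sup>+y. indicator A y * ?m (\<omega>, y) \<partial>phiN n) \<partial>Pr)"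
    proof (rule nn_integral_cong)
      fix \<omega>
      have "(\<integral>\<^sup>+y. indicator A y * ?m (\<omega>, y) \<partial>phiN n) = (\<integral>\<^sup>+k. row_of (\<pi> \<omega>) k * ?I k \<partial>count_space UNIV)"
        using int_ms[of "row_of (\<pi> \<omega>)"] by (simp only: fst_conv snd_conv)
      then show "(\<integral>\<^sup>+k. indicator Z \<omega> * row_of (\<pi> \<omega>) k * ?I k \<partial>count_space UNIV) = indicator Z \<omega> * (\<integral>\<^sup>+y. indicator A y * ?m (\<omega>, y) \<partial>phiN n)"
        by (simp only: mult.assoc) (rule nn_integral_cmult, simp)
    qed
    finally show ?thesis .
  qed
  have "?P = ?Q"
  proof (rule measure_eqI_generator_eq[where E="{a \<times> b | a b. a \<in> sets K \<and> b \<in> sets ?N}" and \<Omega>="UNIV \<times> space ?N" and A="\<lambda>_. UNIV \<times> space ?N"])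
    show "Int_stable {a \<times> b | a b. a \<in> sets K \<and> b \<in> sets ?N}" by (rule Int_stable_pair_measure_generator)
    show "{a \<times> b | a b. a \<in> sets K \<and> b \<in> sets ?N} \<subseteq> Pow (UNIV \<times> space ?N)"
      using sets.sets_into_space[of _ ?N] by blast
    show "sets ?P = sigma_sets (UNIV \<times> space ?N) {a \<times> b | a b. a \<in> sets K \<and> b \<in> sets ?N}"
      using sets_pair_measure[of K ?N] by (simp add: spK)
    show "sets ?Q = sigma_sets (UNIV \<times> space ?N) {a \<times> b | a b. a \<in> sets K \<and> b \<in> sets ?N}"
      using sets_pair_measure[of K ?N] sD by (simp add: spK)
    have "UNIV \<in> sets K" using sets.top[of K] spK by simp
    then show "range (\<lambda>_. UNIV \<times> space ?N) \<subseteq> {a \<times> b | a b. a \<in> sets K \<and> b \<in> sets ?N}" by blast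
    have "prob_space ?P" by (rule prob_space_distr) measurable
    then show "emeasure ?P (UNIV \<times> space ?N) \<noteq> \<infinity>"
      using finite_measure.emeasure_finite[of ?P] by (simp add: prob_space_def)
    fix X assume "X \<in> {a \<times> b | a b. a \<in> sets K \<and> b \<in> sets ?N}"
    then obtain Z A where X: "X = Z \<times> A" and Z[measurable]: "Z \<in> sets K" and A[measurable]: "A \<in> sets ?N" by blast
    have X': "X \<in> sets ?KN" unfolding X by measurable
    have "emeasure ?Q X = (\<integral>\<^sup>+x. ?m x * indicator X x \<partial>?D)"
      using X' by (subst emeasure_density) (auto simp: sD)
    also have "\<dots> = (\<integral>\<^sup>+\<omega>. (\<integral>\<^sup>+y. ?m (\<omega>, y) * indicator X (\<omega>, y) \<partial>phiN n) \<partial>distr Pr K (\<lambda>\<omega>. \<omega>))"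
      using X' by (intro S.nn_integral_fst[symmetric]) simp
    also have "\<dots> = (\<integral>\<^sup>+\<omega>. (\<integral>\<^sup>+y. ?m (\<omega>, y) * indicator X (\<omega>, y) \<partial>phiN n) \<partial>Pr)"
    proof (rule nn_integral_distr[OF idK])
      have "(\<lambda>x. ?m x * indicator X x) \<in> borel_measurable (K \<Otimes>\<^sub>M phiN n)"
        using X' by (subst measurable_cong_sets[OF sets_pair_measure_cong[OF refl sets_phiN] refl]) simp
      from S.borel_measurable_nn_integral_fst[OF this]
      show "(\<lambda>\<omega>. \<integral>\<^sup>+y. ?m (\<omega>, y) * indicator X (\<omega>, y) \<partial>phiN n) \<in> borel_measurable (distr Pr K (\<lambda>\<omega>. \<omega>))" by simp
    qed
    also have "\<dots> = (\<integral>\<^sup>+\<omega>. indicator Z \<omega> * (\<integral>\<^sup>+y. indicator A y * ?m (\<omega>, y) \<partial>phiN n) \<partial>Pr)"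
    proof (rule nn_integral_cong)
      fix \<omega>
      show "(\<integral>\<^sup>+y. ?m (\<omega>, y) * indicator X (\<omega>, y) \<partial>phiN n) = indicator Z \<omega> * (\<integral>\<^sup>+y. indicator A y * ?m (\<omega>, y) \<partial>phiN n)"
        by (cases "\<omega> \<in> Z") (simp_all add: X indicator_times mult.commute)
    qed
    finally show "emeasure ?P X = emeasure ?Q X" unfolding X P[OF Z A] by simp
  qed simp
  have "(\<integral>\<^sup>+\<omega>. k (\<omega>, yw 0 n \<omega>) \<partial>Pr) = (\<integral>\<^sup>+x. k x \<partial>?P)"
    using k by (subst nn_integral_distr) auto
  also have "\<dots> = (\<integral>\<^sup>+x. ?m x * k x \<partial>?D)"
    unfolding \<open>?P = ?Q\<close> using k by (subst nn_integral_density) (auto simp: measurable_cong_sets[OF sD refl])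
  also have "\<dots> = (\<integral>\<^sup>+\<omega>. (\<integral>\<^sup>+y. ?m (\<omega>, y) * k (\<omega>, y) \<partial>phiN n) \<partial>distr Pr K (\<lambda>\<omega>. \<omega>))"
    using k by (intro S.nn_integral_fst[symmetric]) (auto simp: measurable_cong_sets[OF sD refl])
  also have "\<dots> = (\<integral>\<^sup>+\<omega>. (\<integral>\<^sup>+y. ?m (\<omega>, y) * k (\<omega>, y) \<partial>phiN n) \<partial>Pr)"
  proof (rule nn_integral_distr[OF idK])
    have "(\<lambda>x. ?m x * k x) \<in> borel_measurable (K \<Otimes>\<^sub>M phiN n)"
      using k by (subst measurable_cong_sets[OF sets_pair_measure_cong[OF refl sets_phiN] refl]) simp
    from S.borel_measurable_nn_integral_fst[OF this]
    show "(\<lambda>\<omega>. \<integral>\<^sup>+y. ?m (\<omega>, y) * k (\<omega>, y) \<partial>phiN n) \<in> borel_measurable (distr Pr K (\<lambda>\<omega>. \<omega>))" by simp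
  qed
  finally show ?thesis by (simp add: mult.commute)
qed

lemma nn_integral_phiN_0: "(\<integral>\<^sup>+y. f y \<partial>phiN 0) = f (\<lambda>_. undefined)"
  using product_sigma_finite.nn_integral_empty[OF product_sigma_finite_phi, of f] by simp

lemma nn_integral_phiN_1:
  assumes f: "f \<in> borel_measurable borel"
  shows "(\<integral>\<^sup>+y. f (y (Suc 0)) \<partial>phiN (Suc 0)) = (\<integral>\<^sup>+z. f z \<partial>\<phi>)"
proof -
  have "(\<lambda>y. f (y (Suc 0))) \<in> borel_measurable (PiM {1..Suc 0} (\<lambda>_. borel))"
    by (rule measurable_compose[OF _ f], rule measurable_component_singleton) simp
  from nn_integral_phiN_Suc[OF this] show ?thesis unfolding nn_integral_phiN_0 by simp
qed

lemma filter_step_law: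
  assumes fv: "filter_version K \<pi>" and g: "g \<in> borel_measurable (K \<Otimes>\<^sub>M borel)"
  shows "(\<integral>\<^sup>+\<omega>. g (\<omega>, coord_Y 1 \<omega>) \<partial>Pr) = (\<integral>\<^sup>+\<omega>. (\<integral>\<^sup>+y. g (\<omega>, y) * row_mass (row_mult (row_of (\<pi> \<omega>)) (M y)) \<partial>\<phi>) \<partial>Pr)"
proof -
  let ?N = "PiM {1..Suc 0} (\<lambda>_. borel) :: (nat \<Rightarrow> 'f) measure"
  have y1: "yw 0 (Suc 0) \<omega> (Suc 0) = coord_Y 1 \<omega>" for \<omega> :: "('e, 'f) path" by (simp add: yw_def)
  have c: "(\<lambda>x. (fst x, snd x (Suc 0))) \<in> K \<Otimes>\<^sub>M ?N \<rightarrow>\<^sub>M K \<Otimes>\<^sub>M borel"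
    by (intro measurable_Pair measurable_fst measurable_compose[OF measurable_snd measurable_component_singleton]) simp
  have "(\<lambda>x. g (fst x, snd x (Suc 0))) \<in> borel_measurable (K \<Otimes>\<^sub>M ?N)"
    by (rule measurable_compose[OF c g])
  from filter_path_law[OF fv this]
  have "(\<integral>\<^sup>+\<omega>. g (\<omega>, coord_Y 1 \<omega>) \<partial>Pr) = (\<integral>\<^sup>+\<omega>. (\<integral>\<^sup>+y. g (\<omega>, y (Suc 0)) * row_mass (row_mult (row_of (\<pi> \<omega>)) (M (y (Suc 0)))) \<partial>phiN (Suc 0)) \<partial>Pr)"
    by (simp add: y1)
  also have "\<dots> = (\<integral>\<^sup>+\<omega>. (\<integral>\<^sup>+y. g (\<omega>, y) * row_mass (row_mult (row_of (\<pi> \<omega>)) (M y)) \<partial>\<phi>) \<partial>Pr)"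
  proof (intro nn_integral_cong)
    fix \<omega> :: "('e, 'f) path"
    have "space K = UNIV" using fv by (auto simp: filter_version_def subalgebra_def)
    then have "Pair \<omega> \<in> borel \<rightarrow>\<^sub>M K \<Otimes>\<^sub>M borel" by (intro measurable_Pair1') simp
    from measurable_compose[OF this g]
    have [measurable]: "(\<lambda>y. g (\<omega>, y)) \<in> borel_measurable borel" .
    show "(\<integral>\<^sup>+y. g (\<omega>, y (Suc 0)) * row_mass (row_mult (row_of (\<pi> \<omega>)) (M (y (Suc 0)))) \<partial>phiN (Suc 0)) =
      (\<integral>\<^sup>+y. g (\<omega>, y) * row_mass (row_mult (row_of (\<pi> \<omega>)) (M y)) \<partial>\<phi>)"
      by (rule nn_integral_phiN_1) measurable
  qed
  finally show ?thesis .
qed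

text \<open>The law of every observation is absolutely continuous with respect to
  \<open>\<phi>\<close>, by one Markov step. This transfers the bound on the row sums to the
  observed matrices.\<close>

lemma AE_phi_coord_Y:
  assumes "AE y in \<phi>. P y"
  shows "AE \<omega> in Pr. P (coord_Y m \<omega>)"
proof -
  obtain A where A: "A \<in> sets borel" "emeasure \<phi> A = 0" "{y. \<not> P y} \<subseteq> A"
    using assms unfolding eventually_ae_filter null_sets_def sets_phi space_phi by auto
  have "emeasure Pr (coord_Y m -` A) = 0"
  proof -
    let ?N = "\<lambda>j. UNIV \<inter> {\<omega> :: ('e, 'f) path. coord_X ((m - 1) + 1) \<omega> = j \<and> coord_Y ((m - 1) + 1) \<omega> \<in> A}"
    have "?N j \<in> null_sets Pr" for j
    proof (rule null_setsI)
      have "UNIV \<in> sets (sigma_XY (m-1) (m-1) :: ('e, 'f) path measure)"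
        using sets.top[of "sigma_XY (m-1) (m-1) :: ('e, 'f) path measure"] by simp
      from markov_step[OF this A(1)]
      have "emeasure Pr (?N j) = (\<integral>\<^sup>+l. emeasure Pr (UNIV \<inter> {\<omega>. coord_X (m-1) \<omega> = l}) * (\<integral>\<^sup>+y. indicator A y * ennreal (M y l j) \<partial>\<phi>) \<partial>count_space UNIV)" .
      moreover have "(\<integral>\<^sup>+y. indicator A y * ennreal (M y l j) \<partial>\<phi>) = 0" for l
      proof -
        have "AE y in \<phi>. y \<notin> A" using A by (intro AE_not_in) (auto simp: null_sets_def sets_phi)
        then have "(\<integral>\<^sup>+y. indicator A y * ennreal (M y l j) \<partial>\<phi>) = (\<integral>\<^sup>+y. 0 \<partial>\<phi>)"
          by (intro nn_integral_cong_AE) (auto elim!: eventually_mono simp: indicator_def)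
        then show ?thesis by simp
      qed
      ultimately show "emeasure Pr (?N j) = 0" by simp
      have "{\<omega>\<in>space path_space. coord_X ((m-1)+1) \<omega> = j \<and> coord_Y ((m-1)+1) \<omega> \<in> A} \<in> sets path_space"
        using A(1) by measurable
      then show "?N j \<in> sets Pr" by (simp add: sets_Pr)
    qed
    then have "(\<Union>j. ?N j) \<in> null_sets Pr" by (intro null_sets_UN') auto
    moreover have "(\<Union>j. ?N j) = coord_Y m -` A" by auto
    ultimately have "coord_Y m -` A \<in> null_sets Pr" by (simp only:)
    then show ?thesis by auto
  qed
  moreover have "coord_Y m -` A \<in> sets Pr" using measurable_sets[OF coord_Y_Pr A(1), of m] by simp
  ultimately have "coord_Y m -` A \<in> null_sets Pr" by auto
  then show ?thesis by (rule AE_I') (use A in auto)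
qed

section \<open>Nondegenerate masses and the filter recursion\<close>

lemma AE_row_bound: "AE \<omega> in Pr. (SUP i. \<integral>\<^sup>+j. ennreal (M (coord_Y m \<omega>) i j) \<partial>count_space UNIV) < \<infinity>"
  by (rule AE_phi_coord_Y[OF M_row_bound])

text \<open>The next observation is drawn with this very mass as density with respect to
  \<open>\<phi>\<close>, so it avoids the zeros of the density and the null set where it is
  infinite.\<close>

lemma AE_filter_mass:
  assumes fv: "filter_version K \<pi>"
  shows "AE \<omega> in Pr. row_mass (row_mult (row_of (\<pi> \<omega>)) (M (coord_Y 1 \<omega>))) \<noteq> 0 \<and> row_mass (row_mult (row_of (\<pi> \<omega>)) (M (coord_Y 1 \<omega>))) \<noteq> \<infinity>"
proof -
  let ?m = "\<lambda>(\<omega>, y). row_mass (row_mult (row_of (\<pi> \<omega>)) (M y))"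
  have [measurable]: "\<pi> \<in> K \<rightarrow>\<^sub>M borel_of PE" using fv by (simp add: filter_version_def)
  have mm: "?m \<in> borel_measurable (K \<Otimes>\<^sub>M borel)"
  proof -
    have c: "(\<lambda>x. (\<pi> (fst x), snd x)) \<in> K \<Otimes>\<^sub>M borel \<rightarrow>\<^sub>M borel_of PE \<Otimes>\<^sub>M borel" by measurable
    show ?thesis using measurable_compose[OF c joint_measurable(2)] by (simp add: case_prod_beta)
  qed
  have \<pi>P[measurable]: "\<pi> \<in> Pr \<rightarrow>\<^sub>M borel_of PE" using filter_version_measurable[OF fv] by simp
  have mP[measurable]: "(\<lambda>\<omega>. row_mass (row_mult (row_of (\<pi> \<omega>)) (M (coord_Y 1 \<omega>)))) \<in> borel_measurable Pr"
  proof -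
    have c: "(\<lambda>\<omega>. (\<pi> \<omega>, coord_Y 1 \<omega>)) \<in> Pr \<rightarrow>\<^sub>M borel_of PE \<Otimes>\<^sub>M borel" by measurable
    show ?thesis using measurable_compose[OF c joint_measurable(2)] by simp
  qed
  \<comment> \<open>The indicator of the degenerate values, multiplied by the mass, vanishes at mass
    0, and mass infinity occurs only on a null set of \<open>\<phi>\<close>.\<close>
  let ?g = "\<lambda>x. indicator {0, \<infinity>} (?m x) :: ennreal"
  have gm: "?g \<in> borel_measurable (K \<Otimes>\<^sub>M borel)"
    by (rule measurable_compose[OF mm]) simp
  have "(\<integral>\<^sup>+\<omega>. ?g (\<omega>, coord_Y 1 \<omega>) \<partial>Pr) = (\<integral>\<^sup>+\<omega>. (\<integral>\<^sup>+y. ?g (\<omega>, y) * row_mass (row_mult (row_of (\<pi> \<omega>)) (M y)) \<partial>\<phi>) \<partial>Pr)"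
    by (rule filter_step_law[OF fv gm])
  also have "\<dots> = (\<integral>\<^sup>+\<omega>. 0 \<partial>Pr)"
  proof (intro nn_integral_cong)
    fix \<omega> :: "('e, 'f) path"
    have "(\<integral>\<^sup>+y. ?g (\<omega>, y) * row_mass (row_mult (row_of (\<pi> \<omega>)) (M y)) \<partial>\<phi>) = (\<integral>\<^sup>+y. 0 \<partial>\<phi>)"
      using AE_row_mass_finite[OF filter_version_prob[OF fv, of \<omega>]]
      by (intro nn_integral_cong_AE) (auto elim!: eventually_mono simp: indicator_def)
    then show "(\<integral>\<^sup>+y. ?g (\<omega>, y) * row_mass (row_mult (row_of (\<pi> \<omega>)) (M y)) \<partial>\<phi>) = 0" by simp
  qed
  finally have "(\<integral>\<^sup>+\<omega>. ?g (\<omega>, coord_Y 1 \<omega>) \<partial>Pr) = 0" by simp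
  moreover have "(\<lambda>\<omega>. ?g (\<omega>, coord_Y 1 \<omega>)) \<in> borel_measurable Pr"
    unfolding prod.case by (rule measurable_compose[OF mP]) simp
  ultimately have "AE \<omega> in Pr. ?g (\<omega>, coord_Y 1 \<omega>) = 0" by (simp add: nn_integral_0_iff_AE)
  then show ?thesis by (auto elim!: eventually_mono simp: indicator_def split: if_splits)
qed

text \<open>For the shifted path the longer window still starts at the original time
  \<open>- int n\<close> but ends at time 1: the start is unchanged and one observation is
  appended.\<close>

lemma wfilter_Suc:
  assumes "row_mass (row_prod M (yw (- int n) n \<omega>) n v) \<noteq> 0" "row_mass (row_prod M (yw (- int n) n \<omega>) n v) < \<infinity>"
  shows "wfilter (Suc n) v (sh 1 \<omega>) = fstep M (wfilter n v \<omega>) (coord_Y 1 \<omega>)"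
proof -
  have "yw (- int (Suc n)) (Suc n) (sh 1 \<omega>) = yw (- int n) (Suc n) \<omega>" by simp
  moreover have "row_prod M (yw (- int n) (Suc n) \<omega>) n v = row_prod M (yw (- int n) n \<omega>) n v"
    by (rule row_prod_cong) (simp add: yw_def)
  moreover have "yw (- int n) (Suc n) \<omega> (Suc n) = coord_Y 1 \<omega>" by (simp add: yw_def)
  ultimately show ?thesis using fstep_nrm[OF assms, of M "coord_Y 1 \<omega>"] by (simp add: wfilter_def)
qed

text \<open>Nondegeneracy for the two kinds of window filters at once: \<open>B\<close> is the whole
  space with \<open>v = lam\<close>, or the event that the signal starts the window in
  \<open>k\<close> with \<open>v = unit_row k\<close>; the constant \<open>c\<close> is then 1 or
  \<open>lam k\<close>.\<close>

lemma AE_wfilter_mass: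
  assumes B: "B \<in> sets (sigma_XY (- int n) (- int n))" and v: "\<And>i. emeasure Pr (B \<inter> {\<omega>. coord_X (- int n) \<omega> = i}) = c * v i"
    and c: "c \<noteq> 0" "c < \<infinity>" and fin: "row_mass v < \<infinity>"
  shows "AE \<omega> in Pr. \<omega> \<in> B \<longrightarrow> row_mass (row_prod M (yw (- int n) n \<omega>) n v) \<noteq> 0 \<and> row_mass (row_prod M (yw (- int n) n \<omega>) n v) < \<infinity>"
proof -
  let ?m = "\<lambda>y. row_mass (row_prod M y n v)"
  let ?h = "\<lambda>y. indicator {0, \<infinity>} (?m y) :: ennreal"
  have [measurable]: "B \<in> sets Pr" using B subalgebra_XY by (auto simp: subalgebra_def)
  have hm[measurable]: "?h \<in> borel_measurable (PiM {1..n} (\<lambda>_. borel))"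
    by (rule measurable_compose[OF row_mass_row_prod_phiN]) simp
  have "row_mass (row_prod M y n (\<lambda>i. emeasure Pr (B \<inter> {\<omega>. coord_X (- int n) \<omega> = i}))) = c * ?m y" for y
  proof -
    have "row_prod M y n (\<lambda>i. c * v i) = (\<lambda>j. c * row_prod M y n v j)" by (rule ext) (rule row_prod_cmult)
    then show ?thesis unfolding v by (simp only: row_mass_cmult)
  qed
  then have "(\<integral>\<^sup>+\<omega>. indicator B \<omega> * ?h (yw (- int n) n \<omega>) \<partial>Pr) = (\<integral>\<^sup>+y. ?h y * (c * ?m y) \<partial>phiN n)"
    using path_formula_mass[OF B hm] by simp
  also have "\<dots> = (\<integral>\<^sup>+y. 0 \<partial>phiN n)"
    using AE_row_prod_finite[OF fin, of n] by (intro nn_integral_cong_AE) (auto elim!: eventually_mono simp: indicator_def)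
  finally have 0: "(\<integral>\<^sup>+\<omega>. indicator B \<omega> * ?h (yw (- int n) n \<omega>) \<partial>Pr) = 0" by simp
  have "AE \<omega> in Pr. indicator B \<omega> * ?h (yw (- int n) n \<omega>) = 0"
    using 0 by (subst (asm) nn_integral_0_iff_AE) measurable
  then show ?thesis by (auto elim!: eventually_mono simp: indicator_def less_top split: if_splits)
qed

lemma AE_wfilter_lam_Suc: "AE \<omega> in Pr. wfilter (Suc n) lam (sh 1 \<omega>) = fstep M (wfilter n lam \<omega>) (coord_Y 1 \<omega>)"
proof -
  have U: "UNIV \<in> sets (sigma_XY (- int n) (- int n) :: ('e, 'f) path measure)"
    using sets.top[of "sigma_XY (- int n) (- int n) :: ('e, 'f) path measure"] by simp
  have "AE \<omega> in Pr. \<omega> \<in> UNIV \<longrightarrow> row_mass (row_prod M (yw (- int n) n \<omega>) n lam) \<noteq> 0 \<and> row_mass (row_prod M (yw (- int n) n \<omega>) n lam) < \<infinity>"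
    by (rule AE_wfilter_mass[OF U, where c=1]) (auto simp: emeasure_coord_X)
  then show ?thesis by eventually_elim (auto intro!: wfilter_Suc)
qed

text \<open>There are countably many starting states, so nondegeneracy may be shown separately on
  each event that fixes the state at time \<open>- int n\<close>.\<close>

lemma AE_wfilter_unit_Suc:
  "AE \<omega> in Pr. wfilter (Suc n) (unit_row (coord_X (- int n) \<omega>)) (sh 1 \<omega>) = fstep M (wfilter n (unit_row (coord_X (- int n) \<omega>)) \<omega>) (coord_Y 1 \<omega>)"
proof -
  have "AE \<omega> in Pr. \<omega> \<in> {\<omega>. coord_X (- int n) \<omega> = k} \<longrightarrow> row_mass (row_prod M (yw (- int n) n \<omega>) n (unit_row k)) \<noteq> 0 \<and> row_mass (row_prod M (yw (- int n) n \<omega>) n (unit_row k)) < \<infinity>" for k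
  proof (cases "lam k = 0")
    case True
    then have "{\<omega>. coord_X (- int n) \<omega> = k} \<in> null_sets Pr" by (auto simp: emeasure_coord_X)
    then have "AE \<omega> in Pr. \<omega> \<notin> {\<omega>. coord_X (- int n) \<omega> = k}" by (rule AE_not_in)
    then show ?thesis by eventually_elim simp
  next
    case False
    show ?thesis
    proof (rule AE_wfilter_mass[where c="lam k"])
      show "{\<omega>. coord_X (- int n) \<omega> = k} \<in> sets (sigma_XY (- int n) (- int n))" by (rule coord_X_eq_sigma_XY) simp
      show "emeasure Pr ({\<omega>. coord_X (- int n) \<omega> = k} \<inter> {\<omega>. coord_X (- int n) \<omega> = i}) = lam k * unit_row k i" for i
      proof (cases "i = k")
        case False
        then have e: "{\<omega> :: ('e, 'f) path. coord_X (- int n) \<omega> = k} \<inter> {\<omega>. coord_X (- int n) \<omega> = i} = {}" by auto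
        show ?thesis unfolding e using False by (simp add: unit_row_def)
      qed (simp add: unit_row_def emeasure_coord_X)
      show "lam k \<noteq> 0" "lam k < \<infinity>" using False by (auto simp: lam_def less_top[symmetric])
    qed simp
  qed
  then have "AE \<omega> in Pr. \<forall>k. \<omega> \<in> {\<omega>. coord_X (- int n) \<omega> = k} \<longrightarrow> row_mass (row_prod M (yw (- int n) n \<omega>) n (unit_row k)) \<noteq> 0 \<and> row_mass (row_prod M (yw (- int n) n \<omega>) n (unit_row k)) < \<infinity>"
    unfolding AE_all_countable by blast
  then show ?thesis by eventually_elim (auto intro!: wfilter_Suc)
qed

text \<open>The recursion passes to the limit along a subsequence of window filters that converges almost surely.\<close>
lemma filter_recursion:
  assumes fv: "filter_version K \<pi>"
    and um[measurable]: "\<And>n. u n \<in> path_space \<rightarrow>\<^sub>M borel_of PE"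
    and L1: "\<And>i. (\<lambda>n. \<integral>\<omega>. \<bar>measure (u n \<omega>) {i} - measure (\<pi> \<omega>) {i}\<bar> \<partial>Pr) \<longlonglongrightarrow> 0"
    and step: "\<And>n. AE \<omega> in Pr. u (Suc n) (sh 1 \<omega>) = fstep M (u n \<omega>) (coord_Y 1 \<omega>)"
  shows "AE \<omega> in Pr. \<pi> (sh 1 \<omega>) = fstep M (\<pi> \<omega>) (coord_Y 1 \<omega>)"
proof -
  note [measurable] = filter_version_measurable[OF fv]
  have P: "\<pi> \<omega> \<in> prob_measures (discrete_topology UNIV)" "u n \<omega> \<in> prob_measures (discrete_topology UNIV)" for n \<omega>
    using filter_version_prob[OF fv] measurable_space[OF um[of n], of \<omega>] by (auto simp: space_borel_of)
  have m01: "\<bar>measure (u n \<omega>) {i} - measure (\<pi> \<omega>) {i}\<bar> \<le> 1" for \<omega> i n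
  proof -
    have "measure (u n \<omega>) {i} \<le> 1" "measure (\<pi> \<omega>) {i} \<le> 1"
      using P(1)[of \<omega>] P(2)[of n \<omega>] by (auto simp: prob_measures_discrete prob_space.prob_le_1)
    moreover have "0 \<le> measure (u n \<omega>) {i}" "0 \<le> measure (\<pi> \<omega>) {i}" by simp_all
    ultimately show ?thesis by linarith
  qed
  \<comment> \<open>The Boolean selects time 0 or time 1, so that a single subsequence serves both
    sides of the recursion. By stationarity the family at time 1 has the means of the family at time
    0 with the index advanced by one.\<close>
  let ?a = "\<lambda>n (i, b) \<omega>. if b then measure (u n \<omega>) {i} - measure (\<pi> \<omega>) {i}
     else measure (u (Suc n) (sh 1 \<omega>)) {i} - measure (\<pi> (sh 1 \<omega>)) {i}"
  have "\<exists>r. strict_mono r \<and> (AE \<omega> in Pr. \<forall>ib :: 'e \<times> bool. (\<lambda>n. ?a (r n) ib \<omega>) \<longlonglongrightarrow> 0)"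
  proof (rule AE_subseq_countable)
    show "?a n ib \<in> borel_measurable Pr" for n and ib :: "'e \<times> bool"
      by (cases ib) (cases "snd ib", simp_all)
    show "\<bar>?a n ib \<omega>\<bar> \<le> 1" for n and ib :: "'e \<times> bool" and \<omega>
      using m01 by (simp add: case_prod_beta)
    fix ib :: "'e \<times> bool"
    show "(\<lambda>n. expectation (\<lambda>\<omega>. \<bar>?a n ib \<omega>\<bar>)) \<longlonglongrightarrow> 0"
    proof (cases "snd ib")
      case True
      then show ?thesis using L1[of "fst ib"] by (simp add: case_prod_beta)
    next
      case False
      have "expectation (\<lambda>\<omega>. \<bar>measure (u (Suc n) (sh 1 \<omega>)) {fst ib} - measure (\<pi> (sh 1 \<omega>)) {fst ib}\<bar>)
        = expectation (\<lambda>\<omega>. \<bar>measure (u (Suc n) \<omega>) {fst ib} - measure (\<pi> \<omega>) {fst ib}\<bar>)" for n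
        by (rule integral_sh[of "\<lambda>\<omega>. \<bar>measure (u (Suc n) \<omega>) {fst ib} - measure (\<pi> \<omega>) {fst ib}\<bar>"]) measurable
      then show ?thesis using False LIMSEQ_Suc[OF L1[of "fst ib"]] by (simp add: case_prod_beta)
    qed
  qed
  then obtain r where r: "strict_mono r" and AEr: "AE \<omega> in Pr. \<forall>ib :: 'e \<times> bool. (\<lambda>n. ?a (r n) ib \<omega>) \<longlonglongrightarrow> 0" by blast
  have "AE \<omega> in Pr. \<forall>n. u (Suc n) (sh 1 \<omega>) = fstep M (u n \<omega>) (coord_Y 1 \<omega>)"
    using step by (simp add: AE_all_countable)
  with AEr AE_filter_mass[OF fv] AE_row_bound[of 1] show ?thesis
  proof eventually_elim
    case (elim \<omega>)
    have l1: "(\<lambda>n. measure (u (r n) \<omega>) {i}) \<longlonglongrightarrow> measure (\<pi> \<omega>) {i}" for i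
      using elim(1)[rule_format, of "(i, True)"] by (simp add: LIM_zero_iff)
    have l2: "(\<lambda>n. measure (u (Suc (r n)) (sh 1 \<omega>)) {i}) \<longlonglongrightarrow> measure (\<pi> (sh 1 \<omega>)) {i}" for i
      using elim(1)[rule_format, of "(i, False)"] by (simp add: LIM_zero_iff)
    have l3: "(\<lambda>n. measure (fstep M (u (r n) \<omega>) (coord_Y 1 \<omega>)) {i}) \<longlonglongrightarrow> measure (fstep M (\<pi> \<omega>) (coord_Y 1 \<omega>)) {i}" for i
      by (rule fstep_continuous) (use P l1 elim M_nonneg in auto)
    have "measure (\<pi> (sh 1 \<omega>)) {i} = measure (fstep M (\<pi> \<omega>) (coord_Y 1 \<omega>)) {i}" for i
      using LIMSEQ_unique[OF l2[of i]] l3[of i] elim by simp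
    then show ?case by (intro PE_measure_eqI) (use P in \<open>auto simp: fstep_def nrm_prob\<close>)
  qed
qed

lemma wfilter_measurable: "(\<And>i. (\<lambda>\<omega>. v \<omega> i) \<in> borel_measurable path_space) \<Longrightarrow> (\<lambda>\<omega>. wfilter n (v \<omega>) \<omega>) \<in> path_space \<rightarrow>\<^sub>M borel_of PE"
  by (rule wfilter_measurable') auto

lemma pi_min_recursion:
  assumes "is_pi_min Pr 0 \<pi>"
  shows "AE \<omega> in Pr. \<pi> (sh 1 \<omega>) = fstep M (\<pi> \<omega>) (coord_Y 1 \<omega>)"
  by (rule filter_recursion[OF filter_version_min[OF assms] wfilter_measurable wfilter_lam_L1[OF assms] AE_wfilter_lam_Suc]) simp

lemma pi_max_recursion:
  assumes "is_pi_max Pr 0 \<pi>"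
  shows "AE \<omega> in Pr. \<pi> (sh 1 \<omega>) = fstep M (\<pi> \<omega>) (coord_Y 1 \<omega>)"
proof (rule filter_recursion[OF filter_version_max[OF assms] _ wfilter_unit_L1[OF assms]])
  show "(\<lambda>\<omega>. wfilter n (unit_row (coord_X (- int n) \<omega>)) \<omega>) \<in> path_space \<rightarrow>\<^sub>M borel_of PE" for n
    by (rule wfilter_measurable) simp
  \<comment> \<open>The state at time \<open>- int (Suc n)\<close> of the shifted path is the state
    at time \<open>- int n\<close> of the original one, so both filters start in the same
    state.\<close>
  show "AE \<omega> in Pr. wfilter (Suc n) (unit_row (coord_X (- int (Suc n)) (sh 1 \<omega>))) (sh 1 \<omega>) = fstep M (wfilter n (unit_row (coord_X (- int n) \<omega>)) \<omega>) (coord_Y 1 \<omega>)" for n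
    using AE_wfilter_unit_Suc[of n] by simp
qed

section \<open>Invariance of the filter laws\<close>

lemma emeasure_filter_kernel:
  assumes \<mu>: "\<mu> \<in> prob_measures (discrete_topology UNIV)" and A: "A \<in> sets (borel_of PE)"
  shows "emeasure (filter_kernel \<phi> M \<mu>) A = (\<integral>\<^sup>+y. indicator A (filter_step M \<mu> y) * row_mass (row_mult (row_of \<mu>) (M y)) \<partial>\<phi>)"
proof -
  note [measurable_cong] = sets_phi
  note filter_step_measurable[OF \<mu>, measurable]
  have "emeasure (filter_kernel \<phi> M \<mu>) A = emeasure (density \<phi> (\<lambda>y. row_mass (row_mult (row_of \<mu>) (M y)))) (filter_step M \<mu> -` A)"
    unfolding filter_kernel_def using A by (subst emeasure_distr) auto
  also have "\<dots> = (\<integral>\<^sup>+y. row_mass (row_mult (row_of \<mu>) (M y)) * indicator (filter_step M \<mu> -` A) y \<partial>\<phi>)"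
  proof (rule emeasure_density)
    show "filter_step M \<mu> -` A \<in> sets \<phi>"
      using measurable_sets[OF filter_step_measurable[OF \<mu>] A] by (simp add: sets_phi)
  qed measurable
  also have "\<dots> = (\<integral>\<^sup>+y. indicator A (filter_step M \<mu> y) * row_mass (row_mult (row_of \<mu>) (M y)) \<partial>\<phi>)"
    by (intro nn_integral_cong) (auto simp: indicator_def)
  finally show ?thesis .
qed

text \<open>By the recursion the filter at time 1 is a filter step from the filter at time 0, with
  an observation whose conditional density is the one in the kernel. By stationarity both times have
  the same law.\<close>

lemma filter_law_invariant:
  assumes fv: "filter_version K \<pi>" and rec: "AE \<omega> in Pr. \<pi> (sh 1 \<omega>) = fstep M (\<pi> \<omega>) (coord_Y 1 \<omega>)"
  shows "invariant_measure (filter_kernel \<phi> M) (distr Pr (borel_of PE) \<pi>)"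
proof -
  let ?MM = "distr Pr (borel_of PE) \<pi>"
  note \<pi>m[measurable] = filter_version_measurable[OF fv]
  have \<pi>K[measurable]: "\<pi> \<in> K \<rightarrow>\<^sub>M borel_of PE" using fv by (simp add: filter_version_def)
  have pr: "prob_space ?MM" by (rule prob_space_distr) simp
  have in_prob: "?MM \<in> prob_measures PE" using pr by (simp add: prob_measures_def)
  have alg: "?MM \<in> space (prob_algebra (borel_of PE))" using pr by (simp add: space_prob_algebra)
  have "?MM \<bind> filter_kernel \<phi> M = ?MM"
  proof (rule measure_eqI)
    show "sets (?MM \<bind> filter_kernel \<phi> M) = sets ?MM"
      using sets_bind'[OF alg filter_kernel_measurable] by simp
    fix A assume "A \<in> sets (?MM \<bind> filter_kernel \<phi> M)"
    then have A[measurable]: "A \<in> sets (borel_of PE)"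
      using sets_bind'[OF alg filter_kernel_measurable] by simp
    have gm: "(\<lambda>x. indicator A (filter_step M (\<pi> (fst x)) (snd x)) :: ennreal) \<in> borel_measurable (K \<Otimes>\<^sub>M borel)"
    proof -
      have c: "(\<lambda>x. (\<pi> (fst x), snd x)) \<in> K \<Otimes>\<^sub>M borel \<rightarrow>\<^sub>M borel_of PE \<Otimes>\<^sub>M borel" by measurable
      have "(\<lambda>x. filter_step M (\<pi> (fst x)) (snd x)) \<in> K \<Otimes>\<^sub>M borel \<rightarrow>\<^sub>M borel_of PE"
        using measurable_compose[OF c filter_step_measurable_joint] by simp
      then show ?thesis using A by measurable
    qed
    have km: "(\<lambda>\<mu>. emeasure (filter_kernel \<phi> M \<mu>) A) \<in> borel_measurable (borel_of PE)"
      using measurable_emeasure_subprob_algebra[OF A] measurable_prob_algebraD[OF filter_kernel_measurable]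
      by (rule measurable_compose[rotated])
    have "emeasure (?MM \<bind> filter_kernel \<phi> M) A = (\<integral>\<^sup>+\<mu>. emeasure (filter_kernel \<phi> M \<mu>) A \<partial>?MM)"
      by (rule emeasure_bind_prob_algebra[OF alg filter_kernel_measurable A])
    also have "\<dots> = (\<integral>\<^sup>+\<omega>. emeasure (filter_kernel \<phi> M (\<pi> \<omega>)) A \<partial>Pr)"
      using km by (subst nn_integral_distr) auto
    also have "\<dots> = (\<integral>\<^sup>+\<omega>. (\<integral>\<^sup>+y. indicator A (filter_step M (\<pi> \<omega>) y) * row_mass (row_mult (row_of (\<pi> \<omega>)) (M y)) \<partial>\<phi>) \<partial>Pr)"
      by (intro nn_integral_cong emeasure_filter_kernel filter_version_prob[OF fv] A)
    also have "\<dots> = (\<integral>\<^sup>+\<omega>. indicator A (filter_step M (\<pi> \<omega>) (coord_Y 1 \<omega>)) \<partial>Pr)"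
      using filter_step_law[OF fv gm] by simp
    also have "\<dots> = (\<integral>\<^sup>+\<omega>. indicator A (\<pi> (sh 1 \<omega>)) \<partial>Pr)"
      using rec AE_filter_mass[OF fv]
      by (intro nn_integral_cong_AE) (auto elim!: eventually_elim2 simp: filter_step_eq_fstep)
    also have "\<dots> = (\<integral>\<^sup>+\<omega>. indicator A (\<pi> \<omega>) \<partial>Pr)"
      by (rule nn_integral_sh[of "\<lambda>\<omega>. indicator A (\<pi> \<omega>)"]) measurable
    also have "\<dots> = (\<integral>\<^sup>+\<mu>. indicator A \<mu> \<partial>?MM)"
      by (subst nn_integral_distr) auto
    also have "\<dots> = emeasure ?MM A" by simp
    finally show "emeasure (?MM \<bind> filter_kernel \<phi> M) A = emeasure ?MM A" .
  qed
  then show ?thesis using in_prob by (simp add: invariant_measure_def)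
qed

text \<open>By Pythagoras the mean squared distance of the point masses is a difference of second
  moments, and these depend only on the laws of the two filters.\<close>

lemma pi_min_eq_pi_max_if_same_law:
  assumes min: "is_pi_min Pr 0 \<pi>min" and max: "is_pi_max Pr 0 \<pi>max"
    and law: "distr Pr (borel_of PE) \<pi>min = distr Pr (borel_of PE) \<pi>max"
  shows "AE \<omega> in Pr. \<pi>min \<omega> = \<pi>max \<omega>"
proof -
  note fmin = filter_version_min[OF min] and fmax = filter_version_max[OF max]
  note [measurable] = filter_version_measurable[OF fmin] filter_version_measurable[OF fmax]
  have c: "cond_prob_version Pr (sigma_Y 0) {\<omega>. coord_X 0 \<omega> = i} (\<lambda>\<omega>. measure (\<pi>min \<omega>) {i})"
    "cond_prob_version Pr (sigma_tail_XY 0) {\<omega>. coord_X 0 \<omega> = i} (\<lambda>\<omega>. measure (\<pi>max \<omega>) {i})" for i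
    using fmin fmax by (auto simp: filter_version_def)
  have b: "0 \<le> measure (\<pi>min \<omega>) {i}" "measure (\<pi>min \<omega>) {i} \<le> 1" "0 \<le> measure (\<pi>max \<omega>) {i}" "measure (\<pi>max \<omega>) {i} \<le> 1" for \<omega> i
    using c[of i] by (auto simp: cond_prob_version_def)
  have "AE \<omega> in Pr. measure (\<pi>min \<omega>) {i} = measure (\<pi>max \<omega>) {i}" for i
  proof -
    have sq: "expectation (\<lambda>\<omega>. (measure (\<pi> \<omega>) {i})\<^sup>2) = (\<integral>\<mu>. (measure \<mu> {i})\<^sup>2 \<partial>distr Pr (borel_of PE) \<pi>)"
      if [measurable]: "\<pi> \<in> path_space \<rightarrow>\<^sub>M borel_of PE" for \<pi>
      by (subst integral_distr) auto
    have "expectation (\<lambda>\<omega>. (measure (\<pi>min \<omega>) {i} - measure (\<pi>max \<omega>) {i})\<^sup>2) = 0"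
      using cond_prob_version_sq_dist[OF subalgebra_Y subalgebra_tail sigma_Y_subset_tail coord_X_eq_events c]
      by (simp add: sq law)
    moreover have "integrable Pr (\<lambda>\<omega>. (measure (\<pi>min \<omega>) {i} - measure (\<pi>max \<omega>) {i})\<^sup>2)"
    proof (rule integrable_unit_interval)
      fix \<omega>
      have "\<bar>measure (\<pi>min \<omega>) {i} - measure (\<pi>max \<omega>) {i}\<bar> \<le> 1" using b[of \<omega> i] by linarith
      then show "0 \<le> (measure (\<pi>min \<omega>) {i} - measure (\<pi>max \<omega>) {i})\<^sup>2 \<and> (measure (\<pi>min \<omega>) {i} - measure (\<pi>max \<omega>) {i})\<^sup>2 \<le> 1"
        by (simp add: abs_square_le_1)
    qed measurable
    ultimately have "AE \<omega> in Pr. (measure (\<pi>min \<omega>) {i} - measure (\<pi>max \<omega>) {i})\<^sup>2 = 0"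
      by (subst (asm) integral_nonneg_eq_0_iff_AE) auto
    then show ?thesis by eventually_elim simp
  qed
  then have "AE \<omega> in Pr. \<forall>i. measure (\<pi>min \<omega>) {i} = measure (\<pi>max \<omega>) {i}" by (simp add: AE_all_countable)
  then show ?thesis
    by eventually_elim (auto intro!: PE_measure_eqI filter_version_prob[OF fmin] filter_version_prob[OF fmax])
qed

end

section \<open>Condition (C) for countable observation spaces\<close>

lemma measure_set_measurable:
  "(\<lambda>\<mu>. measure \<mu> A) \<in> borel_measurable (borel_of (PE :: 'e::countable measure topology))"
proof -
  have "(\<lambda>\<mu>. measure \<mu> A) \<in> borel_measurable (prob_algebra (count_space (UNIV :: 'e set)))"
    unfolding prob_algebra_def by (intro measurable_restrict_space1) simp
  then show ?thesis using measurable_cong_sets[OF sets_borel_of_PE refl] by blast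
qed

lemma sum_measure_PE:
  fixes \<mu> :: "'e::countable measure"
  assumes \<mu>: "\<mu> \<in> prob_measures (discrete_topology UNIV)"
  shows "(\<integral>\<^sup>+i. ennreal (measure \<mu> {i}) \<partial>count_space UNIV) = 1"
  using row_mass_row_of[OF \<mu>] by (simp add: row_mass_def row_of_eq_measure[OF \<mu>])

lemma integrable_measure_PE:
  fixes \<mu> :: "'e::countable measure"
  assumes \<mu>: "\<mu> \<in> prob_measures (discrete_topology UNIV)"
  shows "integrable (count_space UNIV) (\<lambda>i. measure \<mu> {i})"
  using sum_measure_PE[OF \<mu>] by (intro integrableI_bounded) auto

lemma integral_PE_count_space:
  fixes \<mu> :: "'e::countable measure" and f :: "'e \<Rightarrow> real"
  assumes \<mu>: "\<mu> \<in> prob_measures (discrete_topology UNIV)"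
  shows "(\<integral>i. f i \<partial>\<mu>) = (\<integral>i. measure \<mu> {i} * f i \<partial>count_space UNIV)"
  by (subst prob_density_eq[OF \<mu>], subst integral_density) auto

text \<open>Total variation as a sum over states, with values in \<open>ennreal\<close> for use
  under nonnegative integrals.\<close>

definition l1_dist :: "'e::countable measure \<Rightarrow> 'e measure \<Rightarrow> ennreal" where
  "l1_dist \<mu> \<nu> = (\<integral>\<^sup>+i. ennreal \<bar>measure \<mu> {i} - measure \<nu> {i}\<bar> \<partial>count_space UNIV)"

lemma l1_dist_le_2:
  fixes \<mu> \<nu> :: "'e::countable measure"
  assumes "\<mu> \<in> prob_measures (discrete_topology UNIV)" "\<nu> \<in> prob_measures (discrete_topology UNIV)"
  shows "l1_dist \<mu> \<nu> \<le> 2"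
proof -
  have "l1_dist \<mu> \<nu> \<le> (\<integral>\<^sup>+i. (ennreal (measure \<mu> {i}) + ennreal (measure \<nu> {i})) \<partial>count_space UNIV)"
    unfolding l1_dist_def
  proof (rule nn_integral_mono)
    fix i
    have "\<bar>measure \<mu> {i} - measure \<nu> {i}\<bar> \<le> measure \<mu> {i} + measure \<nu> {i}"
      using measure_nonneg[of \<mu> "{i}"] measure_nonneg[of \<nu> "{i}"] by linarith
    then show "ennreal \<bar>measure \<mu> {i} - measure \<nu> {i}\<bar> \<le> ennreal (measure \<mu> {i}) + ennreal (measure \<nu> {i})"
      by (simp add: ennreal_plus[symmetric] del: ennreal_plus)
  qed
  also have "\<dots> = 2" by (simp add: nn_integral_add sum_measure_PE assms one_add_one)
  finally show ?thesis .
qed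

lemma tv_norm_set:
  fixes \<mu> :: "'e::countable measure"
  assumes "\<mu> \<in> prob_measures (discrete_topology UNIV)"
  shows "{f \<in> borel_measurable \<mu>. \<forall>x\<in>space \<mu>. \<bar>f x\<bar> \<le> 1} = {f :: 'e \<Rightarrow> real. \<forall>x. \<bar>f x\<bar> \<le> 1}"
proof -
  have s: "sets \<mu> = sets (count_space UNIV)" using assms by (simp add: prob_measures_discrete)
  then have "borel_measurable \<mu> = (UNIV :: ('e \<Rightarrow> real) set)"
    by (subst measurable_cong_sets[OF s refl]) (auto simp: measurable_count_space_eq1)
  then show ?thesis using sets_eq_imp_space_eq[OF s] by simp
qed

lemma abs_integral_PE_le_1:
  fixes \<mu> :: "'e::countable measure" and f :: "'e \<Rightarrow> real"
  assumes \<mu>: "\<mu> \<in> prob_measures (discrete_topology UNIV)" and f: "\<And>x. \<bar>f x\<bar> \<le> 1"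
  shows "\<bar>\<integral>x. f x \<partial>\<mu>\<bar> \<le> 1" "integrable \<mu> f"
proof -
  from \<mu> interpret prob_space \<mu> by (simp add: prob_measures_discrete)
  have "f \<in> borel_measurable \<mu>" using \<mu> by (simp add: prob_measures_discrete measurable_def)
  then show i: "integrable \<mu> f" using f by (intro integrable_const_bound[of _ 1]) auto
  have "\<bar>\<integral>x. f x \<partial>\<mu>\<bar> \<le> (\<integral>x. \<bar>f x\<bar> \<partial>\<mu>)" by (rule integral_abs_bound)
  also have "\<dots> \<le> (\<integral>x. 1 \<partial>\<mu>)" using i f by (intro integral_mono) auto
  finally show "\<bar>\<integral>x. f x \<partial>\<mu>\<bar> \<le> 1" by (simp add: prob_space)
qed

text \<open>The test function is the sign of the difference of the point masses.\<close>

lemma l1_dist_le_tv_norm: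
  fixes \<mu> \<nu> :: "'e::countable measure"
  assumes \<mu>: "\<mu> \<in> prob_measures (discrete_topology UNIV)" and \<nu>: "\<nu> \<in> prob_measures (discrete_topology UNIV)"
  shows "l1_dist \<mu> \<nu> \<le> ennreal (tv_norm \<mu> \<nu>)"
proof -
  let ?d = "\<lambda>i. measure \<mu> {i} - measure \<nu> {i}"
  let ?s = "\<lambda>i. if ?d i \<ge> 0 then 1 else -1 :: real"
  have i: "integrable (count_space UNIV) (\<lambda>i. measure \<mu> {i} * ?s i)" "integrable (count_space UNIV) (\<lambda>i. measure \<nu> {i} * ?s i)"
    using integrable_measure_PE[OF \<mu>] integrable_measure_PE[OF \<nu>]
    by (auto intro: Bochner_Integration.integrable_bound)
  have id: "integrable (count_space UNIV) (\<lambda>i. \<bar>?d i\<bar>)"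
    using integrable_measure_PE[OF \<mu>] integrable_measure_PE[OF \<nu>] by auto
  have "(\<integral>i. ?s i \<partial>\<mu>) - (\<integral>i. ?s i \<partial>\<nu>) = (\<integral>i. measure \<mu> {i} * ?s i - measure \<nu> {i} * ?s i \<partial>count_space UNIV)"
    unfolding integral_PE_count_space[OF \<mu>] integral_PE_count_space[OF \<nu>] using i by simp
  also have "\<dots> = (\<integral>i. \<bar>?d i\<bar> \<partial>count_space UNIV)"
    by (intro Bochner_Integration.integral_cong) auto
  finally have eq: "(\<integral>i. ?s i \<partial>\<mu>) - (\<integral>i. ?s i \<partial>\<nu>) = (\<integral>i. \<bar>?d i\<bar> \<partial>count_space UNIV)" .
  have "\<bar>(\<integral>i. ?s i \<partial>\<mu>) - (\<integral>i. ?s i \<partial>\<nu>)\<bar> \<le> tv_norm \<mu> \<nu>"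
    unfolding tv_norm_def tv_norm_set[OF \<mu>]
  proof (rule cSUP_upper)
    show "bdd_above ((\<lambda>f. \<bar>(\<integral>x. f x \<partial>\<mu>) - (\<integral>x. f x \<partial>\<nu>)\<bar>) ` {f :: 'e \<Rightarrow> real. \<forall>x. \<bar>f x\<bar> \<le> 1})"
    proof (rule bdd_aboveI2)
      fix f :: "'e \<Rightarrow> real" assume "f \<in> {f. \<forall>x. \<bar>f x\<bar> \<le> 1}"
      then have "\<bar>\<integral>x. f x \<partial>\<mu>\<bar> \<le> 1" "\<bar>\<integral>x. f x \<partial>\<nu>\<bar> \<le> 1" using abs_integral_PE_le_1 \<mu> \<nu> by blast+
      then show "\<bar>(\<integral>x. f x \<partial>\<mu>) - (\<integral>x. f x \<partial>\<nu>)\<bar> \<le> 2" by linarith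
    qed
  qed auto
  then have "(\<integral>i. \<bar>?d i\<bar> \<partial>count_space UNIV) \<le> tv_norm \<mu> \<nu>" unfolding eq by linarith
  moreover have "l1_dist \<mu> \<nu> = ennreal (\<integral>i. \<bar>?d i\<bar> \<partial>count_space UNIV)"
    unfolding l1_dist_def by (rule nn_integral_eq_integral[OF id]) simp
  ultimately show ?thesis by (simp add: ennreal_leI)
qed

text \<open>Finitely many masses and two tails control the total variation; hence countably many
  sets of small diameter cover the space of probability measures.\<close>

lemma tv_norm_le_finite_part:
  fixes \<mu> \<nu> :: "'e::countable measure"
  assumes \<mu>: "\<mu> \<in> prob_measures (discrete_topology UNIV)" and \<nu>: "\<nu> \<in> prob_measures (discrete_topology UNIV)"
    and J: "finite J"
  shows "tv_norm \<mu> \<nu> \<le> (\<Sum>j\<in>J. \<bar>measure \<mu> {j} - measure \<nu> {j}\<bar>) + measure \<mu> (- J) + measure \<nu> (- J)"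
  unfolding tv_norm_def tv_norm_set[OF \<mu>]
proof (rule cSUP_least)
  have "(\<lambda>_. 0) \<in> {f :: 'e \<Rightarrow> real. \<forall>x. \<bar>f x\<bar> \<le> 1}" by simp
  then show "{f :: 'e \<Rightarrow> real. \<forall>x. \<bar>f x\<bar> \<le> 1} \<noteq> {}" by (metis (no_types) empty_iff)
  fix f :: "'e \<Rightarrow> real" assume "f \<in> {f. \<forall>x. \<bar>f x\<bar> \<le> 1}"
  then have f: "\<And>x. \<bar>f x\<bar> \<le> 1" by simp
  have *: "\<bar>(\<integral>x. f x \<partial>\<kappa>) - (\<Sum>j\<in>J. f j * measure \<kappa> {j})\<bar> \<le> measure \<kappa> (- J)"
    if \<kappa>: "\<kappa> \<in> prob_measures (discrete_topology UNIV)" for \<kappa> :: "'e measure"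
  proof -
    from \<kappa> interpret prob_space \<kappa> by (simp add: prob_measures_discrete)
    have s: "sets \<kappa> = UNIV" using \<kappa> by (simp add: prob_measures_discrete)
    have sp: "space \<kappa> = UNIV" using s sets_eq_imp_space_eq[of \<kappa> "count_space UNIV"] by simp
    have m[measurable]: "g \<in> borel_measurable \<kappa>" for g :: "'e \<Rightarrow> real" using s by (simp add: measurable_def)
    have iA: "integrable \<kappa> (\<lambda>x. f x * indicator A x)" for A
      using f by (intro integrable_const_bound[of _ 1]) (auto simp: indicator_def)
    have "(\<integral>x. f x * indicator J x \<partial>\<kappa>) = (\<integral>x. (\<Sum>j\<in>J. f j * indicator {j} x) \<partial>\<kappa>)"
    proof (intro Bochner_Integration.integral_cong refl)
      fix x
      show "f x * indicator J x = (\<Sum>j\<in>J. f j * indicator {j} x)"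
      proof (cases "x \<in> J")
        case True
        then have "(\<Sum>j\<in>J. f j * indicator {j} x) = (\<Sum>j\<in>J. if x = j then f j else 0)"
          by (intro sum.cong) (auto simp: indicator_def)
        then show ?thesis using True J by simp
      next
        case False
        then have "(\<Sum>j\<in>J. f j * indicator {j} x) = (\<Sum>j\<in>J. 0)"
          by (intro sum.cong) (auto simp: indicator_def)
        then show ?thesis using False by simp
      qed
    qed
    also have "\<dots> = (\<Sum>j\<in>J. f j * measure \<kappa> {j})"
      by (subst Bochner_Integration.integral_sum) (auto simp: s emeasure_eq_measure)
    finally have J1: "(\<integral>x. f x * indicator J x \<partial>\<kappa>) = (\<Sum>j\<in>J. f j * measure \<kappa> {j})" .
    have "(\<integral>x. f x \<partial>\<kappa>) = (\<integral>x. f x * indicator J x + f x * indicator (- J) x \<partial>\<kappa>)"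
      by (intro Bochner_Integration.integral_cong) (auto simp: indicator_def)
    also have "\<dots> = (\<integral>x. f x * indicator J x \<partial>\<kappa>) + (\<integral>x. f x * indicator (- J) x \<partial>\<kappa>)"
      by (rule Bochner_Integration.integral_add) (rule iA)+
    finally have "(\<integral>x. f x \<partial>\<kappa>) - (\<Sum>j\<in>J. f j * measure \<kappa> {j}) = (\<integral>x. f x * indicator (- J) x \<partial>\<kappa>)"
      by (simp add: J1)
    moreover have "\<bar>\<integral>x. f x * indicator (- J) x \<partial>\<kappa>\<bar> \<le> (\<integral>x. indicator (- J) x \<partial>\<kappa>)"
    proof (rule order_trans[OF integral_abs_bound])
      show "(\<integral>x. \<bar>f x * indicator (- J) x\<bar> \<partial>\<kappa>) \<le> (\<integral>x. indicator (- J) x \<partial>\<kappa>)"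
      proof (rule integral_mono)
        show "integrable \<kappa> (\<lambda>x. \<bar>f x * indicator (- J) x\<bar>)" using iA[of "- J"] by simp
        show "integrable \<kappa> (\<lambda>x. indicat_real (- J) x)"
          by (intro integrable_const_bound[of _ 1]) (auto simp: indicator_def)
        show "\<bar>f x * indicator (- J) x\<bar> \<le> indicator (- J) x" for x using f[of x] by (auto simp: indicator_def)
      qed
    qed
    ultimately show ?thesis by (simp add: s sp)
  qed
  have "\<bar>(\<Sum>j\<in>J. f j * measure \<mu> {j}) - (\<Sum>j\<in>J. f j * measure \<nu> {j})\<bar> \<le> (\<Sum>j\<in>J. \<bar>measure \<mu> {j} - measure \<nu> {j}\<bar>)"
  proof -
    have "(\<Sum>j\<in>J. f j * measure \<mu> {j}) - (\<Sum>j\<in>J. f j * measure \<nu> {j}) = (\<Sum>j\<in>J. f j * (measure \<mu> {j} - measure \<nu> {j}))"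
      by (simp add: sum_subtractf right_diff_distrib)
    also have "\<bar>\<dots>\<bar> \<le> (\<Sum>j\<in>J. \<bar>f j * (measure \<mu> {j} - measure \<nu> {j})\<bar>)" by (rule sum_abs)
    also have "\<dots> \<le> (\<Sum>j\<in>J. \<bar>measure \<mu> {j} - measure \<nu> {j}\<bar>)"
      using f by (intro sum_mono) (simp add: abs_mult mult_left_le_one_le)
    finally show ?thesis .
  qed
  then show "\<bar>(\<integral>x. f x \<partial>\<mu>) - (\<integral>x. f x \<partial>\<nu>)\<bar> \<le> (\<Sum>j\<in>J. \<bar>measure \<mu> {j} - measure \<nu> {j}\<bar>) + measure \<mu> (- J) + measure \<nu> (- J)"
    using *[OF \<mu>] *[OF \<nu>] by linarith
qed

lemma PE_tail_small:
  fixes \<mu> :: "'e::countable measure"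
  assumes \<mu>: "\<mu> \<in> prob_measures (discrete_topology UNIV)" and e: "e > 0"
  shows "\<exists>n. measure \<mu> {j. n \<le> to_nat j} < e"
proof -
  from \<mu> interpret prob_space \<mu> by (simp add: prob_measures_discrete)
  have s: "sets \<mu> = UNIV" using \<mu> by (simp add: prob_measures_discrete)
  have "(\<lambda>n. measure \<mu> {j. n \<le> to_nat j}) \<longlonglongrightarrow> measure \<mu> (\<Inter>n. {j. n \<le> to_nat j})"
    by (rule finite_Lim_measure_decseq) (auto simp: s decseq_def)
  moreover have "(\<Inter>n. {j :: 'e. n \<le> to_nat j}) = {}"
  proof -
    have "\<exists>n. \<not> n \<le> to_nat j" for j :: 'e by (intro exI[of _ "Suc (to_nat j)"]) simp
    then show ?thesis by blast
  qed
  ultimately have "(\<lambda>n. measure \<mu> {j. n \<le> to_nat j}) \<longlonglongrightarrow> 0" by simp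
  from order_tendstoD(2)[OF this e] show ?thesis by (auto simp: eventually_sequentially)
qed

context hidden_markov_model begin

text \<open>
  For countable \<open>F\<close> a single observation \<open>y\<close> of positive probability suffices. The sets of the
  countable partition \<open>S\<close> have images of small diameter under the filter step with observation \<open>y\<close>,
  and one of them is charged by the common law of the two filters.
\<close>
lemma condition_C_if_countable:
  assumes min: "is_pi_min Pr 0 \<pi>min" and max: "is_pi_max Pr 0 \<pi>max"
    and eq: "AE \<omega> in Pr. \<pi>min \<omega> = \<pi>max \<omega>" and F: "countable (UNIV :: 'f set)"
  shows "condition_C \<phi> M Pr \<pi>min \<pi>max"
  unfolding condition_C_def
proof (intro allI impI)
  fix e :: real assume e: "e > 0"
  note fmin = filter_version_min[OF min] and fmax = filter_version_max[OF max]
  note [measurable] = filter_version_measurable[OF fmin] filter_version_measurable[OF fmax]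
  note P = filter_version_prob[OF fmin]
  let ?g = "\<lambda>y. row_mass (row_mult lam (M y))"
  \<comment> \<open>Otherwise the countable set where \<open>?g\<close> is positive would be null
    for \<open>\<phi>\<close>, although \<open>?g\<close> has integral 1.\<close>
  have "\<exists>y. emeasure \<phi> {y} \<noteq> 0 \<and> ?g y \<noteq> 0"
  proof (rule ccontr)
    assume *: "\<not> ?thesis"
    have "{y. ?g y \<noteq> 0} \<in> null_sets \<phi>"
    proof -
      have "(\<Union>y\<in>{y. ?g y \<noteq> 0}. {y}) \<in> null_sets \<phi>"
      proof (rule null_sets_UN')
        show "countable {y. ?g y \<noteq> 0}" by (rule countable_subset[OF subset_UNIV F])
        show "{y} \<in> null_sets \<phi>" if "y \<in> {y. ?g y \<noteq> 0}" for y using * that by (auto simp: null_sets_def sets_phi)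
      qed
      then show ?thesis by simp
    qed
    then have "AE y in \<phi>. ?g y = 0" by (intro AE_I'[of "{y. ?g y \<noteq> 0}"]) auto
    then have "(\<integral>\<^sup>+y. ?g y \<partial>\<phi>) = (\<integral>\<^sup>+y. 0 \<partial>\<phi>)" by (intro nn_integral_cong_AE) auto
    then show False by (simp add: nn_integral_row_mass_mult)
  qed
  then obtain y where y: "emeasure \<phi> {y} \<noteq> 0" "?g y \<noteq> 0" by blast
  have fin: "(SUP i. \<integral>\<^sup>+j. ennreal (M y i j) \<partial>count_space UNIV) < \<infinity>"
  proof (rule ccontr)
    assume "\<not> ?thesis"
    then have "AE z in \<phi>. z \<notin> {y}" using M_row_bound by (auto elim!: eventually_mono)
    then have "{y} \<in> null_sets \<phi>" by (subst (asm) AE_iff_null_sets[symmetric]) (auto simp: sets_phi)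
    then show False using y by auto
  qed
  let ?m = "\<lambda>\<mu>. row_mass (row_mult (row_of \<mu>) (M y))"
  have mfin: "?m \<mu> < \<infinity>" if "\<mu> \<in> prob_measures (discrete_topology UNIV)" for \<mu>
  proof -
    let ?s = "SUP i. \<integral>\<^sup>+j. ennreal (M y i j) \<partial>count_space UNIV"
    have "?m \<mu> \<le> (\<integral>\<^sup>+i. row_of \<mu> i * ?s \<partial>count_space UNIV)"
      unfolding row_mass_row_mult by (intro nn_integral_mono mult_left_mono SUP_upper) auto
    also have "\<dots> = ?s" by (simp add: nn_integral_multc nn_integral_row_of[OF that])
    finally show ?thesis using fin by simp
  qed
  have mm[measurable]: "?m \<in> borel_measurable (borel_of PE)"
    using measurable_compose[OF measurable_Pair2'[of y borel "borel_of PE"] joint_measurable(2)] by simp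
  have sm[measurable]: "(\<lambda>\<mu>. fstep M \<mu> y) \<in> borel_of PE \<rightarrow>\<^sub>M borel_of PE"
    unfolding fstep_def
  proof (rule nrm_measurable)
    show "(\<lambda>\<mu>. row_mult (row_of \<mu>) (M y) i) \<in> borel_measurable (borel_of PE)" for i
      using measurable_compose[OF measurable_Pair2'[of y borel "borel_of PE"] joint_measurable(1)] by simp
  qed
  \<comment> \<open>The mean of \<open>\<pi>min\<close> is \<open>lam\<close>, so
    \<open>?m (\<pi>min \<omega>)\<close> has mean \<open>?g y\<close>, which is not 0.\<close>
  have pos: "\<not> (AE \<omega> in Pr. ?m (\<pi>min \<omega>) = 0)"
  proof
    assume *: "AE \<omega> in Pr. ?m (\<pi>min \<omega>) = 0"
    have rm[measurable]: "(\<lambda>\<omega>. row_of (\<pi>min \<omega>) i) \<in> borel_measurable Pr" for i by measurable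
    have l: "lam i = (\<integral>\<^sup>+\<omega>. row_of (\<pi>min \<omega>) i \<partial>Pr)" for i
      using filter_version_mass[OF fmin, of UNIV i] sets.top[of "sigma_Y 0 :: ('e, 'f) path measure"] by (simp add: lam_def)
    have "?g y = (\<integral>\<^sup>+i. (\<integral>\<^sup>+\<omega>. row_of (\<pi>min \<omega>) i * (\<integral>\<^sup>+j. ennreal (M y i j) \<partial>count_space UNIV) \<partial>Pr) \<partial>count_space UNIV)"
      unfolding row_mass_row_mult l by (simp add: nn_integral_multc)
    also have "\<dots> = (\<integral>\<^sup>+\<omega>. ?m (\<pi>min \<omega>) \<partial>Pr)"
      unfolding row_mass_row_mult by (rule nn_integral_count_space_nn_integral[symmetric]) auto
    also have "\<dots> = (\<integral>\<^sup>+\<omega>. 0 \<partial>Pr)" using * by (intro nn_integral_cong_AE) auto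
    finally show False using y by simp
  qed
  \<comment> \<open>At most \<open>n\<close> masses, each determined up to
    \<open>\<delta> n\<close>, contribute at most e/8; together with two tails below e/8 the
    distance stays below e. \<open>Suc n\<close> keeps the denominator positive when
    \<open>n\<close> is 0.\<close>
  define \<delta> where "\<delta> n = e / (8 * real (Suc n))" for n
  have \<delta>: "\<delta> n > 0" for n using e by (simp add: \<delta>_def)
  define c where "c n \<mu> = map (\<lambda>k. \<lfloor>measure (fstep M \<mu> y) {from_nat k} / \<delta> n\<rfloor>) [0..<n]" for n \<mu>
  \<comment> \<open>A label \<open>q\<close> consists of a cut-off and of the integer parts of the
    first scaled masses. There are only countably many labels, so one of the sets is hit with
    positive probability.\<close>
  define S where "S q = {\<mu> \<in> space (borel_of PE). ?m \<mu> \<noteq> 0 \<and> measure (fstep M \<mu> y) {j. fst q \<le> to_nat j} < e / 8 \<and>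
     c (fst q) \<mu> = snd q}" for q :: "nat \<times> int list"
  have Sm: "S q \<in> sets (borel_of PE)" for q
  proof -
    have [measurable]: "(\<lambda>\<mu>. measure (fstep M \<mu> y) A) \<in> borel_measurable (borel_of PE)" for A
      by (rule measurable_compose[OF sm measure_set_measurable])
    have "{\<mu> \<in> space (borel_of PE). c (fst q) \<mu> = snd q} \<in> sets (borel_of PE)"
    proof (cases "length (snd q) = fst q")
      case True
      have "c (fst q) \<mu> = snd q \<longleftrightarrow> (\<forall>k\<in>{..<fst q}. \<lfloor>measure (fstep M \<mu> y) {from_nat k} / \<delta> (fst q)\<rfloor> = snd q ! k)" for \<mu>
        using True by (auto simp: c_def list_eq_iff_nth_eq)
      moreover have "{\<mu> \<in> space (borel_of PE). \<forall>k\<in>{..<fst q}. \<lfloor>measure (fstep M \<mu> y) {from_nat k} / \<delta> (fst q)\<rfloor> = snd q ! k} \<in> sets (borel_of PE)"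
        by measurable
      ultimately show ?thesis by simp
    next
      case False
      then have "c (fst q) \<mu> \<noteq> snd q" for \<mu> by (auto simp: c_def dest!: arg_cong[where f=length])
      then have "{\<mu> \<in> space (borel_of PE). c (fst q) \<mu> = snd q} = {}" by simp
      then show ?thesis by (metis sets.empty_sets)
    qed
    moreover have "{\<mu> \<in> space (borel_of PE). ?m \<mu> \<noteq> 0 \<and> measure (fstep M \<mu> y) {j. fst q \<le> to_nat j} < e / 8} \<in> sets (borel_of PE)"
      by measurable
    ultimately have "{\<mu> \<in> space (borel_of PE). c (fst q) \<mu> = snd q} \<inter> {\<mu> \<in> space (borel_of PE). ?m \<mu> \<noteq> 0 \<and> measure (fstep M \<mu> y) {j. fst q \<le> to_nat j} < e / 8} \<in> sets (borel_of PE)"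
      by (rule sets.Int)
    moreover have "S q = {\<mu> \<in> space (borel_of PE). c (fst q) \<mu> = snd q} \<inter> {\<mu> \<in> space (borel_of PE). ?m \<mu> \<noteq> 0 \<and> measure (fstep M \<mu> y) {j. fst q \<le> to_nat j} < e / 8}"
      by (auto simp: S_def)
    ultimately show ?thesis by simp
  qed
  have S_diam: "tv_norm (fstep M \<mu> y) (fstep M \<nu> y) < e" if "\<mu> \<in> S q" "\<nu> \<in> S q" for q \<mu> \<nu>
  proof -
    let ?a = "fstep M \<mu> y" and ?b = "fstep M \<nu> y" and ?n = "fst q"
    let ?J = "{j :: 'e. to_nat j < ?n}"
    have p: "?a \<in> prob_measures (discrete_topology UNIV)" "?b \<in> prob_measures (discrete_topology UNIV)"
      by (simp_all add: fstep_def nrm_prob)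
    have J: "finite ?J" "card ?J \<le> ?n"
    proof -
      have "to_nat ` ?J \<subseteq> {..<?n}" by auto
      then have "finite (to_nat ` ?J)" "card (to_nat ` ?J) \<le> card {..<?n}"
        using finite_subset card_mono by (blast, metis finite_lessThan card_mono)
      moreover have "inj_on to_nat ?J" by simp
      ultimately show "finite ?J" "card ?J \<le> ?n" by (simp_all add: finite_image_iff card_image)
    qed
    have d: "\<bar>measure ?a {j} - measure ?b {j}\<bar> \<le> \<delta> ?n" if "j \<in> ?J" for j
    proof -
      have "c ?n \<mu> = c ?n \<nu>" using \<open>\<mu> \<in> S q\<close> \<open>\<nu> \<in> S q\<close> by (simp add: S_def)
      then have "c ?n \<mu> ! to_nat j = c ?n \<nu> ! to_nat j" by simp
      then have "\<lfloor>measure ?a {j} / \<delta> ?n\<rfloor> = \<lfloor>measure ?b {j} / \<delta> ?n\<rfloor>"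
        using that by (simp add: c_def)
      then have "\<bar>measure ?a {j} / \<delta> ?n - measure ?b {j} / \<delta> ?n\<bar> \<le> 1" by linarith
      then have "\<bar>(measure ?a {j} - measure ?b {j}) / \<delta> ?n\<bar> \<le> 1" by (simp add: diff_divide_distrib)
      then show ?thesis using \<delta>[of ?n] by (simp add: abs_divide)
    qed
    have "(\<Sum>j\<in>?J. \<bar>measure ?a {j} - measure ?b {j}\<bar>) \<le> (\<Sum>j\<in>?J. \<delta> ?n)" by (rule sum_mono) (rule d)
    also have "\<dots> \<le> real (Suc ?n) * \<delta> ?n" using J(2) \<delta>[of ?n] by (simp add: mult_right_mono)
    also have "\<dots> = e / 8"
    proof -
      have "real (Suc ?n) \<noteq> 0" by simp
      then show ?thesis unfolding \<delta>_def by (simp del: of_nat_Suc)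
    qed
    finally have "(\<Sum>j\<in>?J. \<bar>measure ?a {j} - measure ?b {j}\<bar>) \<le> e / 8" .
    moreover have "measure ?a (- ?J) < e / 8" "measure ?b (- ?J) < e / 8"
      using that by (auto simp: S_def Compl_eq not_less)
    ultimately show ?thesis using tv_norm_le_finite_part[OF p J(1)] e by linarith
  qed
  have cover: "\<exists>q. \<mu> \<in> S q" if "\<mu> \<in> prob_measures (discrete_topology UNIV)" "?m \<mu> \<noteq> 0" for \<mu>
  proof -
    have "fstep M \<mu> y \<in> prob_measures (discrete_topology UNIV)" by (simp add: fstep_def nrm_prob)
    from PE_tail_small[OF this, of "e/8"] e obtain n where "measure (fstep M \<mu> y) {j. n \<le> to_nat j} < e / 8" by auto
    then have "\<mu> \<in> S (n, c n \<mu>)" using that by (simp add: S_def space_borel_of)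
    then show ?thesis by blast
  qed
  have "\<exists>q. \<not> (AE \<omega> in Pr. \<pi>min \<omega> \<notin> S q)"
  proof (rule ccontr)
    assume "\<not> ?thesis"
    then have "AE \<omega> in Pr. \<forall>q. \<pi>min \<omega> \<notin> S q" by (simp add: AE_all_countable)
    then have "AE \<omega> in Pr. ?m (\<pi>min \<omega>) = 0" by eventually_elim (use cover P in blast)
    then show False using pos by blast
  qed
  then obtain q where q: "\<not> (AE \<omega> in Pr. \<pi>min \<omega> \<notin> S q)" by blast
  let ?Ob = "Pi\<^sub>E {1..1::nat} (\<lambda>_. {y})"
  have row1: "row_prod M z 1 v = row_mult v (M y)" if "z \<in> ?Ob" for z v
  proof -
    have "z (Suc 0) = y" using that by (auto simp: PiE_iff One_nat_def)
    then show ?thesis by (simp add: One_nat_def)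
  qed
  have nz: "normalized (row_mult (row_of \<mu>) (M y)) = fstep M \<mu> y" "?m \<mu> > 0" if "\<mu> \<in> S q" for \<mu>
  proof -
    have "\<mu> \<in> prob_measures (discrete_topology UNIV)" "?m \<mu> \<noteq> 0" using that by (auto simp: S_def space_borel_of)
    then show "normalized (row_mult (row_of \<mu>) (M y)) = fstep M \<mu> y" "?m \<mu> > 0"
      using mfin[of \<mu>] by (auto simp: fstep_def nrm_def zero_less_iff_neq_zero)
  qed
  show "\<exists>N\<ge>1. \<exists>S\<in>sets (borel_of PE). \<exists>Ob\<in>sets (PiM {1..N} (\<lambda>_. borel)).
    0 < measure Pr {\<omega> \<in> space Pr. \<pi>min \<omega> \<in> S \<and> \<pi>max \<omega> \<in> S} \<and>
    0 < emeasure (PiM {1..N} (\<lambda>_. \<phi>)) Ob \<and>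
    (\<forall>\<mu>\<in>S. \<forall>y\<in>Ob. 0 < row_mass (row_prod M y N (row_of \<mu>))) \<and>
    (\<forall>\<mu>\<in>S. \<forall>\<nu>\<in>S. \<forall>y\<in>Ob. tv_norm (normalized (row_prod M y N (row_of \<mu>))) (normalized (row_prod M y N (row_of \<nu>))) < e)"
  proof (intro exI[of _ 1] conjI bexI[of _ "S q"] bexI[of _ ?Ob] ballI)
    have "{\<omega> \<in> space Pr. \<pi>min \<omega> \<in> S q \<and> \<pi>max \<omega> \<in> S q} \<in> sets Pr" using Sm[of q] by measurable
    moreover have "\<not> (AE \<omega> in Pr. \<omega> \<notin> {\<omega> \<in> space Pr. \<pi>min \<omega> \<in> S q \<and> \<pi>max \<omega> \<in> S q})"
    proof
      assume "AE \<omega> in Pr. \<omega> \<notin> {\<omega> \<in> space Pr. \<pi>min \<omega> \<in> S q \<and> \<pi>max \<omega> \<in> S q}"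
      with eq have "AE \<omega> in Pr. \<pi>min \<omega> \<notin> S q" by eventually_elim auto
      then show False using q by blast
    qed
    ultimately have "measure Pr {\<omega> \<in> space Pr. \<pi>min \<omega> \<in> S q \<and> \<pi>max \<omega> \<in> S q} \<noteq> 0"
      by (subst (asm) AE_iff_null_sets[symmetric]) (auto simp: null_sets_def emeasure_eq_measure)
    then show "0 < measure Pr {\<omega> \<in> space Pr. \<pi>min \<omega> \<in> S q \<and> \<pi>max \<omega> \<in> S q}" by (simp add: zero_less_measure_iff)
    interpret product_sigma_finite "\<lambda>_::nat. \<phi>" by (rule product_sigma_finite_phi)
    have "emeasure (phiN 1) ?Ob = (\<Prod>i\<in>{1..1::nat}. emeasure \<phi> {y})"
      by (rule emeasure_PiM) (auto simp: sets_phi)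
    then show "0 < emeasure (phiN 1) ?Ob" using y by (simp add: zero_less_iff_neq_zero)
    show "?Ob \<in> sets (PiM {1..1} (\<lambda>_. borel))" by (rule sets_PiM_I_finite) auto
  next
    fix \<mu> \<nu> z assume "\<mu> \<in> S q" "\<nu> \<in> S q" "z \<in> ?Ob"
    then show "tv_norm (normalized (row_prod M z 1 (row_of \<mu>))) (normalized (row_prod M z 1 (row_of \<nu>))) < e"
      using S_diam[of \<mu> q \<nu>] by (simp add: row1 nz)
  qed (use Sm nz row1 in auto)
qed

end

section \<open>Asymptotic independence and ergodicity\<close>

definition path_boxes :: "('e::countable, 'f::polish_space) path set set" where
  "path_boxes = {{\<omega>. \<forall>k\<in>K. coord_X k \<omega> \<in> J k \<and> coord_Y k \<omega> \<in> A k} | K J A. finite K \<and> (\<forall>k. A k \<in> sets borel)}"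

lemma Int_stable_path_boxes: "Int_stable (path_boxes :: ('e::countable, 'f::polish_space) path set set)"
proof (rule Int_stableI)
  fix a b :: "('e, 'f) path set" assume "a \<in> path_boxes" "b \<in> path_boxes"
  then obtain K J A K' J' A' where a: "a = {\<omega>. \<forall>k\<in>K. coord_X k \<omega> \<in> J k \<and> coord_Y k \<omega> \<in> A k}" "finite K" "\<forall>k. A k \<in> sets borel"
    and b: "b = {\<omega>. \<forall>k\<in>K'. coord_X k \<omega> \<in> J' k \<and> coord_Y k \<omega> \<in> A' k}" "finite K'" "\<forall>k. A' k \<in> sets borel"
    unfolding path_boxes_def by blast
  let ?J = "\<lambda>k. (if k \<in> K then J k else UNIV) \<inter> (if k \<in> K' then J' k else UNIV)"
  let ?A = "\<lambda>k. (if k \<in> K then A k else UNIV) \<inter> (if k \<in> K' then A' k else UNIV)"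
  have "a \<inter> b = {\<omega>. \<forall>k\<in>K \<union> K'. coord_X k \<omega> \<in> ?J k \<and> coord_Y k \<omega> \<in> ?A k}"
    unfolding a b by auto
  moreover have "\<forall>k. ?A k \<in> sets borel" using a b by auto
  ultimately show "a \<inter> b \<in> path_boxes"
    unfolding path_boxes_def using a(2) b(2) by (intro CollectI exI[of _ "K \<union> K'"] exI[of _ ?J] exI[of _ ?A]) simp
qed

lemma path_boxes_sets: "(C :: ('e::countable, 'f::polish_space) path set) \<in> path_boxes \<Longrightarrow> C \<in> sets path_space"
proof -
  assume "C \<in> path_boxes"
  then obtain K J A where C: "C = {\<omega>. \<forall>k\<in>K. coord_X k \<omega> \<in> J k \<and> coord_Y k \<omega> \<in> A k}" "finite K" "\<forall>k. A k \<in> sets borel"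
    unfolding path_boxes_def by blast
  have [measurable]: "A k \<in> sets borel" for k using C(3) by simp
  have "{\<omega> \<in> space path_space. \<forall>k\<in>K. coord_X k \<omega> \<in> J k \<and> coord_Y k \<omega> \<in> A k} \<in> sets path_space"
    by (rule sets.sets_Collect_finite_All[OF _ C(2)]) measurable
  then show ?thesis using C(1) by simp
qed

lemma sets_path_space_boxes:
  "sets (path_space :: ('e::countable, 'f::polish_space) path measure) = sigma_sets UNIV path_boxes"
proof
  let ?N = "sigma UNIV (path_boxes :: ('e, 'f) path set set)"
  have sN: "sets ?N = sigma_sets UNIV path_boxes" "space ?N = UNIV" by (auto simp: sets_measure_of)
  have "(\<lambda>\<omega>. \<omega>) \<in> ?N \<rightarrow>\<^sub>M path_space"
  proof (rule measurable_path_spaceI)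
    fix k
    show "coord_X k \<in> ?N \<rightarrow>\<^sub>M count_space UNIV"
    proof (rule measurableI)
      fix J :: "'e set"
      have "coord_X k -` J \<in> (path_boxes :: ('e, 'f) path set set)"
        unfolding path_boxes_def by (intro CollectI exI[of _ "{k}"] exI[of _ "\<lambda>_. J"] exI[of _ "\<lambda>_. UNIV"]) auto
      then show "coord_X k -` J \<inter> space ?N \<in> sets ?N" using sN by auto
    qed auto
    show "coord_Y k \<in> ?N \<rightarrow>\<^sub>M borel"
    proof (rule measurableI)
      fix A :: "'f set" assume "A \<in> sets borel"
      then have "coord_Y k -` A \<in> (path_boxes :: ('e, 'f) path set set)"
        unfolding path_boxes_def by (intro CollectI exI[of _ "{k}"] exI[of _ "\<lambda>_. UNIV"] exI[of _ "\<lambda>_. A"]) auto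
      then show "coord_Y k -` A \<inter> space ?N \<in> sets ?N" using sN by auto
    qed auto
  qed
  from sets_subset_of_measurable_id[OF this sN(2)]
  show "sets (path_space :: ('e, 'f) path measure) \<subseteq> sigma_sets UNIV path_boxes" using sN by simp
  show "sigma_sets UNIV path_boxes \<subseteq> sets (path_space :: ('e, 'f) path measure)"
    using sets.sigma_sets_subset[of path_boxes "path_space :: ('e, 'f) path measure"] path_boxes_sets by auto
qed

section \<open>Conditional independence of past and future given the present state\<close>

context hidden_markov_model begin

lemma future_box_sets:
  assumes "\<And>k. A k \<in> sets borel"
  shows "{\<omega> :: ('e, 'f) path. \<forall>k\<in>{1..n}. coord_X (m + int k) \<omega> \<in> J k \<and> coord_Y (m + int k) \<omega> \<in> A k} \<in> sets (sigma_XY (m + int n) (m + int n))"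
proof -
  let ?S = "sigma_XY (m + int n) (m + int n) :: ('e, 'f) path measure"
  have "{\<omega> \<in> space ?S. \<forall>k\<in>{1..n}. coord_X (m + int k) \<omega> \<in> J k \<and> coord_Y (m + int k) \<omega> \<in> A k} \<in> sets ?S"
  proof (rule sets.sets_Collect_finite_All)
    fix k assume k: "k \<in> {1..n}"
    have "coord_X (m + int k) -` J k \<inter> space ?S \<in> sets ?S" "coord_Y (m + int k) -` A k \<inter> space ?S \<in> sets ?S"
      using k assms by (auto intro!: measurable_sets[OF coord_X_sigma_XY] measurable_sets[OF coord_Y_sigma_XY] simp del: space_sigma_XY)
    then have "(coord_X (m + int k) -` J k \<inter> space ?S) \<inter> (coord_Y (m + int k) -` A k \<inter> space ?S) \<in> sets ?S" by (rule sets.Int)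
    moreover have "(coord_X (m + int k) -` J k \<inter> space ?S) \<inter> (coord_Y (m + int k) -` A k \<inter> space ?S) = {\<omega> \<in> space ?S. coord_X (m + int k) \<omega> \<in> J k \<and> coord_Y (m + int k) \<omega> \<in> A k}"
      by auto
    ultimately show "{\<omega> \<in> space ?S. coord_X (m + int k) \<omega> \<in> J k \<and> coord_Y (m + int k) \<omega> \<in> A k} \<in> sets ?S" by simp
  qed simp
  then show ?thesis by simp
qed

text \<open>Multiplied by \<open>lam i\<close> in place of a quotient. Fixing also the end state
  \<open>l\<close> gives the induction the state from which the next Markov step starts.\<close>

lemma conditional_independence_step:
  assumes B: "B \<in> sets (sigma_XY m m)" and A: "\<And>k. A k \<in> sets borel"
  shows "emeasure Pr (B \<inter> {\<omega>. coord_X m \<omega> = i} \<inter> {\<omega>. \<forall>k\<in>{1..n}. coord_X (m + int k) \<omega> \<in> J k \<and> coord_Y (m + int k) \<omega> \<in> A k} \<inter> {\<omega>. coord_X (m + int n) \<omega> = l}) * lam i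
    = emeasure Pr (B \<inter> {\<omega>. coord_X m \<omega> = i}) *
      emeasure Pr ({\<omega>. coord_X m \<omega> = i} \<inter> {\<omega>. \<forall>k\<in>{1..n}. coord_X (m + int k) \<omega> \<in> J k \<and> coord_Y (m + int k) \<omega> \<in> A k} \<inter> {\<omega>. coord_X (m + int n) \<omega> = l})"
proof (induction n arbitrary: l)
  case 0
  show ?case
  proof (cases "l = i")
    case True
    then show ?thesis by (simp add: Int_absorb2 emeasure_coord_X Int_assoc)
  next
    case False
    then have e: "{\<omega> :: ('e, 'f) path. coord_X m \<omega> = i} \<inter> {\<omega>. coord_X m \<omega> = l} = {}" by auto
    show ?thesis using e by (simp add: Int_assoc)
  qed
next
  case (Suc n)
  let ?C = "\<lambda>n. {\<omega> :: ('e, 'f) path. \<forall>k\<in>{1..n}. coord_X (m + int k) \<omega> \<in> J k \<and> coord_Y (m + int k) \<omega> \<in> A k}"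
  have I: "{1..Suc n} = insert (Suc n) {1..n}" and idx: "m + int (Suc n) = m + int n + 1" by auto
  have C: "?C (Suc n) = ?C n \<inter> {\<omega>. coord_X (m + int n + 1) \<omega> \<in> J (Suc n) \<and> coord_Y (m + int n + 1) \<omega> \<in> A (Suc n)}"
    unfolding I idx[symmetric] by auto
  show ?case
  proof (cases "l \<in> J (Suc n)")
    case False
    then have e: "?C (Suc n) \<inter> {\<omega>. coord_X (m + int (Suc n)) \<omega> = l} = {}" unfolding C idx by auto
    show ?thesis using e by (simp only: Int_assoc Int_empty_right emeasure_empty mult_zero_left mult_zero_right)
  next
    case True
    let ?e = "{\<omega> :: ('e, 'f) path. coord_X (m + int n + 1) \<omega> = l \<and> coord_Y (m + int n + 1) \<omega> \<in> A (Suc n)}"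
    have e: "?C (Suc n) \<inter> {\<omega>. coord_X (m + int (Suc n)) \<omega> = l} = ?C n \<inter> ?e" unfolding C idx using True by auto
    let ?w = "\<lambda>l'. \<integral>\<^sup>+y. indicator (A (Suc n)) y * ennreal (M y l' l) \<partial>\<phi>"
    have Xm: "{\<omega>. coord_X m \<omega> = i} \<in> sets (sigma_XY (m + int n) (m + int n))" by (rule coord_X_eq_sigma_XY) simp
    have XC: "{\<omega>. coord_X m \<omega> = i} \<inter> ?C n \<in> sets (sigma_XY (m + int n) (m + int n))"
      using Xm future_box_sets[OF A] by (rule sets.Int)
    have BXC: "B \<inter> {\<omega>. coord_X m \<omega> = i} \<inter> ?C n \<in> sets (sigma_XY (m + int n) (m + int n))"
      using XC B sigma_XY_mono[of m "m + int n" m "m + int n"] by (simp add: Int_assoc) blast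
    have "emeasure Pr (B \<inter> {\<omega>. coord_X m \<omega> = i} \<inter> ?C n \<inter> ?e) * lam i =
      (\<integral>\<^sup>+l'. emeasure Pr (B \<inter> {\<omega>. coord_X m \<omega> = i} \<inter> ?C n \<inter> {\<omega>. coord_X (m + int n) \<omega> = l'}) * ?w l' \<partial>count_space UNIV) * lam i"
      by (simp only: markov_step[OF BXC A])
    also have "\<dots> = (\<integral>\<^sup>+l'. emeasure Pr (B \<inter> {\<omega>. coord_X m \<omega> = i} \<inter> ?C n \<inter> {\<omega>. coord_X (m + int n) \<omega> = l'}) * lam i * ?w l' \<partial>count_space UNIV)"
      by (subst nn_integral_multc[symmetric]) (auto simp: mult_ac)
    also have "\<dots> = (\<integral>\<^sup>+l'. emeasure Pr (B \<inter> {\<omega>. coord_X m \<omega> = i}) * (emeasure Pr ({\<omega>. coord_X m \<omega> = i} \<inter> ?C n \<inter> {\<omega>. coord_X (m + int n) \<omega> = l'}) * ?w l') \<partial>count_space UNIV)"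
      unfolding Suc.IH by (simp only: mult.assoc)
    also have "\<dots> = emeasure Pr (B \<inter> {\<omega>. coord_X m \<omega> = i}) * (\<integral>\<^sup>+l'. emeasure Pr ({\<omega>. coord_X m \<omega> = i} \<inter> ?C n \<inter> {\<omega>. coord_X (m + int n) \<omega> = l'}) * ?w l' \<partial>count_space UNIV)"
      by (rule nn_integral_cmult) simp
    also have "\<dots> = emeasure Pr (B \<inter> {\<omega>. coord_X m \<omega> = i}) * emeasure Pr ({\<omega>. coord_X m \<omega> = i} \<inter> ?C n \<inter> ?e)"
      by (simp only: markov_step[OF XC A])
    finally show ?thesis using e by (simp only: Int_assoc)
  qed
qed

lemma conditional_independence:
  assumes B: "B \<in> sets (sigma_XY m m)" and A: "\<And>k. A k \<in> sets borel"
  shows "emeasure Pr (B \<inter> {\<omega>. coord_X m \<omega> = i} \<inter> {\<omega>. \<forall>k\<in>{1..n}. coord_X (m + int k) \<omega> \<in> J k \<and> coord_Y (m + int k) \<omega> \<in> A k}) * lam i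
    = emeasure Pr (B \<inter> {\<omega>. coord_X m \<omega> = i}) *
      emeasure Pr ({\<omega>. coord_X m \<omega> = i} \<inter> {\<omega>. \<forall>k\<in>{1..n}. coord_X (m + int k) \<omega> \<in> J k \<and> coord_Y (m + int k) \<omega> \<in> A k})"
proof -
  let ?C = "{\<omega> :: ('e, 'f) path. \<forall>k\<in>{1..n}. coord_X (m + int k) \<omega> \<in> J k \<and> coord_Y (m + int k) \<omega> \<in> A k}"
  have C: "?C \<in> sets Pr"
    using future_box_sets[where A=A and J=J and n=n and m=m, OF A] subalgebra_XY by (auto simp: subalgebra_def)
  have Bs: "B \<in> sets Pr" using B subalgebra_XY by (auto simp: subalgebra_def)
  have s: "B \<inter> {\<omega>. coord_X m \<omega> = i} \<inter> ?C \<in> sets Pr" "{\<omega>. coord_X m \<omega> = i} \<inter> ?C \<in> sets Pr"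
    using C Bs by auto
  have "emeasure Pr (B \<inter> {\<omega>. coord_X m \<omega> = i} \<inter> ?C) * lam i =
    (\<integral>\<^sup>+l. emeasure Pr (B \<inter> {\<omega>. coord_X m \<omega> = i} \<inter> ?C \<inter> {\<omega>. coord_X (m + int n) \<omega> = l}) * lam i \<partial>count_space UNIV)"
    by (subst emeasure_split_X[OF s(1), of "m + int n"], rule nn_integral_multc[symmetric]) simp
  also have "\<dots> = (\<integral>\<^sup>+l. emeasure Pr (B \<inter> {\<omega>. coord_X m \<omega> = i}) * emeasure Pr ({\<omega>. coord_X m \<omega> = i} \<inter> ?C \<inter> {\<omega>. coord_X (m + int n) \<omega> = l}) \<partial>count_space UNIV)"
    by (simp only: conditional_independence_step[OF B A])
  also have "\<dots> = emeasure Pr (B \<inter> {\<omega>. coord_X m \<omega> = i}) * emeasure Pr ({\<omega>. coord_X m \<omega> = i} \<inter> ?C)"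
    by (subst emeasure_split_X[OF s(2), of "m + int n"], rule nn_integral_cmult) simp
  finally show ?thesis .
qed

text \<open>For a box shifted so far that all its times are positive, conditional independence makes
  the difference exactly 0. Taking complements only changes its sign. Disjoint unions pass to the
  limit by Tannery's theorem, since by stationarity the term of \<open>D j\<close> is bounded by
  \<open>measure Pr (D j)\<close> uniformly in the shift.\<close>

lemma asymptotic_independence:
  assumes B: "B \<in> sets (sigma_XY 0 0)" and C: "C \<in> sets path_space"
  shows "(\<lambda>s. measure Pr (B \<inter> {\<omega>. coord_X 0 \<omega> = i} \<inter> sh (int s) -` C) * measure Pr {\<omega>. coord_X 0 \<omega> = i}
     - measure Pr (B \<inter> {\<omega>. coord_X 0 \<omega> = i}) * measure Pr ({\<omega>. coord_X 0 \<omega> = i} \<inter> sh (int s) -` C)) \<longlonglongrightarrow> 0"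
proof -
  let ?X = "{\<omega> :: ('e, 'f) path. coord_X 0 \<omega> = i}"
  let ?a = "\<lambda>C s. measure Pr (B \<inter> ?X \<inter> sh (int s) -` C) * measure Pr ?X - measure Pr (B \<inter> ?X) * measure Pr (?X \<inter> sh (int s) -` C)"
  have Bs: "B \<in> sets Pr" using B subalgebra_XY by (auto simp: subalgebra_def)
  have shs: "sh c -` D \<in> sets Pr" if "D \<in> sets path_space" for c D
    using measurable_sets[OF sh_measurable that, of c] by (simp add: sets_Pr)
  note C' = C[unfolded sets_path_space_boxes]
  have sub: "(path_boxes :: ('e, 'f) path set set) \<subseteq> Pow UNIV" by simp
  have "?a C \<longlonglongrightarrow> 0"
    using Int_stable_path_boxes sub C'
  proof (induction rule: sigma_sets_induct_disjoint)
    case (basic D)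
    then obtain K J A where D: "D = {\<omega>. \<forall>k\<in>K. coord_X k \<omega> \<in> J k \<and> coord_Y k \<omega> \<in> A k}" and K: "finite K" and A: "\<forall>k. A k \<in> sets borel"
      unfolding path_boxes_def by blast
    define b where "b = Max (insert 0 (abs ` K))"
    have b: "\<bar>k\<bar> \<le> b" if "k \<in> K" for k using K that by (auto simp: b_def)
    have z: "?a D s = 0" if s: "int s > b" for s
    proof -
      \<comment> \<open>All shifted times lie between 1 and s + b; at the times that the box does
        not constrain, \<open>UNIV\<close> is inserted.\<close>
      define n where "n = nat (int s + b)"
      define J' where "J' k = (if int k - int s \<in> K then J (int k - int s) else UNIV)" for k
      define A' where "A' k = (if int k - int s \<in> K then A (int k - int s) else UNIV)" for k
      have A': "A' k \<in> sets borel" for k using A by (auto simp: A'_def)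
      have e: "sh (int s) -` D = {\<omega>. \<forall>k\<in>{1..n}. coord_X (0 + int k) \<omega> \<in> J' k \<and> coord_Y (0 + int k) \<omega> \<in> A' k}"
      proof (intro set_eqI iffI)
        fix \<omega> assume "\<omega> \<in> sh (int s) -` D"
        then have "\<forall>k\<in>K. coord_X (k + int s) \<omega> \<in> J k \<and> coord_Y (k + int s) \<omega> \<in> A k" by (simp add: D)
        then show "\<omega> \<in> {\<omega>. \<forall>k\<in>{1..n}. coord_X (0 + int k) \<omega> \<in> J' k \<and> coord_Y (0 + int k) \<omega> \<in> A' k}"
          by (fastforce simp: J'_def A'_def)
      next
        fix \<omega> assume *: "\<omega> \<in> {\<omega>. \<forall>k\<in>{1..n}. coord_X (0 + int k) \<omega> \<in> J' k \<and> coord_Y (0 + int k) \<omega> \<in> A' k}"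
        have "coord_X (k + int s) \<omega> \<in> J k \<and> coord_Y (k + int s) \<omega> \<in> A k" if k: "k \<in> K" for k
        proof -
          have r: "nat (k + int s) \<in> {1..n}" "int (nat (k + int s)) = k + int s"
            using b[OF k] s by (auto simp: n_def)
          then have "coord_X (0 + int (nat (k + int s))) \<omega> \<in> J' (nat (k + int s)) \<and> coord_Y (0 + int (nat (k + int s))) \<omega> \<in> A' (nat (k + int s))"
            using * by blast
          then show ?thesis using k r by (simp add: J'_def A'_def)
        qed
        then show "\<omega> \<in> sh (int s) -` D" by (simp add: D)
      qed
      have "emeasure Pr (B \<inter> ?X \<inter> sh (int s) -` D) * emeasure Pr ?X = emeasure Pr (B \<inter> ?X) * emeasure Pr (?X \<inter> sh (int s) -` D)"
        using conditional_independence[where A=A' and J=J' and n=n and i=i, OF B A'] unfolding e[symmetric] lam_def .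
      then show ?thesis by (simp add: emeasure_eq_measure ennreal_mult[symmetric])
    qed
    have "\<forall>\<^sub>F s in sequentially. ?a D s = 0"
    proof (rule eventually_sequentiallyI)
      fix s assume "nat b + 1 \<le> s"
      then show "?a D s = 0" by (intro z) linarith
    qed
    then show ?case by (rule tendsto_eventually)
  next
    case empty
    show ?case by simp
  next
    case (compl D)
    then have D: "D \<in> sets path_space" unfolding sets_path_space_boxes by simp
    have "?a (UNIV - D) s = - ?a D s" for s
    proof -
      have mm: "measure Pr (Z \<inter> sh (int s) -` (UNIV - D)) = measure Pr Z - measure Pr (Z \<inter> sh (int s) -` D)" if "Z \<in> sets Pr" for Z
      proof -
        have "Z \<inter> sh (int s) -` (UNIV - D) = Z - Z \<inter> sh (int s) -` D" by auto
        moreover have "measure Pr (Z - Z \<inter> sh (int s) -` D) = measure Pr Z - measure Pr (Z \<inter> sh (int s) -` D)"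
          using that shs[OF D, of "int s"] by (intro finite_measure_Diff) auto
        ultimately show ?thesis by simp
      qed
      show ?thesis
        unfolding mm[OF sets.Int[OF Bs coord_X_eq_events]] mm[OF coord_X_eq_events]
        by (simp only: left_diff_distrib right_diff_distrib)
    qed
    then show ?case using tendsto_minus[OF compl(2)] by simp
  next
    case (union D)
    then have D: "D j \<in> sets path_space" for j unfolding sets_path_space_boxes by auto
    have m_union: "(\<lambda>j. measure Pr (Z \<inter> sh (int s) -` D j)) sums measure Pr (Z \<inter> sh (int s) -` (\<Union>j. D j))" if "Z \<in> sets Pr" for Z s
    proof -
      have "(\<lambda>j. measure Pr (Z \<inter> sh (int s) -` D j)) sums measure Pr (\<Union>j. Z \<inter> sh (int s) -` D j)"
      proof (rule finite_measure_UNION)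
        show "range (\<lambda>j. Z \<inter> sh (int s) -` D j) \<subseteq> sets Pr" using that shs[OF D] by auto
        show "disjoint_family (\<lambda>j. Z \<inter> sh (int s) -` D j)"
          using union(1) unfolding disjoint_family_on_def by blast
      qed
      moreover have "(\<Union>j. Z \<inter> sh (int s) -` D j) = Z \<inter> sh (int s) -` (\<Union>j. D j)" by auto
      ultimately show ?thesis by simp
    qed
    have a_sums: "(\<lambda>j. ?a (D j) s) sums ?a (\<Union>j. D j) s" for s
      by (intro sums_diff sums_mult sums_mult2 m_union) (use Bs in auto)
    have bound: "norm (?a (D j) s) \<le> measure Pr (D j)" for j s
    proof -
      have le: "measure Pr (Z \<inter> sh (int s) -` D j) \<le> measure Pr (D j)" for Z
        unfolding measure_sh[OF D, of "int s", symmetric] by (rule finite_measure_mono) (use shs[OF D] in auto)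
      have "measure Pr (B \<inter> ?X \<inter> sh (int s) -` D j) * measure Pr ?X \<le> measure Pr (D j) * 1"
        by (intro mult_mono le prob_le_1) simp_all
      moreover have "measure Pr (B \<inter> ?X) * measure Pr (?X \<inter> sh (int s) -` D j) \<le> 1 * measure Pr (D j)"
        by (intro mult_mono le prob_le_1) simp_all
      moreover have "0 \<le> measure Pr (B \<inter> ?X \<inter> sh (int s) -` D j) * measure Pr ?X"
        "0 \<le> measure Pr (B \<inter> ?X) * measure Pr (?X \<inter> sh (int s) -` D j)" by simp_all
      ultimately show ?thesis unfolding real_norm_def by linarith
    qed
    have sumD: "summable (\<lambda>j. measure Pr (D j))"
    proof -
      have "sh 0 -` Z = Z" for Z :: "('e, 'f) path set" by (intro set_eqI) simp
      then show ?thesis using m_union[of UNIV 0] sets.top[of Pr] by (simp add: sums_iff)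
    qed
    have "\<forall>\<^sub>F (j, s) in at_top \<times>\<^sub>F sequentially. norm (?a (D j) s) \<le> measure Pr (D j)"
      using bound by (auto intro: always_eventually)
    from tannerys_theorem[of "\<lambda>j s. ?a (D j) s" "\<lambda>_. 0" sequentially "\<lambda>j. measure Pr (D j)", OF union(3) this sumD]
    have "(\<lambda>s. \<Sum>j. ?a (D j) s) \<longlonglongrightarrow> 0" by simp
    moreover have "(\<Sum>j. ?a (D j) s) = ?a (\<Union>j. D j) s" for s using a_sums[of s] by (rule sums_unique[symmetric])
    ultimately show ?case by simp
  qed
  then show ?thesis .
qed

section \<open>Irreducibility and the zero-one law for invariant past events\<close>

lemma emeasure_X_pow:
  assumes "B \<in> sets (sigma_XY m m)"
  shows "emeasure Pr (B \<inter> {\<omega>. coord_X (m + int n) \<omega> = j}) =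
    (\<integral>\<^sup>+l. emeasure Pr (B \<inter> {\<omega>. coord_X m \<omega> = l}) * mat_pow (trans_mat \<phi> M) n l j \<partial>count_space UNIV)"
  using assms
proof (induction n arbitrary: m)
  case 0
  have "(\<integral>\<^sup>+l. emeasure Pr (B \<inter> {\<omega>. coord_X m \<omega> = l}) * mat_pow (trans_mat \<phi> M) 0 l j \<partial>count_space UNIV) =
    (\<integral>\<^sup>+l. emeasure Pr (B \<inter> {\<omega>. coord_X m \<omega> = j}) * indicator {j} l \<partial>count_space UNIV)"
    by (intro nn_integral_cong) (auto simp: indicator_def)
  then show ?case by (simp add: nn_integral_cmult_indicator)
next
  case (Suc n)
  have B1: "B \<in> sets (sigma_XY (m + 1) (m + 1))"
    using Suc.prems sigma_XY_mono[of m "m+1" m "m+1"] by auto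
  have idx: "m + int (Suc n) = m + 1 + int n" by simp
  have one: "emeasure Pr (B \<inter> {\<omega>. coord_X (m + 1) \<omega> = l}) = (\<integral>\<^sup>+k. emeasure Pr (B \<inter> {\<omega>. coord_X m \<omega> = k}) * trans_mat \<phi> M k l \<partial>count_space UNIV)" for l
    using markov_step[OF Suc.prems, of UNIV l] by (simp add: trans_mat_def)
  have "emeasure Pr (B \<inter> {\<omega>. coord_X (m + int (Suc n)) \<omega> = j}) =
    (\<integral>\<^sup>+l. (\<integral>\<^sup>+k. emeasure Pr (B \<inter> {\<omega>. coord_X m \<omega> = k}) * trans_mat \<phi> M k l \<partial>count_space UNIV) * mat_pow (trans_mat \<phi> M) n l j \<partial>count_space UNIV)"
    unfolding idx Suc.IH[OF B1] one ..
  also have "\<dots> = (\<integral>\<^sup>+l. (\<integral>\<^sup>+k. emeasure Pr (B \<inter> {\<omega>. coord_X m \<omega> = k}) * trans_mat \<phi> M k l * mat_pow (trans_mat \<phi> M) n l j \<partial>count_space UNIV) \<partial>count_space UNIV)"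
    by (simp add: nn_integral_multc)
  also have "\<dots> = (\<integral>\<^sup>+k. (\<integral>\<^sup>+l. emeasure Pr (B \<inter> {\<omega>. coord_X m \<omega> = k}) * trans_mat \<phi> M k l * mat_pow (trans_mat \<phi> M) n l j \<partial>count_space UNIV) \<partial>count_space UNIV)"
    by (rule nn_integral_count_space_nn_integral) auto
  also have "\<dots> = (\<integral>\<^sup>+k. emeasure Pr (B \<inter> {\<omega>. coord_X m \<omega> = k}) * mat_pow (trans_mat \<phi> M) (Suc n) k j \<partial>count_space UNIV)"
    by (simp add: nn_integral_cmult mult.assoc)
  finally show ?case .
qed

lemma emeasure_X_pair:
  "emeasure Pr ({\<omega>. coord_X m \<omega> = i} \<inter> {\<omega>. coord_X (m + int n) \<omega> = j}) = lam i * mat_pow (trans_mat \<phi> M) n i j"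
proof -
  have "emeasure Pr ({\<omega>. coord_X m \<omega> = i} \<inter> {\<omega>. coord_X (m + int n) \<omega> = j}) =
    (\<integral>\<^sup>+l. emeasure Pr ({\<omega>. coord_X m \<omega> = i} \<inter> {\<omega>. coord_X m \<omega> = l}) * mat_pow (trans_mat \<phi> M) n l j \<partial>count_space UNIV)"
    by (rule emeasure_X_pow) (rule coord_X_eq_sigma_XY, simp)
  also have "\<dots> = (\<integral>\<^sup>+l. (lam i * mat_pow (trans_mat \<phi> M) n i j) * indicator {i} l \<partial>count_space UNIV)"
  proof (rule nn_integral_cong)
    fix l
    show "emeasure Pr ({\<omega>. coord_X m \<omega> = i} \<inter> {\<omega>. coord_X m \<omega> = l}) * mat_pow (trans_mat \<phi> M) n l j = (lam i * mat_pow (trans_mat \<phi> M) n i j) * indicator {i} l"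
    proof (cases "l = i")
      case True then show ?thesis by (simp add: emeasure_coord_X)
    next
      case False
      then have e: "{\<omega> :: ('e, 'f) path. coord_X m \<omega> = i} \<inter> {\<omega>. coord_X m \<omega> = l} = {}" by auto
      show ?thesis unfolding e using False by simp
    qed
  qed
  finally show ?thesis by (simp add: nn_integral_cmult_indicator)
qed

text \<open>Some state is charged; irreducibility leads from it to \<open>i\<close> in some number
  of steps, and stationarity makes the mass found there a lower bound for
  \<open>lam i\<close>.\<close>

lemma lam_pos: "lam i > 0"
proof -
  obtain k where k: "lam k \<noteq> 0"
  proof (rule ccontr)
    assume "\<not> thesis"
    then have "lam k = 0" for k using that by blast
    then have "row_mass lam = 0" by (subst row_mass_eq_0_iff) simp
    then show False by simp
  qed
  obtain n where n: "mat_pow (trans_mat \<phi> M) n k i > 0"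
    using irreducible_P by (auto simp: irreducible_matrix_def)
  have "0 < lam k * mat_pow (trans_mat \<phi> M) n k i" using k n by (simp add: zero_less_iff_neq_zero ennreal_zero_less_mult_iff)
  also have "\<dots> = emeasure Pr ({\<omega>. coord_X 0 \<omega> = k} \<inter> {\<omega>. coord_X (0 + int n) \<omega> = i})" by (rule emeasure_X_pair[symmetric])
  also have "\<dots> \<le> emeasure Pr {\<omega>. coord_X (0 + int n) \<omega> = i}" by (intro emeasure_mono) auto
  also have "\<dots> = lam i" by (rule emeasure_coord_X)
  finally show ?thesis .
qed

text \<open>
  An invariant event of the past is asymptotically a future event, hence independent of itself
  given \<open>X\<^sub>0\<close>.
\<close>
lemma invariant_past_event_0_1:
  assumes I: "I \<in> sets (sigma_XY 0 0)" and inv: "sh 1 -` I = I"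
  shows "measure Pr I = 0 \<or> measure Pr I = 1"
proof -
  have Ip: "I \<in> sets path_space" using I sigma_XY_subset_path by auto
  then have Is[measurable]: "I \<in> sets Pr" by (simp add: sets_Pr)
  have invn: "sh (int n) -` I = I" for n
  proof (induction n)
    case (Suc n)
    have "sh (int (Suc n)) -` I = sh (int n) -` (sh 1 -` I)" by (intro set_eqI) simp
    then show ?case using Suc inv by simp
  qed simp
  let ?X = "\<lambda>m i. {\<omega> :: ('e, 'f) path. coord_X m \<omega> = i}"
  define p where "p i = measure Pr (I \<inter> ?X 0 i)" for i
  define l where "l i = measure Pr (?X 0 i)" for i
  have lpos: "l i > 0" for i using lam_pos[of i] by (simp add: l_def lam_def emeasure_eq_measure)
  have p01: "p i = 0 \<or> p i = l i" for i
  proof -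
    have "I \<inter> ?X 0 i \<inter> I = I \<inter> ?X 0 i" "?X 0 i \<inter> I = I \<inter> ?X 0 i" by auto
    \<comment> \<open>By invariance no term depends on the shift, so the limit 0 is the value
      itself: p i * l i = (p i)^2. In other words \<open>I\<close> has conditional probability 0 or
      1 given X_0 = i.\<close>
    then have "(\<lambda>s :: nat. p i * l i - p i * p i) \<longlonglongrightarrow> 0"
      using asymptotic_independence[OF I Ip, of i] unfolding invn p_def l_def by (simp only:)
    then have "p i * l i - p i * p i = 0" by (simp add: LIMSEQ_const_iff)
    then show ?thesis by (auto simp: algebra_simps)
  qed
  have pm: "measure Pr (I \<inter> ?X (int n) i) = p i" for n i
  proof -
    have "I \<inter> ?X (int n) i = sh (int n) -` (I \<inter> ?X 0 i)" using invn[of n] by auto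
    moreover have "I \<inter> ?X 0 i \<in> sets path_space" using Is coord_X_eq_events[of 0 i] by (simp add: sets_Pr)
    ultimately show ?thesis using measure_sh[of "I \<inter> ?X 0 i" "int n"] by (simp only: p_def)
  qed
  \<comment> \<open>Almost surely \<open>I\<close> contains the event X_0 = i. If it had no mass on
    X_n = j, the n-step transition from \<open>i\<close> to \<open>j\<close> would be null. By
    invariance the mass of \<open>I\<close> on X_n = j is \<open>p j\<close>.\<close>
  have step: "p j = l j" if i: "p i = l i" for i j
  proof -
    obtain n where n: "mat_pow (trans_mat \<phi> M) n i j > 0"
      using irreducible_P by (auto simp: irreducible_matrix_def)
    have pos: "emeasure Pr (?X 0 i \<inter> ?X (0 + int n) j) > 0"
      unfolding emeasure_X_pair using lam_pos[of i] n by (simp add: ennreal_zero_less_mult_iff)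
    have "?X 0 i - I \<in> null_sets Pr"
    proof (rule null_setsI)
      have "measure Pr (?X 0 i - I \<inter> ?X 0 i) = l i - p i"
        unfolding l_def p_def by (rule finite_measure_Diff) auto
      moreover have "?X 0 i - I \<inter> ?X 0 i = ?X 0 i - I" by auto
      ultimately show "emeasure Pr (?X 0 i - I) = 0" using i by (simp add: emeasure_eq_measure)
    qed auto
    have "p j \<noteq> 0"
    proof
      assume "p j = 0"
      then have "I \<inter> ?X (int n) j \<in> null_sets Pr" using pm[of n j] by (auto simp: emeasure_eq_measure)
      with \<open>?X 0 i - I \<in> null_sets Pr\<close> have N: "(?X 0 i - I) \<union> (I \<inter> ?X (int n) j) \<in> null_sets Pr"
        by (rule null_sets.Un)
      have "?X 0 i \<inter> ?X (0 + int n) j \<subseteq> (?X 0 i - I) \<union> (I \<inter> ?X (int n) j)"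
        by (intro subsetI) simp
      then have "emeasure Pr (?X 0 i \<inter> ?X (0 + int n) j) = 0"
        by (rule emeasure_eq_0[OF null_setsD2[OF N] null_setsD1[OF N]])
      then show False using pos by simp
    qed
    then show ?thesis using p01 by blast
  qed
  have split: "emeasure Pr I = (\<integral>\<^sup>+i. ennreal (p i) \<partial>count_space UNIV)"
    using emeasure_split_X[OF Is, of 0] by (simp add: p_def emeasure_eq_measure)
  show ?thesis
  proof (cases "\<exists>i. p i = l i")
    case True
    then have "p i = l i" for i using step by blast
    then have "emeasure Pr I = (\<integral>\<^sup>+i. lam i \<partial>count_space UNIV)" unfolding split by (simp add: l_def lam_def emeasure_eq_measure)
    also have "\<dots> = 1" using row_mass_lam by (simp add: row_mass_def)
    finally show ?thesis by (simp add: emeasure_eq_measure)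
  next
    case False
    then have "p i = 0" for i using p01 by blast
    then have "emeasure Pr I = 0" unfolding split by simp
    then show ?thesis by (simp add: emeasure_eq_measure)
  qed
qed

end

section \<open>Condition (C) identifies the two filters\<close>

lemma nrm_row_of:
  fixes \<mu> :: "'e::countable measure"
  assumes \<mu>: "\<mu> \<in> prob_measures (discrete_topology UNIV)"
  shows "nrm (row_of \<mu>) = \<mu>"
proof (rule PE_measure_eqI[OF nrm_prob \<mu>])
  fix i
  have "ennreal (measure (nrm (row_of \<mu>)) {i}) = ennreal (measure \<mu> {i})"
    using nrm_coord[of "row_of \<mu>" i] row_mass_row_of[OF \<mu>] row_of_eq_measure[OF \<mu>, of i] by simp
  then show "measure (nrm (row_of \<mu>)) {i} = measure \<mu> {i}" by simp
qed

lemma l1_dist_measurable: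
  fixes f g :: "'x \<Rightarrow> 'e::countable measure"
  assumes [measurable]: "f \<in> N \<rightarrow>\<^sub>M borel_of PE" "g \<in> N \<rightarrow>\<^sub>M borel_of PE"
  shows "(\<lambda>x. l1_dist (f x) (g x)) \<in> borel_measurable N"
  unfolding l1_dist_def by (rule borel_measurable_nn_integral_count_space) measurable

lemma l1_dist_eq_0:
  fixes \<mu> \<nu> :: "'e::countable measure"
  assumes "\<mu> \<in> prob_measures (discrete_topology UNIV)" "\<nu> \<in> prob_measures (discrete_topology UNIV)" "l1_dist \<mu> \<nu> = 0"
  shows "\<mu> = \<nu>"
proof (rule PE_measure_eqI[OF assms(1,2)])
  fix i
  have "ennreal \<bar>measure \<mu> {i} - measure \<nu> {i}\<bar> \<le> l1_dist \<mu> \<nu>"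
    unfolding l1_dist_def by (rule nn_integral_ge_point) simp
  then show "measure \<mu> {i} = measure \<nu> {i}" using assms(3) by simp
qed

text \<open>Let x and z be the two normalized rows. Then |v| * |x - z| is at most |v - w| plus z
  times the difference of the masses, and each of the two terms has mass at most that of
  \<open>c\<close>. If \<open>w\<close> vanishes, its normalization is arbitrary, but then
  \<open>v\<close> is below \<open>c\<close> and the distance is at most 2.\<close>

lemma l1_dist_nrm_le:
  fixes v w c :: "'e::countable \<Rightarrow> ennreal"
  assumes fin: "row_mass v < \<infinity>" "row_mass w < \<infinity>" "row_mass c < \<infinity>"
    and vw: "\<And>i. v i \<le> w i + c i" and wv: "\<And>i. w i \<le> v i + c i"
  shows "l1_dist (nrm v) (nrm w) * row_mass v \<le> 2 * row_mass c"
proof (cases "row_mass w = 0")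
  case True
  then have "w i = 0" for i by (simp add: row_mass_eq_0_iff)
  then have "row_mass v \<le> row_mass c" using vw by (intro row_mass_mono) simp
  then show ?thesis by (intro mult_mono l1_dist_le_2 nrm_prob) auto
next
  case False
  let ?x = "\<lambda>i. measure (nrm v) {i}" and ?z = "\<lambda>i. measure (nrm w) {i}"
  define ra rb rC where "ra = enn2real (row_mass v)" and "rb = enn2real (row_mass w)" and "rC = enn2real (row_mass c)"
  have ra: "row_mass v = ennreal ra" "0 \<le> ra" and rb: "row_mass w = ennreal rb" "0 \<le> rb" and rC: "row_mass c = ennreal rC" "0 \<le> rC"
    using fin by (auto simp: ra_def rb_def rC_def less_top)
  have cfin: "c i < \<infinity>" for i using row_mass_ge[of c i] fin(3) by (rule order_le_less_trans)
  have "row_mass v \<le> row_mass w + row_mass c" "row_mass w \<le> row_mass v + row_mass c"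
    unfolding row_mass_add[symmetric] using vw wv by (auto intro!: row_mass_mono)
  then have ab: "ra \<le> rb + rC" "rb \<le> ra + rC"
    using ra rb rC by (auto simp: ennreal_plus[symmetric] simp del: ennreal_plus)
  have pt: "ennreal \<bar>?x i - ?z i\<bar> * row_mass v \<le> c i + ennreal (?z i) * row_mass c" for i
  proof -
    define rc where "rc = enn2real (c i)"
    have rc: "c i = ennreal rc" "0 \<le> rc" using cfin[of i] by (auto simp: rc_def less_top)
    have v: "v i = ennreal (?x i * ra)" using nrm_coord[OF fin(1), of i] ra by (simp add: ennreal_mult)
    have w: "w i = ennreal (?z i * rb)" using nrm_coord[OF fin(2), of i] rb by (simp add: ennreal_mult)
    have z0: "0 \<le> ?z i" by simp
    have 1: "?x i * ra \<le> ?z i * rb + rc"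
      using vw[of i] ra(2) rb(2) rc(2) unfolding v w rc(1) by (simp add: ennreal_plus[symmetric] del: ennreal_plus)
    have 2: "?z i * rb \<le> ?x i * ra + rc"
      using wv[of i] ra(2) rb(2) rc(2) unfolding v w rc(1) by (simp add: ennreal_plus[symmetric] del: ennreal_plus)
    have 3: "?z i * (rb - ra) \<le> ?z i * rC" "?z i * (ra - rb) \<le> ?z i * rC"
      using ab z0 by (auto intro!: mult_left_mono)
    have "\<bar>?x i - ?z i\<bar> * ra = \<bar>?x i * ra - ?z i * ra\<bar>" using ra(2) by (simp add: abs_mult left_diff_distrib[symmetric])
    also have "\<dots> \<le> rc + ?z i * rC"
      using 1 2 3 by (simp add: algebra_simps abs_le_iff)
    finally have "ennreal (\<bar>?x i - ?z i\<bar> * ra) \<le> ennreal (rc + ?z i * rC)" by (rule ennreal_leI)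
    then show ?thesis using ra rC rc z0 by (simp add: ennreal_mult ennreal_plus)
  qed
  have "l1_dist (nrm v) (nrm w) * row_mass v = (\<integral>\<^sup>+i. ennreal \<bar>?x i - ?z i\<bar> * row_mass v \<partial>count_space UNIV)"
    unfolding l1_dist_def by (simp add: nn_integral_multc)
  also have "\<dots> \<le> (\<integral>\<^sup>+i. c i + ennreal (?z i) * row_mass c \<partial>count_space UNIV)"
    by (intro nn_integral_mono pt)
  also have "\<dots> = row_mass c + row_mass c"
    by (simp add: nn_integral_add nn_integral_multc sum_measure_PE[OF nrm_prob] row_mass_def)
  finally show ?thesis by (simp add: mult_2)
qed

section \<open>The filter recursion over several steps\<close>

context hidden_markov_model begin

lemma row_prod_joint_measurable:
  assumes [measurable]: "\<pi> \<in> K \<rightarrow>\<^sub>M borel_of PE"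
  shows "(\<lambda>x. row_prod M (snd x) n (row_of (\<pi> (fst x))) j) \<in> borel_measurable (K \<Otimes>\<^sub>M PiM {1..n} (\<lambda>_. borel))"
proof (rule row_prod_measurable)
  show "(\<lambda>x. row_of (\<pi> (fst x)) i) \<in> borel_measurable (K \<Otimes>\<^sub>M PiM {1..n} (\<lambda>_. borel))" for i by measurable
  show "(\<lambda>x. snd x k) \<in> K \<Otimes>\<^sub>M PiM {1..n} (\<lambda>_. borel) \<rightarrow>\<^sub>M borel" if "1 \<le> k" "k \<le> n" for k
    by (rule measurable_compose[OF measurable_snd measurable_component_singleton]) (use that in auto)
qed

lemma AE_filter_mass_n:
  assumes fv: "filter_version K \<pi>"
  shows "AE \<omega> in Pr. row_mass (row_prod M (yw 0 n \<omega>) n (row_of (\<pi> \<omega>))) \<noteq> 0 \<and> row_mass (row_prod M (yw 0 n \<omega>) n (row_of (\<pi> \<omega>))) < \<infinity>"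
proof -
  let ?m = "\<lambda>x. row_mass (row_prod M (snd x) n (row_of (\<pi> (fst x))))"
  let ?k = "\<lambda>x. indicator {0, \<infinity>} (?m x) :: ennreal"
  have \<pi>K: "\<pi> \<in> K \<rightarrow>\<^sub>M borel_of PE" and K: "subalgebra Pr K" using fv by (auto simp: filter_version_def)
  have mm: "?m \<in> borel_measurable (K \<Otimes>\<^sub>M PiM {1..n} (\<lambda>_. borel))"
    unfolding row_mass_def by (intro borel_measurable_nn_integral_count_space row_prod_joint_measurable \<pi>K)
  have km: "?k \<in> borel_measurable (K \<Otimes>\<^sub>M PiM {1..n} (\<lambda>_. borel))"
    by (rule measurable_compose[OF mm]) simp
  have c: "(\<lambda>\<omega>. (\<omega>, yw 0 n \<omega>)) \<in> Pr \<rightarrow>\<^sub>M K \<Otimes>\<^sub>M PiM {1..n} (\<lambda>_. borel)"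
  proof (rule measurable_Pair)
    show "(\<lambda>\<omega>. \<omega>) \<in> Pr \<rightarrow>\<^sub>M K" using K by (auto simp: measurable_def subalgebra_def)
  qed measurable
  have "(\<integral>\<^sup>+\<omega>. ?k (\<omega>, yw 0 n \<omega>) \<partial>Pr) = (\<integral>\<^sup>+\<omega>. (\<integral>\<^sup>+y. ?k (\<omega>, y) * row_mass (row_prod M y n (row_of (\<pi> \<omega>))) \<partial>phiN n) \<partial>Pr)"
    by (rule filter_path_law[OF fv km])
  also have "\<dots> = (\<integral>\<^sup>+\<omega>. 0 \<partial>Pr)"
  proof (rule nn_integral_cong)
    fix \<omega>
    have "row_mass (row_of (\<pi> \<omega>)) < \<infinity>" using row_mass_row_of[OF filter_version_prob[OF fv, of \<omega>]] by simp
    from AE_row_prod_finite[OF this, of n]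
    have "(\<integral>\<^sup>+y. ?k (\<omega>, y) * row_mass (row_prod M y n (row_of (\<pi> \<omega>))) \<partial>phiN n) = (\<integral>\<^sup>+y. 0 \<partial>phiN n)"
      by (intro nn_integral_cong_AE) (auto elim!: eventually_mono simp: indicator_def)
    then show "(\<integral>\<^sup>+y. ?k (\<omega>, y) * row_mass (row_prod M y n (row_of (\<pi> \<omega>))) \<partial>phiN n) = 0" by simp
  qed
  finally have 0: "(\<integral>\<^sup>+\<omega>. ?k (\<omega>, yw 0 n \<omega>) \<partial>Pr) = 0" by simp
  have "AE \<omega> in Pr. ?k (\<omega>, yw 0 n \<omega>) = 0"
    using 0 measurable_compose[OF c km] by (subst (asm) nn_integral_0_iff_AE) auto
  then show ?thesis by eventually_elim (auto simp: indicator_def less_top split: if_splits)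
qed

text \<open>The intermediate normalizations cancel by \<open>fstep_nrm\<close>, because the masses
  are almost surely nondegenerate at every length.\<close>

lemma filter_recursion_n:
  assumes fv: "filter_version K \<pi>" and rec: "AE \<omega> in Pr. \<pi> (sh 1 \<omega>) = fstep M (\<pi> \<omega>) (coord_Y 1 \<omega>)"
  shows "AE \<omega> in Pr. \<pi> (sh (int n) \<omega>) = nrm (row_prod M (yw 0 n \<omega>) n (row_of (\<pi> \<omega>)))"
proof (induction n)
  case 0
  show ?case by (simp add: nrm_row_of[OF filter_version_prob[OF fv]])
next
  case (Suc n)
  from Suc AE_sh[OF rec, of "int n"] AE_filter_mass_n[OF fv, of n] show ?case
  proof eventually_elim
    case (elim \<omega>)
    have "row_prod M (yw 0 (Suc n) \<omega>) n v = row_prod M (yw 0 n \<omega>) n v" for v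
      by (rule row_prod_cong) (simp add: yw_def)
    moreover have "yw 0 (Suc n) \<omega> (Suc n) = coord_Y (1 + int n) \<omega>" by (simp add: yw_def)
    moreover have "\<pi> (sh (int (Suc n)) \<omega>) = fstep M (\<pi> (sh (int n) \<omega>)) (coord_Y (1 + int n) \<omega>)"
      using elim(2) by simp
    ultimately show ?case using elim(1,3) by (simp add: fstep_nrm)
  qed
qed

section \<open>The gap between the two filters\<close>

context
  fixes \<pi>min \<pi>max
  assumes min: "is_pi_min Pr 0 \<pi>min" and max: "is_pi_max Pr 0 \<pi>max"
begin

definition filter_gap :: "('e, 'f) path \<Rightarrow> ennreal" where
  "filter_gap \<omega> = l1_dist (\<pi>max \<omega>) (\<pi>min \<omega>)"

lemmas fmin = filter_version_min[OF min] and fmax = filter_version_max[OF max]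

text \<open>Measurability for the conditioning field of \<open>\<pi>max\<close> makes smallness of
  the gap a past event, as both the growth estimate and the zero-one law require.\<close>

lemma filter_gap_measurable_tail: "filter_gap \<in> borel_measurable (sigma_tail_XY 0)"
  unfolding filter_gap_def
proof (rule l1_dist_measurable)
  show "\<pi>max \<in> sigma_tail_XY 0 \<rightarrow>\<^sub>M borel_of PE" using fmax by (simp add: filter_version_def)
  have "\<pi>min \<in> sigma_Y 0 \<rightarrow>\<^sub>M borel_of PE" using fmin by (simp add: filter_version_def)
  then show "\<pi>min \<in> sigma_tail_XY 0 \<rightarrow>\<^sub>M borel_of PE"
    using sigma_Y_subset_tail[of 0] by (auto simp: measurable_def)
qed

lemma filter_gap_measurable [measurable]: "filter_gap \<in> borel_measurable path_space"
  using measurable_from_subalg[OF subalgebra_tail filter_gap_measurable_tail] by (simp add: measurable_cong_sets[OF sets_Pr refl])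

lemma filter_gap_sh_measurable [measurable]: "(\<lambda>\<omega>. filter_gap (sh c \<omega>)) \<in> borel_measurable path_space"
  by (rule measurable_compose[OF sh_measurable filter_gap_measurable])

lemma filter_gap_le_2: "filter_gap \<omega> \<le> 2"
  unfolding filter_gap_def by (intro l1_dist_le_2 filter_version_prob[OF fmin] filter_version_prob[OF fmax])

text \<open>
  Given the past, the observations have density \<open>\<pi>\<^sup>m\<^sup>a\<^sup>x M(y\<^sub>1) \<dots> M(y\<^sub>n) 1\<close>, and
  multiplication by the matrices does not increase the \<open>l\<^sup>1\<close>-distance of unnormalized
  filters on average; normalization costs the factor 2.
\<close>
lemma filter_gap_growth:
  assumes B: "B \<in> sets (sigma_tail_XY 0)"
  shows "(\<integral>\<^sup>+\<omega>. indicator B \<omega> * filter_gap (sh (int n) \<omega>) \<partial>Pr) \<le> 2 * (\<integral>\<^sup>+\<omega>. indicator B \<omega> * filter_gap \<omega> \<partial>Pr)"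
proof -
  let ?K = "sigma_tail_XY 0 :: ('e, 'f) path measure"
  let ?N = "PiM {1..n} (\<lambda>_. borel) :: (nat \<Rightarrow> 'f) measure"
  have mK: "\<pi>max \<in> ?K \<rightarrow>\<^sub>M borel_of PE" using fmax by (simp add: filter_version_def)
  have mK': "\<pi>min \<in> ?K \<rightarrow>\<^sub>M borel_of PE"
    using fmin sigma_Y_subset_tail[of 0] by (auto simp: measurable_def filter_version_def)
  let ?l = "\<lambda>(\<omega>, y). l1_dist (nrm (row_prod M y n (row_of (\<pi>max \<omega>)))) (nrm (row_prod M y n (row_of (\<pi>min \<omega>))))"
  let ?k = "\<lambda>x. indicator B (fst x) * ?l x"
  have lm: "?l \<in> borel_measurable (?K \<Otimes>\<^sub>M ?N)"
    unfolding case_prod_beta by (intro l1_dist_measurable nrm_measurable row_prod_joint_measurable mK mK')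
  have km: "?k \<in> borel_measurable (?K \<Otimes>\<^sub>M ?N)"
    using B by (intro borel_measurable_times_ennreal lm measurable_compose[OF measurable_fst borel_measurable_indicator])
  have "(\<integral>\<^sup>+\<omega>. indicator B \<omega> * filter_gap (sh (int n) \<omega>) \<partial>Pr) = (\<integral>\<^sup>+\<omega>. ?k (\<omega>, yw 0 n \<omega>) \<partial>Pr)"
    using filter_recursion_n[OF fmin pi_min_recursion[OF min], of n] filter_recursion_n[OF fmax pi_max_recursion[OF max], of n]
    by (intro nn_integral_cong_AE, eventually_elim) (simp add: filter_gap_def)
  also have "\<dots> = (\<integral>\<^sup>+\<omega>. (\<integral>\<^sup>+y. ?k (\<omega>, y) * row_mass (row_prod M y n (row_of (\<pi>max \<omega>))) \<partial>phiN n) \<partial>Pr)"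
    by (rule filter_path_law[OF fmax km])
  also have "\<dots> \<le> (\<integral>\<^sup>+\<omega>. 2 * (indicator B \<omega> * filter_gap \<omega>) \<partial>Pr)"
  proof (rule nn_integral_mono)
    fix \<omega>
    let ?v = "row_of (\<pi>max \<omega>)" and ?w = "row_of (\<pi>min \<omega>)"
    let ?d = "\<lambda>i. ennreal \<bar>measure (\<pi>max \<omega>) {i} - measure (\<pi>min \<omega>) {i}\<bar>"
    note P = filter_version_prob[OF fmax, of \<omega>] filter_version_prob[OF fmin, of \<omega>]
    have d: "row_mass ?d = filter_gap \<omega>" by (simp add: row_mass_def filter_gap_def l1_dist_def)
    have dfin: "row_mass ?d < \<infinity>" unfolding d using filter_gap_le_2[of \<omega>] by (rule order_le_less_trans) simp
    \<comment> \<open>The vector \<open>?d\<close> dominates the difference of the filters in both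
      directions. This order survives multiplication by nonnegative matrices, and the mass of the
      resulting product integrates to the gap.\<close>
    have vw: "?v i \<le> ?w i + ?d i" "?w i \<le> ?v i + ?d i" for i
      unfolding row_of_eq_measure[OF P(1)] row_of_eq_measure[OF P(2)]
      by (auto simp: ennreal_plus[symmetric] simp del: ennreal_plus)
    have "(\<integral>\<^sup>+y. ?k (\<omega>, y) * row_mass (row_prod M y n ?v) \<partial>phiN n) \<le> (\<integral>\<^sup>+y. indicator B \<omega> * (2 * row_mass (row_prod M y n ?d)) \<partial>phiN n)"
    proof (rule nn_integral_mono_AE)
      have f: "row_mass ?v < \<infinity>" "row_mass ?w < \<infinity>" using row_mass_row_of[OF P(1)] row_mass_row_of[OF P(2)] by auto
      show "AE y in phiN n. ?k (\<omega>, y) * row_mass (row_prod M y n ?v) \<le> indicator B \<omega> * (2 * row_mass (row_prod M y n ?d))"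
        using AE_row_prod_finite[OF f(1), of n] AE_row_prod_finite[OF f(2), of n] AE_row_prod_finite[OF dfin, of n]
      proof eventually_elim
        case (elim y)
        have "row_prod M y n ?v i \<le> row_prod M y n ?w i + row_prod M y n ?d i"
          "row_prod M y n ?w i \<le> row_prod M y n ?v i + row_prod M y n ?d i" for i
          unfolding row_prod_add[symmetric] by (auto intro!: row_prod_mono vw)
        then have "l1_dist (nrm (row_prod M y n ?v)) (nrm (row_prod M y n ?w)) * row_mass (row_prod M y n ?v) \<le> 2 * row_mass (row_prod M y n ?d)"
          using elim by (intro l1_dist_nrm_le) auto
        then show ?case by (simp add: mult.assoc mult_left_mono)
      qed
    qed
    also have "\<dots> = indicator B \<omega> * (2 * filter_gap \<omega>)"
      by (simp add: nn_integral_cmult nn_integral_row_mass_row_prod d measurable_cong_sets[OF sets_phiN refl])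
    finally show "(\<integral>\<^sup>+y. ?k (\<omega>, y) * row_mass (row_prod M y n ?v) \<partial>phiN n) \<le> 2 * (indicator B \<omega> * filter_gap \<omega>)"
      by (simp add: mult_ac)
  qed
  also have "\<dots> = 2 * (\<integral>\<^sup>+\<omega>. indicator B \<omega> * filter_gap \<omega> \<partial>Pr)"
  proof (rule nn_integral_cmult)
    have [measurable]: "B \<in> sets Pr" using B subalgebra_tail by (auto simp: subalgebra_def)
    show "(\<lambda>\<omega>. indicator B \<omega> * filter_gap \<omega>) \<in> borel_measurable Pr" by measurable
  qed
  finally show ?thesis .
qed

text \<open>Optional stopping in inductive form. The growth estimate is applied a single time, from
  the first time at which the gap is below \<open>e\<close>, so its factor 2 does not accumulate; if
  there is no such time up to \<open>n\<close>, the gap is still at most 2. The event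
  \<open>T\<close> is arbitrary in order to carry the information that the gap has not been small so
  far.\<close>

lemma filter_gap_stopping:
  assumes "T \<in> sets (sigma_tail_XY 0)"
  shows "(\<integral>\<^sup>+\<omega>. indicator T \<omega> * filter_gap (sh (int n) \<omega>) \<partial>Pr) \<le>
    2 * ennreal e * emeasure Pr T + 2 * emeasure Pr (T \<inter> {\<omega>. \<forall>k\<le>n. \<not> filter_gap (sh (int k) \<omega>) < ennreal e})"
  using assms
proof (induction n arbitrary: T)
  case 0
  have T[measurable]: "T \<in> sets Pr" using 0 subalgebra_tail by (auto simp: subalgebra_def)
  let ?G = "{\<omega>. \<not> filter_gap \<omega> < ennreal e}"
  have "{\<omega> \<in> space Pr. \<not> filter_gap \<omega> < ennreal e} \<in> sets Pr" by measurable
  then have G[measurable]: "?G \<in> sets Pr" by simp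
  have "(\<integral>\<^sup>+\<omega>. indicator T \<omega> * filter_gap \<omega> \<partial>Pr) \<le> (\<integral>\<^sup>+\<omega>. 2 * ennreal e * indicator T \<omega> + 2 * indicator (T \<inter> ?G) \<omega> \<partial>Pr)"
  proof (rule nn_integral_mono)
    fix \<omega>
    show "indicator T \<omega> * filter_gap \<omega> \<le> 2 * ennreal e * indicator T \<omega> + 2 * indicator (T \<inter> ?G) \<omega>"
    proof (cases "filter_gap \<omega> < ennreal e")
      case True
      then have "filter_gap \<omega> \<le> 2 * ennreal e"
        by (metis add_increasing2 mult_2 order_less_imp_le zero_le)
      then show ?thesis by (simp add: indicator_def add_increasing2)
    next
      case False
      then show ?thesis using filter_gap_le_2[of \<omega>] by (auto simp: indicator_def add_increasing)
    qed
  qed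
  also have "\<dots> = 2 * ennreal e * emeasure Pr T + 2 * emeasure Pr (T \<inter> ?G)"
    by (simp add: nn_integral_add nn_integral_cmult_indicator)
  finally show ?case by simp
next
  case (Suc n)
  let ?B = "{\<omega>. filter_gap \<omega> < ennreal e}"
  let ?G = "\<lambda>n. {\<omega>. \<forall>k\<le>n. \<not> filter_gap (sh (int k) \<omega>) < ennreal e}"
  have "{\<omega> \<in> space (sigma_tail_XY 0). filter_gap \<omega> < ennreal e} \<in> sets (sigma_tail_XY 0)"
    using filter_gap_measurable_tail by measurable
  then have Bt: "?B \<in> sets (sigma_tail_XY 0)" by simp
  have TB: "T \<inter> ?B \<in> sets (sigma_tail_XY 0)" "T - ?B \<in> sets (sigma_tail_XY 0)" using Suc.prems Bt by auto
  have s[measurable]: "T \<in> sets Pr" "T \<inter> ?B \<in> sets Pr" "T - ?B \<in> sets Pr"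
    using TB Suc.prems subalgebra_tail by (auto simp: subalgebra_def)
  have G: "?G n \<in> sets path_space" for n
  proof -
    have "{\<omega> \<in> space path_space. \<forall>k\<in>{..n}. \<not> filter_gap (sh (int k) \<omega>) < ennreal e} \<in> sets path_space"
    proof (rule sets.sets_Collect_finite_All)
      fix k
      show "{\<omega> \<in> space path_space. \<not> filter_gap (sh (int k) \<omega>) < ennreal e} \<in> sets path_space"
        by measurable
    qed simp
    moreover have "{\<omega> \<in> space path_space. \<forall>k\<in>{..n}. \<not> filter_gap (sh (int k) \<omega>) < ennreal e} = ?G n" by auto
    ultimately show ?thesis by simp
  qed
  \<comment> \<open>Seen from time 1, the event that the gap was not small at time 0 belongs to the
    past, so the induction hypothesis applies one step later.\<close>
  let ?T' = "sh (-1) -` (T - ?B)"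
  have T': "?T' \<in> sets (sigma_tail_XY 0)"
  proof -
    have "sh (-1) \<in> sigma_tail_XY (-1) \<rightarrow>\<^sub>M (sigma_tail_XY 0 :: ('e, 'f) path measure)"
      using sh_measurable_sigma_tail[of "-1" 0] by simp
    from measurable_sets[OF this TB(2)] show ?thesis using sigma_tail_mono[of "-1" 0] by auto
  qed
  have sh1: "sh (-1) (sh 1 \<omega>) = \<omega>" for \<omega> :: "('e, 'f) path" by simp
  have "(\<integral>\<^sup>+\<omega>. indicator T \<omega> * filter_gap (sh (int (Suc n)) \<omega>) \<partial>Pr) =
    (\<integral>\<^sup>+\<omega>. indicator (T \<inter> ?B) \<omega> * filter_gap (sh (int (Suc n)) \<omega>) \<partial>Pr) + (\<integral>\<^sup>+\<omega>. indicator (T - ?B) \<omega> * filter_gap (sh (int (Suc n)) \<omega>) \<partial>Pr)"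
    by (subst nn_integral_add[symmetric]) (auto intro!: nn_integral_cong simp: indicator_def)
  also have "\<dots> \<le> 2 * ennreal e * emeasure Pr (T \<inter> ?B) + (2 * ennreal e * emeasure Pr (T - ?B) + 2 * emeasure Pr (T \<inter> ?G (Suc n)))"
  proof (rule add_mono)
    have "(\<integral>\<^sup>+\<omega>. indicator (T \<inter> ?B) \<omega> * filter_gap (sh (int (Suc n)) \<omega>) \<partial>Pr) \<le> 2 * (\<integral>\<^sup>+\<omega>. indicator (T \<inter> ?B) \<omega> * filter_gap \<omega> \<partial>Pr)"
      by (rule filter_gap_growth[OF TB(1)])
    also have "\<dots> \<le> 2 * (\<integral>\<^sup>+\<omega>. ennreal e * indicator (T \<inter> ?B) \<omega> \<partial>Pr)"
      by (intro mult_left_mono nn_integral_mono) (auto simp: indicator_def)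
    also have "\<dots> = 2 * ennreal e * emeasure Pr (T \<inter> ?B)"
      by (simp add: nn_integral_cmult_indicator mult.assoc)
    finally show "(\<integral>\<^sup>+\<omega>. indicator (T \<inter> ?B) \<omega> * filter_gap (sh (int (Suc n)) \<omega>) \<partial>Pr) \<le> 2 * ennreal e * emeasure Pr (T \<inter> ?B)" .
    have T'm: "?T' \<in> sets path_space" using T' subalgebra_tail by (auto simp: subalgebra_def sets_Pr)
    have "(\<integral>\<^sup>+\<omega>. indicator (T - ?B) \<omega> * filter_gap (sh (int (Suc n)) \<omega>) \<partial>Pr) = (\<integral>\<^sup>+\<omega>. indicator ?T' (sh 1 \<omega>) * filter_gap (sh (int n) (sh 1 \<omega>)) \<partial>Pr)"
    proof (rule nn_integral_cong)
      fix \<omega> :: "('e, 'f) path"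
      have "sh (int (Suc n)) \<omega> = sh (int n) (sh 1 \<omega>)" by (simp add: add.commute)
      moreover have "indicator ?T' (sh 1 \<omega>) = (indicator (T - ?B) \<omega> :: ennreal)" by (simp only: indicator_def vimage_eq sh1)
      ultimately show "indicator (T - ?B) \<omega> * filter_gap (sh (int (Suc n)) \<omega>) = indicator ?T' (sh 1 \<omega>) * filter_gap (sh (int n) (sh 1 \<omega>))"
        by simp
    qed
    also have "\<dots> = (\<integral>\<^sup>+\<omega>. indicator ?T' \<omega> * filter_gap (sh (int n) \<omega>) \<partial>Pr)"
      using T'm by (intro nn_integral_sh[of "\<lambda>\<omega>. indicator ?T' \<omega> * filter_gap (sh (int n) \<omega>)"]) measurable
    also have "\<dots> \<le> 2 * ennreal e * emeasure Pr ?T' + 2 * emeasure Pr (?T' \<inter> ?G n)"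
      by (rule Suc.IH[OF T'])
    also have "emeasure Pr ?T' = emeasure Pr (T - ?B)" using s(3) by (intro emeasure_sh) (simp add: sets_Pr)
    also have "emeasure Pr (?T' \<inter> ?G n) = emeasure Pr (T \<inter> ?G (Suc n))"
    proof -
      have "?T' \<inter> ?G n = sh (-1) -` (T \<inter> ?G (Suc n))"
      proof (intro set_eqI)
        fix \<omega> :: "('e, 'f) path"
        have "(\<forall>k\<le>Suc n. \<not> filter_gap (sh (int k) (sh (-1) \<omega>)) < ennreal e) \<longleftrightarrow>
          \<not> filter_gap (sh (-1) \<omega>) < ennreal e \<and> (\<forall>k\<le>n. \<not> filter_gap (sh (int k) \<omega>) < ennreal e)"
        proof -
          have "(\<forall>k\<le>Suc n. P k) \<longleftrightarrow> P 0 \<and> (\<forall>k\<le>n. P (Suc k))" for P by (metis Suc_le_mono le0 not0_implies_Suc)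
          moreover have "sh (int (Suc k)) (sh (-1) \<omega>) = sh (int k) \<omega>" for k by simp
          ultimately show ?thesis by simp
        qed
        then show "\<omega> \<in> ?T' \<inter> ?G n \<longleftrightarrow> \<omega> \<in> sh (-1) -` (T \<inter> ?G (Suc n))" by simp
      qed
      moreover have "T \<inter> ?G (Suc n) \<in> sets path_space" using G s(1) by (auto simp: sets_Pr)
      ultimately show ?thesis by (simp only: emeasure_sh)
    qed
    finally show "(\<integral>\<^sup>+\<omega>. indicator (T - ?B) \<omega> * filter_gap (sh (int (Suc n)) \<omega>) \<partial>Pr) \<le> 2 * ennreal e * emeasure Pr (T - ?B) + 2 * emeasure Pr (T \<inter> ?G (Suc n))" .
  qed
  also have "\<dots> = 2 * ennreal e * emeasure Pr T + 2 * emeasure Pr (T \<inter> ?G (Suc n))"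
  proof -
    have "emeasure Pr (T \<inter> ?B) + emeasure Pr (T - ?B) = emeasure Pr ((T \<inter> ?B) \<union> (T - ?B))"
      using s by (intro plus_emeasure) auto
    also have "(T \<inter> ?B) \<union> (T - ?B) = T" by auto
    finally show ?thesis by (simp add: add.assoc[symmetric] distrib_left[symmetric])
  qed
  finally show ?case .
qed

text \<open>The zero-one law concerns past events, so small gaps are looked for backwards in time.
  That they occur at infinitely many negative times is an invariant event of
  \<open>sigma_XY 0 0\<close>, whose probability is at least that of a small gap at time 0, hence 1.
  Stationarity turns the backward waiting time into the forward one.\<close>

lemma filter_gap_returns:
  assumes pos: "emeasure Pr {\<omega>. filter_gap \<omega> < ennreal e} > 0"
  shows "(\<lambda>n. emeasure Pr {\<omega>. \<forall>k\<le>n. \<not> filter_gap (sh (int k) \<omega>) < ennreal e}) \<longlonglongrightarrow> 0"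
proof -
  let ?B = "{\<omega>. filter_gap \<omega> < ennreal e}"
  let ?Bk = "\<lambda>k. {\<omega>. filter_gap (sh (- int k) \<omega>) < ennreal e}"
  let ?U = "\<lambda>m. \<Union>k\<in>{m..}. ?Bk k"
  let ?I = "\<Inter>m. ?U m"
  have "{\<omega> \<in> space (sigma_tail_XY 0). filter_gap \<omega> < ennreal e} \<in> sets (sigma_tail_XY 0)"
    using filter_gap_measurable_tail by measurable
  then have Bt: "?B \<in> sets (sigma_tail_XY 0)" by simp
  have Bk: "?Bk k \<in> sets (sigma_XY 0 0)" for k
  proof -
    have "sh (- int k) \<in> sigma_tail_XY (- int k) \<rightarrow>\<^sub>M (sigma_tail_XY 0 :: ('e, 'f) path measure)"
      using sh_measurable_sigma_tail[of "- int k" 0] by simp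
    from measurable_sets[OF this Bt] have "?Bk k \<in> sets (sigma_tail_XY (- int k))" by (simp add: vimage_def)
    then show ?thesis using sigma_tail_mono[of "- int k" 0] sigma_tail_subset[of 0] by auto
  qed
  have Bs: "?Bk k \<in> sets Pr" for k using Bk[of k] subalgebra_XY by (auto simp: subalgebra_def)
  have Us: "?U m \<in> sets Pr" for m using Bs by auto
  have I: "?I \<in> sets (sigma_XY 0 0)" using Bk by auto
  have inv: "sh 1 -` ?I = ?I"
  proof (intro set_eqI)
    fix \<omega> :: "('e, 'f) path"
    have 1: "sh (- int (Suc k)) (sh 1 \<omega>) = sh (- int k) \<omega>" for k by simp
    have iff: "\<omega>' \<in> ?I \<longleftrightarrow> (\<forall>m. \<exists>k\<ge>m. filter_gap (sh (- int k) \<omega>') < ennreal e)" for \<omega>' by auto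
    have "(\<forall>m. \<exists>k\<ge>m. P k) \<longleftrightarrow> (\<forall>m. \<exists>k\<ge>m. P (Suc k))" for P :: "nat \<Rightarrow> bool"
      by (metis Suc_le_D Suc_le_mono le_SucI)
    from this[of "\<lambda>k. filter_gap (sh (- int k) (sh 1 \<omega>)) < ennreal e"]
    have "(\<forall>m. \<exists>k\<ge>m. filter_gap (sh (- int k) (sh 1 \<omega>)) < ennreal e) \<longleftrightarrow> (\<forall>m. \<exists>k\<ge>m. filter_gap (sh (- int k) \<omega>) < ennreal e)"
      unfolding 1 .
    then show "\<omega> \<in> sh 1 -` ?I \<longleftrightarrow> \<omega> \<in> ?I" unfolding vimage_eq iff .
  qed
  have PB: "measure Pr (?Bk k) = measure Pr ?B" for k
  proof -
    have "?Bk k = sh (- int k) -` ?B" by auto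
    moreover have "?B \<in> sets path_space" using Bt subalgebra_tail by (auto simp: subalgebra_def sets_Pr)
    ultimately show ?thesis by (simp only: measure_sh)
  qed
  have lim: "(\<lambda>m. measure Pr (?U m)) \<longlonglongrightarrow> measure Pr ?I"
  proof (rule finite_Lim_measure_decseq)
    show "decseq ?U" unfolding decseq_def by (intro allI impI UN_mono) auto
  qed (use Us in auto)
  have leU: "measure Pr ?B \<le> measure Pr (?U m)" for m
    unfolding PB[of m, symmetric] by (rule finite_measure_mono) (use Us in auto)
  have "measure Pr ?B \<le> measure Pr ?I" by (rule LIMSEQ_le_const[OF lim]) (use leU in blast)
  then have "measure Pr ?I \<noteq> 0" using pos by (auto simp: emeasure_eq_measure)
  then have "measure Pr ?I = 1" using invariant_past_event_0_1[OF I inv] by blast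
  moreover have "measure Pr ?I \<le> measure Pr (?U 0)" by (rule finite_measure_mono[OF _ Us]) blast
  ultimately have U0: "measure Pr (?U 0) = 1" using prob_le_1[of "?U 0"] by linarith
  let ?D = "\<lambda>n. {\<omega>. \<forall>k\<le>n. \<not> filter_gap (sh (- int k) \<omega>) < ennreal e}"
  have Dm: "?D n \<in> sets Pr" for n
  proof -
    have "?D n = UNIV - (\<Union>k\<in>{..n}. ?Bk k)" by auto
    then show ?thesis using Bs sets.top[of Pr] by (auto intro!: sets.Diff sets.finite_UN)
  qed
  have "(\<lambda>n. emeasure Pr (?D n)) \<longlonglongrightarrow> emeasure Pr (\<Inter>n. ?D n)"
    by (rule Lim_emeasure_decseq) (use Dm in \<open>auto simp: decseq_def\<close>)
  moreover have "emeasure Pr (\<Inter>n. ?D n) = 0"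
  proof -
    have "(\<Inter>n. ?D n) = space Pr - ?U 0" by auto
    moreover have "measure Pr (space Pr - ?U 0) = 0" using prob_compl[OF Us[of 0]] U0 by simp
    ultimately show ?thesis by (simp add: emeasure_eq_measure)
  qed
  moreover have "emeasure Pr {\<omega>. \<forall>k\<le>n. \<not> filter_gap (sh (int k) \<omega>) < ennreal e} = emeasure Pr (?D n)" for n
  proof -
    have "{\<omega>. \<forall>k\<le>n. \<not> filter_gap (sh (int k) \<omega>) < ennreal e} = sh (int n) -` ?D n"
    proof (intro set_eqI)
      fix \<omega> :: "('e, 'f) path"
      \<comment> \<open>Reversal of the time axis: the times 0, ..., n are the last n + 1 times when
        seen from time n.\<close>
      have "(\<forall>k\<le>n. P k) \<longleftrightarrow> (\<forall>k\<le>n. P (n - k))" for P :: "nat \<Rightarrow> bool" by (metis diff_diff_cancel diff_le_self)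
      from this[of "\<lambda>k. \<not> filter_gap (sh (int k) \<omega>) < ennreal e"]
      have "(\<forall>k\<le>n. \<not> filter_gap (sh (int k) \<omega>) < ennreal e) \<longleftrightarrow> (\<forall>k\<le>n. \<not> filter_gap (sh (int (n - k)) \<omega>) < ennreal e)" .
      also have "\<dots> \<longleftrightarrow> (\<forall>k\<le>n. \<not> filter_gap (sh (- int k) (sh (int n) \<omega>)) < ennreal e)"
        by (auto simp: of_nat_diff)
      finally show "\<omega> \<in> {\<omega>. \<forall>k\<le>n. \<not> filter_gap (sh (int k) \<omega>) < ennreal e} \<longleftrightarrow> \<omega> \<in> sh (int n) -` ?D n" by simp
    qed
    then show ?thesis using emeasure_sh[of "?D n" "int n"] Dm[of n] by (simp only: sets_Pr)
  qed
  ultimately show ?thesis by simp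
qed

text \<open>With positive probability both filters lie in \<open>S\<close>. Given the past, the next
  \<open>N\<close> observations have a density that is positive on \<open>Ob\<close>, so they fall
  into \<open>Ob\<close> with positive probability. Condition (C) then makes the gap small at time
  \<open>N\<close>, and stationarity moves this to time 0.\<close>

lemma filter_gap_pos:
  assumes C: "condition_C \<phi> M Pr \<pi>min \<pi>max" and e: "e > 0"
  shows "emeasure Pr {\<omega>. filter_gap \<omega> < ennreal e} > 0"
proof -
  from C[unfolded condition_C_def, rule_format, OF e] obtain N S Ob where
    S: "S \<in> sets (borel_of PE)" and Ob: "Ob \<in> sets (PiM {1..N} (\<lambda>_. borel))"
    and PS: "measure Pr {\<omega> \<in> space Pr. \<pi>min \<omega> \<in> S \<and> \<pi>max \<omega> \<in> S} > 0"
    and POb: "emeasure (phiN N) Ob > 0"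
    and pos: "\<And>\<mu> y. \<mu> \<in> S \<Longrightarrow> y \<in> Ob \<Longrightarrow> row_mass (row_prod M y N (row_of \<mu>)) > 0"
    and tv: "\<And>\<mu> \<nu> y. \<mu> \<in> S \<Longrightarrow> \<nu> \<in> S \<Longrightarrow> y \<in> Ob \<Longrightarrow>
       tv_norm (normalized (row_prod M y N (row_of \<mu>))) (normalized (row_prod M y N (row_of \<nu>))) < e"
    by blast
  let ?E = "{\<omega>. \<pi>min \<omega> \<in> S \<and> \<pi>max \<omega> \<in> S}"
  let ?K = "sigma_tail_XY 0 :: ('e, 'f) path measure"
  have mK[measurable]: "\<pi>max \<in> ?K \<rightarrow>\<^sub>M borel_of PE" using fmax by (simp add: filter_version_def)
  have mK'[measurable]: "\<pi>min \<in> ?K \<rightarrow>\<^sub>M borel_of PE"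
    using fmin sigma_Y_subset_tail[of 0] by (auto simp: measurable_def filter_version_def)
  have "{\<omega> \<in> space ?K. \<pi>min \<omega> \<in> S \<and> \<pi>max \<omega> \<in> S} \<in> sets ?K" using S by measurable
  then have E: "?E \<in> sets ?K" by simp
  then have Es: "?E \<in> sets Pr" using subalgebra_tail by (auto simp: subalgebra_def)
  let ?k = "\<lambda>x. indicator ?E (fst x) * indicator Ob (snd x) :: ennreal"
  have km: "?k \<in> borel_measurable (?K \<Otimes>\<^sub>M PiM {1..N} (\<lambda>_. borel))"
    using E Ob by (intro borel_measurable_times_ennreal measurable_compose[OF measurable_fst borel_measurable_indicator] measurable_compose[OF measurable_snd borel_measurable_indicator])
  have Am: "?E \<inter> yw 0 N -` Ob \<in> sets Pr"
    using measurable_sets[OF yw_measurable Ob, of 0] by (intro sets.Int[OF Es]) (simp add: sets_Pr)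
  have inner: "(\<integral>\<^sup>+y. indicator Ob y * row_mass (row_prod M y N (row_of \<mu>)) \<partial>phiN N) \<noteq> 0" if "\<mu> \<in> S" for \<mu>
  proof
    assume "(\<integral>\<^sup>+y. indicator Ob y * row_mass (row_prod M y N (row_of \<mu>)) \<partial>phiN N) = 0"
    moreover have "(\<lambda>y. indicator Ob y * row_mass (row_prod M y N (row_of \<mu>))) \<in> borel_measurable (phiN N)"
      using Ob by (subst measurable_cong_sets[OF sets_phiN refl])
        (intro borel_measurable_times_ennreal borel_measurable_indicator row_mass_row_prod_phiN)
    ultimately have "AE y in phiN N. indicator Ob y * row_mass (row_prod M y N (row_of \<mu>)) = 0"
      by (simp add: nn_integral_0_iff_AE)
    then have "AE y in phiN N. y \<notin> Ob"
    proof eventually_elim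
      case (elim y)
      show ?case
      proof
        assume y: "y \<in> Ob"
        show False using pos[OF that y] elim y by simp
      qed
    qed
    then have "Ob \<in> null_sets (phiN N)" using Ob by (subst (asm) AE_iff_null_sets[symmetric]) (auto simp: sets_phiN)
    then show False using POb by auto
  qed
  have "emeasure Pr (?E \<inter> yw 0 N -` Ob) = (\<integral>\<^sup>+\<omega>. ?k (\<omega>, yw 0 N \<omega>) \<partial>Pr)"
    using Am by (subst nn_integral_indicator[symmetric]) (auto intro!: nn_integral_cong simp: indicator_def simp del: nn_integral_indicator)
  also have "\<dots> = (\<integral>\<^sup>+\<omega>. (\<integral>\<^sup>+y. ?k (\<omega>, y) * row_mass (row_prod M y N (row_of (\<pi>max \<omega>))) \<partial>phiN N) \<partial>Pr)"
    by (rule filter_path_law[OF fmax km])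
  finally have law: "emeasure Pr (?E \<inter> yw 0 N -` Ob) = (\<integral>\<^sup>+\<omega>. (\<integral>\<^sup>+y. ?k (\<omega>, y) * row_mass (row_prod M y N (row_of (\<pi>max \<omega>))) \<partial>phiN N) \<partial>Pr)" .
  have "emeasure Pr (?E \<inter> yw 0 N -` Ob) \<noteq> 0"
  proof
    assume 0: "emeasure Pr (?E \<inter> yw 0 N -` Ob) = 0"
    then have "AE \<omega> in Pr. \<omega> \<notin> ?E \<inter> yw 0 N -` Ob" using Am by (intro AE_not_in) auto
    interpret SN: sigma_finite_measure "phiN N" by (rule sigma_finite_phiN)
    have jm: "(\<lambda>x. ?k x * row_mass (row_prod M (snd x) N (row_of (\<pi>max (fst x))))) \<in> borel_measurable (?K \<Otimes>\<^sub>M phiN N)"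
    proof -
      have "(\<lambda>x. ?k x * row_mass (row_prod M (snd x) N (row_of (\<pi>max (fst x))))) \<in> borel_measurable (?K \<Otimes>\<^sub>M PiM {1..N} (\<lambda>_. borel))"
        unfolding row_mass_def by (intro borel_measurable_times_ennreal[OF km] borel_measurable_nn_integral_count_space row_prod_joint_measurable mK)
      then show ?thesis by (subst measurable_cong_sets[OF sets_pair_measure_cong[OF refl sets_phiN] refl])
    qed
    have im: "(\<lambda>\<omega>. \<integral>\<^sup>+y. ?k (\<omega>, y) * row_mass (row_prod M y N (row_of (\<pi>max \<omega>))) \<partial>phiN N) \<in> borel_measurable Pr"
      using measurable_from_subalg[OF subalgebra_tail SN.borel_measurable_nn_integral_fst[OF jm]] by simp
    have "AE \<omega> in Pr. (\<integral>\<^sup>+y. ?k (\<omega>, y) * row_mass (row_prod M y N (row_of (\<pi>max \<omega>))) \<partial>phiN N) = 0"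
      using im 0 unfolding law by (simp add: nn_integral_0_iff_AE)
    then have "AE \<omega> in Pr. \<omega> \<notin> ?E"
    proof eventually_elim
      case (elim \<omega>)
      show ?case
      proof
        assume w: "\<omega> \<in> ?E"
        then show False using elim inner[of "\<pi>max \<omega>"] by simp
      qed
    qed
    then have "?E \<in> null_sets Pr" using Es by (subst (asm) AE_iff_null_sets[symmetric]) auto
    then show False using PS by (auto simp: measure_def null_sets_def)
  qed
  moreover have "AE \<omega> in Pr. \<omega> \<in> ?E \<inter> yw 0 N -` Ob \<longrightarrow> filter_gap (sh (int N) \<omega>) < ennreal e"
    using filter_recursion_n[OF fmin pi_min_recursion[OF min], of N] filter_recursion_n[OF fmax pi_max_recursion[OF max], of N]
      AE_filter_mass_n[OF fmin, of N] AE_filter_mass_n[OF fmax, of N]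
  proof eventually_elim
    case (elim \<omega>)
    show ?case
    proof
      assume w: "\<omega> \<in> ?E \<inter> yw 0 N -` Ob"
      let ?a = "nrm (row_prod M (yw 0 N \<omega>) N (row_of (\<pi>max \<omega>)))" and ?b = "nrm (row_prod M (yw 0 N \<omega>) N (row_of (\<pi>min \<omega>)))"
      have "filter_gap (sh (int N) \<omega>) = l1_dist ?a ?b" using elim by (simp add: filter_gap_def)
      also have "\<dots> \<le> ennreal (tv_norm ?a ?b)" by (intro l1_dist_le_tv_norm nrm_prob)
      \<comment> \<open>Condition (C) speaks of \<open>normalized\<close>; by nondegeneracy of the
        masses it coincides here with \<open>nrm\<close>.\<close>
      also have "tv_norm ?a ?b < e"
        using tv[of "\<pi>max \<omega>" "\<pi>min \<omega>" "yw 0 N \<omega>"] w elim by (auto simp: nrm_def)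
      then have "ennreal (tv_norm ?a ?b) < ennreal e" using e by (simp add: ennreal_lessI)
      finally show "filter_gap (sh (int N) \<omega>) < ennreal e" .
    qed
  qed
  ultimately have "emeasure Pr (sh (int N) -` {\<omega>. filter_gap \<omega> < ennreal e}) \<noteq> 0"
  proof -
    assume ne: "emeasure Pr (?E \<inter> yw 0 N -` Ob) \<noteq> 0" and ae: "AE \<omega> in Pr. \<omega> \<in> ?E \<inter> yw 0 N -` Ob \<longrightarrow> filter_gap (sh (int N) \<omega>) < ennreal e"
    have "{\<omega> \<in> space Pr. filter_gap (sh (int N) \<omega>) < ennreal e} \<in> sets Pr" by measurable
    then have m: "sh (int N) -` {\<omega>. filter_gap \<omega> < ennreal e} \<in> sets Pr" by (simp add: vimage_def)
    have "emeasure Pr (?E \<inter> yw 0 N -` Ob) \<le> emeasure Pr (sh (int N) -` {\<omega>. filter_gap \<omega> < ennreal e})"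
      using ae by (intro emeasure_mono_AE m) simp
    then show ?thesis using ne by auto
  qed
  moreover have "{\<omega> \<in> space path_space. filter_gap \<omega> < ennreal e} \<in> sets path_space" by measurable
  then have "{\<omega>. filter_gap \<omega> < ennreal e} \<in> sets path_space" by simp
  ultimately show ?thesis using emeasure_sh[of "{\<omega>. filter_gap \<omega> < ennreal e}" "int N"]
    by (simp only: zero_less_iff_neq_zero not_False_eq_True)
qed

text \<open>The mean gap is the same at all times, so it is bounded by its estimate at time
  \<open>n\<close>: 2e plus twice the probability that no small gap has occurred. Let
  \<open>n\<close> tend to infinity, then \<open>e\<close> to 0.\<close>

lemma condition_C_imp_pi_min_eq_pi_max:
  assumes C: "condition_C \<phi> M Pr \<pi>min \<pi>max"
  shows "AE \<omega> in Pr. \<pi>min \<omega> = \<pi>max \<omega>"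
proof -
  let ?Z = "\<integral>\<^sup>+\<omega>. filter_gap \<omega> \<partial>Pr"
  have UN: "UNIV \<in> sets (sigma_tail_XY 0 :: ('e, 'f) path measure)"
    using sets.top[of "sigma_tail_XY 0 :: ('e, 'f) path measure"] by simp
  have le: "?Z \<le> 2 * ennreal e" if e: "e > 0" for e
  proof -
    let ?p = "\<lambda>n. emeasure Pr {\<omega>. \<forall>k\<le>n. \<not> filter_gap (sh (int k) \<omega>) < ennreal e}"
    have n: "?Z \<le> 2 * ennreal e + 2 * ?p n" for n
    proof -
      have "?Z = (\<integral>\<^sup>+\<omega>. indicator UNIV \<omega> * filter_gap (sh (int n) \<omega>) \<partial>Pr)"
        using nn_integral_sh[OF filter_gap_measurable, of "int n"] by simp
      also have "\<dots> \<le> 2 * ennreal e * emeasure Pr UNIV + 2 * emeasure Pr (UNIV \<inter> {\<omega>. \<forall>k\<le>n. \<not> filter_gap (sh (int k) \<omega>) < ennreal e})"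
        by (rule filter_gap_stopping[OF UN])
      finally show ?thesis using emeasure_space_1 by simp
    qed
    have "(\<lambda>n. 2 * ennreal e + 2 * ?p n) \<longlonglongrightarrow> 2 * ennreal e + 2 * 0"
      by (intro tendsto_add tendsto_const ennreal_tendsto_cmult filter_gap_returns filter_gap_pos[OF C e]) simp
    then show ?thesis using n by (intro LIMSEQ_le_const[of _ "2 * ennreal e"]) auto
  qed
  have "?Z \<le> 0"
  proof (rule ennreal_le_epsilon)
    fix e :: real assume "0 < e"
    then have "?Z \<le> 2 * ennreal (e/2)" by (intro le) simp
    also have "2 * ennreal (e/2) = ennreal (2 * (e/2))" using \<open>0 < e\<close> by (subst ennreal_mult) auto
    finally show "?Z \<le> 0 + ennreal e" by simp
  qed
  then have "?Z = 0" by simp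
  then have "AE \<omega> in Pr. filter_gap \<omega> = 0" by (subst (asm) nn_integral_0_iff_AE) auto
  then show ?thesis
    by eventually_elim (metis filter_gap_def filter_version_prob[OF fmin] filter_version_prob[OF fmax] l1_dist_eq_0)
qed

end

end

section \<open>The ergodic theorem for the signal chain\<close>

text \<open>
  A weighted mean covers both the Cesaro means (\<open>w n k = 1 / n\<close>) and the sequence itself
  (\<open>w n k = 1\<close> for \<open>k = n\<close> only).
\<close>
definition wmean :: "(nat \<Rightarrow> nat \<Rightarrow> real) \<Rightarrow> (nat \<Rightarrow> real) \<Rightarrow> nat \<Rightarrow> real" where
  "wmean w a n = (\<Sum>k=1..n. w n k * a k)"

text \<open>The conditions of Toeplitz's lemma on summation methods; row 0 is an empty sum and
  cannot be normalized.\<close>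

definition toeplitz :: "(nat \<Rightarrow> nat \<Rightarrow> real) \<Rightarrow> bool" where
  "toeplitz w \<longleftrightarrow> (\<forall>n k. 0 \<le> w n k) \<and> (\<forall>n\<ge>1. (\<Sum>k=1..n. w n k) = 1) \<and> (\<forall>k. (\<lambda>n. w n k) \<longlonglongrightarrow> 0)"

lemma wmean_diff: "wmean w (\<lambda>k. a k - b k) n = wmean w a n - wmean w b n"
  by (simp add: wmean_def sum_subtractf right_diff_distrib)

lemma wmean_cmult: "wmean w (\<lambda>k. c * a k) n = c * wmean w a n"
  by (simp add: wmean_def sum_distrib_left mult_ac)

lemma wmean_abs_le:
  assumes "toeplitz w" "\<And>k. \<bar>a k\<bar> \<le> B" "n \<ge> 1"
  shows "\<bar>wmean w a n\<bar> \<le> B"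
proof -
  have w: "0 \<le> w n k" "(\<Sum>k=1..n. w n k) = 1" for k using assms by (auto simp: toeplitz_def)
  have "\<bar>wmean w a n\<bar> \<le> (\<Sum>k=1..n. \<bar>w n k * a k\<bar>)" unfolding wmean_def by (rule sum_abs)
  also have "\<dots> \<le> (\<Sum>k=1..n. w n k * B)" using w assms(2) by (intro sum_mono) (simp add: abs_mult mult_left_mono)
  also have "\<dots> = B" using w(2) by (simp add: sum_distrib_right[symmetric])
  finally show ?thesis .
qed

text \<open>Toeplitz's lemma: the early terms vanish with their weights, the late ones are small
  themselves.\<close>

lemma wmean_null:
  assumes w: "toeplitz w" and a: "a \<longlonglongrightarrow> 0"
  shows "wmean w a \<longlonglongrightarrow> 0"
proof (rule LIMSEQ_I)
  fix e :: real assume e: "e > 0"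
  have w0: "0 \<le> w n k" and w1: "n \<ge> 1 \<Longrightarrow> (\<Sum>k=1..n. w n k) = 1" and wl: "(\<lambda>n. w n k) \<longlonglongrightarrow> 0" for n k
    using w by (auto simp: toeplitz_def)
  obtain K where K: "\<And>k. k \<ge> K \<Longrightarrow> \<bar>a k\<bar> < e / 2" using LIMSEQ_D[OF a, of "e/2"] e by auto
  have "(\<lambda>n. \<Sum>k=1..K. w n k * \<bar>a k\<bar>) \<longlonglongrightarrow> (\<Sum>k=1..K. 0 * \<bar>a k\<bar>)" by (intro tendsto_sum tendsto_mult wl tendsto_const)
  then have "(\<lambda>n. \<Sum>k=1..K. w n k * \<bar>a k\<bar>) \<longlonglongrightarrow> 0" by simp
  then obtain N where N: "\<And>n. n \<ge> N \<Longrightarrow> \<bar>\<Sum>k=1..K. w n k * \<bar>a k\<bar>\<bar> < e / 2" using LIMSEQ_D[of _ 0 "e/2"] e by fastforce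
  show "\<exists>no. \<forall>n\<ge>no. norm (wmean w a n - 0) < e"
  proof (intro exI allI impI)
    fix n assume n: "max (max 1 N) K \<le> n"
    have "\<bar>wmean w a n\<bar> \<le> (\<Sum>k=1..n. \<bar>w n k * a k\<bar>)" unfolding wmean_def by (rule sum_abs)
    also have "\<dots> = (\<Sum>k=1..n. w n k * \<bar>a k\<bar>)" using w0 by (simp add: abs_mult)
    also have "\<dots> \<le> (\<Sum>k=1..n. (if k \<le> K then w n k * \<bar>a k\<bar> else 0) + w n k * (e/2))"
    proof (rule sum_mono)
      fix k assume "k \<in> {1..n}"
      show "w n k * \<bar>a k\<bar> \<le> (if k \<le> K then w n k * \<bar>a k\<bar> else 0) + w n k * (e/2)"
      proof (cases "k \<le> K")
        case True
        then show ?thesis using w0[of n k] e by simp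
      next
        case False
        then have "w n k * \<bar>a k\<bar> \<le> w n k * (e/2)" using K[of k] by (intro mult_left_mono w0) auto
        then show ?thesis using False by simp
      qed
    qed
    also have "\<dots> = (\<Sum>k=1..n. (if k \<le> K then w n k * \<bar>a k\<bar> else 0)) + e/2"
      using w1[of n] n by (simp add: sum.distrib sum_divide_distrib[symmetric] sum_distrib_right[symmetric])
    also have "(\<Sum>k=1..n. (if k \<le> K then w n k * \<bar>a k\<bar> else 0)) = (\<Sum>k=1..K. w n k * \<bar>a k\<bar>)"
      using n by (intro sum.mono_neutral_cong_right) auto
    also have "\<dots> < e/2" using N[of n] n by auto
    finally show "norm (wmean w a n - 0) < e" by simp
  qed
qed

lemma wmean_integral:
  fixes a :: "nat \<Rightarrow> 'x \<Rightarrow> real"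
  assumes "\<And>k. integrable N (a k)"
  shows "wmean w (\<lambda>k. \<integral>x. a k x \<partial>N) n = (\<integral>x. wmean w (\<lambda>k. a k x) n \<partial>N)"
  unfolding wmean_def using assms by (subst Bochner_Integration.integral_sum) auto

text \<open>Tychonoff's theorem; a countable product of intervals is metrizable, so compactness
  yields convergent subsequences.\<close>

lemma seq_compact_unit_functions:
  fixes h :: "nat \<Rightarrow> 'e::countable \<Rightarrow> real"
  assumes "\<And>n i. 0 \<le> h n i \<and> h n i \<le> 1"
  shows "\<exists>r H. strict_mono (r :: nat \<Rightarrow> nat) \<and> (\<forall>i. (\<lambda>n. h (r n) i) \<longlonglongrightarrow> H i \<and> 0 \<le> H i \<and> H i \<le> 1)"
proof -
  have "compactin (product_topology (\<lambda>_. euclidean) UNIV) (PiE UNIV (\<lambda>_::'e. {0..1::real}))"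
    unfolding compactin_PiE compactin_euclidean_iff by (intro disjI2 ballI compact_Icc)
  then have "compact (PiE UNIV (\<lambda>_::'e. {0..1::real}))" by (simp add: euclidean_product_topology)
  then have sc: "seq_compact (PiE UNIV (\<lambda>_::'e. {0..1::real}))" by (rule compact_imp_seq_compact)
  have mem: "\<forall>n. h n \<in> PiE UNIV (\<lambda>_. {0..1})" using assms by (simp add: PiE_iff)
  obtain H and r :: "nat \<Rightarrow> nat" where H: "H \<in> PiE UNIV (\<lambda>_. {0..1})" "strict_mono r" "(h \<circ> r) \<longlonglongrightarrow> H"
    by (rule seq_compactE[OF sc mem])
  have "(\<lambda>n. h (r n) i) \<longlonglongrightarrow> H i" for i
    using continuous_on_tendsto_compose[OF continuous_on_product_coordinates[of i] H(3)] by (simp add: comp_def)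
  moreover have "0 \<le> H i \<and> H i \<le> 1" for i using PiE_mem[OF H(1), of i] by simp
  ultimately show ?thesis using H(2) by blast
qed

text \<open>The least period \<open>d\<close> divides every \<open>n\<close> in \<open>D\<close>: by
  Bezout \<open>gcd n d\<close> is a difference of multiples of \<open>n\<close> and
  \<open>d\<close>, hence itself a period, and so not smaller than \<open>d\<close>.\<close>

lemma constant_if_periods_coprime:
  fixes s :: "nat \<Rightarrow> real"
  assumes per: "\<And>n l. n \<in> D \<Longrightarrow> s (l + n) = s l" and D: "\<And>n. n \<in> D \<Longrightarrow> n \<ge> 1" "Gcd D = 1"
  shows "s (Suc l) = s l"
proof -
  let ?P = "\<lambda>d. d \<ge> 1 \<and> (\<forall>l. s (l + d) = s l)"
  \<comment> \<open>\<open>D\<close> is nonempty because the Gcd of the empty set is 0.\<close>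
  obtain n0 where n0: "n0 \<in> D" using D(2) by fastforce
  define d where "d = (LEAST d. ?P d)"
  have Pn: "?P n" if "n \<in> D" for n using per D(1) that by auto
  have d: "?P d" unfolding d_def by (rule LeastI[of ?P n0]) (rule Pn[OF n0])
  have mult: "s (l + n * x) = s l" if "?P n" for n x l
  proof (induction x)
    case (Suc x)
    have "s (l + n * Suc x) = s ((l + n * x) + n)" by (simp add: algebra_simps)
    then show ?case using that Suc by simp
  qed simp
  have "d dvd n" if n: "n \<in> D" for n
  proof -
    obtain x y where xy: "n * x = d * y + gcd n d" using bezout_nat[of n d] D(1)[OF n] by auto
    have "s (l + gcd n d) = s l" for l
    proof -
      have "s (l + gcd n d) = s (l + gcd n d + d * y)" using mult[OF d] by simp
      also have "l + gcd n d + d * y = l + n * x" using xy by simp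
      also have "s \<dots> = s l" by (rule mult[OF Pn[OF n]])
      finally show ?thesis .
    qed
    moreover have "gcd n d \<ge> 1" using d by (simp add: Suc_le_eq One_nat_def)
    ultimately have "d \<le> gcd n d" unfolding d_def by (intro Least_le) simp
    moreover have "gcd n d dvd d" by simp
    ultimately have "gcd n d = d" using d by (metis dvd_imp_le le_antisym less_le_trans zero_less_one)
    then show ?thesis by (metis gcd_dvd1)
  qed
  then have "d dvd Gcd D" by (rule Gcd_greatest)
  then have "d = 1" using D(2) by simp
  then show ?thesis using d[THEN conjunct2, rule_format, of l] by (simp add: One_nat_def)
qed

section \<open>The transition operator of the signal and its energy\<close>

context hidden_markov_model begin

definition lamr :: "'e \<Rightarrow> real" where "lamr i = measure Pr {\<omega>. coord_X 0 \<omega> = i}"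

lemma lamr: "lam i = ennreal (lamr i)" "lamr i > 0"
  using lam_pos[of i] by (simp_all add: lam_def lamr_def emeasure_eq_measure)

text \<open>The transition operator h -> P h of the signal, meant for functions with values in
  [0, 1].\<close>

definition Top :: "('e \<Rightarrow> real) \<Rightarrow> 'e \<Rightarrow> real" where
  "Top h i = enn2real (\<integral>\<^sup>+j. trans_mat \<phi> M i j * ennreal (h j) \<partial>count_space UNIV)"

abbreviation "unit_fun (h :: 'e \<Rightarrow> real) \<equiv> (\<forall>i. 0 \<le> h i \<and> h i \<le> 1)"

lemma nn_Top:
  assumes "unit_fun h"
  shows "ennreal (Top h i) = (\<integral>\<^sup>+j. trans_mat \<phi> M i j * ennreal (h j) \<partial>count_space UNIV)" "0 \<le> Top h i" "Top h i \<le> 1"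
proof -
  let ?I = "\<integral>\<^sup>+j. trans_mat \<phi> M i j * ennreal (h j) \<partial>count_space UNIV"
  have "?I \<le> (\<integral>\<^sup>+j. trans_mat \<phi> M i j * 1 \<partial>count_space UNIV)"
    using assms by (intro nn_integral_mono mult_left_mono) auto
  also have "\<dots> = 1" using stochastic_P by (simp add: stochastic_matrix_def)
  finally have le: "?I \<le> 1" .
  then have "?I < \<infinity>" by (rule order_le_less_trans) simp
  then show "ennreal (Top h i) = ?I" by (simp add: Top_def less_top)
  show "0 \<le> Top h i" by (simp add: Top_def)
  show "Top h i \<le> 1" using enn2real_mono[OF le] by (simp add: Top_def)
qed

lemma unit_fun_Top: "unit_fun h \<Longrightarrow> unit_fun (Top h)"
  using nn_Top by blast

lemma unit_fun_Top_pow: "unit_fun h \<Longrightarrow> unit_fun ((Top ^^ n) h)"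
  by (induction n) (use unit_fun_Top in auto)

lemma nn_integral_split_X:
  assumes [measurable]: "f \<in> borel_measurable Pr"
  shows "(\<integral>\<^sup>+\<omega>. f \<omega> \<partial>Pr) = (\<integral>\<^sup>+i. (\<integral>\<^sup>+\<omega>. indicator {\<omega>. coord_X k \<omega> = i} \<omega> * f \<omega> \<partial>Pr) \<partial>count_space UNIV)"
proof -
  have "f \<omega> = (\<integral>\<^sup>+i. f \<omega> * indicator {coord_X k \<omega>} i \<partial>count_space UNIV)" for \<omega>
    by (subst nn_integral_cmult_indicator) auto
  also have "\<dots> \<omega> = (\<integral>\<^sup>+i. indicator {\<omega>. coord_X k \<omega> = i} \<omega> * f \<omega> \<partial>count_space UNIV)" for \<omega>
    by (intro nn_integral_cong) (auto simp: indicator_def)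
  finally have "(\<integral>\<^sup>+\<omega>. f \<omega> \<partial>Pr) = (\<integral>\<^sup>+\<omega>. (\<integral>\<^sup>+i. indicator {\<omega>. coord_X k \<omega> = i} \<omega> * f \<omega> \<partial>count_space UNIV) \<partial>Pr)"
    by simp
  also have "\<dots> = (\<integral>\<^sup>+i. (\<integral>\<^sup>+\<omega>. indicator {\<omega>. coord_X k \<omega> = i} \<omega> * f \<omega> \<partial>Pr) \<partial>count_space UNIV)"
    by (rule nn_integral_count_space_nn_integral) auto
  finally show ?thesis .
qed

lemma nn_integral_fun_X:
  assumes [measurable]: "B \<in> sets Pr"
  shows "(\<integral>\<^sup>+\<omega>. indicator B \<omega> * g (coord_X k \<omega>) \<partial>Pr) = (\<integral>\<^sup>+i. emeasure Pr (B \<inter> {\<omega>. coord_X k \<omega> = i}) * g i \<partial>count_space UNIV)"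
proof -
  have gm[measurable]: "(\<lambda>\<omega>. g (coord_X k \<omega>)) \<in> borel_measurable Pr"
    by (rule measurable_compose[OF coord_X_Pr]) simp
  have "(\<integral>\<^sup>+\<omega>. indicator B \<omega> * g (coord_X k \<omega>) \<partial>Pr) = (\<integral>\<^sup>+i. (\<integral>\<^sup>+\<omega>. indicator {\<omega>. coord_X k \<omega> = i} \<omega> * (indicator B \<omega> * g (coord_X k \<omega>)) \<partial>Pr) \<partial>count_space UNIV)"
    by (rule nn_integral_split_X) measurable
  also have "\<dots> = (\<integral>\<^sup>+i. emeasure Pr (B \<inter> {\<omega>. coord_X k \<omega> = i}) * g i \<partial>count_space UNIV)"
  proof (rule nn_integral_cong)
    fix i
    have "(\<integral>\<^sup>+\<omega>. indicator {\<omega>. coord_X k \<omega> = i} \<omega> * (indicator B \<omega> * g (coord_X k \<omega>)) \<partial>Pr) = (\<integral>\<^sup>+\<omega>. g i * indicator (B \<inter> {\<omega>. coord_X k \<omega> = i}) \<omega> \<partial>Pr)"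
      by (intro nn_integral_cong) (auto simp: indicator_def)
    then show "(\<integral>\<^sup>+\<omega>. indicator {\<omega>. coord_X k \<omega> = i} \<omega> * (indicator B \<omega> * g (coord_X k \<omega>)) \<partial>Pr) = emeasure Pr (B \<inter> {\<omega>. coord_X k \<omega> = i}) * g i"
      by (subst (asm) nn_integral_cmult_indicator) (auto simp: mult.commute)
  qed
  finally show ?thesis .
qed

lemma markov_Top:
  assumes B: "B \<in> sets (sigma_XY m m)" and h: "unit_fun h"
  shows "(\<integral>\<^sup>+\<omega>. indicator B \<omega> * ennreal (h (coord_X (m + 1) \<omega>)) \<partial>Pr) = (\<integral>\<^sup>+\<omega>. indicator B \<omega> * ennreal (Top h (coord_X m \<omega>)) \<partial>Pr)"
proof -
  have [measurable]: "B \<in> sets Pr" using B subalgebra_XY by (auto simp: subalgebra_def)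
  have one: "emeasure Pr (B \<inter> {\<omega>. coord_X (m + 1) \<omega> = l}) = (\<integral>\<^sup>+k. emeasure Pr (B \<inter> {\<omega>. coord_X m \<omega> = k}) * trans_mat \<phi> M k l \<partial>count_space UNIV)" for l
    using markov_step[OF B, of UNIV l] by (simp add: trans_mat_def)
  have "(\<integral>\<^sup>+\<omega>. indicator B \<omega> * ennreal (h (coord_X (m + 1) \<omega>)) \<partial>Pr) =
     (\<integral>\<^sup>+j. (\<integral>\<^sup>+k. emeasure Pr (B \<inter> {\<omega>. coord_X m \<omega> = k}) * trans_mat \<phi> M k j \<partial>count_space UNIV) * ennreal (h j) \<partial>count_space UNIV)"
    by (subst nn_integral_fun_X) (simp_all only: one, simp)
  also have "\<dots> = (\<integral>\<^sup>+j. (\<integral>\<^sup>+k. emeasure Pr (B \<inter> {\<omega>. coord_X m \<omega> = k}) * trans_mat \<phi> M k j * ennreal (h j) \<partial>count_space UNIV) \<partial>count_space UNIV)"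
    by (simp add: nn_integral_multc)
  also have "\<dots> = (\<integral>\<^sup>+k. (\<integral>\<^sup>+j. emeasure Pr (B \<inter> {\<omega>. coord_X m \<omega> = k}) * trans_mat \<phi> M k j * ennreal (h j) \<partial>count_space UNIV) \<partial>count_space UNIV)"
    by (rule nn_integral_count_space_nn_integral) auto
  also have "\<dots> = (\<integral>\<^sup>+k. emeasure Pr (B \<inter> {\<omega>. coord_X m \<omega> = k}) * ennreal (Top h k) \<partial>count_space UNIV)"
    unfolding nn_Top[OF h] by (simp add: nn_integral_cmult mult.assoc)
  also have "\<dots> = (\<integral>\<^sup>+\<omega>. indicator B \<omega> * ennreal (Top h (coord_X m \<omega>)) \<partial>Pr)"
    by (rule nn_integral_fun_X[symmetric]) simp
  finally show ?thesis .
qed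

lemma markov_Top_pow:
  assumes B: "B \<in> sets (sigma_XY m m)" and h: "unit_fun h"
  shows "(\<integral>\<^sup>+\<omega>. indicator B \<omega> * ennreal (h (coord_X (m + int n) \<omega>)) \<partial>Pr) = (\<integral>\<^sup>+\<omega>. indicator B \<omega> * ennreal ((Top ^^ n) h (coord_X m \<omega>)) \<partial>Pr)"
  using h
proof (induction n arbitrary: h)
  case (Suc n)
  have B': "B \<in> sets (sigma_XY (m + int n) (m + int n))"
    using B sigma_XY_mono[of m "m + int n" m "m + int n"] by auto
  have idx: "m + int (Suc n) = m + int n + 1" by simp
  have "(\<integral>\<^sup>+\<omega>. indicator B \<omega> * ennreal (h (coord_X (m + int (Suc n)) \<omega>)) \<partial>Pr) = (\<integral>\<^sup>+\<omega>. indicator B \<omega> * ennreal (Top h (coord_X (m + int n) \<omega>)) \<partial>Pr)"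
    unfolding idx by (rule markov_Top[OF B' Suc.prems])
  also have "\<dots> = (\<integral>\<^sup>+\<omega>. indicator B \<omega> * ennreal ((Top ^^ n) (Top h) (coord_X m \<omega>)) \<partial>Pr)"
    by (rule Suc.IH) (rule unit_fun_Top[OF Suc.prems])
  finally show ?case by (simp add: funpow_swap1)
qed simp

lemma fun_X_measurable [measurable]: "(\<lambda>\<omega>. h (coord_X k \<omega>)) \<in> borel_measurable Pr" for h :: "'e \<Rightarrow> real"
  by (rule measurable_compose[OF coord_X_Pr]) simp

lemma integral_Top_pair:
  assumes h: "unit_fun h" and k: "unit_fun k"
  shows "(\<integral>\<omega>. k (coord_X 0 \<omega>) * h (coord_X 1 \<omega>) \<partial>Pr) = (\<integral>\<omega>. k (coord_X 0 \<omega>) * Top h (coord_X 0 \<omega>) \<partial>Pr)"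
proof -
  have nn: "(\<integral>\<^sup>+\<omega>. ennreal (k (coord_X 0 \<omega>) * g (coord_X m \<omega>)) \<partial>Pr) =
      (\<integral>\<^sup>+i. ennreal (k i) * (\<integral>\<^sup>+\<omega>. indicator {\<omega>. coord_X 0 \<omega> = i} \<omega> * ennreal (g (coord_X m \<omega>)) \<partial>Pr) \<partial>count_space UNIV)"
    if g: "unit_fun g" for g m
  proof -
    have "(\<integral>\<^sup>+\<omega>. ennreal (k (coord_X 0 \<omega>) * g (coord_X m \<omega>)) \<partial>Pr) =
      (\<integral>\<^sup>+i. (\<integral>\<^sup>+\<omega>. indicator {\<omega>. coord_X 0 \<omega> = i} \<omega> * ennreal (k (coord_X 0 \<omega>) * g (coord_X m \<omega>)) \<partial>Pr) \<partial>count_space UNIV)"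
      by (rule nn_integral_split_X) measurable
    also have "\<dots> = (\<integral>\<^sup>+i. (\<integral>\<^sup>+\<omega>. ennreal (k i) * (indicator {\<omega>. coord_X 0 \<omega> = i} \<omega> * ennreal (g (coord_X m \<omega>))) \<partial>Pr) \<partial>count_space UNIV)"
      using k g by (intro nn_integral_cong) (auto simp: indicator_def ennreal_mult)
    also have "\<dots> = (\<integral>\<^sup>+i. ennreal (k i) * (\<integral>\<^sup>+\<omega>. indicator {\<omega>. coord_X 0 \<omega> = i} \<omega> * ennreal (g (coord_X m \<omega>)) \<partial>Pr) \<partial>count_space UNIV)"
      by (intro nn_integral_cong nn_integral_cmult) measurable
    finally show ?thesis .
  qed
  have "(\<integral>\<^sup>+\<omega>. indicator {\<omega>. coord_X 0 \<omega> = i} \<omega> * ennreal (h (coord_X 1 \<omega>)) \<partial>Pr) = (\<integral>\<^sup>+\<omega>. indicator {\<omega>. coord_X 0 \<omega> = i} \<omega> * ennreal (Top h (coord_X 0 \<omega>)) \<partial>Pr)" for i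
    using markov_Top[OF coord_X_eq_sigma_XY[of 0 0 i 0] h] by simp
  then have eq: "(\<integral>\<^sup>+\<omega>. ennreal (k (coord_X 0 \<omega>) * h (coord_X 1 \<omega>)) \<partial>Pr) = (\<integral>\<^sup>+\<omega>. ennreal (k (coord_X 0 \<omega>) * Top h (coord_X 0 \<omega>)) \<partial>Pr)"
    unfolding nn[OF h] nn[OF unit_fun_Top[OF h]] by simp
  have "0 \<le> k i * g j" "k i * g j \<le> 1" if "unit_fun g" for g i j using k that by (auto intro: mult_le_one)
  then show ?thesis
    using eq h unit_fun_Top[OF h]
    by (subst (asm) (1 2) nn_integral_eq_integral) (auto intro!: integrable_unit_interval)
qed

lemma integral_fun_X_shift:
  "(\<integral>\<omega>. h (coord_X m \<omega>) \<partial>Pr) = (\<integral>\<omega>. h (coord_X 0 \<omega>) \<partial>Pr)" for h :: "'e \<Rightarrow> real"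
proof -
  have "(\<lambda>\<omega>. h (coord_X 0 \<omega>)) \<in> borel_measurable path_space"
    using fun_X_measurable by (simp add: measurable_cong_sets[OF sets_Pr refl])
  from integral_sh[OF this, of m] show ?thesis by simp
qed

lemma integral_Top:
  assumes h: "unit_fun h"
  shows "(\<integral>\<omega>. Top h (coord_X 0 \<omega>) \<partial>Pr) = (\<integral>\<omega>. h (coord_X 0 \<omega>) \<partial>Pr)"
  using integral_Top_pair[OF h, of "\<lambda>_. 1"] integral_fun_X_shift[of h 1] by simp

lemma integral_Top_pow:
  assumes h: "unit_fun h"
  shows "(\<integral>\<omega>. (Top ^^ n) h (coord_X 0 \<omega>) \<partial>Pr) = (\<integral>\<omega>. h (coord_X 0 \<omega>) \<partial>Pr)"
  by (induction n) (simp_all add: integral_Top[OF unit_fun_Top_pow[OF h]])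

lemma integrable_unit_fun: "unit_fun h \<Longrightarrow> integrable Pr (\<lambda>\<omega>. h (coord_X k \<omega>))"
  by (intro integrable_unit_interval) auto

text \<open>Pythagoras once more: \<open>Top h (coord_X 0 \<omega>)\<close> is the projection of
  \<open>h (coord_X 1 \<omega>)\<close> onto the functions of X_0, and by stationarity h has the
  same second moment at times 0 and 1.\<close>

lemma energy_identity:
  assumes h: "unit_fun h"
  shows "(\<integral>\<omega>. (h (coord_X 1 \<omega>) - Top h (coord_X 0 \<omega>))\<^sup>2 \<partial>Pr) = (\<integral>\<omega>. (h (coord_X 0 \<omega>))\<^sup>2 \<partial>Pr) - (\<integral>\<omega>. (Top h (coord_X 0 \<omega>))\<^sup>2 \<partial>Pr)"
proof -
  note T = unit_fun_Top[OF h]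
  have i: "integrable Pr (\<lambda>\<omega>. (h (coord_X 1 \<omega>))\<^sup>2)" "integrable Pr (\<lambda>\<omega>. (Top h (coord_X 0 \<omega>))\<^sup>2)"
    "integrable Pr (\<lambda>\<omega>. Top h (coord_X 0 \<omega>) * h (coord_X 1 \<omega>))"
    using h T by (auto intro!: integrable_unit_interval simp: power_le_one mult_le_one)
  have "(\<integral>\<omega>. (h (coord_X 1 \<omega>) - Top h (coord_X 0 \<omega>))\<^sup>2 \<partial>Pr) =
     (\<integral>\<omega>. (h (coord_X 1 \<omega>))\<^sup>2 + (Top h (coord_X 0 \<omega>))\<^sup>2 - 2 * (Top h (coord_X 0 \<omega>) * h (coord_X 1 \<omega>)) \<partial>Pr)"
    by (intro Bochner_Integration.integral_cong) (auto simp: power2_diff)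
  also have "\<dots> = (\<integral>\<omega>. (h (coord_X 1 \<omega>))\<^sup>2 \<partial>Pr) + (\<integral>\<omega>. (Top h (coord_X 0 \<omega>))\<^sup>2 \<partial>Pr) - 2 * (\<integral>\<omega>. Top h (coord_X 0 \<omega>) * h (coord_X 1 \<omega>) \<partial>Pr)"
    using i by simp
  also have "(\<integral>\<omega>. Top h (coord_X 0 \<omega>) * h (coord_X 1 \<omega>) \<partial>Pr) = (\<integral>\<omega>. (Top h (coord_X 0 \<omega>))\<^sup>2 \<partial>Pr)"
    unfolding integral_Top_pair[OF h T] by (simp add: power2_eq_square)
  also have "(\<integral>\<omega>. (h (coord_X 1 \<omega>))\<^sup>2 \<partial>Pr) = (\<integral>\<omega>. (h (coord_X 0 \<omega>))\<^sup>2 \<partial>Pr)"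
    by (rule integral_fun_X_shift[of "\<lambda>i. (h i)\<^sup>2"])
  finally show ?thesis by simp
qed

text \<open>Without loss of energy h(X_1) equals its projection almost surely, and every transition
  of positive probability is charged because \<open>lam\<close> charges all states.\<close>

lemma energy_equality:
  assumes h: "unit_fun h" and e: "(\<integral>\<omega>. (h (coord_X 0 \<omega>))\<^sup>2 \<partial>Pr) = (\<integral>\<omega>. (Top h (coord_X 0 \<omega>))\<^sup>2 \<partial>Pr)"
    and ij: "trans_mat \<phi> M i j > 0"
  shows "h j = Top h i"
proof -
  note T = unit_fun_Top[OF h]
  have "integrable Pr (\<lambda>\<omega>. (h (coord_X 1 \<omega>) - Top h (coord_X 0 \<omega>))\<^sup>2)"
  proof (rule integrable_unit_interval)
    fix \<omega>
    have "0 \<le> h (coord_X 1 \<omega>)" "h (coord_X 1 \<omega>) \<le> 1" "0 \<le> Top h (coord_X 0 \<omega>)" "Top h (coord_X 0 \<omega>) \<le> 1" using h T by auto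
    then have "\<bar>h (coord_X 1 \<omega>) - Top h (coord_X 0 \<omega>)\<bar> \<le> 1" by linarith
    then show "0 \<le> (h (coord_X 1 \<omega>) - Top h (coord_X 0 \<omega>))\<^sup>2 \<and> (h (coord_X 1 \<omega>) - Top h (coord_X 0 \<omega>))\<^sup>2 \<le> 1"
      by (simp add: abs_square_le_1)
  qed measurable
  then have "AE \<omega> in Pr. (h (coord_X 1 \<omega>) - Top h (coord_X 0 \<omega>))\<^sup>2 = 0"
    using energy_identity[OF h] e by (subst integral_nonneg_eq_0_iff_AE[symmetric]) auto
  then have ae: "AE \<omega> in Pr. h (coord_X 1 \<omega>) = Top h (coord_X 0 \<omega>)" by eventually_elim simp
  show ?thesis
  proof (rule ccontr)
    assume ne: "h j \<noteq> Top h i"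
    let ?A = "{\<omega>. coord_X 0 \<omega> = i} \<inter> {\<omega>. coord_X (0 + 1) \<omega> = j \<and> coord_Y (0 + 1) \<omega> \<in> UNIV}"
    have U: "UNIV \<in> sets (sigma_XY 0 0 :: ('e, 'f) path measure)" using sets.top[of "sigma_XY 0 0 :: ('e, 'f) path measure"] by simp
    have "emeasure Pr ?A = lam i * trans_mat \<phi> M i j"
      using markov_step_pure[OF U, of UNIV i j] by (simp add: emeasure_coord_X trans_mat_def)
    then have pos: "emeasure Pr ?A > 0" using lam_pos[of i] ij by (simp add: ennreal_zero_less_mult_iff)
    have "?A = {\<omega>. coord_X 0 \<omega> = i} \<inter> {\<omega>. coord_X 1 \<omega> = j}" by auto
    then have "?A \<in> sets Pr" by simp
    moreover have "AE \<omega> in Pr. \<omega> \<notin> ?A" using ae by eventually_elim (use ne in auto)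
    ultimately have "?A \<in> null_sets Pr" by (subst (asm) AE_iff_null_sets[symmetric]) auto
    then show False using pos by auto
  qed
qed

lemma mat_pow_Suc_pos:
  assumes "mat_pow (trans_mat \<phi> M) (Suc n) i j > 0"
  obtains k where "trans_mat \<phi> M i k > 0" "mat_pow (trans_mat \<phi> M) n k j > 0"
proof (rule ccontr)
  assume *: "\<not> thesis"
  have z: "trans_mat \<phi> M i k * mat_pow (trans_mat \<phi> M) n k j = 0" for k
    using * that[of k] by (auto simp: zero_less_iff_neq_zero)
  have "mat_pow (trans_mat \<phi> M) (Suc n) i j = (\<integral>\<^sup>+k. 0 \<partial>count_space (UNIV :: 'e set))"
    unfolding mat_pow.simps z by (rule refl)
  then show False using assms by simp
qed

text \<open>A fixed function keeps its energy, so it does not change along transitions, and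
  irreducibility connects all states.\<close>

lemma harmonic_constant:
  assumes h: "unit_fun h" and T: "Top h = h"
  shows "h i = (\<integral>\<omega>. h (coord_X 0 \<omega>) \<partial>Pr)"
proof -
  have step: "h j = h i" if "trans_mat \<phi> M i j > 0" for i j
    using energy_equality[OF h _ that] T by simp
  have pow: "h j = h i" if "mat_pow (trans_mat \<phi> M) n i j > 0" for n i j
    using that
  proof (induction n arbitrary: i)
    case 0
    then show ?case by (simp split: if_splits)
  next
    case (Suc n)
    obtain k where "trans_mat \<phi> M i k > 0" "mat_pow (trans_mat \<phi> M) n k j > 0"
      using mat_pow_Suc_pos[OF Suc.prems] by blast
    then show ?case using step Suc.IH by metis
  qed
  have "h j = h i" for j using irreducible_P pow unfolding irreducible_matrix_def by blast
  then have "(\<lambda>\<omega> :: ('e, 'f) path. h (coord_X 0 \<omega>)) = (\<lambda>_. h i)" by (intro ext)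
  then show ?thesis using prob_space by simp
qed

text \<open>Writes the operator as an integral under \<open>Pr\<close>, where dominated convergence
  and linearity are available; \<open>lamr i > 0\<close> recovers \<open>Top h i\<close>.\<close>

lemma Top_eq_integral:
  assumes h: "unit_fun h"
  shows "lamr i * Top h i = (\<integral>\<omega>. indicator {\<omega>. coord_X 0 \<omega> = i} \<omega> * h (coord_X 1 \<omega>) \<partial>Pr)"
proof -
  have k: "unit_fun (indicator {i})" by (auto simp: indicator_def)
  have "(\<integral>\<omega>. indicator {\<omega>. coord_X 0 \<omega> = i} \<omega> * h (coord_X 1 \<omega>) \<partial>Pr) = (\<integral>\<omega>. indicator {i} (coord_X 0 \<omega>) * h (coord_X 1 \<omega>) \<partial>Pr)"
    by (intro Bochner_Integration.integral_cong) (auto simp: indicator_def)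
  also have "\<dots> = (\<integral>\<omega>. indicator {i} (coord_X 0 \<omega>) * Top h (coord_X 0 \<omega>) \<partial>Pr)"
    by (rule integral_Top_pair[OF h k])
  also have "\<dots> = (\<integral>\<omega>. Top h i * indicator {\<omega>. coord_X 0 \<omega> = i} \<omega> \<partial>Pr)"
    by (intro Bochner_Integration.integral_cong) (auto simp: indicator_def)
  also have "\<dots> = Top h i * lamr i"
    by (simp add: lamr_def emeasure_eq_measure)
  finally show ?thesis by (simp add: mult.commute)
qed

lemma Top_tendsto:
  assumes h: "\<And>n. unit_fun (h n)" and lim: "\<And>i. (\<lambda>n. h n i) \<longlonglongrightarrow> H i" and H: "unit_fun H"
  shows "(\<lambda>n. Top (h n) i) \<longlonglongrightarrow> Top H i"
proof -
  have "(\<lambda>n. lamr i * Top (h n) i) \<longlonglongrightarrow> lamr i * Top H i"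
    unfolding Top_eq_integral[OF h] Top_eq_integral[OF H]
  proof (rule integral_dominated_convergence[where w="\<lambda>_. 1"])
    show "AE \<omega> in Pr. (\<lambda>n. indicator {\<omega>. coord_X 0 \<omega> = i} \<omega> * h n (coord_X 1 \<omega>)) \<longlonglongrightarrow> indicator {\<omega>. coord_X 0 \<omega> = i} \<omega> * H (coord_X 1 \<omega>)"
      by (intro AE_I2 tendsto_mult_left lim)
    show "AE \<omega> in Pr. norm (indicator {\<omega>. coord_X 0 \<omega> = i} \<omega> * h n (coord_X 1 \<omega>)) \<le> 1" for n
      using h by (intro AE_I2) (auto simp: indicator_def)
  qed auto
  then have "(\<lambda>n. (lamr i * Top (h n) i) / lamr i) \<longlonglongrightarrow> (lamr i * Top H i) / lamr i"
    using lamr(2)[of i] by (intro tendsto_divide tendsto_const) auto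
  then show ?thesis using lamr(2)[of i] by simp
qed

lemma Top_pow_tendsto:
  assumes h: "\<And>n. unit_fun (h n)" and lim: "\<And>i. (\<lambda>n. h n i) \<longlonglongrightarrow> H i" and H: "unit_fun H"
  shows "(\<lambda>n. (Top ^^ l) (h n) i) \<longlonglongrightarrow> (Top ^^ l) H i"
proof (induction l arbitrary: i)
  case (Suc l)
  show ?case using Top_tendsto[OF unit_fun_Top_pow[OF h] Suc.IH unit_fun_Top_pow[OF H]] by simp
qed (simp add: lim)

lemma integral_fun_X_tendsto:
  assumes h: "\<And>n. unit_fun (h n)" and lim: "\<And>i. (\<lambda>n. h n i) \<longlonglongrightarrow> H i"
  shows "(\<lambda>n. \<integral>\<omega>. h n (coord_X 0 \<omega>) \<partial>Pr) \<longlonglongrightarrow> (\<integral>\<omega>. H (coord_X 0 \<omega>) \<partial>Pr)"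
proof (rule integral_dominated_convergence[where w="\<lambda>_. 1"])
  show "AE \<omega> in Pr. norm (h n (coord_X 0 \<omega>)) \<le> 1" for n using h by auto
qed (use lim in auto)

text \<open>
  Along a subsequence the powers converge to a function whose energy is preserved by the
  operator; by the energy identity and aperiodicity it is harmonic.
\<close>
lemma Top_pow_ergodic:
  assumes ap: "aperiodic_matrix (trans_mat \<phi> M)" and h: "unit_fun h"
  shows "(\<lambda>n. (Top ^^ n) h i) \<longlonglongrightarrow> (\<integral>\<omega>. h (coord_X 0 \<omega>) \<partial>Pr)"
proof (rule tendsto_subseqI)
  fix r :: "nat \<Rightarrow> nat" assume r: "strict_mono r"
  note u = unit_fun_Top_pow[OF h]
  obtain s H where s: "strict_mono s" and lim: "\<And>i. (\<lambda>n. (Top ^^ r (s n)) h i) \<longlonglongrightarrow> H i" and H: "unit_fun H"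
    using seq_compact_unit_functions[of "\<lambda>n. (Top ^^ r n) h"] u by blast
  have rs: "strict_mono (\<lambda>n. r (s n))" using strict_mono_o[OF r s] by (simp add: comp_def)
  \<comment> \<open>The energies decrease to some \<open>c\<close>. All shifted subsequences have
    this limit, so every power of the operator applied to \<open>H\<close> has energy exactly
    \<open>c\<close>.\<close>
  define a where "a n = (\<integral>\<omega>. ((Top ^^ n) h (coord_X 0 \<omega>))\<^sup>2 \<partial>Pr)" for n
  have "decseq a"
  proof (rule decseq_SucI)
    fix n
    have "0 \<le> (\<integral>\<omega>. ((Top ^^ n) h (coord_X 1 \<omega>) - Top ((Top ^^ n) h) (coord_X 0 \<omega>))\<^sup>2 \<partial>Pr)" by simp
    also have "\<dots> = a n - a (Suc n)" unfolding energy_identity[OF u] by (simp add: a_def)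
    finally show "a (Suc n) \<le> a n" by simp
  qed
  define c where "c = (INF n. a n)"
  have c: "a \<longlonglongrightarrow> c"
    unfolding c_def using \<open>decseq a\<close> by (intro LIMSEQ_decseq_INF bdd_belowI2[of _ 0]) (auto simp: a_def)
  have TH: "(\<lambda>n. (Top ^^ (l + r (s n))) h i) \<longlonglongrightarrow> (Top ^^ l) H i" for l i
    using Top_pow_tendsto[OF u lim H, of l i] by (simp add: funpow_add)
  have energy: "(\<integral>\<omega>. ((Top ^^ l) H (coord_X 0 \<omega>))\<^sup>2 \<partial>Pr) = c" for l
  proof -
    have "(\<lambda>n. a (l + r (s n))) \<longlonglongrightarrow> (\<integral>\<omega>. ((Top ^^ l) H (coord_X 0 \<omega>))\<^sup>2 \<partial>Pr)"
      unfolding a_def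
      using u by (intro integral_fun_X_tendsto[of "\<lambda>n i. ((Top ^^ (l + r (s n))) h i)\<^sup>2"] tendsto_power TH) (auto simp: power_le_one)
    moreover have "(\<lambda>n. a (l + r (s n))) \<longlonglongrightarrow> c"
    proof -
      have "strict_mono (\<lambda>n. l + r (s n))" using rs by (simp add: strict_mono_def)
      from LIMSEQ_subseq_LIMSEQ[OF c this] show ?thesis by (simp add: comp_def)
    qed
    ultimately show ?thesis by (rule LIMSEQ_unique)
  qed
  \<comment> \<open>Equality in the energy identity: a transition from \<open>i\<close> to
    \<open>j\<close> is compensated by one more power of the operator. Around a loop of length n at
    \<open>i\<close>, the sequence of values \<open>(Top ^^ l) H i\<close> therefore has period
    n.\<close>
  have step: "(Top ^^ l) H j = (Top ^^ Suc l) H i" if "trans_mat \<phi> M i j > 0" for l i j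
    using energy_equality[OF unit_fun_Top_pow[OF H, of l] _ that] energy[of l] energy[of "Suc l"] by simp
  have pow: "(Top ^^ l) H j = (Top ^^ (l + n)) H i" if "mat_pow (trans_mat \<phi> M) n i j > 0" for n i j l
    using that
  proof (induction n arbitrary: i)
    case 0
    then show ?case by (simp split: if_splits)
  next
    case (Suc n)
    obtain k where "trans_mat \<phi> M i k > 0" "mat_pow (trans_mat \<phi> M) n k j > 0"
      using mat_pow_Suc_pos[OF Suc.prems] by blast
    then show ?case using step[of i k "l + n"] Suc.IH by simp
  qed
  have "Top H = H"
  proof
    fix i
    \<comment> \<open>The return times of \<open>i\<close> are periods of this sequence, and by
      aperiodicity their Gcd is 1.\<close>
    have "(Top ^^ Suc 0) H i = (Top ^^ 0) H i"
    proof (rule constant_if_periods_coprime[where D="{n. n \<ge> 1 \<and> mat_pow (trans_mat \<phi> M) n i i > 0}"])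
      show "Gcd {n. n \<ge> 1 \<and> mat_pow (trans_mat \<phi> M) n i i > 0} = 1"
        using ap by (simp add: aperiodic_matrix_def)
    qed (auto simp: pow[symmetric])
    then show "Top H i = H i" by simp
  qed
  then have "H i = (\<integral>\<omega>. H (coord_X 0 \<omega>) \<partial>Pr)" by (rule harmonic_constant[OF H])
  also have "\<dots> = (\<integral>\<omega>. h (coord_X 0 \<omega>) \<partial>Pr)"
    using integral_fun_X_tendsto[OF u lim] by (simp add: integral_Top_pow[OF h] LIMSEQ_const_iff)
  finally show "\<exists>s. strict_mono s \<and> (\<lambda>n. (Top ^^ r (s n)) h i) \<longlonglongrightarrow> (\<integral>\<omega>. h (coord_X 0 \<omega>) \<partial>Pr)"
    using s lim[of i] by auto
qed

text \<open>The delay \<open>m\<close> leaves room for an observation window: between the times -k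
  and -m the chain makes k - m steps. The finitely many earlier terms get the value 0 and carry
  vanishing weight.\<close>

definition ergodic_weights :: "(nat \<Rightarrow> nat \<Rightarrow> real) \<Rightarrow> bool" where
  "ergodic_weights w \<longleftrightarrow> toeplitz w \<and> (\<forall>h i m. unit_fun h \<longrightarrow>
     wmean w (\<lambda>k. if m \<le> k then (Top ^^ (k - m)) h i else 0) \<longlonglongrightarrow> (\<integral>\<omega>. h (coord_X 0 \<omega>) \<partial>Pr))"

lemma ergodic_weights_aperiodic:
  assumes ap: "aperiodic_matrix (trans_mat \<phi> M)"
  shows "ergodic_weights (\<lambda>n k. if k = n then 1 else 0)"
proof -
  let ?w = "\<lambda>n k :: nat. if k = n then 1 else 0 :: real"
  have wm: "wmean ?w a n = a n" if "n \<ge> 1" for a n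
  proof -
    have "wmean ?w a n = (\<Sum>k=1..n. if k = n then a k else 0)" unfolding wmean_def by (intro sum.cong) auto
    then show ?thesis using that by simp
  qed
  have "(\<lambda>n. ?w n k) \<longlonglongrightarrow> 0" for k
    by (rule tendsto_eventually, rule eventually_sequentiallyI[of "Suc k"]) auto
  then have t: "toeplitz ?w" by (auto simp: toeplitz_def)
  have "wmean ?w (\<lambda>k. if m \<le> k then (Top ^^ (k - m)) h i else 0) \<longlonglongrightarrow> (\<integral>\<omega>. h (coord_X 0 \<omega>) \<partial>Pr)" if h: "unit_fun h" for h i m
  proof -
    have "(\<lambda>n. (Top ^^ (n - m)) h i) \<longlonglongrightarrow> (\<integral>\<omega>. h (coord_X 0 \<omega>) \<partial>Pr)"
      using Top_pow_ergodic[OF ap h, of i] by (subst LIMSEQ_offset[of _ m]) (simp_all)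
    then show ?thesis
    proof (rule Lim_transform_eventually)
      show "\<forall>\<^sub>F n in sequentially. (Top ^^ (n - m)) h i = wmean ?w (\<lambda>k. if m \<le> k then (Top ^^ (k - m)) h i else 0) n"
        using eventually_ge_at_top[of "max 1 m"] by eventually_elim (subst wm, auto)
    qed
  qed
  then show ?thesis using t by (simp add: ergodic_weights_def)
qed

lemma Top_sum:
  assumes h: "\<And>k. k \<in> K \<Longrightarrow> unit_fun (h k)" and K: "finite K" and c: "\<And>k. k \<in> K \<Longrightarrow> 0 \<le> c k"
    and s: "unit_fun (\<lambda>i. \<Sum>k\<in>K. c k * h k i)"
  shows "Top (\<lambda>i. \<Sum>k\<in>K. c k * h k i) i = (\<Sum>k\<in>K. c k * Top (h k) i)"
proof -
  have "lamr i * Top (\<lambda>i. \<Sum>k\<in>K. c k * h k i) i = (\<integral>\<omega>. (\<Sum>k\<in>K. c k * (indicator {\<omega>. coord_X 0 \<omega> = i} \<omega> * h k (coord_X 1 \<omega>))) \<partial>Pr)"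
    unfolding Top_eq_integral[OF s] by (intro Bochner_Integration.integral_cong) (auto simp: sum_distrib_left mult_ac)
  also have "\<dots> = (\<Sum>k\<in>K. c k * (\<integral>\<omega>. indicator {\<omega>. coord_X 0 \<omega> = i} \<omega> * h k (coord_X 1 \<omega>) \<partial>Pr))"
  proof (subst Bochner_Integration.integral_sum)
    show "integrable Pr (\<lambda>\<omega>. c k * (indicator {\<omega>. coord_X 0 \<omega> = i} \<omega> * h k (coord_X 1 \<omega>)))" if "k \<in> K" for k
      using h[OF that] by (intro integrable_mult_right integrable_unit_interval) (auto simp: indicator_def)
  qed simp
  also have "\<dots> = (\<Sum>k\<in>K. c k * (lamr i * Top (h k) i))"
    by (intro sum.cong refl) (simp add: Top_eq_integral[OF h])
  also have "\<dots> = lamr i * (\<Sum>k\<in>K. c k * Top (h k) i)" by (simp add: sum_distrib_left mult_ac)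
  finally show ?thesis using lamr(2)[of i] by simp
qed

text \<open>The mean ergodic theorem by compactness. Applying the operator to a Cesaro mean changes
  it by a telescoping sum of size at most 1/n, so every subsequential limit is harmonic, hence
  constant and equal to the mean of \<open>h\<close>.\<close>

lemma ergodic_weights_cesaro: "ergodic_weights (\<lambda>n k. 1 / real n)"
proof -
  let ?w = "\<lambda>n k :: nat. 1 / real n"
  have t: "toeplitz ?w" by (auto simp: toeplitz_def lim_1_over_n)
  \<comment> \<open>The sums start at k = 1, so for \<open>m \<ge> 1\<close> they contain the powers
    from 0 on. The case m = 0 is reduced to m = 1 at the end, with \<open>Top h\<close> in place of
    \<open>h\<close>.\<close>
  have pos: "wmean ?w (\<lambda>k. if m \<le> k then (Top ^^ (k - m)) h i else 0) \<longlonglongrightarrow> (\<integral>\<omega>. h (coord_X 0 \<omega>) \<partial>Pr)" if h: "unit_fun h" and m: "m \<ge> 1" for h i m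
  proof (rule tendsto_subseqI)
    fix r :: "nat \<Rightarrow> nat" assume r: "strict_mono r"
    note u = unit_fun_Top_pow[OF h]
    let ?c = "\<integral>\<omega>. h (coord_X 0 \<omega>) \<partial>Pr"
    define g where "g k = (if m \<le> k then (Top ^^ (k - m)) h else (\<lambda>_. 0))" for k
    have g: "unit_fun (g k)" for k using u by (simp add: g_def)
    define A where "A n i = (\<Sum>k\<in>{1..n}. (1 / real n) * g k i)" for n i
    have wA: "wmean ?w (\<lambda>k. if m \<le> k then (Top ^^ (k - m)) h i else 0) n = A n i" for n i
      unfolding wmean_def A_def g_def by (intro sum.cong) auto
    have A: "unit_fun (A n)" for n
    proof
      fix i
      have "A n i \<le> (\<Sum>k\<in>{1..n}. (1 / real n) * 1)" unfolding A_def using g by (intro sum_mono mult_left_mono) auto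
      also have "\<dots> \<le> 1" by simp
      finally show "0 \<le> A n i \<and> A n i \<le> 1" using g by (auto simp: A_def intro!: sum_nonneg)
    qed
    have TA: "Top (A n) i - A n i = ((Top ^^ (Suc n - m)) h i - h i) / real n" if n: "n \<ge> m" for n i
    proof -
      have "Top (A n) i = (\<Sum>k\<in>{1..n}. (1 / real n) * Top (g k) i)"
        using A[of n] g unfolding A_def by (intro Top_sum) auto
      also have "\<dots> = (\<Sum>k\<in>{m..n}. (1 / real n) * (Top ^^ (Suc k - m)) h i)"
      proof (rule sum.mono_neutral_cong_right)
        have "Top (\<lambda>_. 0) i = 0" by (simp add: Top_def)
        then show "\<forall>k\<in>{1..n} - {m..n}. (1 / real n) * Top (g k) i = 0" by (auto simp: g_def)
        show "(1 / real n) * Top (g k) i = (1 / real n) * (Top ^^ (Suc k - m)) h i" if "k \<in> {m..n}" for k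
          using that by (simp add: g_def Suc_diff_le)
      qed (use n m in auto)
      finally have 1: "Top (A n) i = (\<Sum>k\<in>{m..n}. (1 / real n) * (Top ^^ (Suc k - m)) h i)" .
      have 2: "A n i = (\<Sum>k\<in>{m..n}. (1 / real n) * (Top ^^ (k - m)) h i)"
        unfolding A_def by (rule sum.mono_neutral_cong_right) (use n m in \<open>auto simp: g_def\<close>)
      have "Top (A n) i - A n i = (1 / real n) * (\<Sum>k\<in>{m..n}. (Top ^^ (Suc k - m)) h i - (Top ^^ (k - m)) h i)"
        unfolding 1 2 by (simp add: sum_subtractf sum_distrib_left right_diff_distrib)
      also have "(\<Sum>k\<in>{m..n}. (Top ^^ (Suc k - m)) h i - (Top ^^ (k - m)) h i) = (Top ^^ (Suc n - m)) h i - (Top ^^ (m - m)) h i"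
        using n by (intro sum_Suc_diff) simp
      finally show ?thesis by simp
    qed
    obtain s H where s: "strict_mono s" and lim: "\<And>i. (\<lambda>n. A (r (s n)) i) \<longlonglongrightarrow> H i" and H: "unit_fun H"
      using seq_compact_unit_functions[of "\<lambda>n. A (r n)"] A by blast
    have rs: "strict_mono (\<lambda>n. r (s n))" using strict_mono_o[OF r s] by (simp add: comp_def)
    have inv_rs: "(\<lambda>n. 1 / real (r (s n))) \<longlonglongrightarrow> 0"
      using LIMSEQ_subseq_LIMSEQ[OF lim_1_over_n rs] by (simp add: comp_def)
    have ev: "\<forall>\<^sub>F n in sequentially. m \<le> r (s n)"
      using eventually_ge_at_top[of m]
    proof eventually_elim
      case (elim n)
      then show ?case using seq_suble[OF rs, of n] by linarith
    qed
    have "Top H = H"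
    proof
      fix i
      have "(\<lambda>n. Top (A (r (s n))) i - A (r (s n)) i) \<longlonglongrightarrow> 0"
      proof (rule Lim_null_comparison)
        show "\<forall>\<^sub>F n in sequentially. norm (Top (A (r (s n))) i - A (r (s n)) i) \<le> 1 / real (r (s n))"
          using ev
        proof eventually_elim
          case (elim n)
          have "0 \<le> (Top ^^ (Suc (r (s n)) - m)) h i" "(Top ^^ (Suc (r (s n)) - m)) h i \<le> 1" using u by auto
          then have "\<bar>(Top ^^ (Suc (r (s n)) - m)) h i - h i\<bar> \<le> 1" using h[rule_format, of i] by linarith
          then show ?case unfolding TA[OF elim] by (simp add: abs_divide divide_right_mono)
        qed
      qed (rule inv_rs)
      moreover have "(\<lambda>n. Top (A (r (s n))) i - A (r (s n)) i) \<longlonglongrightarrow> Top H i - H i"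
        by (intro tendsto_diff Top_tendsto[OF A lim H] lim)
      ultimately have "Top H i - H i = 0" by (rule LIMSEQ_unique[rotated])
      then show "Top H i = H i" by simp
    qed
    then have "H i = (\<integral>\<omega>. H (coord_X 0 \<omega>) \<partial>Pr)" by (rule harmonic_constant[OF H])
    also have "\<dots> = ?c"
    proof (rule LIMSEQ_unique[OF integral_fun_X_tendsto[OF A lim]])
      \<comment> \<open>Of the n terms those with k < m vanish, which leaves the fraction (n - m +
        1) / n of \<open>?c\<close>.\<close>
      have EA: "(\<integral>\<omega>. A n (coord_X 0 \<omega>) \<partial>Pr) = ?c - real (m - 1) * ?c * (1 / real n)" if n: "n \<ge> m" for n
      proof -
        have "(\<integral>\<omega>. A n (coord_X 0 \<omega>) \<partial>Pr) = (\<Sum>k\<in>{1..n}. (1 / real n) * (\<integral>\<omega>. g k (coord_X 0 \<omega>) \<partial>Pr))"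
          unfolding A_def
        proof (subst Bochner_Integration.integral_sum)
          show "integrable Pr (\<lambda>\<omega>. (1 / real n) * g k (coord_X 0 \<omega>))" for k
            by (intro integrable_mult_right integrable_unit_fun g)
        qed simp
        also have "\<dots> = (\<Sum>k\<in>{m..n}. (1 / real n) * ?c)"
          using n m by (intro sum.mono_neutral_cong_right) (auto simp: g_def integral_Top_pow[OF h])
        also have "\<dots> = real (Suc n - m) * ((1 / real n) * ?c)" by simp
        also have "real (Suc n - m) = real n - real (m - 1)" using n m by (simp add: of_nat_diff)
        also have "(real n - real (m - 1)) * ((1 / real n) * ?c) = ?c - real (m - 1) * ?c * (1 / real n)"
          using n m by (simp add: field_simps)
        finally show ?thesis .
      qed
      have "(\<lambda>n. ?c - real (m - 1) * ?c * (1 / real (r (s n)))) \<longlonglongrightarrow> ?c - real (m - 1) * ?c * 0"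
        by (intro tendsto_diff tendsto_const tendsto_mult_left inv_rs)
      then have "(\<lambda>n. ?c - real (m - 1) * ?c * (1 / real (r (s n)))) \<longlonglongrightarrow> ?c" by simp
      then show "(\<lambda>n. \<integral>\<omega>. A (r (s n)) (coord_X 0 \<omega>) \<partial>Pr) \<longlonglongrightarrow> ?c"
      proof (rule Lim_transform_eventually)
        show "\<forall>\<^sub>F n in sequentially. ?c - real (m - 1) * ?c * (1 / real (r (s n))) = (\<integral>\<omega>. A (r (s n)) (coord_X 0 \<omega>) \<partial>Pr)"
          using ev by eventually_elim (simp only: EA)
      qed
    qed
    finally have "(\<lambda>n. A (r (s n)) i) \<longlonglongrightarrow> ?c" using lim[of i] by simp
    then show "\<exists>s. strict_mono s \<and> (\<lambda>n. wmean ?w (\<lambda>k. if m \<le> k then (Top ^^ (k - m)) h i else 0) (r (s n))) \<longlonglongrightarrow> ?c"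
      unfolding wA using s by blast
  qed
  have "wmean ?w (\<lambda>k. if m \<le> k then (Top ^^ (k - m)) h i else 0) \<longlonglongrightarrow> (\<integral>\<omega>. h (coord_X 0 \<omega>) \<partial>Pr)" if h: "unit_fun h" for h i m
  proof (cases "m = 0")
    case False
    then show ?thesis using pos[OF h, of m i] by simp
  next
    case True
    have "wmean ?w (\<lambda>k. if m \<le> k then (Top ^^ (k - m)) h i else 0) = wmean ?w (\<lambda>k. if 1 \<le> k then (Top ^^ (k - 1)) (Top h) i else 0)"
    proof
      fix n
      have "(Top ^^ k) h i = (Top ^^ (k - 1)) (Top h) i" if k1: "1 \<le> k" for k
      proof -
        obtain k' where "k = Suc k'" using k1 by (cases k) (auto simp: One_nat_def)
        then show ?thesis by (simp add: funpow_swap1)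
      qed
      then show "wmean ?w (\<lambda>k. if m \<le> k then (Top ^^ (k - m)) h i else 0) n = wmean ?w (\<lambda>k. if 1 \<le> k then (Top ^^ (k - 1)) (Top h) i else 0) n"
        unfolding wmean_def using True by (intro sum.cong) auto
    qed
    then show ?thesis using pos[OF unit_fun_Top[OF h], of 1 i] integral_Top[OF h] by simp
  qed
  then show ?thesis using t by (simp add: ergodic_weights_def)
qed

end

section \<open>Convergence of the filter laws\<close>

text \<open>The number \<open>w\<close> is the average of the \<open>v k\<close> with weights
  proportional to \<open>r k * m k\<close>, so this is convexity of the distance to
  \<open>u\<close>. It is multiplied by the total weight \<open>mm\<close> in order to include
  \<open>mm = 0\<close>; finiteness of \<open>mm\<close> allows the cancellation.\<close>

lemma mixture_distance:
  fixes r m :: "'e::countable \<Rightarrow> ennreal" and v :: "'e \<Rightarrow> real"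
  assumes nn: "0 \<le> u" "0 \<le> w" "\<And>k. 0 \<le> v k" and mm: "mm = (\<integral>\<^sup>+k. r k * m k \<partial>count_space UNIV)" "mm < \<infinity>"
    and w: "ennreal w * mm = (\<integral>\<^sup>+k. r k * (ennreal (v k) * m k) \<partial>count_space UNIV)"
  shows "ennreal \<bar>u - w\<bar> * mm \<le> (\<integral>\<^sup>+k. r k * (ennreal \<bar>u - v k\<bar> * m k) \<partial>count_space UNIV)"
proof -
  let ?R = "\<integral>\<^sup>+k. r k * (ennreal \<bar>u - v k\<bar> * m k) \<partial>count_space UNIV"
  have u: "ennreal u * mm = (\<integral>\<^sup>+k. r k * (ennreal u * m k) \<partial>count_space UNIV)"
    unfolding mm by (simp add: nn_integral_cmult[symmetric] mult_ac)
  have pt: "r k * (ennreal a * m k) \<le> r k * (ennreal b * m k) + r k * (ennreal c * m k)"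
    if "0 \<le> b" "0 \<le> c" "a \<le> b + c" for a b c k
    using that by (simp add: distrib_left[symmetric] distrib_right[symmetric] ennreal_plus[symmetric] del: ennreal_plus)
      (intro mult_left_mono mult_right_mono ennreal_leI; simp)
  have uw: "ennreal u * mm \<le> ?R + ennreal w * mm"
    unfolding u w by (subst nn_integral_add[symmetric]) (auto intro!: nn_integral_mono pt nn)
  have wu: "ennreal w * mm \<le> ?R + ennreal u * mm"
    unfolding u w by (subst nn_integral_add[symmetric]) (auto intro!: nn_integral_mono pt nn)
  have fin: "ennreal c * mm < \<infinity>" for c using mm(2) by (simp add: ennreal_mult_less_top)
  show ?thesis
  proof (cases "w \<le> u")
    case True
    then have "ennreal \<bar>u - w\<bar> * mm + ennreal w * mm = ennreal u * mm"
      using nn by (simp add: distrib_right[symmetric] ennreal_plus[symmetric] del: ennreal_plus)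
    with uw have "ennreal w * mm + ennreal \<bar>u - w\<bar> * mm \<le> ennreal w * mm + ?R" by (simp only: add.commute)
    then show ?thesis using fin[of w] by (simp only: ennreal_add_left_cancel_le) auto
  next
    case False
    then have "ennreal \<bar>u - w\<bar> * mm + ennreal u * mm = ennreal w * mm"
      using nn by (simp add: distrib_right[symmetric] ennreal_plus[symmetric] del: ennreal_plus)
    with wu have "ennreal u * mm + ennreal \<bar>u - w\<bar> * mm \<le> ennreal u * mm + ?R" by (simp only: add.commute)
    then show ?thesis using fin[of u] by (simp only: ennreal_add_left_cancel_le) auto
  qed
qed

lemma abs_measure_nrm_diff_le_1: "\<bar>measure (nrm v) A - measure (nrm v') A\<bar> \<le> 1"
proof -
  have "measure (nrm v) A \<le> 1" for v :: "'a \<Rightarrow> ennreal"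
    using nrm_prob[of v] by (auto simp: prob_measures_discrete intro: prob_space.prob_le_1)
  then show ?thesis by (smt (verit) measure_nonneg)
qed

lemma PE_AE_pos:
  fixes \<rho> :: "'e::countable measure"
  assumes "\<rho> \<in> prob_measures (discrete_topology UNIV)"
  shows "AE k in \<rho>. measure \<rho> {k} > 0"
proof -
  have "AE k in density (count_space UNIV) (\<lambda>i. ennreal (measure \<rho> {i})). measure \<rho> {k} > 0"
    by (simp add: AE_density AE_count_space)
  then show ?thesis by (simp only: prob_density_eq[OF assms, symmetric])
qed

lemma PE_measurable:
  fixes \<rho> :: "'e::countable measure"
  assumes "\<rho> \<in> prob_measures (discrete_topology UNIV)"
  shows "g \<in> borel_measurable \<rho>"
proof -
  have s: "sets \<rho> = sets (count_space UNIV)" using assms by (simp add: prob_measures_discrete)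
  show ?thesis unfolding measurable_cong_sets[OF s refl] by simp
qed

lemma wmean_integral_tendsto:
  fixes a :: "nat \<Rightarrow> 'x \<Rightarrow> real"
  assumes w: "toeplitz w" and N: "prob_space N" and a[measurable]: "\<And>n. a n \<in> borel_measurable N"
    and b: "\<And>n x. 0 \<le> a n x \<and> a n x \<le> 1" and lim: "AE x in N. wmean w (\<lambda>n. a n x) \<longlonglongrightarrow> c"
  shows "wmean w (\<lambda>n. \<integral>x. a n x \<partial>N) \<longlonglongrightarrow> c"
proof -
  interpret N: prob_space N by (rule N)
  have I: "integrable N (a n)" for n using b by (intro N.integrable_unit_interval) auto
  have "(\<lambda>n. \<integral>x. wmean w (\<lambda>k. a k x) n \<partial>N) \<longlonglongrightarrow> (\<integral>x. c \<partial>N)"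
  proof (rule integral_dominated_convergence[where w = "\<lambda>_. 1"])
    show "(\<lambda>x. wmean w (\<lambda>k. a k x) n) \<in> borel_measurable N" for n unfolding wmean_def by measurable
    show "AE x in N. norm (wmean w (\<lambda>k. a k x) n) \<le> 1" for n
    proof (cases "n = 0")
      case True
      then show ?thesis by (simp add: wmean_def)
    next
      case False
      then show ?thesis using b by (intro AE_I2) (auto intro!: wmean_abs_le[OF w])
    qed
  qed (use lim in auto)
  moreover have "(\<lambda>n. \<integral>x. wmean w (\<lambda>k. a k x) n \<partial>N) = wmean w (\<lambda>n. \<integral>x. a n x \<partial>N)"
    by (rule ext) (rule wmean_integral[OF I, symmetric])
  ultimately show ?thesis by (simp add: N.prob_space)
qed

section \<open>Means over observation windows given the starting state\<close>

context hidden_markov_model begin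

text \<open>The expectation of \<open>h\<close> at the next \<open>n\<close> observations when the
  signal starts in \<open>j\<close>.\<close>

definition obs_mean :: "nat \<Rightarrow> ((nat \<Rightarrow> 'f) \<Rightarrow> ennreal) \<Rightarrow> 'e \<Rightarrow> ennreal" where
  "obs_mean n h j = (\<integral>\<^sup>+y. h y * row_mass (row_prod M y n (unit_row j)) \<partial>phiN n)"

lemma obs_mean_row:
  assumes [measurable]: "h \<in> borel_measurable (PiM {1..n} (\<lambda>_. borel))"
  shows "(\<integral>\<^sup>+y. h y * row_mass (row_prod M y n v) \<partial>phiN n) = (\<integral>\<^sup>+j. v j * obs_mean n h j \<partial>count_space UNIV)"
proof -
  have "(\<integral>\<^sup>+y. h y * row_mass (row_prod M y n v) \<partial>phiN n) =
      (\<integral>\<^sup>+y. (\<integral>\<^sup>+j. v j * (h y * row_mass (row_prod M y n (unit_row j))) \<partial>count_space UNIV) \<partial>phiN n)"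
    by (subst row_mass_sum[OF row_prod_sum]) (simp add: nn_integral_cmult[symmetric] mult_ac)
  also have "\<dots> = (\<integral>\<^sup>+j. (\<integral>\<^sup>+y. v j * (h y * row_mass (row_prod M y n (unit_row j))) \<partial>phiN n) \<partial>count_space UNIV)"
    by (rule nn_integral_count_space_nn_integral) auto
  also have "\<dots> = (\<integral>\<^sup>+j. v j * obs_mean n h j \<partial>count_space UNIV)"
    by (intro nn_integral_cong) (simp add: obs_mean_def nn_integral_cmult)
  finally show ?thesis .
qed

lemma obs_mean_le_1: "(\<And>y. h y \<le> 1) \<Longrightarrow> obs_mean n h j \<le> 1"
  unfolding obs_mean_def
  using nn_integral_row_mass_row_prod[of n "unit_row j"]
    nn_integral_mono[of "phiN n" "\<lambda>y. h y * row_mass (row_prod M y n (unit_row j))" "\<lambda>y. row_mass (row_prod M y n (unit_row j))"]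
  by (simp add: mult_left_le_one_le mult_right_mono[of _ "1 :: ennreal", simplified])

lemma path_formula_obs_mean:
  assumes B: "B \<in> sets (sigma_XY m m)" and h: "h \<in> borel_measurable (PiM {1..n} (\<lambda>_. borel))"
  shows "(\<integral>\<^sup>+\<omega>. indicator B \<omega> * h (yw m n \<omega>) \<partial>Pr) = (\<integral>\<^sup>+\<omega>. indicator B \<omega> * obs_mean n h (coord_X m \<omega>) \<partial>Pr)"
proof -
  have "B \<in> sets Pr" using B sigma_XY_subset_path sets_Pr by blast
  then show ?thesis
    unfolding path_formula_mass[OF B h] obs_mean_row[OF h] by (rule nn_integral_fun_X[symmetric])
qed

lemma obs_mean_state:
  assumes h: "h \<in> borel_measurable (PiM {1..n} (\<lambda>_. borel))"
  shows "(\<integral>\<^sup>+\<omega>. indicator {\<omega>. coord_X m \<omega> = k} \<omega> * h (yw m n \<omega>) \<partial>Pr) = lam k * obs_mean n h k"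
proof -
  have "(\<integral>\<^sup>+\<omega>. indicator {\<omega>. coord_X m \<omega> = k} \<omega> * h (yw m n \<omega>) \<partial>Pr) =
      (\<integral>\<^sup>+\<omega>. obs_mean n h k * indicator {\<omega>. coord_X m \<omega> = k} \<omega> \<partial>Pr)"
    unfolding path_formula_obs_mean[OF coord_X_eq_sigma_XY[OF order.refl] h]
    by (intro nn_integral_cong) (simp add: indicator_def)
  also have "\<dots> = lam k * obs_mean n h k"
    by (simp add: nn_integral_cmult_indicator emeasure_coord_X mult.commute)
  finally show ?thesis .
qed

lemma integral_obs_mean:
  assumes h[measurable]: "h \<in> borel_measurable (PiM {1..n} (\<lambda>_. borel))" and h01: "\<And>y. 0 \<le> h y \<and> h y \<le> 1"
  shows "(\<integral>\<omega>. indicator {\<omega>. coord_X m \<omega> = k} \<omega> * h (yw m n \<omega>) \<partial>Pr) = lamr k * enn2real (obs_mean n (\<lambda>y. ennreal (h y)) k)"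
proof -
  let ?I = "indicator {\<omega>. coord_X m \<omega> = k} :: ('e, 'f) path \<Rightarrow> real"
  have "ennreal (\<integral>\<omega>. ?I \<omega> * h (yw m n \<omega>) \<partial>Pr) = (\<integral>\<^sup>+\<omega>. ennreal (?I \<omega> * h (yw m n \<omega>)) \<partial>Pr)"
    using h01 by (intro nn_integral_eq_integral[symmetric] integrable_unit_interval) (auto simp: indicator_def)
  also have "\<dots> = (\<integral>\<^sup>+\<omega>. indicator {\<omega>. coord_X m \<omega> = k} \<omega> * ennreal (h (yw m n \<omega>)) \<partial>Pr)"
    by (intro nn_integral_cong) (simp add: indicator_def)
  also have "\<dots> = lam k * obs_mean n (\<lambda>y. ennreal (h y)) k" by (rule obs_mean_state) simp
  finally have "enn2real (ennreal (\<integral>\<omega>. ?I \<omega> * h (yw m n \<omega>) \<partial>Pr)) = lamr k * enn2real (obs_mean n (\<lambda>y. ennreal (h y)) k)"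
    using lamr[of k] by (simp add: enn2real_mult)
  moreover have "0 \<le> (\<integral>\<omega>. ?I \<omega> * h (yw m n \<omega>) \<partial>Pr)" using h01 by (intro integral_nonneg_AE) (simp add: indicator_def)
  ultimately show ?thesis by simp
qed

lemma unit_fun_obs_mean:
  assumes "\<And>y. 0 \<le> h y \<and> h y \<le> 1"
  shows "unit_fun (\<lambda>k. enn2real (obs_mean n (\<lambda>y. ennreal (h y)) k))"
    and "ennreal (enn2real (obs_mean n (\<lambda>y. ennreal (h y)) k)) = obs_mean n (\<lambda>y. ennreal (h y)) k"
proof -
  have le: "obs_mean n (\<lambda>y. ennreal (h y)) k \<le> 1" for k using assms by (intro obs_mean_le_1) simp
  show "unit_fun (\<lambda>k. enn2real (obs_mean n (\<lambda>y. ennreal (h y)) k))"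
    using enn2real_mono[OF le] by simp
  show "ennreal (enn2real (obs_mean n (\<lambda>y. ennreal (h y)) k)) = obs_mean n (\<lambda>y. ennreal (h y)) k"
    using le[of k] by (intro ennreal_enn2real) (auto simp: less_top[symmetric] top_unique)
qed

text \<open>The Markov property used twice: at time -m for the window, and at time -n for the n - m
  steps that the chain makes before the window begins.\<close>

lemma integral_obs_mean_Top:
  assumes h[measurable]: "h \<in> borel_measurable (PiM {1..m} (\<lambda>_. borel))" and h01: "\<And>y. 0 \<le> h y \<and> h y \<le> 1" and mn: "m \<le> n"
  shows "(\<integral>\<omega>. indicator {\<omega>. coord_X (- int n) \<omega> = i} \<omega> * h (yw (- int m) m \<omega>) \<partial>Pr) =
    lamr i * (Top ^^ (n - m)) (\<lambda>k. enn2real (obs_mean m (\<lambda>y. ennreal (h y)) k)) i"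
proof -
  let ?I = "indicator {\<omega>. coord_X (- int n) \<omega> = i} :: ('e, 'f) path \<Rightarrow> real"
  let ?g = "\<lambda>k. enn2real (obs_mean m (\<lambda>y. ennreal (h y)) k)"
  note g = unit_fun_obs_mean[of h m, OF h01]
  have g0: "0 \<le> (Top ^^ (n - m)) ?g i" using unit_fun_Top_pow[OF g(1)] by simp
  have B: "{\<omega>. coord_X (- int n) \<omega> = i} \<in> sets (sigma_XY (- int n) (- int n))" by (rule coord_X_eq_sigma_XY) simp
  have B': "{\<omega>. coord_X (- int n) \<omega> = i} \<in> sets (sigma_XY (- int m) (- int m))" by (rule coord_X_eq_sigma_XY) (use mn in simp)
  have e: "- int m = - int n + int (n - m)" using mn by simp
  have "ennreal (\<integral>\<omega>. ?I \<omega> * h (yw (- int m) m \<omega>) \<partial>Pr) = (\<integral>\<^sup>+\<omega>. ennreal (?I \<omega> * h (yw (- int m) m \<omega>)) \<partial>Pr)"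
    using h01 by (intro nn_integral_eq_integral[symmetric] integrable_unit_interval) (auto simp: indicator_def)
  also have "\<dots> = (\<integral>\<^sup>+\<omega>. indicator {\<omega>. coord_X (- int n) \<omega> = i} \<omega> * ennreal (h (yw (- int m) m \<omega>)) \<partial>Pr)"
    by (intro nn_integral_cong) (simp add: indicator_def)
  also have "\<dots> = (\<integral>\<^sup>+\<omega>. indicator {\<omega>. coord_X (- int n) \<omega> = i} \<omega> * ennreal (?g (coord_X (- int m) \<omega>)) \<partial>Pr)"
    unfolding g(2) by (rule path_formula_obs_mean[OF B']) simp
  also have "\<dots> = (\<integral>\<^sup>+\<omega>. indicator {\<omega>. coord_X (- int n) \<omega> = i} \<omega> * ennreal ((Top ^^ (n - m)) ?g (coord_X (- int n) \<omega>)) \<partial>Pr)"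
    unfolding e by (rule markov_Top_pow[OF B g(1)])
  also have "\<dots> = (\<integral>\<^sup>+\<omega>. ennreal ((Top ^^ (n - m)) ?g i) * indicator {\<omega>. coord_X (- int n) \<omega> = i} \<omega> \<partial>Pr)"
    by (intro nn_integral_cong) (simp add: indicator_def)
  also have "\<dots> = ennreal (lamr i * (Top ^^ (n - m)) ?g i)"
    using lamr[of i] by (subst nn_integral_cmult_indicator) (simp_all add: emeasure_coord_X ennreal_mult'' g0 mult.commute)
  finally have "ennreal (\<integral>\<omega>. ?I \<omega> * h (yw (- int m) m \<omega>) \<partial>Pr) = ennreal (lamr i * (Top ^^ (n - m)) ?g i)" .
  moreover have "0 \<le> (\<integral>\<omega>. ?I \<omega> * h (yw (- int m) m \<omega>) \<partial>Pr)" using h01 by (intro integral_nonneg_AE) (simp add: indicator_def)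
  ultimately show ?thesis using g0 lamr(2)[of i] by (simp add: less_imp_le)
qed

lemma integral_obs_mean_total:
  assumes h[measurable]: "h \<in> borel_measurable (PiM {1..m} (\<lambda>_. borel))" and h01: "\<And>y. 0 \<le> h y \<and> h y \<le> 1"
  shows "(\<integral>\<omega>. enn2real (obs_mean m (\<lambda>y. ennreal (h y)) (coord_X 0 \<omega>)) \<partial>Pr) = (\<integral>\<omega>. h (yw (- int m) m \<omega>) \<partial>Pr)"
proof -
  let ?g = "\<lambda>k. enn2real (obs_mean m (\<lambda>y. ennreal (h y)) k)"
  note g = unit_fun_obs_mean[of h m, OF h01]
  have U: "UNIV \<in> sets (sigma_XY (- int m) (- int m) :: ('e, 'f) path measure)"
    using sets.top[of "sigma_XY (- int m) (- int m) :: ('e, 'f) path measure"] by simp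
  have "ennreal (\<integral>\<omega>. h (yw (- int m) m \<omega>) \<partial>Pr) = (\<integral>\<^sup>+\<omega>. ennreal (h (yw (- int m) m \<omega>)) \<partial>Pr)"
    using h01 by (intro nn_integral_eq_integral[symmetric] integrable_unit_interval) auto
  also have "\<dots> = (\<integral>\<^sup>+\<omega>. ennreal (?g (coord_X (- int m) \<omega>)) \<partial>Pr)"
    unfolding g(2) using path_formula_obs_mean[OF U, of "\<lambda>y. ennreal (h y)" m] by simp
  also have "\<dots> = ennreal (\<integral>\<omega>. ?g (coord_X (- int m) \<omega>) \<partial>Pr)"
    using g(1) by (intro nn_integral_eq_integral integrable_unit_fun) auto
  finally have "(\<integral>\<omega>. h (yw (- int m) m \<omega>) \<partial>Pr) = (\<integral>\<omega>. ?g (coord_X (- int m) \<omega>) \<partial>Pr)"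
    using h01 by (subst (asm) ennreal_inj) (auto intro!: integral_nonneg_AE)
  then show ?thesis using integral_fun_X_shift[of ?g "- int m"] by simp
qed

lemma ergodic_weightsD: "ergodic_weights w \<Longrightarrow> toeplitz w"
  by (simp add: ergodic_weights_def)

lemma ergodic_weights_tendsto:
  "ergodic_weights w \<Longrightarrow> unit_fun h \<Longrightarrow>
    wmean w (\<lambda>k. if m \<le> k then (Top ^^ (k - m)) h i else 0) \<longlonglongrightarrow> (\<integral>\<omega>. h (coord_X 0 \<omega>) \<partial>Pr)"
  by (simp add: ergodic_weights_def)

text \<open>The length \<open>m\<close> of the window is fixed, so the distance n - m between the
  conditioning state and the window grows, and the ergodic theorem decouples the two.\<close>

lemma wmean_state_obs:
  assumes w: "ergodic_weights w"
    and h[measurable]: "h \<in> borel_measurable (PiM {1..m} (\<lambda>_. borel))" and h01: "\<And>y. 0 \<le> h y \<and> h y \<le> 1"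
  shows "wmean w (\<lambda>n. \<integral>\<omega>. indicator {\<omega>. coord_X (- int n) \<omega> = i} \<omega> * h (yw (- int m) m \<omega>) \<partial>Pr)
    \<longlonglongrightarrow> lamr i * (\<integral>\<omega>. h (yw (- int m) m \<omega>) \<partial>Pr)"
proof -
  let ?a = "\<lambda>n. \<integral>\<omega>. indicator {\<omega>. coord_X (- int n) \<omega> = i} \<omega> * h (yw (- int m) m \<omega>) \<partial>Pr"
  let ?g = "\<lambda>k. enn2real (obs_mean m (\<lambda>y. ennreal (h y)) k)"
  let ?b = "\<lambda>n. if m \<le> n then (Top ^^ (n - m)) ?g i else 0"
  note g = unit_fun_obs_mean(1)[of h m, OF h01]
  have b: "wmean w ?b \<longlonglongrightarrow> (\<integral>\<omega>. h (yw (- int m) m \<omega>) \<partial>Pr)"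
    using ergodic_weights_tendsto[OF w g, of m i] by (simp only: integral_obs_mean_total[OF h h01])
  \<comment> \<open>The two sequences differ only at the finitely many indices below
    \<open>m\<close>, and Toeplitz weights ignore these.\<close>
  have "eventually (\<lambda>n. ?a n - lamr i * ?b n = 0) sequentially"
    using eventually_ge_at_top[of m] by eventually_elim (simp add: integral_obs_mean_Top[OF h h01])
  then have "(\<lambda>n. ?a n - lamr i * ?b n) \<longlonglongrightarrow> 0" by (rule tendsto_eventually)
  from wmean_null[OF ergodic_weightsD[OF w] this]
  have "(\<lambda>n. wmean w ?a n - lamr i * wmean w ?b n) \<longlonglongrightarrow> 0" by (simp only: wmean_diff[symmetric] wmean_cmult[symmetric])
  from tendsto_add[OF this tendsto_mult_left[OF b, of "lamr i"]] show ?thesis by simp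
qed

section \<open>Iterates of the filter kernel\<close>

lemma nrm_row_prod_joint_measurable:
  "(\<lambda>x. nrm (row_prod M (snd x) n (row_of (fst x)))) \<in> borel_of PE \<Otimes>\<^sub>M PiM {1..n} (\<lambda>_. borel) \<rightarrow>\<^sub>M borel_of PE"
  by (rule nrm_measurable) (rule row_prod_joint_measurable[OF measurable_ident_sets[OF refl]])

lemma filter_mean_measurable:
  assumes g[measurable]: "g \<in> borel_measurable (borel_of PE)"
  shows "(\<lambda>\<rho>. \<integral>\<^sup>+y. g (nrm (row_prod M y n (row_of \<rho>))) * row_mass (row_prod M y n (row_of \<rho>)) \<partial>phiN n) \<in> borel_measurable (borel_of PE)"
proof -
  note nrm_row_prod_joint_measurable[of n, measurable]
  have [measurable]: "(\<lambda>x. row_mass (row_prod M (snd x) n (row_of (fst x)))) \<in> borel_measurable (borel_of PE \<Otimes>\<^sub>M PiM {1..n} (\<lambda>_. borel))"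
    unfolding row_mass_def
    by (rule borel_measurable_nn_integral_count_space) (rule row_prod_joint_measurable[OF measurable_ident_sets[OF refl]])
  have "(\<lambda>x. g (nrm (row_prod M (snd x) n (row_of (fst x)))) * row_mass (row_prod M (snd x) n (row_of (fst x))))
      \<in> borel_measurable (borel_of PE \<Otimes>\<^sub>M phiN n)"
    by measurable
  then show ?thesis
    using sigma_finite_measure.borel_measurable_nn_integral[OF sigma_finite_phiN, of "\<lambda>\<rho> y. g (nrm (row_prod M y n (row_of \<rho>))) * row_mass (row_prod M y n (row_of \<rho>))"]
    by (simp add: case_prod_beta)
qed

lemma nn_integral_filter_kernel:
  assumes \<mu>: "\<mu> \<in> prob_measures (discrete_topology UNIV)" and g[measurable]: "g \<in> borel_measurable (borel_of PE)"
  shows "(\<integral>\<^sup>+\<nu>. g \<nu> \<partial>filter_kernel \<phi> M \<mu>) = (\<integral>\<^sup>+y. g (nrm (row_mult (row_of \<mu>) (M y))) * row_mass (row_mult (row_of \<mu>) (M y)) \<partial>\<phi>)"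
proof -
  note [measurable_cong] = sets_phi
  note filter_step_measurable[OF \<mu>, measurable]
  have [measurable]: "(\<lambda>y. row_mass (row_mult (row_of \<mu>) (M y))) \<in> borel_measurable borel"
    using measurable_Pair2[OF joint_measurable(2), of \<mu>] \<mu> by (simp add: space_borel_of_PE)
  have "(\<integral>\<^sup>+\<nu>. g \<nu> \<partial>filter_kernel \<phi> M \<mu>) = (\<integral>\<^sup>+y. row_mass (row_mult (row_of \<mu>) (M y)) * g (filter_step M \<mu> y) \<partial>\<phi>)"
    unfolding filter_kernel_def by (subst nn_integral_distr, simp, simp, subst nn_integral_density) auto
  also have "\<dots> = (\<integral>\<^sup>+y. g (nrm (row_mult (row_of \<mu>) (M y))) * row_mass (row_mult (row_of \<mu>) (M y)) \<partial>\<phi>)"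
  proof (rule nn_integral_cong_AE, use AE_row_mass_finite[OF \<mu>] in eventually_elim)
    case (elim y)
    then show ?case
      using filter_step_eq_fstep[of \<mu> M y] by (cases "row_mass (row_mult (row_of \<mu>) (M y)) = 0") (auto simp: fstep_def mult.commute)
  qed
  finally show ?thesis .
qed

lemma apply_kernel_Suc: "apply_kernel K (Suc n) m = apply_kernel K n m \<bind> K"
  by (simp add: apply_kernel_def)

lemma apply_kernel_prob:
  assumes "M0 \<in> prob_measures PE"
  shows "apply_kernel (filter_kernel \<phi> M) n M0 \<in> prob_measures PE"
proof (induction n)
  case 0
  then show ?case using assms by (simp add: apply_kernel_def)
next
  case (Suc n)
  then have "apply_kernel (filter_kernel \<phi> M) n M0 \<in> space (prob_algebra (borel_of PE))"
    by (simp add: space_prob_algebra prob_measures_def)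
  from prob_space_bind'[OF this filter_kernel_measurable] sets_bind'[OF this filter_kernel_measurable]
  show ?case by (simp add: apply_kernel_Suc prob_measures_def)
qed

text \<open>The n kernel steps amount to one passage over a window of n observations: the
  intermediate normalizations cancel, because \<open>nrm\<close> ignores scale while the masses
  multiply up to the density of the window.\<close>

lemma nn_integral_apply_kernel:
  assumes M0: "M0 \<in> prob_measures PE" and g: "g \<in> borel_measurable (borel_of PE)"
  shows "(\<integral>\<^sup>+\<nu>. g \<nu> \<partial>apply_kernel (filter_kernel \<phi> M) n M0) =
    (\<integral>\<^sup>+\<rho>. (\<integral>\<^sup>+y. g (nrm (row_prod M y n (row_of \<rho>))) * row_mass (row_prod M y n (row_of \<rho>)) \<partial>phiN n) \<partial>M0)"
  using g
proof (induction n arbitrary: g)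
  case 0
  have "space M0 = prob_measures (discrete_topology UNIV)"
    using M0 sets_eq_imp_space_eq[of M0 "borel_of PE"] by (simp add: prob_measures_def space_borel_of_PE)
  then show ?case
    unfolding apply_kernel_def funpow_0
    by (intro nn_integral_cong) (subst nn_integral_phiN_0, simp add: nrm_row_of row_mass_row_of)
next
  case (Suc n)
  note g = Suc.prems
  let ?m = "apply_kernel (filter_kernel \<phi> M) n M0"
  let ?g' = "\<lambda>\<rho>. \<integral>\<^sup>+\<nu>. g \<nu> \<partial>filter_kernel \<phi> M \<rho>"
  have mp: "?m \<in> prob_measures PE" by (rule apply_kernel_prob[OF M0])
  have ms: "sets ?m = sets (borel_of PE)" using mp by (simp add: prob_measures_def)
  have K: "filter_kernel \<phi> M \<in> borel_of PE \<rightarrow>\<^sub>M subprob_algebra (borel_of PE)"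
    by (rule measurable_prob_algebraD[OF filter_kernel_measurable])
  have g': "?g' \<in> borel_measurable (borel_of PE)"
    by (rule measurable_compose[OF K nn_integral_measurable_subprob_algebra]) (rule g)
  have "(\<integral>\<^sup>+\<nu>. g \<nu> \<partial>apply_kernel (filter_kernel \<phi> M) (Suc n) M0) = (\<integral>\<^sup>+\<rho>. ?g' \<rho> \<partial>?m)"
    unfolding apply_kernel_Suc
    by (rule nn_integral_bind[OF g]) (use K in \<open>simp add: measurable_cong_sets[OF ms refl]\<close>)
  also have "\<dots> = (\<integral>\<^sup>+\<rho>. (\<integral>\<^sup>+y. ?g' (nrm (row_prod M y n (row_of \<rho>))) * row_mass (row_prod M y n (row_of \<rho>)) \<partial>phiN n) \<partial>M0)"
    by (rule Suc.IH[OF g'])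
  also have "\<dots> = (\<integral>\<^sup>+\<rho>. (\<integral>\<^sup>+y. g (nrm (row_prod M y (Suc n) (row_of \<rho>))) * row_mass (row_prod M y (Suc n) (row_of \<rho>)) \<partial>phiN (Suc n)) \<partial>M0)"
  proof (rule nn_integral_cong)
    fix \<rho> assume "\<rho> \<in> space M0"
    then have \<rho>: "\<rho> \<in> prob_measures (discrete_topology UNIV)"
      using M0 sets_eq_imp_space_eq[of M0 "borel_of PE"] by (simp add: prob_measures_def space_borel_of_PE)
    have fin0: "row_mass (row_of \<rho>) < \<infinity>" by (simp add: row_mass_row_of[OF \<rho>])
    have nm: "(\<lambda>y. nrm (row_prod M y (Suc n) (row_of \<rho>))) \<in> PiM {1..Suc n} (\<lambda>_. borel) \<rightarrow>\<^sub>M borel_of PE"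
      by (rule nrm_measurable) (rule row_prod_phiN)
    have "(\<lambda>y. g (nrm (row_prod M y (Suc n) (row_of \<rho>))) * row_mass (row_prod M y (Suc n) (row_of \<rho>))) \<in> borel_measurable (PiM {1..Suc n} (\<lambda>_. borel))"
      by (intro borel_measurable_times_ennreal measurable_compose[OF nm g] row_mass_row_prod_phiN)
    from nn_integral_phiN_Suc[OF this]
    have "(\<integral>\<^sup>+y. g (nrm (row_prod M y (Suc n) (row_of \<rho>))) * row_mass (row_prod M y (Suc n) (row_of \<rho>)) \<partial>phiN (Suc n)) =
        (\<integral>\<^sup>+y. (\<integral>\<^sup>+z. g (nrm (row_mult (row_prod M y n (row_of \<rho>)) (M z))) * row_mass (row_mult (row_prod M y n (row_of \<rho>)) (M z)) \<partial>\<phi>) \<partial>phiN n)"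
      by (simp cong: row_prod_cong)
    also have "\<dots> = (\<integral>\<^sup>+y. ?g' (nrm (row_prod M y n (row_of \<rho>))) * row_mass (row_prod M y n (row_of \<rho>)) \<partial>phiN n)"
    proof (rule nn_integral_cong_AE, use AE_row_prod_finite[OF fin0, of n] in eventually_elim)
      case (elim y)
      let ?v = "row_prod M y n (row_of \<rho>)"
      let ?c = "row_mass ?v"
      show ?case
      proof (cases "?c = 0")
        case True
        then have "?v = (\<lambda>_. 0)" by (simp add: row_mass_eq_0_iff fun_eq_iff)
        then have "row_mult ?v (M z) = (\<lambda>_. 0)" for z by (simp add: row_mult_def fun_eq_iff)
        then show ?thesis using True by (simp add: row_mass_def)
      next
        case False
        have fin: "?c < \<infinity>" using elim by simp
        \<comment> \<open>The mass \<open>?c\<close> is pulled out of the row; it disappears inside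
          \<open>nrm\<close> and reappears as the density of the first n observations.\<close>
        have e: "row_mult ?v (M z) = (\<lambda>i. ?c * row_mult (row_of (nrm ?v)) (M z) i)" for z
          by (subst row_of_nrm[OF fin]) (simp add: row_mult_cmult fun_eq_iff)
        have [measurable]: "(\<lambda>z. row_mass (row_mult (row_of (nrm ?v)) (M z))) \<in> borel_measurable borel"
          using measurable_Pair2[OF joint_measurable(2), of "nrm ?v"] by (simp add: space_borel_of_PE nrm_prob)
        note [measurable_cong] = sets_phi
        have "(\<lambda>x. nrm (row_mult (row_of (fst x)) (M (snd x)))) \<in> borel_of PE \<Otimes>\<^sub>M borel \<rightarrow>\<^sub>M borel_of PE"
          by (rule nrm_measurable) (rule joint_measurable)
        from measurable_Pair2[OF this, of "nrm ?v"]
        have [measurable]: "(\<lambda>z. nrm (row_mult (row_of (nrm ?v)) (M z))) \<in> borel \<rightarrow>\<^sub>M borel_of PE"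
          by (simp add: space_borel_of_PE nrm_prob)
        note g[measurable]
        have "g (nrm (row_mult ?v (M z))) * row_mass (row_mult ?v (M z)) =
          g (nrm (row_mult (row_of (nrm ?v)) (M z))) * row_mass (row_mult (row_of (nrm ?v)) (M z)) * ?c" for z
          unfolding e nrm_cmult[OF False fin] row_mass_cmult by (simp only: mult_ac)
        then show ?thesis
          unfolding nn_integral_filter_kernel[OF nrm_prob g] by (simp add: nn_integral_multc)
      qed
    qed
    finally show "(\<integral>\<^sup>+y. ?g' (nrm (row_prod M y n (row_of \<rho>))) * row_mass (row_prod M y n (row_of \<rho>)) \<partial>phiN n) =
      (\<integral>\<^sup>+y. g (nrm (row_prod M y (Suc n) (row_of \<rho>))) * row_mass (row_prod M y (Suc n) (row_of \<rho>)) \<partial>phiN (Suc n))" by simp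
  qed
  finally show ?case .
qed

section \<open>Forgetting of the initial law when the two filters agree\<close>

context
  fixes \<pi>min \<pi>max :: "('e, 'f) path \<Rightarrow> 'e measure" and f :: "'e measure \<Rightarrow> real"
  assumes min: "is_pi_min Pr 0 \<pi>min" and max: "is_pi_max Pr 0 \<pi>max" and eq: "AE \<omega> in Pr. \<pi>min \<omega> = \<pi>max \<omega>"
    and f: "f \<in> bdd_continuous PE" and f01: "\<And>x. 0 \<le> f x \<and> f x \<le> 1"
begin

lemma f_measurable [measurable]: "f \<in> borel_measurable (borel_of PE)"
  using f by (rule bdd_continuous_measurable)

lemma pi_min_measurable [measurable]: "\<pi>min \<in> path_space \<rightarrow>\<^sub>M borel_of PE"
  by (rule filter_version_measurable[OF filter_version_min[OF min]])

lemma wfilter_const_measurable [measurable]: "wfilter n v \<in> path_space \<rightarrow>\<^sub>M borel_of PE"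
  using wfilter_measurable[of "\<lambda>_. v" n] by simp

lemma wfilter_unit_measurable [measurable]: "(\<lambda>\<omega>. wfilter n (unit_row (coord_X m \<omega>)) \<omega>) \<in> path_space \<rightarrow>\<^sub>M borel_of PE"
  by (rule wfilter_measurable) simp

lemma f_nrm_measurable [measurable]: "(\<lambda>y. f (nrm (row_prod M y n v))) \<in> borel_measurable (PiM {1..n} (\<lambda>_. borel))"
proof -
  have "(\<lambda>y. nrm (row_prod M y n v)) \<in> PiM {1..n} (\<lambda>_. borel) \<rightarrow>\<^sub>M borel_of PE"
    by (rule nrm_measurable) simp
  then show ?thesis by simp
qed

text \<open>
  A window filter depends on the far past only through the signal at the left end of its window, so
  the ergodic theorem makes it independent of \<open>X\<^bsub>-n\<^esub>\<close> in the mean.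
\<close>
lemma wmean_state_limit:
  assumes w: "ergodic_weights w"
  shows "wmean w (\<lambda>n. \<integral>\<omega>. indicator {\<omega>. coord_X (- int n) \<omega> = i} \<omega> * f (\<pi>min \<omega>) \<partial>Pr) \<longlonglongrightarrow> lamr i * (\<integral>\<omega>. f (\<pi>min \<omega>) \<partial>Pr)"
proof (rule LIMSEQ_I)
  fix e :: real assume e: "e > 0"
  let ?d = "\<lambda>m. \<integral>\<omega>. \<bar>f (wfilter m lam \<omega>) - f (\<pi>min \<omega>)\<bar> \<partial>Pr"
  let ?a = "\<lambda>n. \<integral>\<omega>. indicator {\<omega>. coord_X (- int n) \<omega> = i} \<omega> * f (\<pi>min \<omega>) \<partial>Pr"
  let ?b = "\<lambda>m n. \<integral>\<omega>. indicator {\<omega>. coord_X (- int n) \<omega> = i} \<omega> * f (wfilter m lam \<omega>) \<partial>Pr"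
  have "?d \<longlonglongrightarrow> 0" by (rule L1_convergence_bdd_continuous[OF _ _ wfilter_lam_L1[OF min] f]) auto
  \<comment> \<open>The window length \<open>m\<close> is fixed before \<open>n\<close>. The error
    \<open>?d m\<close> does not depend on \<open>n\<close>, so it survives the weighted
    mean.\<close>
  from order_tendstoD(2)[OF this, of "e/3"] e obtain m where m: "?d m < e/3"
    by (auto simp: eventually_sequentially)
  have I: "integrable Pr (\<lambda>\<omega>. f (wfilter m lam \<omega>))" "integrable Pr (\<lambda>\<omega>. f (\<pi>min \<omega>))"
    "integrable Pr (\<lambda>\<omega>. indicator {\<omega>. coord_X (- int n) \<omega> = i} \<omega> * f (wfilter m lam \<omega>))"
    "integrable Pr (\<lambda>\<omega>. indicator {\<omega>. coord_X (- int n) \<omega> = i} \<omega> * f (\<pi>min \<omega>))" for n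
    using f01 by (auto intro!: integrable_unit_interval simp: indicator_def)
  have "wmean w (?b m) \<longlonglongrightarrow> lamr i * (\<integral>\<omega>. f (wfilter m lam \<omega>) \<partial>Pr)"
    using wmean_state_obs[OF w f_nrm_measurable, of m lam i] f01 by (simp add: wfilter_def)
  from LIMSEQ_D[OF this, of "e/3"] e obtain N where N: "\<And>n. n \<ge> N \<Longrightarrow> \<bar>wmean w (?b m) n - lamr i * (\<integral>\<omega>. f (wfilter m lam \<omega>) \<partial>Pr)\<bar> < e/3"
    by auto
  have lam1: "0 \<le> lamr i" "lamr i \<le> 1" using lamr(2)[of i] by (auto simp: lamr_def)
  have ab: "\<bar>?b m n - ?a n\<bar> \<le> ?d m" for n
  proof -
    have "\<bar>?b m n - ?a n\<bar> = \<bar>\<integral>\<omega>. indicator {\<omega>. coord_X (- int n) \<omega> = i} \<omega> * (f (wfilter m lam \<omega>) - f (\<pi>min \<omega>)) \<partial>Pr\<bar>"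
      using I(3,4)[of n] by (simp add: right_diff_distrib)
    also have "\<dots> \<le> (\<integral>\<omega>. \<bar>indicator {\<omega>. coord_X (- int n) \<omega> = i} \<omega> * (f (wfilter m lam \<omega>) - f (\<pi>min \<omega>))\<bar> \<partial>Pr)"
      by (rule integral_abs_bound)
    also have "\<dots> \<le> ?d m"
      using I by (intro integral_mono') (auto simp: indicator_def)
    finally show ?thesis .
  qed
  have c: "\<bar>(\<integral>\<omega>. f (wfilter m lam \<omega>) \<partial>Pr) - (\<integral>\<omega>. f (\<pi>min \<omega>) \<partial>Pr)\<bar> \<le> ?d m"
    using I(1,2) integral_abs_bound[of Pr "\<lambda>\<omega>. f (wfilter m lam \<omega>) - f (\<pi>min \<omega>)"] by simp
  have "norm (wmean w ?a n - lamr i * (\<integral>\<omega>. f (\<pi>min \<omega>) \<partial>Pr)) < e" if n: "n \<ge> Suc N" for n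
  proof -
    have "\<bar>wmean w (?b m) n - wmean w ?a n\<bar> \<le> ?d m"
      using wmean_abs_le[OF ergodic_weightsD[OF w] ab, of n] n by (simp add: wmean_diff)
    moreover have "\<bar>lamr i * (\<integral>\<omega>. f (wfilter m lam \<omega>) \<partial>Pr) - lamr i * (\<integral>\<omega>. f (\<pi>min \<omega>) \<partial>Pr)\<bar> \<le> 1 * ?d m"
      unfolding right_diff_distrib[symmetric] abs_mult using lam1 c by (intro mult_mono) auto
    moreover have "\<bar>wmean w (?b m) n - lamr i * (\<integral>\<omega>. f (wfilter m lam \<omega>) \<partial>Pr)\<bar> < e/3" using n by (intro N) simp
    ultimately show ?thesis using m unfolding real_norm_def by linarith
  qed
  then show "\<exists>no. \<forall>n\<ge>no. norm (wmean w ?a n - lamr i * (\<integral>\<omega>. f (\<pi>min \<omega>) \<partial>Pr)) < e" by blast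
qed

text \<open>The unnormalized filter started in \<open>\<rho>\<close> is the
  \<open>\<rho>\<close>-mixture of those started in single states, so after normalization the weight
  of state \<open>k\<close> is proportional to its mass.\<close>

lemma AE_wfilter_mixture:
  assumes \<rho>: "\<rho> \<in> prob_measures (discrete_topology UNIV)" and u: "\<And>y. 0 \<le> u y"
  shows "AE y in phiN n. ennreal \<bar>u y - measure (nrm (row_prod M y n (row_of \<rho>))) {i}\<bar> * row_mass (row_prod M y n (row_of \<rho>)) \<le>
    (\<integral>\<^sup>+k. row_of \<rho> k * (ennreal \<bar>u y - measure (nrm (row_prod M y n (unit_row k))) {i}\<bar> * row_mass (row_prod M y n (unit_row k))) \<partial>count_space UNIV)"
proof -
  have "AE y in phiN n. \<forall>k. row_mass (row_prod M y n (unit_row k)) < \<infinity>"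
    unfolding AE_all_countable by (intro allI AE_row_prod_finite) simp
  moreover have "AE y in phiN n. row_mass (row_prod M y n (row_of \<rho>)) < \<infinity>"
    by (rule AE_row_prod_finite) (simp add: row_mass_row_of[OF \<rho>])
  ultimately show ?thesis
  proof eventually_elim
    case (elim y)
    show ?case
    proof (rule mixture_distance)
      show "row_mass (row_prod M y n (row_of \<rho>)) = (\<integral>\<^sup>+k. row_of \<rho> k * row_mass (row_prod M y n (unit_row k)) \<partial>count_space UNIV)"
        by (rule row_mass_sum) (rule row_prod_sum)
      show "ennreal (measure (nrm (row_prod M y n (row_of \<rho>))) {i}) * row_mass (row_prod M y n (row_of \<rho>)) =
        (\<integral>\<^sup>+k. row_of \<rho> k * (ennreal (measure (nrm (row_prod M y n (unit_row k))) {i}) * row_mass (row_prod M y n (unit_row k))) \<partial>count_space UNIV)"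
        using elim by (simp only: nrm_coord) (rule row_prod_sum)
    qed (use elim u in auto)
  qed
qed

text \<open>Where the signal is in \<open>k\<close> at time -n, the filter started in
  \<open>k\<close> is the one started in the true state and tends to \<open>\<pi>max\<close>, while
  the filter started in \<open>lam\<close> tends to \<open>\<pi>min\<close>. The limits coincide,
  and division by \<open>lamr k > 0\<close> gives the mean conditioned on \<open>k\<close>.\<close>

lemma unit_start_gap:
  "(\<lambda>n. enn2real (obs_mean n (\<lambda>y. ennreal \<bar>measure (nrm (row_prod M y n lam)) {i} - measure (nrm (row_prod M y n (unit_row k))) {i}\<bar>) k)) \<longlonglongrightarrow> 0"
proof -
  let ?c = "\<lambda>n. enn2real (obs_mean n (\<lambda>y. ennreal \<bar>measure (nrm (row_prod M y n lam)) {i} - measure (nrm (row_prod M y n (unit_row k))) {i}\<bar>) k)"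
  let ?U = "\<lambda>n \<omega>. measure (wfilter n lam \<omega>) {i}"
  let ?V = "\<lambda>n \<omega>. measure (wfilter n (unit_row (coord_X (- int n) \<omega>)) \<omega>) {i}"
  have [measurable]: "\<pi>max \<in> path_space \<rightarrow>\<^sub>M borel_of PE"
    by (rule filter_version_measurable[OF filter_version_max[OF max]])
  have p1: "measure (\<pi>min \<omega>) {i} \<le> 1" "measure (\<pi>max \<omega>) {i} \<le> 1" for \<omega>
    using filter_version_prob[OF filter_version_min[OF min], of \<omega>] filter_version_prob[OF filter_version_max[OF max], of \<omega>]
    by (auto simp: prob_measures_discrete intro: prob_space.prob_le_1)
  have I: "integrable Pr (?U n)" "integrable Pr (?V n)" "integrable Pr (\<lambda>\<omega>. measure (\<pi>min \<omega>) {i})" "integrable Pr (\<lambda>\<omega>. measure (\<pi>max \<omega>) {i})" for n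
    using measure_wfilter_01 p1 by (auto intro!: integrable_unit_interval)
  have bound: "\<bar>lamr k * ?c n\<bar> \<le> (\<integral>\<omega>. \<bar>?U n \<omega> - measure (\<pi>min \<omega>) {i}\<bar> \<partial>Pr) + (\<integral>\<omega>. \<bar>?V n \<omega> - measure (\<pi>max \<omega>) {i}\<bar> \<partial>Pr)" for n
  proof -
    have "lamr k * ?c n = (\<integral>\<omega>. indicator {\<omega>. coord_X (- int n) \<omega> = k} \<omega> *
        \<bar>measure (nrm (row_prod M (yw (- int n) n \<omega>) n lam)) {i} - measure (nrm (row_prod M (yw (- int n) n \<omega>) n (unit_row k))) {i}\<bar> \<partial>Pr)"
      using abs_measure_nrm_diff_le_1 by (intro integral_obs_mean[symmetric]) auto
    also have "\<dots> = (\<integral>\<omega>. indicator {\<omega>. coord_X (- int n) \<omega> = k} \<omega> * \<bar>?U n \<omega> - ?V n \<omega>\<bar> \<partial>Pr)"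
      by (intro Bochner_Integration.integral_cong refl) (simp add: wfilter_def indicator_def)
    also have "\<dots> \<le> (\<integral>\<omega>. \<bar>?U n \<omega> - measure (\<pi>min \<omega>) {i}\<bar> + \<bar>?V n \<omega> - measure (\<pi>max \<omega>) {i}\<bar> \<partial>Pr)"
    proof (rule integral_mono_AE)
      show "AE \<omega> in Pr. indicator {\<omega>. coord_X (- int n) \<omega> = k} \<omega> * \<bar>?U n \<omega> - ?V n \<omega>\<bar> \<le> \<bar>?U n \<omega> - measure (\<pi>min \<omega>) {i}\<bar> + \<bar>?V n \<omega> - measure (\<pi>max \<omega>) {i}\<bar>"
        using eq by eventually_elim (simp add: indicator_def, linarith)
      show "integrable Pr (\<lambda>\<omega>. indicator {\<omega>. coord_X (- int n) \<omega> = k} \<omega> * \<bar>?U n \<omega> - ?V n \<omega>\<bar>)"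
      proof (rule integrable_unit_interval)
        show "(\<lambda>\<omega>. indicator {\<omega>. coord_X (- int n) \<omega> = k} \<omega> * \<bar>?U n \<omega> - ?V n \<omega>\<bar>) \<in> borel_measurable Pr" by measurable
      qed (use abs_measure_nrm_diff_le_1 in \<open>auto simp: wfilter_def indicator_def\<close>)
    qed (use I in auto)
    also have "\<dots> = (\<integral>\<omega>. \<bar>?U n \<omega> - measure (\<pi>min \<omega>) {i}\<bar> \<partial>Pr) + (\<integral>\<omega>. \<bar>?V n \<omega> - measure (\<pi>max \<omega>) {i}\<bar> \<partial>Pr)"
      using I by (intro Bochner_Integration.integral_add) auto
    finally show ?thesis using lamr(2)[of k] by simp
  qed
  have "(\<lambda>n. (\<integral>\<omega>. \<bar>?U n \<omega> - measure (\<pi>min \<omega>) {i}\<bar> \<partial>Pr) + (\<integral>\<omega>. \<bar>?V n \<omega> - measure (\<pi>max \<omega>) {i}\<bar> \<partial>Pr)) \<longlonglongrightarrow> 0 + 0"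
    by (intro tendsto_add wfilter_lam_L1[OF min] wfilter_unit_L1[OF max])
  then have "(\<lambda>n. lamr k * ?c n) \<longlonglongrightarrow> 0"
    by (intro Lim_null_comparison[of "\<lambda>n. lamr k * ?c n", OF always_eventually[OF allI]]) (use bound in auto)
  from tendsto_mult_left[OF this, of "1 / lamr k"] show ?thesis using lamr(2)[of k] by simp
qed

text \<open>
  The distance between the filter started in \<open>\<rho>\<close> and the one started in the invariant law is at most
  the \<open>\<rho>\<close>-average of the distances for the single starting states, by the triangle inequality for
  unnormalized filters.
\<close>
lemma mixture_start_gap:
  assumes \<rho>: "\<rho> \<in> prob_measures (discrete_topology UNIV)" and k: "measure \<rho> {k} > 0"
  shows "(\<lambda>n. \<integral>\<omega>. indicator {\<omega>. coord_X (- int n) \<omega> = k} \<omega> * \<bar>measure (wfilter n lam \<omega>) {i} - measure (wfilter n (row_of \<rho>) \<omega>) {i}\<bar> \<partial>Pr) \<longlonglongrightarrow> 0"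
proof -
  let ?u = "\<lambda>n y. measure (nrm (row_prod M y n lam)) {i}"
  let ?w = "\<lambda>n y. measure (nrm (row_prod M y n (row_of \<rho>))) {i}"
  let ?v = "\<lambda>n k y. measure (nrm (row_prod M y n (unit_row k))) {i}"
  let ?C = "\<lambda>n k. obs_mean n (\<lambda>y. ennreal \<bar>?u n y - ?v n k y\<bar>) k"
  let ?D = "\<lambda>n. obs_mean n (\<lambda>y. ennreal \<bar>?u n y - ?w n y\<bar>)"
  have b: "0 \<le> \<bar>measure (nrm v) {i} - measure (nrm v') {i}\<bar> \<and> \<bar>measure (nrm v) {i} - measure (nrm v') {i}\<bar> \<le> 1" for v v' :: "'e \<Rightarrow> ennreal"
    using abs_measure_nrm_diff_le_1 by simp
  have C: "0 \<le> enn2real (?C n l) \<and> enn2real (?C n l) \<le> 1" "ennreal (enn2real (?C n l)) = ?C n l" for n l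
    using unit_fun_obs_mean[of "\<lambda>y. \<bar>?u n y - ?v n l y\<bar>" n] b by auto
  have D: "ennreal (enn2real (?D n l)) = ?D n l" for n l
    using unit_fun_obs_mean(2)[of "\<lambda>y. \<bar>?u n y - ?w n y\<bar>" n] b by auto
  \<comment> \<open>On the left each mean is taken given its own starting state. Averaging over
    \<open>\<rho>\<close> produces the law of the window under the start \<open>\<rho>\<close>, for
    which the mixture bound holds.\<close>
  have mix: "(\<integral>\<^sup>+l. row_of \<rho> l * ?D n l \<partial>count_space UNIV) \<le> ennreal (\<integral>l. enn2real (?C n l) \<partial>\<rho>)" for n
  proof -
    have "(\<integral>\<^sup>+l. row_of \<rho> l * ?D n l \<partial>count_space UNIV) = (\<integral>\<^sup>+y. ennreal \<bar>?u n y - ?w n y\<bar> * row_mass (row_prod M y n (row_of \<rho>)) \<partial>phiN n)"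
      by (rule obs_mean_row[symmetric]) measurable
    also have "\<dots> \<le> (\<integral>\<^sup>+y. (\<integral>\<^sup>+l. row_of \<rho> l * (ennreal \<bar>?u n y - ?v n l y\<bar> * row_mass (row_prod M y n (unit_row l))) \<partial>count_space UNIV) \<partial>phiN n)"
      by (intro nn_integral_mono_AE AE_wfilter_mixture[OF \<rho>]) simp
    also have "\<dots> = (\<integral>\<^sup>+l. (\<integral>\<^sup>+y. row_of \<rho> l * (ennreal \<bar>?u n y - ?v n l y\<bar> * row_mass (row_prod M y n (unit_row l))) \<partial>phiN n) \<partial>count_space UNIV)"
      by (rule nn_integral_count_space_nn_integral) auto
    also have "\<dots> = (\<integral>\<^sup>+l. row_of \<rho> l * ennreal (enn2real (?C n l)) \<partial>count_space UNIV)"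
      unfolding C(2) by (intro nn_integral_cong) (simp add: obs_mean_def nn_integral_cmult)
    also have "\<dots> = ennreal (\<integral>l. enn2real (?C n l) \<partial>\<rho>)"
      using C(1) by (intro integral_PE_bounded[OF \<rho>, where B = 1]) auto
    finally show ?thesis .
  qed
  \<comment> \<open>A single term of the nonnegative average: as \<open>\<rho>\<close> charges
    \<open>k\<close>, the averaged bound becomes a bound given the starting state
    \<open>k\<close>.\<close>
  have "ennreal (measure \<rho> {k} * enn2real (?D n k)) \<le> ennreal (\<integral>l. enn2real (?C n l) \<partial>\<rho>)" for n
  proof -
    have "ennreal (measure \<rho> {k} * enn2real (?D n k)) = row_of \<rho> k * ?D n k"
      by (simp only: row_of_eq_measure[OF \<rho>, of k] ennreal_mult'[OF measure_nonneg] D)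
    also have "\<dots> \<le> (\<integral>\<^sup>+l. row_of \<rho> l * ?D n l \<partial>count_space UNIV)"
      by (rule nn_integral_ge_point) simp
    finally show ?thesis using mix by (rule order_trans)
  qed
  then have le: "measure \<rho> {k} * enn2real (?D n k) \<le> (\<integral>l. enn2real (?C n l) \<partial>\<rho>)" for n
    by (subst (asm) ennreal_le_iff) (auto intro!: integral_nonneg_AE)
  interpret \<rho>: prob_space \<rho> using \<rho> by (simp add: prob_measures_discrete)
  have "(\<lambda>n. \<integral>l. enn2real (?C n l) \<partial>\<rho>) \<longlonglongrightarrow> (\<integral>l. 0 \<partial>\<rho>)"
  proof (rule integral_dominated_convergence[where w = "\<lambda>_. 1"])
    show "AE l in \<rho>. (\<lambda>n. enn2real (?C n l)) \<longlonglongrightarrow> 0" by (intro AE_I2 unit_start_gap)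
    show "AE l in \<rho>. norm (enn2real (?C n l)) \<le> 1" for n
      unfolding real_norm_def abs_of_nonneg[OF enn2real_nonneg] by (intro AE_I2 C(1)[THEN conjunct2])
  qed (rule PE_measurable[OF \<rho>], rule PE_measurable[OF \<rho>], rule \<rho>.integrable_const)
  then have "(\<lambda>n. measure \<rho> {k} * enn2real (?D n k)) \<longlonglongrightarrow> 0"
    unfolding Bochner_Integration.integral_zero
    by (rule Lim_null_comparison[rotated])
      (intro always_eventually allI, simp only: real_norm_def abs_of_nonneg mult_nonneg_nonneg measure_nonneg enn2real_nonneg le)
  from tendsto_mult_left[OF this, of "lamr k / measure \<rho> {k}"]
  have "(\<lambda>n. lamr k * enn2real (?D n k)) \<longlonglongrightarrow> 0" using k by simp
  moreover have "lamr k * enn2real (?D n k) = (\<integral>\<omega>. indicator {\<omega>. coord_X (- int n) \<omega> = k} \<omega> * \<bar>measure (wfilter n lam \<omega>) {i} - measure (wfilter n (row_of \<rho>) \<omega>) {i}\<bar> \<partial>Pr)" for n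
    unfolding wfilter_def using b by (intro integral_obs_mean[symmetric]) auto
  ultimately show ?thesis by simp
qed

lemma mixture_start_limit:
  assumes \<rho>: "\<rho> \<in> prob_measures (discrete_topology UNIV)" and k: "measure \<rho> {k} > 0"
  shows "(\<lambda>n. \<integral>\<omega>. indicator {\<omega>. coord_X (- int n) \<omega> = k} \<omega> * \<bar>f (wfilter n (row_of \<rho>) \<omega>) - f (\<pi>min \<omega>)\<bar> \<partial>Pr) \<longlonglongrightarrow> 0"
proof -
  \<comment> \<open>Off the event that the chain is in \<open>k\<close> at time -n, the convergent
    filter started in \<open>lam\<close> is substituted. Thus \<open>u n\<close> converges in mean
    on the whole space, and \<open>L1_convergence_bdd_continuous\<close> applies to
    \<open>f\<close>.\<close>
  define u where "u n \<omega> = (if coord_X (- int n) \<omega> = k then wfilter n (row_of \<rho>) \<omega> else wfilter n lam \<omega>)" for n \<omega>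
  have [measurable]: "u n \<in> path_space \<rightarrow>\<^sub>M borel_of PE" for n
    unfolding u_def by measurable
  have u01: "0 \<le> measure (u n \<omega>) {i} \<and> measure (u n \<omega>) {i} \<le> 1" for n \<omega> i
    by (simp add: u_def measure_wfilter_01)
  have p1: "measure (\<pi>min \<omega>) {i} \<le> 1" for \<omega> i
    using filter_version_prob[OF filter_version_min[OF min], of \<omega>] by (auto simp: prob_measures_discrete intro: prob_space.prob_le_1)
  have I: "integrable Pr (\<lambda>\<omega>. measure (wfilter n v \<omega>) {i})" "integrable Pr (\<lambda>\<omega>. measure (\<pi>min \<omega>) {i})"
    "integrable Pr (\<lambda>\<omega>. measure (u n \<omega>) {i})" for n v i
    using measure_wfilter_01 p1 u01 by (auto intro!: integrable_unit_interval)
  have Ii: "integrable Pr (\<lambda>\<omega>. indicator {\<omega>. coord_X (- int n) \<omega> = k} \<omega> * g \<omega>)" if "integrable Pr g" for n and g :: "('e, 'f) path \<Rightarrow> real"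
    by (rule Bochner_Integration.integrable_bound[OF that]) (use that in \<open>auto simp: indicator_def\<close>)
  have "(\<lambda>n. \<integral>\<omega>. \<bar>measure (u n \<omega>) {i} - measure (\<pi>min \<omega>) {i}\<bar> \<partial>Pr) \<longlonglongrightarrow> 0" for i
  proof (rule Lim_null_comparison[OF always_eventually[OF allI]])
    fix n
    have "(\<integral>\<omega>. \<bar>measure (u n \<omega>) {i} - measure (\<pi>min \<omega>) {i}\<bar> \<partial>Pr) \<le>
      (\<integral>\<omega>. indicator {\<omega>. coord_X (- int n) \<omega> = k} \<omega> * \<bar>measure (wfilter n lam \<omega>) {i} - measure (wfilter n (row_of \<rho>) \<omega>) {i}\<bar> +
        \<bar>measure (wfilter n lam \<omega>) {i} - measure (\<pi>min \<omega>) {i}\<bar> \<partial>Pr)"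
      using I by (intro integral_mono Bochner_Integration.integrable_add Ii) (auto simp: u_def indicator_def)
    also have "\<dots> = (\<integral>\<omega>. indicator {\<omega>. coord_X (- int n) \<omega> = k} \<omega> * \<bar>measure (wfilter n lam \<omega>) {i} - measure (wfilter n (row_of \<rho>) \<omega>) {i}\<bar> \<partial>Pr) +
        (\<integral>\<omega>. \<bar>measure (wfilter n lam \<omega>) {i} - measure (\<pi>min \<omega>) {i}\<bar> \<partial>Pr)"
      using I by (intro Bochner_Integration.integral_add Ii) auto
    finally show "norm (\<integral>\<omega>. \<bar>measure (u n \<omega>) {i} - measure (\<pi>min \<omega>) {i}\<bar> \<partial>Pr) \<le> \<dots>" by simp
  next
    show "(\<lambda>n. (\<integral>\<omega>. indicator {\<omega>. coord_X (- int n) \<omega> = k} \<omega> * \<bar>measure (wfilter n lam \<omega>) {i} - measure (wfilter n (row_of \<rho>) \<omega>) {i}\<bar> \<partial>Pr) +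
        (\<integral>\<omega>. \<bar>measure (wfilter n lam \<omega>) {i} - measure (\<pi>min \<omega>) {i}\<bar> \<partial>Pr)) \<longlonglongrightarrow> 0"
      using tendsto_add[OF mixture_start_gap[OF \<rho> k, of i] wfilter_lam_L1[OF min, of i]] by simp
  qed
  then have L: "(\<lambda>n. \<integral>\<omega>. \<bar>f (u n \<omega>) - f (\<pi>min \<omega>)\<bar> \<partial>Pr) \<longlonglongrightarrow> 0"
    by (intro L1_convergence_bdd_continuous[OF _ _ _ f]) auto
  have If: "integrable Pr (\<lambda>\<omega>. f (u n \<omega>))" "integrable Pr (\<lambda>\<omega>. f (\<pi>min \<omega>))" "integrable Pr (\<lambda>\<omega>. f (wfilter n (row_of \<rho>) \<omega>))" for n
    using f01 by (auto intro!: integrable_unit_interval)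
  show ?thesis
  proof (rule Lim_null_comparison[OF always_eventually[OF allI] L])
    fix n
    have "(\<integral>\<omega>. indicator {\<omega>. coord_X (- int n) \<omega> = k} \<omega> * \<bar>f (wfilter n (row_of \<rho>) \<omega>) - f (\<pi>min \<omega>)\<bar> \<partial>Pr) \<le> (\<integral>\<omega>. \<bar>f (u n \<omega>) - f (\<pi>min \<omega>)\<bar> \<partial>Pr)"
      using If by (intro integral_mono Ii) (auto simp: u_def indicator_def)
    then show "norm (\<integral>\<omega>. indicator {\<omega>. coord_X (- int n) \<omega> = k} \<omega> * \<bar>f (wfilter n (row_of \<rho>) \<omega>) - f (\<pi>min \<omega>)\<bar> \<partial>Pr) \<le> (\<integral>\<omega>. \<bar>f (u n \<omega>) - f (\<pi>min \<omega>)\<bar> \<partial>Pr)"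
      by simp
  qed
qed

lemma wmean_obs_mean:
  assumes w: "ergodic_weights w" and \<rho>: "\<rho> \<in> prob_measures (discrete_topology UNIV)" and k: "measure \<rho> {k} > 0"
  shows "wmean w (\<lambda>n. enn2real (obs_mean n (\<lambda>y. ennreal (f (nrm (row_prod M y n (row_of \<rho>))))) k)) \<longlonglongrightarrow> (\<integral>\<omega>. f (\<pi>min \<omega>) \<partial>Pr)"
proof -
  let ?q = "\<lambda>n. enn2real (obs_mean n (\<lambda>y. ennreal (f (nrm (row_prod M y n (row_of \<rho>))))) k)"
  let ?a = "\<lambda>n. \<integral>\<omega>. indicator {\<omega>. coord_X (- int n) \<omega> = k} \<omega> * f (\<pi>min \<omega>) \<partial>Pr"
  have I: "integrable Pr (\<lambda>\<omega>. indicator {\<omega>. coord_X (- int n) \<omega> = k} \<omega> * f (\<pi>min \<omega>))"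
    "integrable Pr (\<lambda>\<omega>. indicator {\<omega>. coord_X (- int n) \<omega> = k} \<omega> * f (wfilter n (row_of \<rho>) \<omega>))" for n
    using f01 by (auto intro!: integrable_unit_interval simp: indicator_def)
  have q: "lamr k * ?q n = (\<integral>\<omega>. indicator {\<omega>. coord_X (- int n) \<omega> = k} \<omega> * f (wfilter n (row_of \<rho>) \<omega>) \<partial>Pr)" for n
    unfolding wfilter_def using f01 by (intro integral_obs_mean[symmetric]) auto
  have "(\<lambda>n. lamr k * ?q n - ?a n) \<longlonglongrightarrow> 0"
  proof (rule Lim_null_comparison[OF always_eventually[OF allI] mixture_start_limit[OF \<rho> k]])
    fix n
    have "\<bar>lamr k * ?q n - ?a n\<bar> = \<bar>\<integral>\<omega>. indicator {\<omega>. coord_X (- int n) \<omega> = k} \<omega> * (f (wfilter n (row_of \<rho>) \<omega>) - f (\<pi>min \<omega>)) \<partial>Pr\<bar>"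
      unfolding q using I[of n] by (simp add: right_diff_distrib)
    also have "\<dots> \<le> (\<integral>\<omega>. \<bar>indicator {\<omega>. coord_X (- int n) \<omega> = k} \<omega> * (f (wfilter n (row_of \<rho>) \<omega>) - f (\<pi>min \<omega>))\<bar> \<partial>Pr)"
      by (rule integral_abs_bound)
    finally show "norm (lamr k * ?q n - ?a n) \<le> (\<integral>\<omega>. indicator {\<omega>. coord_X (- int n) \<omega> = k} \<omega> * \<bar>f (wfilter n (row_of \<rho>) \<omega>) - f (\<pi>min \<omega>)\<bar> \<partial>Pr)"
      by (simp add: abs_mult)
  qed
  from wmean_null[OF ergodic_weightsD[OF w] this]
  have "(\<lambda>n. lamr k * wmean w ?q n - wmean w ?a n) \<longlonglongrightarrow> 0" by (simp only: wmean_diff[symmetric] wmean_cmult[symmetric])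
  from tendsto_add[OF this wmean_state_limit[OF w, of k]]
  have "(\<lambda>n. lamr k * wmean w ?q n) \<longlonglongrightarrow> lamr k * (\<integral>\<omega>. f (\<pi>min \<omega>) \<partial>Pr)" by simp
  from tendsto_mult_left[OF this, of "1 / lamr k"] show ?thesis using lamr(2)[of k] by simp
qed

text \<open>The mean after n kernel steps is an average, over \<open>\<rho>\<close> under
  \<open>M0\<close> and over the starting state under \<open>\<rho>\<close>, of the conditional
  means \<open>?q n \<rho> k\<close>. These lie in [0, 1] and converge in weighted mean at every
  charged state to a limit that depends on neither variable, so dominated convergence applies
  twice.\<close>

lemma wmean_apply_kernel:
  assumes w: "ergodic_weights w" and M0: "M0 \<in> prob_measures PE"
  shows "wmean w (\<lambda>n. \<integral>\<nu>. f \<nu> \<partial>apply_kernel (filter_kernel \<phi> M) n M0) \<longlonglongrightarrow> (\<integral>\<omega>. f (\<pi>min \<omega>) \<partial>Pr)"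
proof -
  let ?Q = "\<lambda>n \<rho>. \<integral>\<^sup>+y. ennreal (f (nrm (row_prod M y n (row_of \<rho>)))) * row_mass (row_prod M y n (row_of \<rho>)) \<partial>phiN n"
  let ?q = "\<lambda>n \<rho> k. enn2real (obs_mean n (\<lambda>y. ennreal (f (nrm (row_prod M y n (row_of \<rho>))))) k)"
  have sp: "space M0 = prob_measures (discrete_topology UNIV)" and sM: "sets M0 = sets (borel_of PE)" and pM: "prob_space M0"
    using M0 sets_eq_imp_space_eq[of M0 "borel_of PE"] by (simp_all add: prob_measures_def space_borel_of_PE)
  have q01: "0 \<le> ?q n \<rho> k \<and> ?q n \<rho> k \<le> 1" for n \<rho> k
    using unit_fun_obs_mean(1)[of "\<lambda>y. f (nrm (row_prod M y n (row_of \<rho>)))"] f01 by blast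
  have qe: "ennreal (?q n \<rho> k) = obs_mean n (\<lambda>y. ennreal (f (nrm (row_prod M y n (row_of \<rho>))))) k" for n \<rho> k
    using unit_fun_obs_mean(2)[of "\<lambda>y. f (nrm (row_prod M y n (row_of \<rho>)))"] f01 by blast
  have Q: "?Q n \<rho> = ennreal (\<integral>k. ?q n \<rho> k \<partial>\<rho>)" if \<rho>: "\<rho> \<in> prob_measures (discrete_topology UNIV)" for n \<rho>
  proof -
    have "?Q n \<rho> = (\<integral>\<^sup>+k. row_of \<rho> k * ennreal (?q n \<rho> k) \<partial>count_space UNIV)"
      unfolding qe by (rule obs_mean_row) simp
    also have "\<dots> = ennreal (\<integral>k. ?q n \<rho> k \<partial>\<rho>)"
      using q01 by (intro integral_PE_bounded[OF \<rho>, where B = 1]) auto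
    finally show ?thesis .
  qed
  have Q1: "?Q n \<rho> \<le> 1" if \<rho>: "\<rho> \<in> prob_measures (discrete_topology UNIV)" for n \<rho>
  proof -
    have "?Q n \<rho> \<le> (\<integral>\<^sup>+y. 1 * row_mass (row_prod M y n (row_of \<rho>)) \<partial>phiN n)"
      using f01 by (intro nn_integral_mono mult_right_mono) auto
    then show ?thesis using nn_integral_row_mass_row_prod[of n "row_of \<rho>"] row_mass_row_of[OF \<rho>] by simp
  qed
  \<comment> \<open>The minimum keeps \<open>r\<close> in [0, 1] at every \<open>\<rho>\<close>; on
    probability measures it changes nothing, since there \<open>?Q n \<rho> \<le> 1\<close>.\<close>
  define r where "r n \<rho> = min 1 (enn2real (?Q n \<rho>))" for n \<rho>
  have r01: "0 \<le> r n \<rho> \<and> r n \<rho> \<le> 1" for n \<rho> by (simp add: r_def)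
  have rQ: "ennreal (r n \<rho>) = ?Q n \<rho>" "r n \<rho> = (\<integral>k. ?q n \<rho> k \<partial>\<rho>)" if \<rho>: "\<rho> \<in> prob_measures (discrete_topology UNIV)" for n \<rho>
  proof -
    have nn: "0 \<le> (\<integral>k. ?q n \<rho> k \<partial>\<rho>)" by (intro integral_nonneg_AE) simp
    have "(\<integral>k. ?q n \<rho> k \<partial>\<rho>) \<le> 1" using Q1[OF \<rho>, of n] unfolding Q[OF \<rho>] by simp
    then show "r n \<rho> = (\<integral>k. ?q n \<rho> k \<partial>\<rho>)" using nn by (simp add: r_def Q[OF \<rho>])
    then show "ennreal (r n \<rho>) = ?Q n \<rho>" by (simp add: Q[OF \<rho>])
  qed
  have rm: "r n \<in> borel_measurable M0" for n
    using filter_mean_measurable[of "\<lambda>\<nu>. ennreal (f \<nu>)" n] unfolding r_def measurable_cong_sets[OF sM refl] by measurable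
  have lim: "wmean w (\<lambda>n. r n \<rho>) \<longlonglongrightarrow> (\<integral>\<omega>. f (\<pi>min \<omega>) \<partial>Pr)" if \<rho>: "\<rho> \<in> prob_measures (discrete_topology UNIV)" for \<rho>
    unfolding rQ(2)[OF \<rho>]
  proof (rule wmean_integral_tendsto[OF ergodic_weightsD[OF w]])
    show "prob_space \<rho>" using \<rho> by (simp add: prob_measures_discrete)
    show "AE k in \<rho>. wmean w (\<lambda>n. ?q n \<rho> k) \<longlonglongrightarrow> (\<integral>\<omega>. f (\<pi>min \<omega>) \<partial>Pr)"
      using PE_AE_pos[OF \<rho>] by eventually_elim (rule wmean_obs_mean[OF w \<rho>])
  qed (use q01 PE_measurable[OF \<rho>] in auto)
  have "(\<integral>\<nu>. f \<nu> \<partial>apply_kernel (filter_kernel \<phi> M) n M0) = (\<integral>\<rho>. r n \<rho> \<partial>M0)" for n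
  proof -
    let ?m = "apply_kernel (filter_kernel \<phi> M) n M0"
    have ms: "sets ?m = sets (borel_of PE)" "prob_space ?m"
      using apply_kernel_prob[OF M0, of n] by (auto simp: prob_measures_def)
    have "f \<in> borel_measurable ?m" unfolding measurable_cong_sets[OF ms(1) refl] by simp
    then have "ennreal (\<integral>\<nu>. f \<nu> \<partial>?m) = (\<integral>\<^sup>+\<nu>. ennreal (f \<nu>) \<partial>?m)"
      using f01 by (intro nn_integral_eq_integral[symmetric] prob_space.integrable_unit_interval[OF ms(2)]) auto
    also have "\<dots> = (\<integral>\<^sup>+\<rho>. ?Q n \<rho> \<partial>M0)" by (rule nn_integral_apply_kernel[OF M0]) simp
    also have "\<dots> = (\<integral>\<^sup>+\<rho>. ennreal (r n \<rho>) \<partial>M0)" by (intro nn_integral_cong) (simp add: sp rQ(1))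
    also have "\<dots> = ennreal (\<integral>\<rho>. r n \<rho> \<partial>M0)"
      using r01 rm by (intro nn_integral_eq_integral prob_space.integrable_unit_interval[OF pM]) auto
    finally show ?thesis
      using f01 r01 by (subst (asm) ennreal_inj) (auto intro!: integral_nonneg_AE)
  qed
  then show ?thesis
    using wmean_integral_tendsto[OF ergodic_weightsD[OF w] pM rm r01 AE_I2[OF lim]] sp by simp
qed

end

end

section \<open>Weak convergence on spaces of measures\<close>

text \<open>Being eventually in a neighbourhood is inherited from the subbasis by finite
  intersections and by unions, so induction over the generation of the open set suffices.\<close>

lemma limitin_weak_topologyI:
  assumes a: "a \<in> prob_measures S" and u: "eventually (\<lambda>n. u n \<in> prob_measures S) sequentially"
    and lim: "\<And>f. f \<in> bdd_continuous S \<Longrightarrow> (\<lambda>n. \<integral>x. f x \<partial>u n) \<longlonglongrightarrow> (\<integral>x. f x \<partial>a)"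
  shows "limitin (weak_topology S) u a sequentially"
  unfolding limitin_def
proof (intro conjI allI impI)
  show "a \<in> topspace (weak_topology S)" using a by simp
  fix U assume "openin (weak_topology S) U \<and> a \<in> U"
  then have "generate_topology_on {{\<mu> \<in> prob_measures S. (\<integral>x. f x \<partial>\<mu>) \<in> U} | f U. f \<in> bdd_continuous S \<and> open U} U" "a \<in> U"
    by (simp_all add: weak_topology_def openin_topology_generated_by_iff)
  then show "eventually (\<lambda>n. u n \<in> U) sequentially"
  proof induction
    case (Int V W)
    then show ?case by (auto intro: eventually_conj)
  next
    case (UN K)
    then obtain k where k: "k \<in> K" "a \<in> k" by auto
    then have "eventually (\<lambda>n. u n \<in> k) sequentially" using UN.IH by blast
    then show ?case by (rule eventually_mono) (use k(1) in blast)
  next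
    case (Basis V)
    then obtain f W where f: "f \<in> bdd_continuous S" "open W" "V = {\<mu> \<in> prob_measures S. (\<integral>x. f x \<partial>\<mu>) \<in> W}" by auto
    from Basis.prems f(3) have "(\<integral>x. f x \<partial>a) \<in> W" by simp
    from topological_tendstoD[OF lim[OF f(1)] f(2) this] u show ?case
      unfolding f(3) by eventually_elim simp
  qed simp
qed

lemma prob_measures_integral_affine:
  assumes m: "m \<in> prob_measures S" and f: "f \<in> bdd_continuous S" "\<And>x. 0 \<le> f x \<and> f x \<le> 1"
    and g: "\<And>x. x \<in> topspace S \<Longrightarrow> g x = c * f x + d"
  shows "(\<integral>x. g x \<partial>m) = c * (\<integral>x. f x \<partial>m) + d"
proof -
  interpret prob_space m using m by (simp add: prob_measures_def)
  have s: "sets m = sets (borel_of S)" using m by (simp add: prob_measures_def)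
  have sp: "space m = topspace S" using sets_eq_imp_space_eq[OF s] by (simp add: space_borel_of)
  have "f \<in> borel_measurable m"
    unfolding measurable_cong_sets[OF s refl] by (rule bdd_continuous_measurable[OF f(1)])
  then have I: "integrable m f" using f(2) by (rule integrable_unit_interval)
  have "(\<integral>x. g x \<partial>m) = (\<integral>x. c * f x + d \<partial>m)"
    by (intro Bochner_Integration.integral_cong refl) (simp add: sp g)
  then show ?thesis using I by (simp add: prob_space)
qed

lemma bdd_continuous_compose:
  assumes "continuous_map S euclidean f" "continuous_on UNIV h" "\<And>x :: 'b::topological_space. 0 \<le> h x \<and> h x \<le> (1::real)"
  shows "(\<lambda>x. h (f x)) \<in> bdd_continuous S"
proof -
  have "continuous_map euclidean euclideanreal h" using assms(2) by simp
  from continuous_map_compose[OF assms(1) this] have "continuous_map S euclideanreal (\<lambda>x. h (f x))" by (simp add: comp_def)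
  moreover have "bounded ((\<lambda>x. h (f x)) ` topspace S)"
    using assms(3) by (intro boundedI[of _ 1]) auto
  ultimately show ?thesis by (simp add: bdd_continuous_def)
qed

text \<open>An affine rescaling turns any bounded continuous test function into one with values in
  [0, 1], and integrals against probability measures respect it.\<close>

lemma limitin_weak_topology_unitI:
  assumes a: "a \<in> prob_measures S" and u: "eventually (\<lambda>n. u n \<in> prob_measures S) sequentially"
    and lim: "\<And>f. f \<in> bdd_continuous S \<Longrightarrow> (\<And>x. 0 \<le> f x \<and> f x \<le> 1) \<Longrightarrow> (\<lambda>n. \<integral>x. f x \<partial>u n) \<longlonglongrightarrow> (\<integral>x. f x \<partial>a)"
  shows "limitin (weak_topology S) u a sequentially"
proof (rule limitin_weak_topologyI[OF a u])
  fix f assume f: "f \<in> bdd_continuous S"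
  obtain B where B: "B > 0" "\<And>x. x \<in> topspace S \<Longrightarrow> \<bar>f x\<bar> \<le> B" using bdd_continuous_bound[OF f] by blast
  \<comment> \<open>On \<open>topspace S\<close> this is the affine map from [-B, B] to [0, 1]; the
    clipping secures the bounds off \<open>topspace S\<close>, where \<open>f\<close> is
    arbitrary.\<close>
  define h where "h = (\<lambda>t. min 1 (max 0 ((t + B) / (2 * B))))"
  have h01: "0 \<le> h t \<and> h t \<le> 1" for t by (simp add: h_def)
  have "continuous_on UNIV h" unfolding h_def using B(1) by (intro continuous_intros) auto
  then have hc: "(\<lambda>x. h (f x)) \<in> bdd_continuous S"
    using f by (intro bdd_continuous_compose h01) (simp_all add: bdd_continuous_def)
  have fh: "f x = 2 * B * h (f x) + - B" if "x \<in> topspace S" for x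
  proof -
    have "0 \<le> (f x + B) / (2 * B)" "(f x + B) / (2 * B) \<le> 1" using B(1) B(2)[OF that] by (auto simp: field_simps)
    then have "h (f x) = (f x + B) / (2 * B)" by (simp add: h_def)
    then show ?thesis using B(1) by (simp add: field_simps)
  qed
  note aff = prob_measures_integral_affine[OF _ hc h01 fh]
  have "(\<lambda>n. 2 * B * (\<integral>x. h (f x) \<partial>u n) + - B) \<longlonglongrightarrow> 2 * B * (\<integral>x. h (f x) \<partial>a) + - B"
    by (intro tendsto_intros lim hc h01)
  then have "(\<lambda>n. 2 * B * (\<integral>x. h (f x) \<partial>u n) + - B) \<longlonglongrightarrow> (\<integral>x. f x \<partial>a)" by (simp only: aff[OF a])
  moreover have "eventually (\<lambda>n. 2 * B * (\<integral>x. h (f x) \<partial>u n) + - B = (\<integral>x. f x \<partial>u n)) sequentially"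
    using u by eventually_elim (rule aff[symmetric])
  ultimately show "(\<lambda>n. \<integral>x. f x \<partial>u n) \<longlonglongrightarrow> (\<integral>x. f x \<partial>a)" by (rule Lim_transform_eventually)
qed

text \<open>The point masses embed \<open>PE\<close> into a metric space of functions. At distance 0
  from the image of the complement, a sequence of the complement would converge weakly to
  \<open>x\<close>, which is impossible for \<open>x\<close> in the open set
  \<open>U\<close>.\<close>

lemma openin_PE_infdist:
  fixes U :: "'e::countable measure set"
  assumes U: "openin PE U" "prob_measures (discrete_topology UNIV) - U \<noteq> {}"
    and x: "x \<in> prob_measures (discrete_topology UNIV)"
  shows "infdist (\<lambda>i. measure x {i}) ((\<lambda>\<mu> i. measure \<mu> {i}) ` (prob_measures (discrete_topology UNIV) - U)) > 0 \<longleftrightarrow> x \<in> U"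
proof -
  let ?\<iota> = "\<lambda>\<mu> :: 'e measure. \<lambda>i. measure \<mu> {i}"
  let ?C = "prob_measures (discrete_topology UNIV) - U"
  have "infdist (?\<iota> x) (?\<iota> ` ?C) = 0 \<longleftrightarrow> x \<notin> U"
  proof
    assume "x \<notin> U"
    then show "infdist (?\<iota> x) (?\<iota> ` ?C) = 0" using x by (intro infdist_zero) auto
  next
    assume "infdist (?\<iota> x) (?\<iota> ` ?C) = 0"
    then have "?\<iota> x \<in> closure (?\<iota> ` ?C)" using U(2) by (subst in_closure_iff_infdist_zero) auto
    then obtain y where y: "\<forall>n. y n \<in> ?\<iota> ` ?C" "y \<longlonglongrightarrow> ?\<iota> x" unfolding closure_sequential by blast
    then have "\<forall>n. \<exists>z. z \<in> ?C \<and> y n = ?\<iota> z" by blast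
    then obtain z where z: "\<And>n. z n \<in> ?C" "\<And>n. y n = ?\<iota> (z n)" by metis
    have "limitin PE z x sequentially"
    proof (rule limitin_weak_topologyI[OF x])
      show "eventually (\<lambda>n. z n \<in> prob_measures (discrete_topology UNIV)) sequentially" using z(1) by simp
      fix g :: "'e \<Rightarrow> real" assume g: "g \<in> bdd_continuous (discrete_topology UNIV)"
      have "(\<lambda>n. measure (z n) {i}) \<longlonglongrightarrow> measure x {i}" for i
        using continuous_on_tendsto_compose[OF continuous_on_product_coordinates[of i] y(2)] by (simp add: z(2))
      then show "(\<lambda>n. \<integral>x. g x \<partial>z n) \<longlonglongrightarrow> (\<integral>y. g y \<partial>x)"
        using g z(1) by (intro weak_conv_PE x) (auto simp: bdd_continuous_def)
    qed
    then have "x \<in> U \<Longrightarrow> eventually (\<lambda>n. z n \<in> U) sequentially" using U(1) by (auto simp: limitin_def)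
    then show "x \<notin> U" using z(1) by (auto simp: eventually_sequentially)
  qed
  moreover have "infdist (?\<iota> x) (?\<iota> ` ?C) \<ge> 0" by (rule infdist_nonneg)
  ultimately show ?thesis by linarith
qed

lemma continuous_map_PE_coordinates:
  "continuous_map (PE :: 'e::countable measure topology) euclidean (\<lambda>\<mu> i. measure \<mu> {i})"
proof -
  have "continuous_map PE euclideanreal (\<lambda>\<mu>. measure \<mu> {i})" for i :: 'e
    unfolding continuous_map_def
  proof (intro conjI allI impI)
    fix W :: "real set" assume W: "openin euclideanreal W"
    have ind: "indicator {i} \<in> bdd_continuous (discrete_topology (UNIV :: 'e set))"
      by (auto simp: bdd_continuous_def intro!: boundedI[of _ 1])
    have "{\<mu> \<in> topspace PE. measure \<mu> {i} \<in> W} = {\<mu> \<in> prob_measures (discrete_topology UNIV). (\<integral>x. indicator {i} x \<partial>\<mu>) \<in> W}"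
    proof -
      have "measure \<mu> {i} = (\<integral>x. indicator {i} x \<partial>\<mu>)" if "\<mu> \<in> prob_measures (discrete_topology UNIV)" for \<mu> :: "'e measure"
        using that sets_eq_imp_space_eq[of \<mu> "count_space UNIV"] by (simp add: prob_measures_discrete)
      then show ?thesis by auto
    qed
    also have "openin PE \<dots>"
      unfolding weak_topology_def
      by (rule topology_generated_by_Basis, intro CollectI exI[of _ "indicator {i}"] exI[of _ W] conjI refl ind) (use W in simp)
    finally show "openin PE {\<mu> \<in> topspace PE. measure \<mu> {i} \<in> W}" .
  qed simp
  then show ?thesis
    unfolding euclidean_product_topology[symmetric] by (simp add: continuous_map_componentwise_UNIV)
qed

text \<open>With \<open>d\<close> the distance to the complement of an open \<open>U\<close>, the
  functions \<open>min 1 (real n * d \<mu>)\<close> increase to the indicator of \<open>U\<close>.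
  So bounded continuous functions determine the measure of open sets, which form an
  intersection-stable generator.\<close>

lemma prob_measures_PE_eqI:
  fixes m m' :: "'e::countable measure measure"
  assumes m: "m \<in> prob_measures PE" and m': "m' \<in> prob_measures PE"
    and eq: "\<And>f. f \<in> bdd_continuous PE \<Longrightarrow> (\<And>x. 0 \<le> f x \<and> f x \<le> 1) \<Longrightarrow> (\<integral>x. f x \<partial>m) = (\<integral>x. f x \<partial>m')"
  shows "m = m'"
proof -
  let ?D = "prob_measures (discrete_topology UNIV) :: 'e measure set"
  have s: "sets m = sets (borel_of PE)" "sets m' = sets (borel_of PE)" using m m' by (auto simp: prob_measures_def)
  have sp: "space m = ?D" "space m' = ?D"
    using sets_eq_imp_space_eq[OF s(1)] sets_eq_imp_space_eq[OF s(2)] by (auto simp: space_borel_of)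
  interpret m: prob_space m using m by (simp add: prob_measures_def)
  interpret m': prob_space m' using m' by (simp add: prob_measures_def)
  have U: "emeasure m U = emeasure m' U" if U: "openin PE U" for U
  proof (cases "?D - U = {}")
    case True
    then have "U = ?D" using openin_subset[OF U] by auto
    then show ?thesis using m.emeasure_space_1 m'.emeasure_space_1 by (simp add: sp)
  next
    case False
    define d where "d \<mu> = infdist (\<lambda>i. measure \<mu> {i}) ((\<lambda>\<mu> i. measure \<mu> {i}) ` (?D - U))" for \<mu> :: "'e measure"
    let ?f = "\<lambda>n \<mu>. min 1 (real n * d \<mu>)"
    have d0: "d \<mu> \<ge> 0" for \<mu> by (simp add: d_def infdist_nonneg)
    have f01: "0 \<le> ?f n \<mu> \<and> ?f n \<mu> \<le> 1" for n \<mu> using d0 by simp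
    have fc: "?f n \<in> bdd_continuous PE" for n
      unfolding d_def
      by (rule bdd_continuous_compose[OF continuous_map_PE_coordinates, where h = "\<lambda>x. min 1 (real n * infdist x ((\<lambda>\<mu> i. measure \<mu> {i}) ` (?D - U)))"])
        (auto intro!: continuous_intros mult_nonneg_nonneg infdist_nonneg)
    have lim: "(\<lambda>n. ?f n \<mu>) \<longlonglongrightarrow> indicator U \<mu>" if \<mu>: "\<mu> \<in> ?D" for \<mu>
    proof (cases "\<mu> \<in> U")
      case True
      then have "d \<mu> > 0" using openin_PE_infdist[OF U False \<mu>] by (simp add: d_def)
      then obtain N where "1 < real N * d \<mu>" using reals_Archimedean3 by blast
      then have "1 \<le> real n * d \<mu>" if "n \<ge> N" for n
        using mult_right_mono[of "real N" "real n" "d \<mu>"] that d0[of \<mu>] by simp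
      then have "eventually (\<lambda>n. ?f n \<mu> = 1) sequentially"
        unfolding eventually_sequentially by (intro exI[of _ N]) auto
      then show ?thesis using True by (simp add: tendsto_eventually)
    next
      case nU: False
      then have "d \<mu> = 0" using openin_PE_infdist[OF U False \<mu>] d0[of \<mu>] by (simp add: d_def)
      then show ?thesis using nU by simp
    qed
    have Us: "U \<in> sets (borel_of PE)" using U by (auto simp: sets_borel_of)
    have conv: "(\<lambda>n. \<integral>x. ?f n x \<partial>k) \<longlonglongrightarrow> measure k U" if k: "prob_space k" "sets k = sets (borel_of PE)" "space k = ?D" for k
    proof -
      interpret k: prob_space k by (rule k)
      have "(\<lambda>n. \<integral>x. ?f n x \<partial>k) \<longlonglongrightarrow> (\<integral>x. indicator U x \<partial>k)"
      proof (rule integral_dominated_convergence[where w = "\<lambda>_. 1"])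
        show "indicator U \<in> borel_measurable k" using Us k(2) by simp
        show "?f n \<in> borel_measurable k" for n
          unfolding measurable_cong_sets[OF k(2) refl] by (rule bdd_continuous_measurable[OF fc])
      qed (use f01 lim k(3) in auto)
      then show ?thesis using Us k(2) by simp
    qed
    have "measure m U = measure m' U"
      using LIMSEQ_unique[OF conv[OF m.prob_space_axioms s(1) sp(1)]] conv[OF m'.prob_space_axioms s(2) sp(2)] eq[OF fc f01]
      by simp
    then show ?thesis by (simp add: m.emeasure_eq_measure m'.emeasure_eq_measure)
  qed
  show ?thesis
  proof (rule measure_eqI_generator_eq[where E = "{U. openin PE U}" and \<Omega> = ?D and A = "\<lambda>_. ?D"])
    show "Int_stable {U. openin PE U}" by (auto simp: Int_stable_def)
    show "{U. openin PE U} \<subseteq> Pow ?D" using openin_subset[of PE] by auto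
    show "range (\<lambda>_::nat. ?D) \<subseteq> {U. openin PE U}" using openin_topspace[of "PE :: 'e measure topology"] by auto
  qed (use U s in \<open>auto simp: sets_borel_of\<close>)
qed

text \<open>\<open>cesaro_mean\<close> is built by \<open>measure_of\<close> from a set function;
  writing it as a mixture over a uniformly chosen index shows that this function is a measure and
  makes its integrals computable.\<close>

lemma cesaro_mean_eq:
  assumes m: "\<And>k. m k \<in> prob_measures S" and n: "1 \<le> n"
  shows "cesaro_mean m n = measure_pmf (pmf_of_set {1..n}) \<bind> m"
    and "cesaro_mean m n \<in> prob_measures S"
proof -
  let ?p = "measure_pmf (pmf_of_set {1..n})"
  have ne: "{1..n} \<noteq> {}" "finite {1..n}" using n by auto
  have p: "?p \<in> space (prob_algebra (count_space UNIV))"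
    by (simp add: space_prob_algebra measure_pmf.prob_space_axioms)
  have K: "m \<in> count_space UNIV \<rightarrow>\<^sub>M prob_algebra (borel_of S)"
    using m by (auto simp: space_prob_algebra prob_measures_def)
  have s: "sets (?p \<bind> m) = sets (borel_of S)" by (rule sets_bind'[OF p K])
  have s0: "sets (m 0) = sets (?p \<bind> m)" using m[of 0] s by (simp add: prob_measures_def)
  have "measure_of (space (m 0)) (sets (m 0)) (\<lambda>A. (\<Sum>k=1..n. emeasure (m k) A) / of_nat n) =
      measure_of (space (m 0)) (sets (m 0)) (emeasure (?p \<bind> m))"
  proof (rule measure_of_eq[OF sets.space_closed])
    fix A assume "A \<in> sigma_sets (space (m 0)) (sets (m 0))"
    then have "A \<in> sets (borel_of S)" using m[of 0] by (simp add: sets.sigma_sets_eq prob_measures_def)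
    from emeasure_bind_prob_algebra[OF p K this]
    show "(\<Sum>k=1..n. emeasure (m k) A) / of_nat n = emeasure (?p \<bind> m) A"
      by (simp add: nn_integral_pmf_of_set[OF ne])
  qed
  also have "\<dots> = measure_of (space (?p \<bind> m)) (sets (?p \<bind> m)) (emeasure (?p \<bind> m))"
    using s0 sets_eq_imp_space_eq[OF s0] by simp
  finally show e: "cesaro_mean m n = ?p \<bind> m"
    unfolding cesaro_mean_def measure_of_of_measure .
  show "cesaro_mean m n \<in> prob_measures S"
    unfolding e using s prob_space_bind'[OF p K] by (simp add: prob_measures_def)
qed

lemma integral_cesaro_mean:
  assumes m: "\<And>k. m k \<in> prob_measures S" and n: "1 \<le> n" and f: "f \<in> bdd_continuous S" "\<And>x. 0 \<le> f x \<and> f x \<le> 1"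
  shows "(\<integral>x. f x \<partial>cesaro_mean m n) = wmean (\<lambda>n k. 1 / real n) (\<lambda>k. \<integral>x. f x \<partial>m k) n"
proof -
  let ?p = "measure_pmf (pmf_of_set {1..n})"
  have ne: "{1..n} \<noteq> {}" "finite {1..n}" using n by auto
  have fm: "f \<in> borel_measurable (borel_of S)" by (rule bdd_continuous_measurable[OF f(1)])
  have K: "m \<in> ?p \<rightarrow>\<^sub>M subprob_algebra (borel_of S)"
    using m by (auto simp: space_subprob_algebra prob_measures_def prob_space_imp_subprob_space)
  have I: "ennreal (\<integral>x. f x \<partial>k) = (\<integral>\<^sup>+x. ennreal (f x) \<partial>k)" if k: "k \<in> prob_measures S" for k
  proof -
    have k': "prob_space k" "sets k = sets (borel_of S)" using k by (auto simp: prob_measures_def)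
    have "f \<in> borel_measurable k" unfolding measurable_cong_sets[OF k'(2) refl] by (rule fm)
    then show ?thesis using f(2)
      by (intro nn_integral_eq_integral[symmetric] prob_space.integrable_unit_interval[OF k'(1)]) auto
  qed
  have nn: "0 \<le> (\<integral>x. f x \<partial>k)" for k using f(2) by (intro integral_nonneg_AE) simp
  have "ennreal (\<integral>x. f x \<partial>cesaro_mean m n) = (\<integral>\<^sup>+x. ennreal (f x) \<partial>(?p \<bind> m))"
    using I[OF cesaro_mean_eq(2)[OF m n]] unfolding cesaro_mean_eq(1)[OF m n] .
  also have "\<dots> = (\<Sum>k=1..n. ennreal (\<integral>x. f x \<partial>m k)) / of_nat n"
    using fm by (subst nn_integral_bind[OF _ K]) (simp_all add: nn_integral_pmf_of_set[OF ne] I[OF m])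
  also have "\<dots> = ennreal ((\<Sum>k=1..n. \<integral>x. f x \<partial>m k) / real n)"
    using nn n by (simp add: sum_ennreal divide_ennreal sum_nonneg ennreal_of_nat_eq_real_of_nat)
  finally have "(\<integral>x. f x \<partial>cesaro_mean m n) = (\<Sum>k=1..n. \<integral>x. f x \<partial>m k) / real n"
    using nn by (subst (asm) ennreal_inj) (auto intro!: divide_nonneg_nonneg sum_nonneg)
  then show ?thesis by (simp add: wmean_def sum_divide_distrib)
qed

context hidden_markov_model begin

lemma filter_ergodic:
  assumes min: "is_pi_min Pr 0 \<pi>min" and max: "is_pi_max Pr 0 \<pi>max" and C: "condition_C \<phi> M Pr \<pi>min \<pi>max"
  defines "MM \<equiv> distr Pr (borel_of PE) \<pi>min"
  shows "invariant_measure (filter_kernel \<phi> M) MM"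
    and "invariant_measure (filter_kernel \<phi> M) MM' \<Longrightarrow> MM' = MM"
    and "M0 \<in> prob_measures PE \<Longrightarrow> limitin PPE (cesaro_mean (\<lambda>k. apply_kernel (filter_kernel \<phi> M) k M0)) MM sequentially"
    and "aperiodic_matrix (trans_mat \<phi> M) \<Longrightarrow> M0 \<in> prob_measures PE \<Longrightarrow>
      limitin PPE (\<lambda>n. apply_kernel (filter_kernel \<phi> M) n M0) MM sequentially"
proof -
  let ?K = "filter_kernel \<phi> M"
  have eq: "AE \<omega> in Pr. \<pi>min \<omega> = \<pi>max \<omega>" by (rule condition_C_imp_pi_min_eq_pi_max[OF min max C])
  show inv: "invariant_measure ?K MM"
    unfolding MM_def by (rule filter_law_invariant[OF filter_version_min[OF min] pi_min_recursion[OF min]])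
  then have MM: "MM \<in> prob_measures PE" by (simp add: invariant_measure_def)
  have \<pi>m: "\<pi>min \<in> Pr \<rightarrow>\<^sub>M borel_of PE"
    unfolding measurable_cong_sets[OF sets_Pr refl] by (rule filter_version_measurable[OF filter_version_min[OF min]])
  \<comment> \<open>One limit for both modes of convergence: Cesaro weights in general, and the
    weights concentrated at k = n for an aperiodic chain.\<close>
  have lim: "wmean w (\<lambda>n. \<integral>\<nu>. f \<nu> \<partial>apply_kernel ?K n M0) \<longlonglongrightarrow> (\<integral>\<nu>. f \<nu> \<partial>MM)"
    if w: "ergodic_weights w" and M0: "M0 \<in> prob_measures PE" and f: "f \<in> bdd_continuous PE" "\<And>x. 0 \<le> f x \<and> f x \<le> 1" for w f M0
  proof -
    have "(\<integral>\<nu>. f \<nu> \<partial>MM) = (\<integral>\<omega>. f (\<pi>min \<omega>) \<partial>Pr)"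
      unfolding MM_def by (rule integral_distr[OF \<pi>m bdd_continuous_measurable[OF f(1)]])
    then show ?thesis using wmean_apply_kernel[OF min max eq f w M0] by simp
  qed
  note c = ergodic_weights_cesaro
  show ces: "limitin PPE (cesaro_mean (\<lambda>k. apply_kernel ?K k M0)) MM sequentially" if M0: "M0 \<in> prob_measures PE" for M0
  proof (rule limitin_weak_topology_unitI[OF MM])
    note p = apply_kernel_prob[OF M0]
    show "eventually (\<lambda>n. cesaro_mean (\<lambda>k. apply_kernel ?K k M0) n \<in> prob_measures PE) sequentially"
      using eventually_ge_at_top[of 1] by eventually_elim (rule cesaro_mean_eq(2)[OF p])
    fix f :: "'e measure \<Rightarrow> real" assume f: "f \<in> bdd_continuous PE" "\<And>x. 0 \<le> f x \<and> f x \<le> 1"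
    have "eventually (\<lambda>n. wmean (\<lambda>n k. 1 / real n) (\<lambda>k. \<integral>\<nu>. f \<nu> \<partial>apply_kernel ?K k M0) n = (\<integral>\<nu>. f \<nu> \<partial>cesaro_mean (\<lambda>k. apply_kernel ?K k M0) n)) sequentially"
      using eventually_ge_at_top[of 1] by eventually_elim (rule integral_cesaro_mean[OF p _ f, symmetric])
    with lim[OF c M0 f] show "(\<lambda>n. \<integral>\<nu>. f \<nu> \<partial>cesaro_mean (\<lambda>k. apply_kernel ?K k M0) n) \<longlonglongrightarrow> (\<integral>\<nu>. f \<nu> \<partial>MM)"
      by (rule Lim_transform_eventually)
  qed
  show "limitin PPE (\<lambda>n. apply_kernel ?K n M0) MM sequentially"
    if ap: "aperiodic_matrix (trans_mat \<phi> M)" and M0: "M0 \<in> prob_measures PE"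
  proof (rule limitin_weak_topology_unitI[OF MM])
    show "eventually (\<lambda>n. apply_kernel ?K n M0 \<in> prob_measures PE) sequentially"
      using apply_kernel_prob[OF M0] by simp
    fix f :: "'e measure \<Rightarrow> real" assume f: "f \<in> bdd_continuous PE" "\<And>x. 0 \<le> f x \<and> f x \<le> 1"
    let ?a = "\<lambda>n. \<integral>\<nu>. f \<nu> \<partial>apply_kernel ?K n M0"
    have "eventually (\<lambda>n. wmean (\<lambda>n k. if k = n then 1 else 0) ?a n = ?a n) sequentially"
      using eventually_ge_at_top[of 1] by eventually_elim (simp add: wmean_def if_distrib[of "\<lambda>x. x * _"] cong: if_cong)
    with lim[OF ergodic_weights_aperiodic[OF ap] M0 f] show "?a \<longlonglongrightarrow> (\<integral>\<nu>. f \<nu> \<partial>MM)"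
      by (rule Lim_transform_eventually)
  qed
  \<comment> \<open>An invariant law equals its own Cesaro means, so its integrals are constant
    along the sequence and must agree with those of the limit.\<close>
  show "MM' = MM" if inv': "invariant_measure ?K MM'"
  proof (rule prob_measures_PE_eqI[OF _ MM])
    show M': "MM' \<in> prob_measures PE" using inv' by (simp add: invariant_measure_def)
    have fix_MM': "apply_kernel ?K n MM' = MM'" for n
      using inv' by (induction n) (simp_all add: apply_kernel_def invariant_measure_def)
    fix f :: "'e measure \<Rightarrow> real" assume f: "f \<in> bdd_continuous PE" "\<And>x. 0 \<le> f x \<and> f x \<le> 1"
    have "eventually (\<lambda>n. wmean (\<lambda>n k. 1 / real n) (\<lambda>_. \<integral>\<nu>. f \<nu> \<partial>MM') n = (\<integral>\<nu>. f \<nu> \<partial>MM')) sequentially"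
      using eventually_ge_at_top[of 1] by eventually_elim (simp add: wmean_def)
    with lim[OF c M' f] have "(\<lambda>_. \<integral>\<nu>. f \<nu> \<partial>MM') \<longlonglongrightarrow> (\<integral>\<nu>. f \<nu> \<partial>MM)"
      unfolding fix_MM' by (rule Lim_transform_eventually)
    then show "(\<integral>\<nu>. f \<nu> \<partial>MM') = (\<integral>\<nu>. f \<nu> \<partial>MM)" by (simp add: LIMSEQ_const_iff)
  qed
qed

lemma condition_C_if_uniquely_ergodic:
  assumes min: "is_pi_min Pr 0 \<pi>min" and max: "is_pi_max Pr 0 \<pi>max"
    and F: "countable (UNIV :: 'f set)" and u: "\<exists>!MM. invariant_measure (filter_kernel \<phi> M) MM"
  shows "condition_C \<phi> M Pr \<pi>min \<pi>max"
proof -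
  have "invariant_measure (filter_kernel \<phi> M) (distr Pr (borel_of PE) \<pi>min)"
    by (rule filter_law_invariant[OF filter_version_min[OF min] pi_min_recursion[OF min]])
  moreover have "invariant_measure (filter_kernel \<phi> M) (distr Pr (borel_of PE) \<pi>max)"
    by (rule filter_law_invariant[OF filter_version_max[OF max] pi_max_recursion[OF max]])
  ultimately have "distr Pr (borel_of PE) \<pi>min = distr Pr (borel_of PE) \<pi>max" using u by blast
  then show ?thesis
    by (intro condition_C_if_countable[OF min max _ F] pi_min_eq_pi_max_if_same_law[OF min max])
qed

end

theorem theorem2p6:
  fixes \<phi> :: "'f::polish_space measure"
    and M :: "'f \<Rightarrow> 'e::countable \<Rightarrow> 'e \<Rightarrow> real"
    and Pr :: "('e, 'f) path measure"
    and \<pi>min \<pi>max :: "('e, 'f) path \<Rightarrow> 'e measure"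
  assumes "hidden_markov_model \<phi> M Pr"
    and "is_pi_min Pr 0 \<pi>min"
    and "is_pi_max Pr 0 \<pi>max"
  shows "(condition_C \<phi> M Pr \<pi>min \<pi>max \<longrightarrow>
            (\<exists>MM. invariant_measure (filter_kernel \<phi> M) MM \<and>
              (\<forall>MM'. invariant_measure (filter_kernel \<phi> M) MM' \<longrightarrow> MM' = MM) \<and>
              (\<forall>M0 \<in> prob_measures PE.
                 limitin PPE (cesaro_mean (\<lambda>k. apply_kernel (filter_kernel \<phi> M) k M0)) MM sequentially) \<and>
              (aperiodic_matrix (trans_mat \<phi> M) \<longrightarrow>
                (\<forall>M0 \<in> prob_measures PE.
                   limitin PPE (\<lambda>n. apply_kernel (filter_kernel \<phi> M) n M0) MM sequentially))))
         \<and> (countable (UNIV :: 'f set) \<and> (\<exists>!MM. invariant_measure (filter_kernel \<phi> M) MM) \<longrightarrow>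
            condition_C \<phi> M Pr \<pi>min \<pi>max)"
proof -
  interpret hidden_markov_model \<phi> M Pr by (rule assms(1))
  note erg = filter_ergodic[OF assms(2,3)]
  show ?thesis
  proof (intro conjI impI)
    assume C: "condition_C \<phi> M Pr \<pi>min \<pi>max"
    show "\<exists>MM. invariant_measure (filter_kernel \<phi> M) MM \<and>
        (\<forall>MM'. invariant_measure (filter_kernel \<phi> M) MM' \<longrightarrow> MM' = MM) \<and>
        (\<forall>M0 \<in> prob_measures PE.
           limitin PPE (cesaro_mean (\<lambda>k. apply_kernel (filter_kernel \<phi> M) k M0)) MM sequentially) \<and>
        (aperiodic_matrix (trans_mat \<phi> M) \<longrightarrow>
          (\<forall>M0 \<in> prob_measures PE.
             limitin PPE (\<lambda>n. apply_kernel (filter_kernel \<phi> M) n M0) MM sequentially))"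
      by (intro exI[of _ "distr Pr (borel_of PE) \<pi>min"] conjI allI impI ballI erg[OF C])
  qed (elim conjE, rule condition_C_if_uniquely_ergodic[OF assms(2,3)])
qed

end
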